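(* (Iwasawa decomposition.) Let $G$ be a group with a generating root group datum of type $\Phi\neq\emptyset$, an $R$-valuation $(\varphi_\alpha)_{\alpha\in\Phi}$ of it, and an action $\nu:N\to\mathrm{Aff}_R(\mathbb{A}_R)$ compatible with the valuation (all defined in the context). Suppose that the totally ordered abelian group $R$ is equipped with a $\mathbb{Q}$-module structure. Let $C,C'$ be two vector chambers of $V_R$ and $x\in\mathbb{A}_R$. Let $\mathcal{F}=\mathcal{F}_{x,C}$ be the face of direction $C$ at $x$. Then $$G=U_{C'}\,N\,\widehat{P}_{\mathcal{F}}$$ and there is a natural one-to-one correspondence $\widetilde{W}=N/T_b\to U_{C'}\backslash G/\widehat{P}_{\mathcal{F}}$ (induced by $n\mapsto U_{C'}n\widehat{P}_{\mathcal{F}}$).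
   Context: **Root systems.** $V_{\mathbb{R}}$ is a finite-dimensional real vector space and $\Phi\subset V_{\mathbb{R}}^*$ a (possibly non-reduced) root system spanning $V_{\mathbb R}^*$, with coroots $\alpha^\vee$, reflections $r_\alpha(\beta)=\beta-\beta(\alpha^\vee)\alpha$, Weyl group $W(\Phi)$. $\alpha$ is multipliable if $2\alpha\in\Phi$. $(\alpha,\beta)=\{r\alpha+s\beta\in\Phi:r,s\in\mathbb{Z}_{>0}\}$. For a basis $\Delta$, $\Phi_\Delta^+$ is the set of positive roots. **Root group datum** of type $\Phi$ of a group $G$: a system $(T,(U_\alpha,M_\alpha)_{\alpha\in\Phi})$ with (RGD1) $T$ and the $U_\alpha$ are subgroups, $U_\alpha\neq1$; (RGD2) if $\beta\notin\mathbb{R}_{<0}\alpha$, $[U_\alpha,U_\beta]$ lies in the group generated by the $U_\gamma$, $\gamma\in(\alpha,\beta)$; (RGD3) $U_{2\alpha}\subsetneq U_\alpha$ if $\alpha$ is multipliable; (RGD4) $M_\alpha$ is a right coset of $T$ and $U_{-\alpha}\setminus\{1\}\subset U_\alpha M_\alpha U_\alpha$; (RGD5) $mU_\beta m^{-1}=U_{r_\alpha(\beta)}$ for $m\in M_\alpha$; (RGD6) for any choice of positive roots, $TU^+\cap U^-=\{1\}$, where $U^\pm$ is generated by the $U_\alpha$, $\alpha\in\Phi^\pm$. It is generating if $T$ and the $U_\alpha$ generate $G$. $N$ is the group generated by the $M_\alpha$; there is an epimorphism ${}^v\nu:N\to W(\Phi)$ with kernel $T$ and ${}^v\nu(M_\alpha)=\{r_\alpha\}$.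 For $u\in U_\alpha\setminus\{1\}$, $m(u)$ is the unique element of $M_\alpha\cap U_{-\alpha}uU_{-\alpha}$. **$R$-valuation** ($R$ a non-zero totally ordered abelian group): maps $\varphi_\alpha:U_\alpha\to R\cup\{\infty\}$ with (V0) $\varphi_\alpha(U_\alpha)$ has at least 3 elements; (V1) $U_{\alpha,\lambda}=\varphi_\alpha^{-1}([\lambda,\infty])$ is a subgroup and $U_{\alpha,\infty}=\{1\}$; (V2) for $m\in M_\alpha$, $u\mapsto\varphi_{-\alpha}(u)-\varphi_\alpha(mum^{-1})$ is constant on $U_{-\alpha}\setminus\{1\}$; (V3) if $\beta\notin\mathbb{R}_{\le0}\alpha$, $[U_{\alpha,\lambda},U_{\beta,\mu}]$ lies in the group generated by the $U_{r\alpha+s\beta,r\lambda+s\mu}$, $r,s\in\mathbb{Z}_{>0}$, $r\alpha+s\beta\in\Phi$; (V4) $\varphi_{2\alpha}=2\varphi_\alpha|_{U_{2\alpha}}$ for $\alpha$ multipliable; (V5) if $u\in U_\alpha$, $u',u''\in U_{-\alpha}$ and $u'uu''\in M_\alpha$ then $\varphi_{-\alpha}(u')=-\varphi_\alpha(u)$. $\Gamma_\alpha=\varphi_\alpha(U_\alpha\setminus\{1\})$. **Apartment and compatible action.** $V_{\mathbb{Z}}\subset V_{\mathbb{R}}$ is the coweight lattice, $V_R=V_{\mathbb{Z}}\otimes R$, $\mathbb{A}_R$ an affine space under $V_R$ with origin $o$; $\alpha(x)$ means $\alpha(x-o)$. $\mathrm{Aff}_R(\mathbb{A}_R)=V_R\rtimes\mathrm{GL}(V_{\mathbb{Z}})$.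 $\nu:N\to\mathrm{Aff}_R(\mathbb{A}_R)$ is compatible with the valuation if (CA1) its linear part is ${}^v\nu$; (CA2) $2\varphi_\alpha(u)+\alpha(\nu(m(u))(o)-o)=0$ for any $\alpha\in\Phi$ and $u\in U_\alpha\setminus\{1\}$; (CA3) for any $\alpha\in\Phi$ and $m\in M_\alpha$, the element $\nu(m)$ has order 2. $T_b=\ker\nu$, $\widetilde{W}=\nu(N)$. **Subgroups.** For $\emptyset\ne\Omega\subset\mathbb{A}_R$: $U_{\alpha,\Omega}=\bigcap_{x\in\Omega}U_{\alpha,-\alpha(x)}$, $U_\Omega$ is generated by the $U_{\alpha,\Omega}$ ($\alpha\in\Phi$), $\widehat{N}_\Omega$ is the pointwise stabilizer of $\Omega$ in $N$ (via $\nu$), $\widehat{P}_\Omega$ is generated by $U_\Omega$ and $\widehat{N}_\Omega$. For a filter $\mathcal{V}$ on $\mathbb{A}_R$, $\widehat{P}_{\mathcal{V}}=\bigcup_{\Omega\in\mathcal{V}}\widehat{P}_\Omega$. **Chambers and faces.** The vector chamber of a basis $\Delta$ is $C^v_\Delta=\{v\in V_R:\alpha(v)>0\ \forall\alpha\in\Delta\}$; $U_{C'}$ denotes the group generated by the $U_\alpha$ with $\alpha\in\Phi^+_{\Delta'}$ if $C'=C^v_{\Delta'}$. Put $D_{\alpha,\lambda}=\{y\in\mathbb{A}_R:\alpha(y)\ge-\lambda\}$, $\mathring{D}_{\alpha,\lambda}=\{y:\alpha(y)>-\lambda\}$, $D_{\alpha,\infty}=\mathring{D}_{\alpha,\infty}=\mathbb{A}_R$;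 $\mathbb{A}_R$ has the topology generated by the $\mathring{D}_{\alpha,\lambda}$, $\lambda\in R$. $\mathcal{F}_{x,C}$ is the filter generated by the sets $\bigcap_{\alpha\in\Psi}\mathring{D}_{\alpha,\lambda_\alpha}\cap\bigcap_{\alpha\in\Phi\setminus\Psi}D_{\alpha,\lambda_\alpha}$ ($\Psi\subset\Phi$, $\lambda_\alpha\in\Gamma_\alpha\cup\{\infty\}$) containing $(x+C)\cap\Omega$ for some neighbourhood $\Omega$ of $x$. *)

theory Defs
  imports
    "HOL-Analysis.Analysis"
    "HOL-Library.Extended"
    "HOL-Algebra.Bij"
    "HOL-Algebra.Coset"
    "HOL-Algebra.Generated_Groups"
    "HOL-Algebra.Elementary_Groups"
    "HOL-Algebra.Multiplicative_Group"
    "HOL-Algebra.Free_Abelian_Groups"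
begin

section \<open>Tensor product of abelian groups\<close>

definition additive_group :: "'a::ab_group_add set \<Rightarrow> 'a monoid" where
  "additive_group S = \<lparr>carrier = S, monoid.mult = (+), one = 0\<rparr>"

definition int_mult :: "int \<Rightarrow> 'r::ab_group_add \<Rightarrow> 'r" where
  "int_mult n r = r [^]\<^bsub>additive_group UNIV\<^esub> n"

definition tensor_relators ::
    "('a, 'c) monoid_scheme \<Rightarrow> ('b, 'd) monoid_scheme \<Rightarrow> ('a \<times> 'b \<Rightarrow>\<^sub>0 int) set" where
  "tensor_relators A B =
     {frag_of (a \<otimes>\<^bsub>A\<^esub> a', b) - frag_of (a, b) - frag_of (a', b) | a a' b.
        a \<in> carrier A \<and> a' \<in> carrier A \<and> b \<in> carrier B} \<union>
     {frag_of (a, b \<otimes>\<^bsub>B\<^esub> b') - frag_of (a, b) - frag_of (a, b') | a b b'.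
        a \<in> carrier A \<and> b \<in> carrier B \<and> b' \<in> carrier B}"

definition tensor_kernel ::
    "('a, 'c) monoid_scheme \<Rightarrow> ('b, 'd) monoid_scheme \<Rightarrow> ('a \<times> 'b \<Rightarrow>\<^sub>0 int) set" where
  "tensor_kernel A B =
     generate (free_Abelian_group (carrier A \<times> carrier B)) (tensor_relators A B)"

definition tensor_group ::
    "('a, 'c) monoid_scheme \<Rightarrow> ('b, 'd) monoid_scheme \<Rightarrow> ('a \<times> 'b \<Rightarrow>\<^sub>0 int) set monoid" where
  "tensor_group A B = free_Abelian_group (carrier A \<times> carrier B) Mod tensor_kernel A B"

definition pure_tensor ::
    "('a, 'c) monoid_scheme \<Rightarrow> ('b, 'd) monoid_scheme \<Rightarrow> 'a \<Rightarrow> 'b \<Rightarrow> ('a \<times> 'b \<Rightarrow>\<^sub>0 int) set" where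
  "pure_tensor A B a b =
     tensor_kernel A B #>\<^bsub>free_Abelian_group (carrier A \<times> carrier B)\<^esub> frag_of (a, b)"

text \<open>The homomorphism \<open>A \<otimes> B \<rightarrow> H\<close> induced by a biadditive map.\<close>

definition is_tensor_lift ::
    "('a, 'c) monoid_scheme \<Rightarrow> ('b, 'd) monoid_scheme \<Rightarrow> ('h, 'e) monoid_scheme \<Rightarrow>
     ('a \<Rightarrow> 'b \<Rightarrow> 'h) \<Rightarrow> (('a \<times> 'b \<Rightarrow>\<^sub>0 int) set \<Rightarrow> 'h) \<Rightarrow> bool" where
  "is_tensor_lift A B H f h \<longleftrightarrow>
     h \<in> hom (tensor_group A B) H \<and> h \<in> extensional (carrier (tensor_group A B)) \<and>
     (\<forall>a\<in>carrier A. \<forall>b\<in>carrier B. h (pure_tensor A B a b) = f a b)"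

definition tensor_lift ::
    "('a, 'c) monoid_scheme \<Rightarrow> ('b, 'd) monoid_scheme \<Rightarrow> ('h, 'e) monoid_scheme \<Rightarrow>
     ('a \<Rightarrow> 'b \<Rightarrow> 'h) \<Rightarrow> ('a \<times> 'b \<Rightarrow>\<^sub>0 int) set \<Rightarrow> 'h" where
  "tensor_lift A B H f = (THE h. is_tensor_lift A B H f h)"

lemma tensor_kernel_normal:
  assumes "group A" "group B"
  shows "tensor_kernel A B \<lhd> free_Abelian_group (carrier A \<times> carrier B)"
proof -
  interpret A: group A by fact
  interpret B: group B by fact
  interpret F: comm_group "free_Abelian_group (carrier A \<times> carrier B)"
    by (rule abelian_free_Abelian_group)
  have k: "Poly_Mapping.keys (frag_of p - frag_of q - frag_of r) \<subseteq> carrier A \<times> carrier B"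
    if "p \<in> carrier A \<times> carrier B" "q \<in> carrier A \<times> carrier B" "r \<in> carrier A \<times> carrier B"
    for p q r
    using keys_diff[of "frag_of p - frag_of q" "frag_of r"] keys_diff[of "frag_of p" "frag_of q"] that
    by auto
  have "tensor_relators A B \<subseteq> carrier (free_Abelian_group (carrier A \<times> carrier B))"
    unfolding tensor_relators_def using k by auto
  then show ?thesis
    unfolding tensor_kernel_def
    by (intro F.subgroup_imp_normal F.generate_is_subgroup)
qed

text \<open>The universal property: the definite description above is always met.\<close>

lemma tensor_lift_unique:
  fixes H (structure)
  assumes "group A" "group B" "comm_group H"
    and f: "\<And>a b. a \<in> carrier A \<Longrightarrow> b \<in> carrier B \<Longrightarrow> f a b \<in> carrier H"
    and fl: "\<And>a a' b. a \<in> carrier A \<Longrightarrow> a' \<in> carrier A \<Longrightarrow> b \<in> carrier B \<Longrightarrow>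
          f (a \<otimes>\<^bsub>A\<^esub> a') b = f a b \<otimes> f a' b"
    and fr: "\<And>a b b'. a \<in> carrier A \<Longrightarrow> b \<in> carrier B \<Longrightarrow> b' \<in> carrier B \<Longrightarrow>
          f a (b \<otimes>\<^bsub>B\<^esub> b') = f a b \<otimes> f a b'"
  shows "\<exists>!h. is_tensor_lift A B H f h"
proof -
  define F where "F = free_Abelian_group (carrier A \<times> carrier B)"
  define K where "K = tensor_kernel A B"
  interpret H: comm_group H by fact
  interpret F: comm_group F unfolding F_def by (rule abelian_free_Abelian_group)
  interpret A: group A by fact
  interpret B: group B by fact
  have nK: "K \<lhd> F" unfolding K_def F_def by (rule tensor_kernel_normal[OF assms(1,2)])
  have pt: "pure_tensor A B a b = K #>\<^bsub>F\<^esub> frag_of (a, b)" for a b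
    by (simp add: pure_tensor_def K_def F_def)
  have tg: "tensor_group A B = F Mod K" by (simp add: tensor_group_def K_def F_def)
  obtain h0 where h0: "h0 \<in> hom F H"
      and h0f: "\<And>p. p \<in> carrier A \<times> carrier B \<Longrightarrow> h0 (frag_of p) = f (fst p) (snd p)"
    using H.free_Abelian_group_universal[of "\<lambda>p. f (fst p) (snd p)" "carrier A \<times> carrier B"] f
    unfolding F_def by (auto simp: image_subset_iff)
  interpret h0: group_hom F H h0
    by (simp add: F.group_axioms H.group_axioms group_hom_axioms.intro group_hom_def h0)
  have cF: "p \<in> carrier A \<times> carrier B \<Longrightarrow> frag_of p \<in> carrier F" for p
    by (simp add: F_def)
  have diff: "x - y \<in> carrier F \<and> h0 (x - y) = h0 x \<otimes> inv (h0 y)"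
    if "x \<in> carrier F" "y \<in> carrier F" for x y
  proof -
    have e: "x - y = x \<otimes>\<^bsub>F\<^esub> inv\<^bsub>F\<^esub> y" using that by (simp add: F_def)
    show ?thesis unfolding e using that by simp
  qed
  have rel: "h0 (frag_of p - frag_of q - frag_of r) = \<one> \<and> frag_of p - frag_of q - frag_of r \<in> carrier F"
    if "p \<in> carrier A \<times> carrier B" "q \<in> carrier A \<times> carrier B" "r \<in> carrier A \<times> carrier B"
       "h0 (frag_of p) = h0 (frag_of q) \<otimes> h0 (frag_of r)" for p q r
  proof -
    have "h0 (frag_of q) \<in> carrier H" "h0 (frag_of r) \<in> carrier H" using that cF by auto
    then have "h0 (frag_of q) \<otimes> h0 (frag_of r) \<otimes> inv (h0 (frag_of q)) \<otimes> inv (h0 (frag_of r)) = \<one>"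
      by (metis H.inv_closed H.m_assoc H.m_closed H.m_comm H.r_inv H.inv_mult_group)
    then show ?thesis
      using diff[of "frag_of p - frag_of q" "frag_of r"] diff[of "frag_of p" "frag_of q"] that cF by simp
  qed
  have "tensor_relators A B \<subseteq> kernel F H h0"
    unfolding tensor_relators_def kernel_def
    using rel by (auto simp: h0f fl fr)
  then have K: "K \<subseteq> kernel F H h0"
    unfolding K_def tensor_kernel_def F_def[symmetric]
    by (intro F.generate_subgroup_incl h0.subgroup_kernel)
  have "h0 x = h0 y" if "x \<in> carrier F" "y \<in> carrier F" "K #>\<^bsub>F\<^esub> x = K #>\<^bsub>F\<^esub> y" for x y
  proof -
    have "x \<in> K #>\<^bsub>F\<^esub> y"
      using that F.rcos_self[of x K] nK normal_imp_subgroup by metis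
    then obtain k where "k \<in> K" "x = k \<otimes>\<^bsub>F\<^esub> y" by (auto simp: r_coset_def)
    with K that show ?thesis by (auto simp: kernel_def)
  qed
  from FactGroup_universal[OF h0 nK this] obtain g
    where g: "g \<in> hom (F Mod K) H" "\<And>x. x \<in> carrier F \<Longrightarrow> g (K #>\<^bsub>F\<^esub> x) = h0 x" by blast
  have "is_tensor_lift A B H f (restrict g (carrier (tensor_group A B)))"
    unfolding is_tensor_lift_def
  proof (intro conjI ballI)
    show "restrict g (carrier (tensor_group A B)) \<in> hom (tensor_group A B) H"
    proof -
      interpret Q: group "F Mod K" using nK by (rule normal.factorgroup_is_group)
      show ?thesis
        using g(1) Q.m_closed unfolding tg by (auto simp: hom_def simp del: mult_FactGroup)
    qed
    fix a b assume ab: "a \<in> carrier A" "b \<in> carrier B"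
    then have "K #>\<^bsub>F\<^esub> frag_of (a, b) \<in> carrier (F Mod K)"
      using cF by (auto simp: carrier_FactGroup)
    then show "restrict g (carrier (tensor_group A B)) (pure_tensor A B a b) = f a b"
      unfolding pt tg using ab cF by (simp add: g(2) h0f)
  qed auto
  moreover have "h = h'" if h: "is_tensor_lift A B H f h" and h': "is_tensor_lift A B H f h'" for h h'
  proof (rule extensionalityI)
    show "h \<in> extensional (carrier (tensor_group A B))" "h' \<in> extensional (carrier (tensor_group A B))"
      using h h' by (auto simp: is_tensor_lift_def)
    interpret Q: group "F Mod K" using nK by (rule normal.factorgroup_is_group)
    interpret h: group_hom "F Mod K" H h
      using h by (simp add: is_tensor_lift_def tg Q.group_axioms H.group_axioms group_hom_axioms.intro group_hom_def)
    interpret h': group_hom "F Mod K" H h'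
      using h' by (simp add: is_tensor_lift_def tg Q.group_axioms H.group_axioms group_hom_axioms.intro group_hom_def)
    have c: "K #>\<^bsub>F\<^esub> x \<in> carrier (F Mod K)" if "x \<in> carrier F" for x
      using that by (auto simp: carrier_FactGroup)
    have "h (K #>\<^bsub>F\<^esub> x) = h' (K #>\<^bsub>F\<^esub> x)" if "Poly_Mapping.keys x \<subseteq> carrier A \<times> carrier B" for x
      using that
    proof (induction x rule: free_Abelian_group_induct[consumes 1])
      case 1
      have "K #>\<^bsub>F\<^esub> 0 = \<one>\<^bsub>F Mod K\<^esub>"
        using F.coset_mult_one[of K] nK
        by (metis F_def normal_imp_subgroup one_FactGroup one_free_Abelian_group subgroup.subset)
      then show ?case using h.hom_one h'.hom_one by metis
    next
      case (2 x y)
      then have xy: "x \<in> carrier F" "y \<in> carrier F" by (auto simp: F_def)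
      have e: "x - y = x \<otimes>\<^bsub>F\<^esub> inv\<^bsub>F\<^esub> y" using xy by (simp add: F_def)
      have "K #>\<^bsub>F\<^esub> (x - y) = (K #>\<^bsub>F\<^esub> x) \<otimes>\<^bsub>F Mod K\<^esub> inv\<^bsub>F Mod K\<^esub> (K #>\<^bsub>F\<^esub> y)"
        unfolding e using xy nK c
        by (simp add: normal.inv_FactGroup normal.rcos_inv normal.rcos_sum)
      then show ?case using 2 xy c by (simp del: mult_FactGroup)
    next
      case (3 p)
      then show ?case using h h' by (auto simp: is_tensor_lift_def pt)
    qed
    then show "h x = h' x" if "x \<in> carrier (tensor_group A B)" for x
      using that unfolding tg carrier_FactGroup by (auto simp: F_def)
  qed
  ultimately show ?thesis by blast
qed


section \<open>Root systems in the dual of a real vector space\<close>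

text \<open>
  \<open>V\<^sub>\<real>\<close> is the type \<open>'v\<close> (the inner product of the class is never used); as it is
  finite-dimensional, its dual consists of the bounded linear functionals.
\<close>

type_synonym 'v dual = "'v \<Rightarrow>\<^sub>L real"

definition reflection :: "('v::euclidean_space dual \<Rightarrow> 'v) \<Rightarrow> 'v dual \<Rightarrow> 'v dual \<Rightarrow> 'v dual" where
  "reflection cor \<alpha> \<beta> = \<beta> - blinfun_apply \<beta> (cor \<alpha>) *\<^sub>R \<alpha>"

text \<open>The coroot map is a parameter; on \<open>\<Phi>\<close> it is uniquely determined by these conditions.\<close>

definition root_system :: "'v::euclidean_space dual set \<Rightarrow> ('v dual \<Rightarrow> 'v) \<Rightarrow> bool" where
  "root_system \<Phi> cor \<longleftrightarrow>
     finite \<Phi> \<and> 0 \<notin> \<Phi> \<and> span \<Phi> = UNIV \<and>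
     (\<forall>\<alpha>\<in>\<Phi>. blinfun_apply \<alpha> (cor \<alpha>) = 2) \<and>
     (\<forall>\<alpha>\<in>\<Phi>. reflection cor \<alpha> ` \<Phi> \<subseteq> \<Phi>) \<and>
     (\<forall>\<alpha>\<in>\<Phi>. \<forall>\<beta>\<in>\<Phi>. blinfun_apply \<beta> (cor \<alpha>) \<in> \<int>)"

definition weyl_group ::
    "'v::euclidean_space dual set \<Rightarrow> ('v dual \<Rightarrow> 'v) \<Rightarrow> ('v dual \<Rightarrow> 'v dual) monoid" where
  "weyl_group \<Phi> cor = subgroup_generated (BijGroup UNIV) (reflection cor ` \<Phi>)"

definition multipliable :: "'v::euclidean_space dual set \<Rightarrow> 'v dual \<Rightarrow> bool" where
  "multipliable \<Phi> \<alpha> \<longleftrightarrow> 2 *\<^sub>R \<alpha> \<in> \<Phi>"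

definition root_interval ::
    "'v::euclidean_space dual set \<Rightarrow> 'v dual \<Rightarrow> 'v dual \<Rightarrow> 'v dual set" where
  "root_interval \<Phi> \<alpha> \<beta> =
     {\<gamma> \<in> \<Phi>. \<exists>r s::nat. 0 < r \<and> 0 < s \<and> \<gamma> = real r *\<^sub>R \<alpha> + real s *\<^sub>R \<beta>}"

definition pos_roots ::
    "'v::euclidean_space dual set \<Rightarrow> 'v dual set \<Rightarrow> 'v dual set" where
  "pos_roots \<Phi> \<Delta> = {\<beta> \<in> \<Phi>. \<exists>c::'v dual \<Rightarrow> nat. \<beta> = (\<Sum>\<delta>\<in>\<Delta>. real (c \<delta>) *\<^sub>R \<delta>)}"

definition root_basis :: "'v::euclidean_space dual set \<Rightarrow> 'v dual set \<Rightarrow> bool" where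
  "root_basis \<Phi> \<Delta> \<longleftrightarrow>
     \<Delta> \<subseteq> \<Phi> \<and> independent \<Delta> \<and> span \<Delta> = UNIV \<and>
     (\<forall>\<beta>\<in>\<Phi>. \<beta> \<in> pos_roots \<Phi> \<Delta> \<or> - \<beta> \<in> pos_roots \<Phi> \<Delta>)"


section \<open>Root group data\<close>

definition commutator_subgroup :: "('g, 'b) monoid_scheme \<Rightarrow> 'g set \<Rightarrow> 'g set \<Rightarrow> 'g set" where
  "commutator_subgroup G H K =
     generate G {h \<otimes>\<^bsub>G\<^esub> k \<otimes>\<^bsub>G\<^esub> inv\<^bsub>G\<^esub> h \<otimes>\<^bsub>G\<^esub> inv\<^bsub>G\<^esub> k | h k. h \<in> H \<and> k \<in> K}"

text \<open>The conjuncts are the axioms (RGD1) to (RGD6), in this order.\<close>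

definition root_group_datum ::
    "('g, 'b) monoid_scheme \<Rightarrow> 'v::euclidean_space dual set \<Rightarrow> ('v dual \<Rightarrow> 'v) \<Rightarrow>
     'g set \<Rightarrow> ('v dual \<Rightarrow> 'g set) \<Rightarrow> ('v dual \<Rightarrow> 'g set) \<Rightarrow> bool" where
  "root_group_datum G \<Phi> cor T U M \<longleftrightarrow>
     subgroup T G \<and> (\<forall>\<alpha>\<in>\<Phi>. subgroup (U \<alpha>) G \<and> U \<alpha> \<noteq> {\<one>\<^bsub>G\<^esub>}) \<and>
     (\<forall>\<alpha>\<in>\<Phi>. \<forall>\<beta>\<in>\<Phi>. \<not> (\<exists>c<0. \<beta> = c *\<^sub>R \<alpha>) \<longrightarrow>
        commutator_subgroup G (U \<alpha>) (U \<beta>) \<subseteq> generate G (\<Union>\<gamma>\<in>root_interval \<Phi> \<alpha> \<beta>. U \<gamma>)) \<and>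
     (\<forall>\<alpha>\<in>\<Phi>. multipliable \<Phi> \<alpha> \<longrightarrow> U (2 *\<^sub>R \<alpha>) \<subset> U \<alpha>) \<and>
     (\<forall>\<alpha>\<in>\<Phi>. M \<alpha> \<in> rcosets\<^bsub>G\<^esub> T \<and>
        U (- \<alpha>) - {\<one>\<^bsub>G\<^esub>} \<subseteq> U \<alpha> <#>\<^bsub>G\<^esub> M \<alpha> <#>\<^bsub>G\<^esub> U \<alpha>) \<and>
     (\<forall>\<alpha>\<in>\<Phi>. \<forall>\<beta>\<in>\<Phi>. \<forall>m\<in>M \<alpha>.
        (\<lambda>u. m \<otimes>\<^bsub>G\<^esub> u \<otimes>\<^bsub>G\<^esub> inv\<^bsub>G\<^esub> m) ` U \<beta> = U (reflection cor \<alpha> \<beta>)) \<and>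
     (\<forall>\<Delta>. root_basis \<Phi> \<Delta> \<longrightarrow>
        (T <#>\<^bsub>G\<^esub> generate G (\<Union>\<alpha>\<in>pos_roots \<Phi> \<Delta>. U \<alpha>)) \<inter>
        generate G (\<Union>\<alpha>\<in>pos_roots \<Phi> \<Delta>. U (- \<alpha>)) = {\<one>\<^bsub>G\<^esub>})"

definition generating_rgd ::
    "('g, 'b) monoid_scheme \<Rightarrow> 'v::euclidean_space dual set \<Rightarrow>
     'g set \<Rightarrow> ('v dual \<Rightarrow> 'g set) \<Rightarrow> bool" where
  "generating_rgd G \<Phi> T U \<longleftrightarrow> generate G (T \<union> (\<Union>\<alpha>\<in>\<Phi>. U \<alpha>)) = carrier G"

definition rgd_N ::
    "('g, 'b) monoid_scheme \<Rightarrow> 'v::euclidean_space dual set \<Rightarrow> ('v dual \<Rightarrow> 'g set) \<Rightarrow> 'g set" where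
  "rgd_N G \<Phi> M = generate G (\<Union>\<alpha>\<in>\<Phi>. M \<alpha>)"

definition rgd_N_group ::
    "('g, 'b) monoid_scheme \<Rightarrow> 'v::euclidean_space dual set \<Rightarrow> ('v dual \<Rightarrow> 'g set) \<Rightarrow>
     ('g, 'b) monoid_scheme" where
  "rgd_N_group G \<Phi> M = G\<lparr>carrier := rgd_N G \<Phi> M\<rparr>"

text \<open>The epimorphism \<open>\<^sup>v\<nu> : N \<rightarrow> W(\<Phi>)\<close>; it is unique because the \<open>M \<alpha>\<close> generate \<open>N\<close>.\<close>

definition weyl_epi ::
    "('g, 'b) monoid_scheme \<Rightarrow> 'v::euclidean_space dual set \<Rightarrow> ('v dual \<Rightarrow> 'v) \<Rightarrow>
     'g set \<Rightarrow> ('v dual \<Rightarrow> 'g set) \<Rightarrow> 'g \<Rightarrow> 'v dual \<Rightarrow> 'v dual" where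
  "weyl_epi G \<Phi> cor T M =
     (THE f. f \<in> epi (rgd_N_group G \<Phi> M) (weyl_group \<Phi> cor) \<and> f \<in> extensional (rgd_N G \<Phi> M) \<and>
        kernel (rgd_N_group G \<Phi> M) (weyl_group \<Phi> cor) f = T \<and>
        (\<forall>\<alpha>\<in>\<Phi>. f ` M \<alpha> = {reflection cor \<alpha>}))"

definition rgd_m ::
    "('g, 'b) monoid_scheme \<Rightarrow> ('v::euclidean_space dual \<Rightarrow> 'g set) \<Rightarrow> ('v dual \<Rightarrow> 'g set) \<Rightarrow>
     'v dual \<Rightarrow> 'g \<Rightarrow> 'g" where
  "rgd_m G U M \<alpha> u = (THE m. m \<in> M \<alpha> \<inter> (U (- \<alpha>) <#>\<^bsub>G\<^esub> {u} <#>\<^bsub>G\<^esub> U (- \<alpha>)))"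


section \<open>Valuations\<close>

text \<open>
  The values lie in \<open>R \<union> {\<infinity>}\<close>, i.e. in \<open>'r extended\<close> without its bottom element \<open>Minf\<close>;
  this is the first conjunct of \<open>rgd_valuation\<close>, and the others are (V0) to (V5).
\<close>

definition val_subgroup ::
    "('v::euclidean_space dual \<Rightarrow> 'g set) \<Rightarrow> ('v dual \<Rightarrow> 'g \<Rightarrow> 'r::linordered_ab_group_add extended) \<Rightarrow>
     'v dual \<Rightarrow> 'r extended \<Rightarrow> 'g set" where
  "val_subgroup U \<phi> \<alpha> l = {u \<in> U \<alpha>. l \<le> \<phi> \<alpha> u}"

definition rgd_valuation ::
    "('g, 'b) monoid_scheme \<Rightarrow> 'v::euclidean_space dual set \<Rightarrow>
     ('v dual \<Rightarrow> 'g set) \<Rightarrow> ('v dual \<Rightarrow> 'g set) \<Rightarrow>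
     ('v dual \<Rightarrow> 'g \<Rightarrow> 'r::linordered_ab_group_add extended) \<Rightarrow> bool" where
  "rgd_valuation G \<Phi> U M \<phi> \<longleftrightarrow>
     (\<forall>\<alpha>\<in>\<Phi>. \<forall>u\<in>U \<alpha>. \<phi> \<alpha> u \<noteq> Minf) \<and>
     (\<forall>\<alpha>\<in>\<Phi>. \<exists>S. S \<subseteq> \<phi> \<alpha> ` U \<alpha> \<and> card S = 3) \<and>
     (\<forall>\<alpha>\<in>\<Phi>. (\<forall>l. l \<noteq> Minf \<longrightarrow> subgroup (val_subgroup U \<phi> \<alpha> l) G) \<and>
        val_subgroup U \<phi> \<alpha> Pinf = {\<one>\<^bsub>G\<^esub>}) \<and>
     (\<forall>\<alpha>\<in>\<Phi>. \<forall>m\<in>M \<alpha>. \<exists>c. \<forall>u\<in>U (- \<alpha>) - {\<one>\<^bsub>G\<^esub>}.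
        \<phi> (- \<alpha>) u - \<phi> \<alpha> (m \<otimes>\<^bsub>G\<^esub> u \<otimes>\<^bsub>G\<^esub> inv\<^bsub>G\<^esub> m) = c) \<and>
     (\<forall>\<alpha>\<in>\<Phi>. \<forall>\<beta>\<in>\<Phi>. \<not> (\<exists>c\<le>0. \<beta> = c *\<^sub>R \<alpha>) \<longrightarrow>
        (\<forall>l k. commutator_subgroup G (val_subgroup U \<phi> \<alpha> (Fin l)) (val_subgroup U \<phi> \<beta> (Fin k)) \<subseteq>
           generate G (\<Union>{val_subgroup U \<phi> (real r *\<^sub>R \<alpha> + real s *\<^sub>R \<beta>)
                            (Fin (int_mult (int r) l + int_mult (int s) k)) | r s.
                          0 < r \<and> 0 < s \<and> real r *\<^sub>R \<alpha> + real s *\<^sub>R \<beta> \<in> \<Phi>}))) \<and>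
     (\<forall>\<alpha>\<in>\<Phi>. multipliable \<Phi> \<alpha> \<longrightarrow> (\<forall>u\<in>U (2 *\<^sub>R \<alpha>). \<phi> (2 *\<^sub>R \<alpha>) u = \<phi> \<alpha> u + \<phi> \<alpha> u)) \<and>
     (\<forall>\<alpha>\<in>\<Phi>. \<forall>u\<in>U \<alpha>. \<forall>u'\<in>U (- \<alpha>). \<forall>u''\<in>U (- \<alpha>).
        u' \<otimes>\<^bsub>G\<^esub> u \<otimes>\<^bsub>G\<^esub> u'' \<in> M \<alpha> \<longrightarrow> \<phi> (- \<alpha>) u' = - \<phi> \<alpha> u)"

definition val_Gamma ::
    "('g, 'b) monoid_scheme \<Rightarrow> ('v::euclidean_space dual \<Rightarrow> 'g set) \<Rightarrow>
     ('v dual \<Rightarrow> 'g \<Rightarrow> 'r::linordered_ab_group_add extended) \<Rightarrow> 'v dual \<Rightarrow> 'r extended set" where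
  "val_Gamma G U \<phi> \<alpha> = \<phi> \<alpha> ` (U \<alpha> - {\<one>\<^bsub>G\<^esub>})"


section \<open>The apartment\<close>

definition coweight_lattice :: "'v::euclidean_space dual set \<Rightarrow> 'v monoid" where
  "coweight_lattice \<Phi> = additive_group {v. \<forall>\<alpha>\<in>\<Phi>. blinfun_apply \<alpha> v \<in> \<int>}"

text \<open>
  \<open>V\<^sub>R = V\<^sub>\<int> \<otimes> R\<close>. The affine space \<open>\<bbbA>\<^sub>R\<close> is \<open>V\<^sub>R\<close> acting on itself, with the neutral element as
  origin, so that \<open>x - o\<close> is \<open>x\<close>.
\<close>

type_synonym ('v, 'r) point = "('v \<times> 'r \<Rightarrow>\<^sub>0 int) set"

definition VR :: "'v::euclidean_space dual set \<Rightarrow> ('v, 'r::linordered_ab_group_add) point monoid" where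
  "VR \<Phi> = tensor_group (coweight_lattice \<Phi>) (additive_group UNIV)"

abbreviation apartment ::
    "'v::euclidean_space dual set \<Rightarrow> ('v, 'r::linordered_ab_group_add) point set" where
  "apartment \<Phi> \<equiv> carrier (VR \<Phi>)"

text \<open>For \<open>\<alpha> \<in> \<Phi>\<close>, the map \<open>V\<^sub>R \<rightarrow> R\<close> with \<open>v \<otimes> r \<mapsto> \<alpha>(v) r\<close>, where \<open>\<alpha>(v)\<close> is an integer.\<close>

definition root_value ::
    "'v::euclidean_space dual set \<Rightarrow> 'v dual \<Rightarrow> ('v, 'r::linordered_ab_group_add) point \<Rightarrow> 'r" where
  "root_value \<Phi> \<alpha> =
     tensor_lift (coweight_lattice \<Phi>) (additive_group UNIV) (additive_group UNIV)
       (\<lambda>v r. int_mult \<lfloor>blinfun_apply \<alpha> v\<rfloor> r)"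

text \<open>The map \<open>g \<otimes> id\<close> of \<open>V\<^sub>R\<close> for \<open>g \<in> GL(V\<^sub>\<int>)\<close>.\<close>

definition VR_map ::
    "'v::euclidean_space dual set \<Rightarrow> ('v \<Rightarrow> 'v) \<Rightarrow>
     ('v, 'r::linordered_ab_group_add) point \<Rightarrow> ('v, 'r) point" where
  "VR_map \<Phi> g =
     tensor_lift (coweight_lattice \<Phi>) (additive_group UNIV) (VR \<Phi>)
       (\<lambda>v r. pure_tensor (coweight_lattice \<Phi>) (additive_group UNIV) (g v) r)"

text \<open>\<open>Aff\<^sub>R(\<bbbA>\<^sub>R)\<close>: the pair \<open>(t, g)\<close> stands for the map \<open>x \<mapsto> g x + t\<close>.\<close>

type_synonym ('v, 'r) aff = "('v, 'r) point \<times> ('v \<Rightarrow> 'v)"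

definition aff_group ::
    "'v::euclidean_space dual set \<Rightarrow> ('v, 'r::linordered_ab_group_add) aff monoid" where
  "aff_group \<Phi> =
     \<lparr>carrier = carrier (VR \<Phi>) \<times> carrier (AutoGroup (coweight_lattice \<Phi>)),
      monoid.mult = (\<lambda>(t, g) (t', g').
        (t \<otimes>\<^bsub>VR \<Phi>\<^esub> VR_map \<Phi> g t', g \<otimes>\<^bsub>AutoGroup (coweight_lattice \<Phi>)\<^esub> g')),
      one = (\<one>\<^bsub>VR \<Phi>\<^esub>, \<one>\<^bsub>AutoGroup (coweight_lattice \<Phi>)\<^esub>)\<rparr>"

definition aff_apply ::
    "'v::euclidean_space dual set \<Rightarrow> ('v, 'r::linordered_ab_group_add) aff \<Rightarrow>
     ('v, 'r) point \<Rightarrow> ('v, 'r) point" where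
  "aff_apply \<Phi> a x = VR_map \<Phi> (snd a) x \<otimes>\<^bsub>VR \<Phi>\<^esub> fst a"

text \<open>
  \<open>W(\<Phi>)\<close> acts on the dual of \<open>V\<^sub>\<real>\<close>, hence contragrediently on \<open>V\<^sub>\<real>\<close>: the linear part \<open>g\<close> of
  \<open>\<nu> n\<close> is the transformation with \<open>(w \<beta>)(g v) = \<beta>(v)\<close>, where \<open>w\<close> is the image of \<open>n\<close> in \<open>W(\<Phi>)\<close>.
  This is (CA1), the second conjunct below.
\<close>

definition compatible_action ::
    "('g, 'b) monoid_scheme \<Rightarrow> 'v::euclidean_space dual set \<Rightarrow> ('v dual \<Rightarrow> 'v) \<Rightarrow>
     'g set \<Rightarrow> ('v dual \<Rightarrow> 'g set) \<Rightarrow> ('v dual \<Rightarrow> 'g set) \<Rightarrow>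
     ('v dual \<Rightarrow> 'g \<Rightarrow> 'r::linordered_ab_group_add extended) \<Rightarrow> ('g \<Rightarrow> ('v, 'r) aff) \<Rightarrow> bool" where
  "compatible_action G \<Phi> cor T U M \<phi> \<nu> \<longleftrightarrow>
     \<nu> \<in> hom (rgd_N_group G \<Phi> M) (aff_group \<Phi>) \<and>
     (\<forall>n\<in>rgd_N G \<Phi> M. \<forall>\<beta>. \<forall>v\<in>carrier (coweight_lattice \<Phi>).
        blinfun_apply (weyl_epi G \<Phi> cor T M n \<beta>) (snd (\<nu> n) v) = blinfun_apply \<beta> v) \<and>
     (\<forall>\<alpha>\<in>\<Phi>. \<forall>u\<in>U \<alpha> - {\<one>\<^bsub>G\<^esub>}.
        \<phi> \<alpha> u + \<phi> \<alpha> u +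
          Fin (root_value \<Phi> \<alpha> (aff_apply \<Phi> (\<nu> (rgd_m G U M \<alpha> u)) \<one>\<^bsub>VR \<Phi>\<^esub>)) = 0) \<and>
     (\<forall>\<alpha>\<in>\<Phi>. \<forall>m\<in>M \<alpha>. group.ord (aff_group \<Phi>) (\<nu> m) = 2)"

definition rgd_Tb ::
    "('g, 'b) monoid_scheme \<Rightarrow> 'v::euclidean_space dual set \<Rightarrow> ('v dual \<Rightarrow> 'g set) \<Rightarrow>
     ('g \<Rightarrow> ('v, 'r::linordered_ab_group_add) aff) \<Rightarrow> 'g set" where
  "rgd_Tb G \<Phi> M \<nu> = kernel (rgd_N_group G \<Phi> M) (aff_group \<Phi>) \<nu>"


section \<open>Subgroups attached to subsets and filters of the apartment\<close>

definition U_root ::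
    "'v::euclidean_space dual set \<Rightarrow> ('v dual \<Rightarrow> 'g set) \<Rightarrow>
     ('v dual \<Rightarrow> 'g \<Rightarrow> 'r::linordered_ab_group_add extended) \<Rightarrow>
     'v dual \<Rightarrow> ('v, 'r) point set \<Rightarrow> 'g set" where
  "U_root \<Phi> U \<phi> \<alpha> \<Omega> = (\<Inter>x\<in>\<Omega>. val_subgroup U \<phi> \<alpha> (Fin (- root_value \<Phi> \<alpha> x)))"

definition U_set ::
    "('g, 'b) monoid_scheme \<Rightarrow> 'v::euclidean_space dual set \<Rightarrow> ('v dual \<Rightarrow> 'g set) \<Rightarrow>
     ('v dual \<Rightarrow> 'g \<Rightarrow> 'r::linordered_ab_group_add extended) \<Rightarrow>
     ('v, 'r) point set \<Rightarrow> 'g set" where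
  "U_set G \<Phi> U \<phi> \<Omega> = generate G (\<Union>\<alpha>\<in>\<Phi>. U_root \<Phi> U \<phi> \<alpha> \<Omega>)"

definition N_hat ::
    "('g, 'b) monoid_scheme \<Rightarrow> 'v::euclidean_space dual set \<Rightarrow> ('v dual \<Rightarrow> 'g set) \<Rightarrow>
     ('g \<Rightarrow> ('v, 'r::linordered_ab_group_add) aff) \<Rightarrow> ('v, 'r) point set \<Rightarrow> 'g set" where
  "N_hat G \<Phi> M \<nu> \<Omega> = {n \<in> rgd_N G \<Phi> M. \<forall>x\<in>\<Omega>. aff_apply \<Phi> (\<nu> n) x = x}"

definition P_hat ::
    "('g, 'b) monoid_scheme \<Rightarrow> 'v::euclidean_space dual set \<Rightarrow>
     ('v dual \<Rightarrow> 'g set) \<Rightarrow> ('v dual \<Rightarrow> 'g set) \<Rightarrow>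
     ('v dual \<Rightarrow> 'g \<Rightarrow> 'r::linordered_ab_group_add extended) \<Rightarrow>
     ('g \<Rightarrow> ('v, 'r) aff) \<Rightarrow> ('v, 'r) point set \<Rightarrow> 'g set" where
  "P_hat G \<Phi> U M \<phi> \<nu> \<Omega> = generate G (U_set G \<Phi> U \<phi> \<Omega> \<union> N_hat G \<Phi> M \<nu> \<Omega>)"

text \<open>
  A filter on \<open>\<bbbA>\<^sub>R\<close> is given by the filter it generates on the ambient type; its members are the
  subsets \<open>\<Omega>\<close> of \<open>\<bbbA>\<^sub>R\<close> that hold eventually.
\<close>

definition P_hat_filter ::
    "('g, 'b) monoid_scheme \<Rightarrow> 'v::euclidean_space dual set \<Rightarrow>
     ('v dual \<Rightarrow> 'g set) \<Rightarrow> ('v dual \<Rightarrow> 'g set) \<Rightarrow>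
     ('v dual \<Rightarrow> 'g \<Rightarrow> 'r::linordered_ab_group_add extended) \<Rightarrow>
     ('g \<Rightarrow> ('v, 'r) aff) \<Rightarrow> ('v, 'r) point filter \<Rightarrow> 'g set" where
  "P_hat_filter G \<Phi> U M \<phi> \<nu> F =
     \<Union>{P_hat G \<Phi> U M \<phi> \<nu> \<Omega> | \<Omega>.
          \<Omega> \<noteq> {} \<and> \<Omega> \<subseteq> apartment \<Phi> \<and> eventually (\<lambda>y. y \<in> \<Omega>) F}"


section \<open>Vector chambers and faces\<close>

definition vector_chamber ::
    "'v::euclidean_space dual set \<Rightarrow> 'v dual set \<Rightarrow>
     ('v, 'r::linordered_ab_group_add) point set" where
  "vector_chamber \<Phi> \<Delta> = {v \<in> carrier (VR \<Phi>). \<forall>\<alpha>\<in>\<Delta>. 0 < root_value \<Phi> \<alpha> v}"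

definition vector_chambers ::
    "'v::euclidean_space dual set \<Rightarrow> ('v, 'r::linordered_ab_group_add) point set set" where
  "vector_chambers \<Phi> = {vector_chamber \<Phi> \<Delta> | \<Delta>. root_basis \<Phi> \<Delta>}"

definition U_chamber ::
    "('g, 'b) monoid_scheme \<Rightarrow> 'v::euclidean_space dual set \<Rightarrow> ('v dual \<Rightarrow> 'g set) \<Rightarrow>
     ('v, 'r::linordered_ab_group_add) point set \<Rightarrow> 'g set" where
  "U_chamber G \<Phi> U C =
     generate G (\<Union>{U \<alpha> | \<alpha> \<Delta>. root_basis \<Phi> \<Delta> \<and> C = vector_chamber \<Phi> \<Delta> \<and> \<alpha> \<in> pos_roots \<Phi> \<Delta>})"

text \<open>Since \<open>- Pinf = Minf\<close>, both sets are the whole apartment for \<open>l = Pinf\<close>.\<close>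

definition half_space ::
    "'v::euclidean_space dual set \<Rightarrow> 'v dual \<Rightarrow> 'r::linordered_ab_group_add extended \<Rightarrow>
     ('v, 'r) point set" where
  "half_space \<Phi> \<alpha> l = {y \<in> apartment \<Phi>. - l \<le> Fin (root_value \<Phi> \<alpha> y)}"

definition open_half_space ::
    "'v::euclidean_space dual set \<Rightarrow> 'v dual \<Rightarrow> 'r::linordered_ab_group_add extended \<Rightarrow>
     ('v, 'r) point set" where
  "open_half_space \<Phi> \<alpha> l = {y \<in> apartment \<Phi>. - l < Fin (root_value \<Phi> \<alpha> y)}"

definition apartment_topology ::
    "'v::euclidean_space dual set \<Rightarrow> ('v, 'r::linordered_ab_group_add) point topology" where
  "apartment_topology \<Phi> =
     topology_generated_by {open_half_space \<Phi> \<alpha> (Fin l) | \<alpha> l. \<alpha> \<in> \<Phi>}"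

definition neighbourhood ::
    "'v::euclidean_space dual set \<Rightarrow> ('v, 'r::linordered_ab_group_add) point \<Rightarrow>
     ('v, 'r) point set \<Rightarrow> bool" where
  "neighbourhood \<Phi> x \<Omega> \<longleftrightarrow>
     \<Omega> \<subseteq> apartment \<Phi> \<and> (\<exists>S. openin (apartment_topology \<Phi>) S \<and> x \<in> S \<and> S \<subseteq> \<Omega>)"

definition face_generators ::
    "('g, 'b) monoid_scheme \<Rightarrow> 'v::euclidean_space dual set \<Rightarrow> ('v dual \<Rightarrow> 'g set) \<Rightarrow>
     ('v dual \<Rightarrow> 'g \<Rightarrow> 'r::linordered_ab_group_add extended) \<Rightarrow>
     ('v, 'r) point \<Rightarrow> ('v, 'r) point set \<Rightarrow> ('v, 'r) point set set" where
  "face_generators G \<Phi> U \<phi> x C =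
     {S. (\<exists>\<Psi> l. \<Psi> \<subseteq> \<Phi> \<and> (\<forall>\<alpha>\<in>\<Phi>. l \<alpha> \<in> val_Gamma G U \<phi> \<alpha> \<union> {Pinf}) \<and>
            S = apartment \<Phi> \<inter> (\<Inter>\<alpha>\<in>\<Psi>. open_half_space \<Phi> \<alpha> (l \<alpha>)) \<inter>
                (\<Inter>\<alpha>\<in>\<Phi> - \<Psi>. half_space \<Phi> \<alpha> (l \<alpha>))) \<and>
         (\<exists>\<Omega>. neighbourhood \<Phi> x \<Omega> \<and> (\<lambda>v. x \<otimes>\<^bsub>VR \<Phi>\<^esub> v) ` C \<inter> \<Omega> \<subseteq> S)}"

definition face ::
    "('g, 'b) monoid_scheme \<Rightarrow> 'v::euclidean_space dual set \<Rightarrow> ('v dual \<Rightarrow> 'g set) \<Rightarrow>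
     ('v dual \<Rightarrow> 'g \<Rightarrow> 'r::linordered_ab_group_add extended) \<Rightarrow>
     ('v, 'r) point \<Rightarrow> ('v, 'r) point set \<Rightarrow> ('v, 'r) point filter" where
  "face G \<Phi> U \<phi> x C = (INF S\<in>face_generators G \<Phi> U \<phi> x C. principal S)"


section \<open>Double cosets\<close>

definition double_coset :: "('g, 'b) monoid_scheme \<Rightarrow> 'g set \<Rightarrow> 'g \<Rightarrow> 'g set \<Rightarrow> 'g set" where
  "double_coset G H g K = H <#>\<^bsub>G\<^esub> {g} <#>\<^bsub>G\<^esub> K"

definition double_cosets :: "('g, 'b) monoid_scheme \<Rightarrow> 'g set \<Rightarrow> 'g set \<Rightarrow> 'g set set" where
  "double_cosets G H K = {double_coset G H g K | g. g \<in> carrier G}"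

end

theory Submission
  imports Defs
begin

text \<open>
  The group \<open>G\<close> is the union of the sets \<open>U\<^sub>C\<^sub>' n P\<close> because this union is stable under left
  multiplication by the rank one groups attached to the simple roots: modulo the unipotent radical,
  this comes down to the fact that a non-trivial \<open>u \<in> U\<^sub>b\<close> either fixes the face or is of the form
  \<open>u' m u''\<close> with \<open>u', u'' \<in> U\<^sub>-\<^sub>b\<close>, \<open>m \<in> M\<^sub>b\<close> and \<open>u''\<close> fixing the face.

  For the injectivity, every set of the face contains a germ of a chamber; hence no root is constant
  on it and its pointwise stabiliser in \<open>N\<close> is \<open>T\<^sub>b\<close>. For such sets \<open>P\<close> has an Iwahori decomposition
  \<open>P\<^sup>+ P\<^sup>- T\<^sub>b\<close> with respect to every system of positive roots (adjacent systems are compared by a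
  computation in rank one), and the claim reduces to \<open>N \<inter> U\<^sup>+ U\<^sup>- = 1\<close>, which follows from the
  disjointness of the Bruhat cells.
\<close>


section \<open>Root systems\<close>

text \<open>The two chambers never have to be compared. The face enters the existence part only
  through the alternative for a single \<open>u \<in> U b\<close>, which holds for every root, and
  the uniqueness part only through sets on which no root is constant. Neither refers to a choice of
  positive roots, so the positive system can be taken from C'. In the uniqueness part an equation n'
  = u n p is read as n^-1 n' = (n^-1 u n) p, and p has to be factored with respect to the system in
  which n^-1 u n is positive. That system depends on n, which is why the Iwahori decomposition is
  wanted for every positive system.

  The delicate point in rank one is that the torus factor lies in T_b and not merely in T. For u in
  U_a and u' in U_-a whose values have a positive sum, two elements of M_a occur whose values agree,
  and (CA2) together with (CA3) forces them to act equally on the apartment. The Q-module structure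
  serves to divide in R: it puts a small box at the tip of x + C inside every member of the face,
  however large the coefficients of the roots are.\<close>

lemma linear_functional_on_dual:
  fixes h :: "'v::euclidean_space dual \<Rightarrow> real"
  assumes "linear h"
  obtains v where "\<And>\<beta>. blinfun_apply \<beta> v = h \<beta>"
proof
  fix \<beta> :: "'v dual"
  have e: "(\<Sum>b\<in>Basis. blinfun_apply \<beta> b *\<^sub>R blinfun_inner_left b) = \<beta>"
  proof (rule blinfun_eqI)
    fix v :: 'v
    have "blinfun_apply \<beta> v = blinfun_apply \<beta> (\<Sum>b\<in>Basis. (v \<bullet> b) *\<^sub>R b)"
      by (simp add: euclidean_representation)
    also have "\<dots> = (\<Sum>b\<in>Basis. (v \<bullet> b) * blinfun_apply \<beta> b)"
      by (simp add: blinfun.sum_right blinfun.scaleR_right)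
    finally show "blinfun_apply (\<Sum>b\<in>Basis. blinfun_apply \<beta> b *\<^sub>R blinfun_inner_left b) v = blinfun_apply \<beta> v"
      by (simp add: blinfun.sum_left blinfun.scaleR_left mult.commute inner_commute)
  qed
  have "h \<beta> = h (\<Sum>b\<in>Basis. blinfun_apply \<beta> b *\<^sub>R blinfun_inner_left b)"
    by (simp add: e)
  also have "\<dots> = (\<Sum>b\<in>Basis. blinfun_apply \<beta> b * h (blinfun_inner_left b))"
    by (simp add: linear_sum[OF assms] linear_scale[OF assms])
  finally show "blinfun_apply \<beta> (\<Sum>b\<in>Basis. h (blinfun_inner_left b) *\<^sub>R b) = h \<beta>"
    by (simp add: blinfun.sum_right blinfun.scaleR_right mult.commute)
qed

lemma linear_reflection: "linear (reflection cor \<alpha>)"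
  by (rule linearI)
     (simp_all add: reflection_def blinfun.add_left blinfun.scaleR_left algebra_simps)

locale root_sys =
  fixes \<Phi> :: "'v::euclidean_space dual set" and cor :: "'v dual \<Rightarrow> 'v"
  assumes root_system: "root_system \<Phi> cor"
begin

abbreviation refl :: "'v dual \<Rightarrow> 'v dual \<Rightarrow> 'v dual" where
  "refl \<equiv> reflection cor"

lemma finite_roots: "finite \<Phi>"
  and zero_notin_roots: "0 \<notin> \<Phi>"
  and span_roots: "span \<Phi> = UNIV"
  and coroot_self: "\<alpha> \<in> \<Phi> \<Longrightarrow> blinfun_apply \<alpha> (cor \<alpha>) = 2"
  and refl_root: "\<alpha> \<in> \<Phi> \<Longrightarrow> \<beta> \<in> \<Phi> \<Longrightarrow> refl \<alpha> \<beta> \<in> \<Phi>"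
  and coroot_int: "\<alpha> \<in> \<Phi> \<Longrightarrow> \<beta> \<in> \<Phi> \<Longrightarrow> blinfun_apply \<beta> (cor \<alpha>) \<in> \<int>"
  using root_system unfolding root_system_def by blast+

lemma refl_self: "\<alpha> \<in> \<Phi> \<Longrightarrow> refl \<alpha> \<alpha> = - \<alpha>"
  by (simp add: reflection_def coroot_self scaleR_2)

lemma uminus_root: "\<alpha> \<in> \<Phi> \<Longrightarrow> - \<alpha> \<in> \<Phi>"
  using refl_root[of \<alpha> \<alpha>] by (simp add: refl_self)

lemma refl_refl: "\<alpha> \<in> \<Phi> \<Longrightarrow> refl \<alpha> (refl \<alpha> \<beta>) = \<beta>"
  by (simp add: reflection_def coroot_self blinfun.diff_left blinfun.scaleR_left algebra_simps scaleR_2)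

lemma refl_uminus: "refl \<alpha> (- \<beta>) = - refl \<alpha> \<beta>"
  by (rule linear_neg[OF linear_reflection])

lemma bij_refl: "\<alpha> \<in> \<Phi> \<Longrightarrow> bij (refl \<alpha>)"
  by (rule o_bij[of "refl \<alpha>"]) (auto simp: refl_refl)

lemma linear_eq_on_roots:
  assumes "linear f" "linear g" "\<And>\<beta>. \<beta> \<in> \<Phi> \<Longrightarrow> f \<beta> = g \<beta>"
  shows "f = g"
  using linear_eq_on_span[OF assms(1,2), of \<Phi>] assms(3) span_roots by auto

text \<open>
  The form \<open>\<Sum>\<beta>\<in>\<Phi>. \<beta>(u) \<beta>(v)\<close> is invariant under the reflections; with respect to it \<open>\<alpha>\<close> is
  a positive multiple of the coroot of \<open>\<alpha>\<close>, which gives the symmetry of the sign.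
\<close>

lemma coroot_sign_symmetric:
  assumes "\<alpha> \<in> \<Phi>" "\<beta> \<in> \<Phi>" "0 < blinfun_apply \<alpha> (cor \<beta>)"
  shows "0 < blinfun_apply \<beta> (cor \<alpha>)"
proof -
  define B where "B u v = (\<Sum>\<gamma>\<in>\<Phi>. blinfun_apply \<gamma> u * blinfun_apply \<gamma> v)" for u v
  have B_comm: "B u v = B v u" for u v
    by (simp add: B_def mult.commute)
  have main: "2 * B (cor \<alpha>) v = blinfun_apply \<alpha> v * B (cor \<alpha>) (cor \<alpha>)"
    and pos: "0 < B (cor \<alpha>) (cor \<alpha>)" if a: "\<alpha> \<in> \<Phi>" for \<alpha> v
  proof -
    have "B (cor \<alpha>) v = (\<Sum>\<gamma>\<in>\<Phi>. blinfun_apply (refl \<alpha> \<gamma>) (cor \<alpha>) * blinfun_apply (refl \<alpha> \<gamma>) v)"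
      unfolding B_def
      by (rule sum.reindex_bij_witness[of _ "refl \<alpha>" "refl \<alpha>"]) (auto simp: refl_refl refl_root a)
    also have "\<dots> = (\<Sum>\<gamma>\<in>\<Phi>. - (blinfun_apply \<gamma> (cor \<alpha>) * blinfun_apply \<gamma> v)
          + blinfun_apply \<alpha> v * (blinfun_apply \<gamma> (cor \<alpha>) * blinfun_apply \<gamma> (cor \<alpha>)))"
      by (rule sum.cong) (simp_all add: reflection_def blinfun.diff_left blinfun.scaleR_left coroot_self a algebra_simps)
    also have "\<dots> = - B (cor \<alpha>) v + blinfun_apply \<alpha> v * B (cor \<alpha>) (cor \<alpha>)"
      by (simp only: sum.distrib B_def sum_negf sum_distrib_left)
    finally show "2 * B (cor \<alpha>) v = blinfun_apply \<alpha> v * B (cor \<alpha>) (cor \<alpha>)"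
      by simp
    have "0 < blinfun_apply \<alpha> (cor \<alpha>) * blinfun_apply \<alpha> (cor \<alpha>)"
      by (simp add: coroot_self a)
    then show "0 < B (cor \<alpha>) (cor \<alpha>)"
      unfolding B_def by (intro sum_pos2[OF finite_roots a]) auto
  qed
  have "0 < 2 * B (cor \<alpha>) (cor \<beta>)"
    unfolding main[OF assms(1)] using assms pos by simp
  then have "0 < blinfun_apply \<beta> (cor \<alpha>) * B (cor \<beta>) (cor \<beta>)"
    using main[OF assms(2), of "cor \<alpha>"] B_comm[of "cor \<alpha>" "cor \<beta>"] by simp
  with pos[OF assms(2)] show ?thesis
    by (simp add: zero_less_mult_iff)
qed

end

section \<open>Positive systems: dual basis, height and simple reflections\<close>

definition coweight :: "'v::euclidean_space dual set \<Rightarrow> 'v dual \<Rightarrow> 'v" where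
  "coweight \<Delta> \<delta> = (SOME v. \<forall>\<beta>. blinfun_apply \<beta> v = representation \<Delta> \<beta> \<delta>)"

text \<open>The usual height of roots, extended linearly to the whole dual, so that being positive
  becomes the sign of a linear function.\<close>

definition height :: "'v::euclidean_space dual set \<Rightarrow> 'v dual \<Rightarrow> real" where
  "height \<Delta> \<beta> = (\<Sum>\<delta>\<in>\<Delta>. blinfun_apply \<beta> (coweight \<Delta> \<delta>))"

lemma linear_height: "linear (height \<Delta>)"
  by (rule linearI)
     (simp_all add: height_def blinfun.add_left blinfun.scaleR_left sum.distrib sum_distrib_left)

text \<open>The basis is a locale parameter because facts proved for \<open>\<Delta>\<close> are
  later instantiated at the opposite basis, at images under the Weyl group and at the basis of the
  second chamber.\<close>

locale based_root_sys = root_sys \<Phi> cor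
  for \<Phi> :: "'v::euclidean_space dual set" and cor +
  fixes \<Delta> :: "'v dual set"
  assumes root_basis: "root_basis \<Phi> \<Delta>"
begin

abbreviation "pos \<equiv> pos_roots \<Phi> \<Delta>"

lemma basis_subset: "\<Delta> \<subseteq> \<Phi>" and independent_basis: "independent \<Delta>"
  and span_basis: "span \<Delta> = UNIV"
  and pos_or_neg: "\<beta> \<in> \<Phi> \<Longrightarrow> \<beta> \<in> pos \<or> - \<beta> \<in> pos"
  using root_basis unfolding root_basis_def by auto

lemma finite_basis: "finite \<Delta>"
  using basis_subset finite_roots finite_subset by blast

lemma basis_root: "a \<in> \<Delta> \<Longrightarrow> a \<in> \<Phi>"
  using basis_subset by auto

lemma pos_root: "\<beta> \<in> pos \<Longrightarrow> \<beta> \<in> \<Phi>"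
  by (simp add: pos_roots_def)

text \<open>The coefficient of \<open>\<delta>\<close> with respect to a basis is a linear
  functional on the dual, hence evaluation at a vector. So the choice in \<open>coweight\<close> can
  be met, and these vectors are the fundamental coweights.\<close>

lemma coweight: "blinfun_apply \<beta> (coweight \<Delta> \<delta>) = representation \<Delta> \<beta> \<delta>"
proof -
  have "linear (\<lambda>\<beta>::'v dual. representation \<Delta> \<beta> \<delta>)"
    using independent_basis span_basis
    by (intro linearI) (simp_all add: representation_add representation_scale)
  then obtain v where "\<And>\<beta>::'v dual. blinfun_apply \<beta> v = representation \<Delta> \<beta> \<delta>"
    by (rule linear_functional_on_dual) blast
  then show ?thesis
    unfolding coweight_def using someI[of "\<lambda>v. \<forall>\<beta>::'v dual. blinfun_apply \<beta> v = representation \<Delta> \<beta> \<delta>" v] by auto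
qed

lemma coweight_basis:
  "a \<in> \<Delta> \<Longrightarrow> blinfun_apply a (coweight \<Delta> \<delta>) = (if \<delta> = a then 1 else 0)"
  by (simp add: coweight representation_basis independent_basis)

lemma coweight_expand: "(\<Sum>\<delta>\<in>\<Delta>. blinfun_apply \<beta> (coweight \<Delta> \<delta>) *\<^sub>R \<delta>) = \<beta>"
  unfolding coweight
  by (rule sum_representation_eq) (auto simp: independent_basis span_basis finite_basis)

lemma coweight_eqI:
  fixes \<beta> \<gamma> :: "'v dual"
  shows "(\<And>\<delta>. \<delta> \<in> \<Delta> \<Longrightarrow> blinfun_apply \<beta> (coweight \<Delta> \<delta>) = blinfun_apply \<gamma> (coweight \<Delta> \<delta>)) \<Longrightarrow> \<beta> = \<gamma>"
  by (subst coweight_expand[of \<beta>, symmetric], subst coweight_expand[of \<gamma>, symmetric]) simp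

lemma coweight_pos_nat:
  assumes "\<beta> \<in> pos" "\<delta> \<in> \<Delta>"
  shows "blinfun_apply \<beta> (coweight \<Delta> \<delta>) \<in> \<nat>"
proof -
  obtain c :: "'v dual \<Rightarrow> nat" where c: "\<beta> = (\<Sum>\<delta>\<in>\<Delta>. real (c \<delta>) *\<^sub>R \<delta>)"
    using assms by (auto simp: pos_roots_def)
  have "blinfun_apply \<beta> (coweight \<Delta> \<delta>) = (\<Sum>a\<in>\<Delta>. if \<delta> = a then real (c a) else 0)"
    unfolding c by (simp add: blinfun.sum_left blinfun.scaleR_left coweight_basis if_distrib cong: if_cong)
  then show ?thesis
    using assms finite_basis by simp
qed

lemma coweight_pos_ge: "\<beta> \<in> pos \<Longrightarrow> \<delta> \<in> \<Delta> \<Longrightarrow> 0 \<le> blinfun_apply \<beta> (coweight \<Delta> \<delta>)"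
  using coweight_pos_nat by (force simp: Nats_def)

lemma coweight_int: "\<beta> \<in> \<Phi> \<Longrightarrow> \<delta> \<in> \<Delta> \<Longrightarrow> blinfun_apply \<beta> (coweight \<Delta> \<delta>) \<in> \<int>"
  using coweight_pos_nat[of \<beta> \<delta>] coweight_pos_nat[of "- \<beta>" \<delta>] pos_or_neg[of \<beta>]
    Nats_subset_Ints minus_in_Ints_iff[of "blinfun_apply \<beta> (coweight \<Delta> \<delta>)"]
  by (auto simp: blinfun.minus_left)

lemma coweight_pos_pos:
  assumes "\<beta> \<in> pos"
  obtains \<delta> where "\<delta> \<in> \<Delta>" "0 < blinfun_apply \<beta> (coweight \<Delta> \<delta>)"
proof -
  have "\<beta> \<noteq> 0" using assms pos_root zero_notin_roots by blast
  then obtain \<delta> where "\<delta> \<in> \<Delta>" "blinfun_apply \<beta> (coweight \<Delta> \<delta>) \<noteq> 0"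
    using coweight_eqI[of \<beta> 0] by auto
  with coweight_pos_ge[OF assms] that show thesis by force
qed

text \<open>The coefficients of a root all have the same sign, so a single positive one
  decides.\<close>

lemma pos_if_coweight_pos:
  assumes "\<beta> \<in> \<Phi>" "\<delta> \<in> \<Delta>" "0 < blinfun_apply \<beta> (coweight \<Delta> \<delta>)"
  shows "\<beta> \<in> pos"
  using pos_or_neg[OF assms(1)] coweight_pos_ge[of "- \<beta>" \<delta>] assms by (auto simp: blinfun.minus_left)

lemma height_pos:
  assumes "\<beta> \<in> pos"
  shows "0 < height \<Delta> \<beta>"
proof -
  obtain \<delta> where "\<delta> \<in> \<Delta>" "0 < blinfun_apply \<beta> (coweight \<Delta> \<delta>)"
    using coweight_pos_pos[OF assms] .
  then show ?thesis
    unfolding height_def by (rule sum_pos2[OF finite_basis]) (rule coweight_pos_ge[OF assms])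
qed

lemma pos_iff_height: "\<beta> \<in> \<Phi> \<Longrightarrow> \<beta> \<in> pos \<longleftrightarrow> 0 < height \<Delta> \<beta>"
  using height_pos[of \<beta>] height_pos[of "- \<beta>"] pos_or_neg[of \<beta>]
  by (auto simp: linear_neg[OF linear_height])

lemma uminus_notin_pos: "\<beta> \<in> pos \<Longrightarrow> - \<beta> \<notin> pos"
  using height_pos[of \<beta>] height_pos[of "- \<beta>"] by (auto simp: linear_neg[OF linear_height])

lemma height_pos_nat: "\<beta> \<in> pos \<Longrightarrow> height \<Delta> \<beta> \<in> \<nat>"
proof -
  assume b: "\<beta> \<in> pos"
  have "sum f S \<in> \<nat>" if "finite S" "\<And>s. s \<in> S \<Longrightarrow> f s \<in> \<nat>" for f :: "'v dual \<Rightarrow> real" and S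
    using that by (induction S rule: finite_induct) (auto intro: Nats_add)
  then show ?thesis
    unfolding height_def using coweight_pos_nat[OF b] finite_basis by presburger
qed

lemma basis_in_pos: "a \<in> \<Delta> \<Longrightarrow> a \<in> pos"
  by (rule pos_if_coweight_pos[of a a]) (auto simp: coweight_basis basis_root)

text \<open>The factor c is a natural number, being a coefficient of a positive root. Evaluating the
  root c a on its own coroot gives 2 = c k with k integral, so c divides 2. The root system may be
  non-reduced; hence \<open>a\<close> and \<open>2 *\<^sub>R a\<close> are split off together from
  the positive roots in what follows.\<close>

lemma multiple_of_basis_root:
  assumes a: "a \<in> \<Delta>" and ca: "c *\<^sub>R a \<in> pos"
  shows "c *\<^sub>R a \<in> {a, 2 *\<^sub>R a}"
proof -
  have "c \<in> \<nat>"
    using coweight_pos_nat[OF ca a] a by (simp add: blinfun.scaleR_left coweight_basis)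
  then obtain n where n: "c = real n" by (auto simp: Nats_def)
  have r: "c *\<^sub>R a \<in> \<Phi>" using ca pos_root by auto
  obtain k where k: "blinfun_apply a (cor (c *\<^sub>R a)) = real_of_int k"
    using coroot_int[OF r basis_root[OF a]] by (auto simp: Ints_def)
  have "real n * real_of_int k = 2"
    using coroot_self[OF r] unfolding blinfun.scaleR_left k by (simp add: n)
  then have "int n * k = 2"
    by (metis of_int_eq_iff of_int_mult of_int_numeral of_int_of_nat_eq)
  then have "n dvd 2"
    by (metis dvd_triv_left int_dvd_int_iff of_nat_numeral)
  then have "n \<le> 2" "n \<noteq> 0" by (auto dest: dvd_imp_le intro: Nat.gr0I)
  then have "n = 1 \<or> n = 2" by auto
  then show ?thesis using n by auto
qed

text \<open>A positive root that is not a multiple of \<open>a\<close> involves another basis root, whose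
  coefficient is not affected by adding multiples of \<open>a\<close>.\<close>

lemma pos_add_multiple:
  assumes a: "a \<in> \<Delta>" and b: "\<beta> \<in> pos - {a, 2 *\<^sub>R a}" and s: "0 < s"
    and r: "\<gamma> = c *\<^sub>R a + s *\<^sub>R \<beta>" "\<gamma> \<in> \<Phi>"
  shows "\<gamma> \<in> pos - {a, 2 *\<^sub>R a}"
proof -
  have "\<exists>\<delta>\<in>\<Delta>. \<delta> \<noteq> a \<and> 0 < blinfun_apply \<beta> (coweight \<Delta> \<delta>)"
  proof (rule ccontr)
    assume "\<not> ?thesis"
    then have z: "blinfun_apply \<beta> (coweight \<Delta> \<delta>) = 0" if "\<delta> \<in> \<Delta>" "\<delta> \<noteq> a" for \<delta>
      using that b coweight_pos_ge[of \<beta> \<delta>] by force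
    have "\<beta> = blinfun_apply \<beta> (coweight \<Delta> a) *\<^sub>R a"
      by (rule coweight_eqI) (use a z in \<open>auto simp: blinfun.scaleR_left coweight_basis\<close>)
    then show False
      using multiple_of_basis_root[OF a, of "blinfun_apply \<beta> (coweight \<Delta> a)"] b by auto
  qed
  then obtain \<delta> where d: "\<delta> \<in> \<Delta>" "\<delta> \<noteq> a" "0 < blinfun_apply \<beta> (coweight \<Delta> \<delta>)" by blast
  then have p: "0 < blinfun_apply \<gamma> (coweight \<Delta> \<delta>)"
    using s a unfolding r(1) by (simp add: blinfun.scaleR_left blinfun.add_left coweight_basis)
  with d(1) r(2) have "\<gamma> \<in> pos" by (auto intro: pos_if_coweight_pos)
  moreover have "\<gamma> \<noteq> a" "\<gamma> \<noteq> 2 *\<^sub>R a"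
    using p d(2) a by (auto simp: coweight_basis blinfun.scaleR_left)
  ultimately show ?thesis by auto
qed

lemma refl_basis_pos:
  assumes a: "a \<in> \<Delta>" and b: "\<beta> \<in> pos - {a, 2 *\<^sub>R a}"
  shows "refl a \<beta> \<in> pos - {a, 2 *\<^sub>R a}"
  using b pos_root refl_root basis_root[OF a]
  by (intro pos_add_multiple[OF a b, of 1 _ "- blinfun_apply \<beta> (cor a)"])
     (auto simp: reflection_def)

lemma refl_basis_multiple: "a \<in> \<Delta> \<Longrightarrow> refl a (2 *\<^sub>R a) = - (2 *\<^sub>R a)"
  using linear_scale[OF linear_reflection, of cor a 2 a] by (simp add: refl_self basis_root)

text \<open>Expanding the first \<beta> of \<beta>(\<beta>^vee) = 2 in the basis yields a basis root
  a with positive coefficient and a(\<beta>^vee) > 0. By the symmetry of the sign also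
  \<beta>(a^vee) > 0, so reflecting in a subtracts a positive multiple of a.\<close>

lemma height_descent:
  assumes b: "\<beta> \<in> pos" "\<And>a. a \<in> \<Delta> \<Longrightarrow> \<beta> \<notin> {a, 2 *\<^sub>R a}"
  obtains a where "a \<in> \<Delta>" "refl a \<beta> \<in> pos" "height \<Delta> (refl a \<beta>) < height \<Delta> \<beta>"
proof -
  have "2 = blinfun_apply (\<Sum>\<delta>\<in>\<Delta>. blinfun_apply \<beta> (coweight \<Delta> \<delta>) *\<^sub>R \<delta>) (cor \<beta>)"
    using coroot_self b pos_root by (simp add: coweight_expand)
  also have "\<dots> = (\<Sum>\<delta>\<in>\<Delta>. blinfun_apply \<beta> (coweight \<Delta> \<delta>) * blinfun_apply \<delta> (cor \<beta>))"
    by (simp add: blinfun.sum_left blinfun.scaleR_left)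
  finally have "\<exists>a\<in>\<Delta>. 0 < blinfun_apply \<beta> (coweight \<Delta> a) * blinfun_apply a (cor \<beta>)"
    using sum_nonpos[of \<Delta> "\<lambda>\<delta>. blinfun_apply \<beta> (coweight \<Delta> \<delta>) * blinfun_apply \<delta> (cor \<beta>)"]
    by force
  then obtain a where a: "a \<in> \<Delta>" "0 < blinfun_apply \<beta> (coweight \<Delta> a) * blinfun_apply a (cor \<beta>)" by blast
  then have "0 < blinfun_apply a (cor \<beta>)"
    using coweight_pos_ge[OF b(1), of a] by (auto simp: zero_less_mult_iff)
  then have k: "0 < blinfun_apply \<beta> (cor a)"
    using coroot_sign_symmetric[of a \<beta>] a b pos_root basis_root by auto
  have "refl a \<beta> \<in> pos" using refl_basis_pos[OF a(1), of \<beta>] b a by auto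
  moreover have "height \<Delta> (refl a \<beta>) < height \<Delta> \<beta>"
    using k height_pos[OF basis_in_pos[OF a(1)]]
    by (simp add: reflection_def linear_diff[OF linear_height] linear_scale[OF linear_height])
  ultimately show thesis using that a by blast
qed

text \<open>Heights of positive roots are natural numbers and drop under a suitable simple
  reflection until a basis root or its double is reached. As reflections are involutions, the
  descent can be offered as an ascending induction step.\<close>

lemma pos_induct [consumes 1, case_names basis double refl]:
  assumes "\<beta> \<in> pos"
    and "\<And>a. a \<in> \<Delta> \<Longrightarrow> P a" and "\<And>a. a \<in> \<Delta> \<Longrightarrow> 2 *\<^sub>R a \<in> \<Phi> \<Longrightarrow> P (2 *\<^sub>R a)"
    and step: "\<And>a \<beta>. a \<in> \<Delta> \<Longrightarrow> \<beta> \<in> pos \<Longrightarrow> P \<beta> \<Longrightarrow> P (refl a \<beta>)"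
  shows "P \<beta>"
  using assms(1)
proof (induction "nat \<lfloor>height \<Delta> \<beta>\<rfloor>" arbitrary: \<beta> rule: less_induct)
  case less
  show ?case
  proof (cases "\<exists>a\<in>\<Delta>. \<beta> \<in> {a, 2 *\<^sub>R a}")
    case True
    then show ?thesis using assms(2,3) less.prems pos_root by auto
  next
    case False
    then obtain a where a: "a \<in> \<Delta>" "refl a \<beta> \<in> pos" "height \<Delta> (refl a \<beta>) < height \<Delta> \<beta>"
      using height_descent[OF less.prems] by blast
    obtain m n where "height \<Delta> (refl a \<beta>) = real m" "height \<Delta> \<beta> = real n"
      using height_pos_nat[OF a(2)] height_pos_nat[OF less.prems] by (auto simp: Nats_def)
    then have "P (refl a \<beta>)" using a less.hyps[of "refl a \<beta>"] by auto
    then have "P (refl a (refl a \<beta>))" using step a by blast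
    then show ?thesis using a basis_root refl_refl by simp
  qed
qed

lemma root_basis_image:
  assumes w: "linear w" "bij w" "w ` \<Phi> = \<Phi>"
  shows "root_basis \<Phi> (w ` \<Delta>)" and "pos_roots \<Phi> (w ` \<Delta>) = w ` pos"
proof -
  have inj: "inj_on w S" for S using w(2) by (meson bij_is_inj inj_on_subset subset_UNIV)
  show p: "pos_roots \<Phi> (w ` \<Delta>) = w ` pos"
  proof (intro equalityI subsetI)
    fix \<gamma> assume "\<gamma> \<in> pos_roots \<Phi> (w ` \<Delta>)"
    then obtain c :: "'v dual \<Rightarrow> nat" where g: "\<gamma> \<in> \<Phi>" "\<gamma> = (\<Sum>\<delta>\<in>w ` \<Delta>. real (c \<delta>) *\<^sub>R \<delta>)"
      by (auto simp: pos_roots_def)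
    have e: "\<gamma> = w (\<Sum>\<delta>\<in>\<Delta>. real (c (w \<delta>)) *\<^sub>R \<delta>)"
      unfolding g(2) by (subst sum.reindex[OF inj]) (simp add: linear_sum[OF w(1)] linear_scale[OF w(1)])
    have "(\<Sum>\<delta>\<in>\<Delta>. real (c (w \<delta>)) *\<^sub>R \<delta>) \<in> \<Phi>"
      using g(1) w(3) inj[of UNIV] unfolding e by (metis (no_types, lifting) UNIV_I image_iff inj_onD)
    then have "(\<Sum>\<delta>\<in>\<Delta>. real (c (w \<delta>)) *\<^sub>R \<delta>) \<in> pos"
      unfolding pos_roots_def by (auto intro!: exI[of _ "\<lambda>\<delta>. c (w \<delta>)"])
    then show "\<gamma> \<in> w ` pos" using e by blast
  next
    fix \<gamma> assume "\<gamma> \<in> w ` pos"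
    then obtain \<beta> and c :: "'v dual \<Rightarrow> nat" where b: "\<gamma> = w \<beta>" "\<beta> \<in> \<Phi>" "\<beta> = (\<Sum>\<delta>\<in>\<Delta>. real (c \<delta>) *\<^sub>R \<delta>)"
      by (auto simp: pos_roots_def)
    have "w \<beta> = (\<Sum>\<delta>\<in>w ` \<Delta>. real (c (inv_into UNIV w \<delta>)) *\<^sub>R \<delta>)"
      unfolding b(3) using inj[of UNIV]
      by (subst sum.reindex[OF inj]) (simp add: linear_sum[OF w(1)] linear_scale[OF w(1)])
    moreover have "w \<beta> \<in> \<Phi>" using b(2) w(3) by blast
    ultimately show "\<gamma> \<in> pos_roots \<Phi> (w ` \<Delta>)"
      unfolding pos_roots_def b(1) mem_Collect_eq by (intro conjI exI) assumption+
  qed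
  show "root_basis \<Phi> (w ` \<Delta>)"
    unfolding root_basis_def
  proof (intro conjI ballI)
    show "w ` \<Delta> \<subseteq> \<Phi>" using basis_subset w(3) by blast
    show "independent (w ` \<Delta>)"
      by (rule linear_independent_injective_image[OF w(1) independent_basis]) (rule inj)
    show "span (w ` \<Delta>) = UNIV"
      using linear_span_image[OF w(1), of \<Delta>] span_basis w(2) by (simp add: bij_is_surj)
    fix \<beta> assume "\<beta> \<in> \<Phi>"
    then obtain \<gamma> where g: "\<gamma> \<in> \<Phi>" "\<beta> = w \<gamma>" using w(3) by blast
    then show "\<beta> \<in> pos_roots \<Phi> (w ` \<Delta>) \<or> - \<beta> \<in> pos_roots \<Phi> (w ` \<Delta>)"
      unfolding p using pos_or_neg[OF g(1)] linear_neg[OF w(1), of \<gamma>] by (metis imageI)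
  qed
qed

lemma root_basis_uminus: "root_basis \<Phi> (uminus ` \<Delta>)" "pos_roots \<Phi> (uminus ` \<Delta>) = uminus ` pos"
proof -
  have "linear (uminus :: 'v dual \<Rightarrow> 'v dual)" "bij (uminus :: 'v dual \<Rightarrow> 'v dual)"
    by (auto intro!: linearI o_bij[of uminus])
  moreover have "uminus ` \<Phi> = \<Phi>"
    using uminus_root by force
  ultimately show "root_basis \<Phi> (uminus ` \<Delta>)" "pos_roots \<Phi> (uminus ` \<Delta>) = uminus ` pos"
    by (auto dest: root_basis_image)
qed

lemma refl_image_roots: "\<alpha> \<in> \<Phi> \<Longrightarrow> refl \<alpha> ` \<Phi> = \<Phi>"
  by (auto simp: refl_root intro!: image_eqI[of \<beta> "refl \<alpha>" "refl \<alpha> \<beta>" for \<beta>] refl_refl[symmetric])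

text \<open>A positive system and its image under a simple reflection differ only in multiples of
  the simple root. This makes the passage between adjacent systems a question of rank one.\<close>

lemma refl_basis_pos_image:
  assumes a: "a \<in> \<Delta>"
  shows "refl a ` pos - {- a, - (2 *\<^sub>R a)} = pos - {a, 2 *\<^sub>R a}"
proof (intro equalityI subsetI)
  fix \<gamma> assume "\<gamma> \<in> refl a ` pos - {- a, - (2 *\<^sub>R a)}"
  then show "\<gamma> \<in> pos - {a, 2 *\<^sub>R a}"
    using refl_basis_pos[OF a] refl_self[OF basis_root[OF a]] refl_basis_multiple[OF a] by auto
next
  fix \<gamma> assume g: "\<gamma> \<in> pos - {a, 2 *\<^sub>R a}"
  then have "\<gamma> = refl a (refl a \<gamma>)" "refl a \<gamma> \<in> pos - {a, 2 *\<^sub>R a}"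
    using refl_basis_pos[OF a g] by (auto simp: refl_refl basis_root a)
  moreover have "\<gamma> \<noteq> - a" "\<gamma> \<noteq> - (2 *\<^sub>R a)"
    using height_pos[of \<gamma>] g height_pos[OF basis_in_pos[OF a]]
    by (auto simp: linear_neg[OF linear_height] linear_scale[OF linear_height])
  ultimately show "\<gamma> \<in> refl a ` pos - {- a, - (2 *\<^sub>R a)}" by blast
qed

end

section \<open>Conjugation and generated subgroups\<close>

context group
begin

definition cj :: "'a \<Rightarrow> 'a \<Rightarrow> 'a" where
  "cj g u = g \<otimes> u \<otimes> inv g"

lemma cancel_inv_left: "x \<in> carrier G \<Longrightarrow> y \<in> carrier G \<Longrightarrow> inv x \<otimes> (x \<otimes> y) = y"
  and cancel_left_inv: "x \<in> carrier G \<Longrightarrow> y \<in> carrier G \<Longrightarrow> x \<otimes> (inv x \<otimes> y) = y"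
  by (simp_all add: m_assoc[symmetric])

text \<open>These rules bring a word to right-associated form and cancel adjacent inverse pairs.
  After unfolding \<open>cj\<close>, they close the identities between long products below.\<close>

lemmas group_word = m_assoc inv_mult_group cancel_inv_left cancel_left_inv

lemma cj_closed [simp, intro]: "g \<in> carrier G \<Longrightarrow> u \<in> carrier G \<Longrightarrow> cj g u \<in> carrier G"
  by (simp add: cj_def)

lemma cj_mult: "g \<in> carrier G \<Longrightarrow> h \<in> carrier G \<Longrightarrow> u \<in> carrier G \<Longrightarrow> cj (g \<otimes> h) u = cj g (cj h u)"
  by (simp add: cj_def group_word)

lemma cj_prod: "g \<in> carrier G \<Longrightarrow> u \<in> carrier G \<Longrightarrow> v \<in> carrier G \<Longrightarrow> cj g (u \<otimes> v) = cj g u \<otimes> cj g v"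
  by (simp add: cj_def group_word)

lemma cj_inv: "g \<in> carrier G \<Longrightarrow> u \<in> carrier G \<Longrightarrow> cj g (inv u) = inv (cj g u)"
  by (simp add: cj_def group_word)

lemma cj_one [simp]: "u \<in> carrier G \<Longrightarrow> cj \<one> u = u"
  by (simp add: cj_def)

lemma cj_arg_one [simp]: "g \<in> carrier G \<Longrightarrow> cj g \<one> = \<one>"
  by (simp add: cj_def)

lemma cj_inv_cj [simp]: "g \<in> carrier G \<Longrightarrow> u \<in> carrier G \<Longrightarrow> cj (inv g) (cj g u) = u"
  and cj_cj_inv [simp]: "g \<in> carrier G \<Longrightarrow> u \<in> carrier G \<Longrightarrow> cj g (cj (inv g) u) = u"
  by (simp_all add: cj_def group_word)

lemma cj_mult_comm: "g \<in> carrier G \<Longrightarrow> u \<in> carrier G \<Longrightarrow> cj g u \<otimes> g = g \<otimes> u"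
  by (simp add: cj_def group_word)

lemma cj_eq_one: "g \<in> carrier G \<Longrightarrow> u \<in> carrier G \<Longrightarrow> cj g u = \<one> \<longleftrightarrow> u = \<one>"
proof -
  assume c: "g \<in> carrier G" "u \<in> carrier G"
  show "cj g u = \<one> \<longleftrightarrow> u = \<one>"
  proof
    assume "cj g u = \<one>"
    then have "cj (inv g) (cj g u) = cj (inv g) \<one>" by (rule arg_cong)
    then show "u = \<one>" using c by simp
  qed (use c in simp)
qed

lemma cj_in_subgroup: "subgroup H G \<Longrightarrow> h \<in> H \<Longrightarrow> u \<in> H \<Longrightarrow> cj h u \<in> H"
  by (simp add: cj_def subgroup.m_closed subgroup.m_inv_closed)

lemma cj_image_mult:
  "g \<in> carrier G \<Longrightarrow> h \<in> carrier G \<Longrightarrow> A \<subseteq> carrier G \<Longrightarrow> cj (g \<otimes> h) ` A = cj g ` cj h ` A"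
  unfolding image_image by (rule image_cong) (auto simp: cj_mult)

lemma cj_image_inv:
  "g \<in> carrier G \<Longrightarrow> A \<subseteq> carrier G \<Longrightarrow> cj g ` A = B \<Longrightarrow> cj (inv g) ` B = A"
proof -
  assume a: "g \<in> carrier G" "A \<subseteq> carrier G" "cj g ` A = B"
  have "(\<lambda>x. cj (inv g) (cj g x)) ` A = (\<lambda>x. x) ` A" using a by (intro image_cong) auto
  then show "cj (inv g) ` B = A" unfolding a(3)[symmetric] image_image by simp
qed

lemma generate_cj:
  assumes "g \<in> carrier G" "S \<subseteq> carrier G" "\<And>s. s \<in> S \<Longrightarrow> cj g s \<in> generate G S'" "S' \<subseteq> carrier G"
    and "k \<in> generate G S"
  shows "cj g k \<in> generate G S'"
  using assms(5)
proof (induction k rule: generate.induct)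
  case one then show ?case using assms(1) by (simp add: generate.one)
next
  case (incl h) then show ?case by (rule assms(3))
next
  case (inv h)
  then have "inv (cj g h) \<in> generate G S'"
    using generate_m_inv_closed[OF assms(4) assms(3)] by blast
  then show ?case using inv assms(1,2) by (simp add: cj_inv subsetD)
next
  case (eng h1 h2)
  then show ?case
    using generate_in_carrier[OF assms(2)] assms(1) generate.eng by (simp add: cj_prod)
qed

text \<open>Since H normalises K, one has (h1 k1)(h2 k2) = (h1 h2)((h2^-1 k1 h2) k2), so the
  products h k are already closed under multiplication.\<close>

lemma generate_product:
  assumes H: "subgroup H G" and K: "subgroup K G"
    and n: "\<And>h k. h \<in> H \<Longrightarrow> k \<in> K \<Longrightarrow> cj h k \<in> K"
    and z: "z \<in> generate G (H \<union> K)"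
  shows "\<exists>h\<in>H. \<exists>k\<in>K. z = h \<otimes> k"
proof -
  have base: "\<exists>h\<in>H. \<exists>k\<in>K. z = h \<otimes> k" if "z \<in> H \<union> K" for z
  proof (cases "z \<in> H")
    case True
    then have "z = z \<otimes> \<one>" using subgroup.mem_carrier[OF H] by simp
    with True subgroup.one_closed[OF K] show ?thesis by blast
  next
    case False
    then have "z \<in> K" "z = \<one> \<otimes> z" using that subgroup.mem_carrier[OF K] by auto
    with subgroup.one_closed[OF H] show ?thesis by blast
  qed
  show ?thesis
    using z
  proof (induction z rule: generate.induct)
    case one
    show ?case using subgroup.one_closed[OF H] by (intro base) simp
  next
    case (incl z)
    then show ?case by (rule base)
  next
    case (inv z)
    then have "inv z \<in> H \<union> K"
      using subgroup.m_inv_closed[OF H] subgroup.m_inv_closed[OF K] by auto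
    then show ?case by (rule base)
  next
    case (eng z1 z2)
    then obtain h1 k1 h2 k2 where z: "h1 \<in> H" "k1 \<in> K" "z1 = h1 \<otimes> k1" "h2 \<in> H" "k2 \<in> K" "z2 = h2 \<otimes> k2"
      by blast
    note c = z(1,4)[THEN subgroup.mem_carrier[OF H]] z(2,5)[THEN subgroup.mem_carrier[OF K]]
    have "z1 \<otimes> z2 = (h1 \<otimes> h2) \<otimes> (cj (inv h2) k1 \<otimes> k2)"
      using c by (simp add: z cj_def group_word)
    moreover have "h1 \<otimes> h2 \<in> H" "cj (inv h2) k1 \<otimes> k2 \<in> K"
      using z n H K subgroup.m_closed subgroup.m_inv_closed by metis+
    ultimately show ?case by blast
  qed
qed

end


section \<open>Root group data\<close>

locale rgd = based_root_sys \<Phi> cor \<Delta> + group G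
  for \<Phi> :: "'v::euclidean_space dual set" and cor \<Delta> and G :: "('g, 'b) monoid_scheme" (structure) +
  fixes T :: "'g set" and U M :: "'v dual \<Rightarrow> 'g set"
  assumes root_group_datum: "root_group_datum G \<Phi> cor T U M"
begin

abbreviation gen :: "('v dual \<Rightarrow> 'g set) \<Rightarrow> 'v dual set \<Rightarrow> 'g set" where
  "gen X A \<equiv> generate G (\<Union>\<alpha>\<in>A. X \<alpha>)"

lemmas datum = root_group_datum[unfolded root_group_datum_def multipliable_def, folded cj_def]

lemmas T_subgroup = datum[THEN conjunct1]

lemma U_subgroup: "\<alpha> \<in> \<Phi> \<Longrightarrow> subgroup (U \<alpha>) G" and U_not_one: "\<alpha> \<in> \<Phi> \<Longrightarrow> U \<alpha> \<noteq> {\<one>}"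
  using datum[THEN conjunct2, THEN conjunct1] by blast+

lemma U_commutator: "\<alpha> \<in> \<Phi> \<Longrightarrow> \<beta> \<in> \<Phi> \<Longrightarrow> \<not> (\<exists>c<0. \<beta> = c *\<^sub>R \<alpha>) \<Longrightarrow>
        commutator_subgroup G (U \<alpha>) (U \<beta>) \<subseteq> gen U (root_interval \<Phi> \<alpha> \<beta>)"
  by (rule datum[THEN conjunct2, THEN conjunct2, THEN conjunct1, rule_format])

lemma U_double: "\<alpha> \<in> \<Phi> \<Longrightarrow> 2 *\<^sub>R \<alpha> \<in> \<Phi> \<Longrightarrow> U (2 *\<^sub>R \<alpha>) \<subset> U \<alpha>"
  by (rule datum[THEN conjunct2, THEN conjunct2, THEN conjunct2, THEN conjunct1, rule_format])

lemma M_rcoset: "\<alpha> \<in> \<Phi> \<Longrightarrow> M \<alpha> \<in> rcosets T"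
  and U_decomp_set: "\<alpha> \<in> \<Phi> \<Longrightarrow> U (- \<alpha>) - {\<one>} \<subseteq> U \<alpha> <#> M \<alpha> <#> U \<alpha>"
  using datum[THEN conjunct2, THEN conjunct2, THEN conjunct2, THEN conjunct2, THEN conjunct1] by blast+

lemma M_cj_U: "\<alpha> \<in> \<Phi> \<Longrightarrow> \<beta> \<in> \<Phi> \<Longrightarrow> m \<in> M \<alpha> \<Longrightarrow> cj m ` U \<beta> = U (refl \<alpha> \<beta>)"
  by (rule datum[THEN conjunct2, THEN conjunct2, THEN conjunct2, THEN conjunct2, THEN conjunct2, THEN conjunct1, rule_format])

lemma T_Upos_Uneg: "root_basis \<Phi> \<Delta>' \<Longrightarrow>
        (T <#> gen U (pos_roots \<Phi> \<Delta>')) \<inter> gen (\<lambda>\<alpha>. U (- \<alpha>)) (pos_roots \<Phi> \<Delta>') = {\<one>}"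
  by (rule datum[THEN conjunct2, THEN conjunct2, THEN conjunct2, THEN conjunct2, THEN conjunct2, THEN conjunct2, rule_format])

lemma U_carrier: "\<alpha> \<in> \<Phi> \<Longrightarrow> U \<alpha> \<subseteq> carrier G"
  using U_subgroup subgroup.subset by blast

lemma U_mem_carrier: "u \<in> U \<alpha> \<Longrightarrow> \<alpha> \<in> \<Phi> \<Longrightarrow> u \<in> carrier G"
  using U_carrier by blast

lemma T_mem_carrier: "t \<in> T \<Longrightarrow> t \<in> carrier G"
  using T_subgroup subgroup.mem_carrier by metis

lemma U_union_carrier: "A \<subseteq> \<Phi> \<Longrightarrow> (\<Union>\<alpha>\<in>A. U \<alpha>) \<subseteq> carrier G"
  using U_carrier by blast

lemma U_nontrivial: "\<alpha> \<in> \<Phi> \<Longrightarrow> \<exists>u\<in>U \<alpha>. u \<noteq> \<one>"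
  using U_not_one[of \<alpha>] subgroup.one_closed[OF U_subgroup[of \<alpha>]] by blast

lemma pos_subset: "pos \<subseteq> \<Phi>"
  using pos_root by blast

lemma neg_subset: "uminus ` pos \<subseteq> \<Phi>"
  using pos_root uminus_root by blast

text \<open>(RGD6) for the given basis yields t u = v = 1. It remains to separate t from u, that is,
  to see that T meets U+ trivially; this is (RGD6) for the opposite basis, with t written as t times
  1.\<close>

lemma T_eq_Upos_Uneg:
  assumes t: "t \<in> T" and u: "u \<in> gen U pos" and v: "v \<in> gen U (uminus ` pos)" and e: "t \<otimes> u = v"
  shows "t = \<one>" "u = \<one>" "v = \<one>"
proof -
  interpret O: rgd \<Phi> cor "uminus ` \<Delta>" G T U M
    by (unfold_locales) (auto simp: root_basis_uminus root_group_datum)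
  have g: "gen (\<lambda>\<alpha>. U (- \<alpha>)) A = gen U (uminus ` A)" for A by (simp add: image_image)
  have c: "t \<in> carrier G" "u \<in> carrier G"
    using t u T_mem_carrier generate_in_carrier U_union_carrier[OF pos_subset] by auto
  have sep: "s \<otimes> x = \<one>" if "s \<in> T" "x \<in> gen U pos" "s \<otimes> x \<in> gen U (uminus ` pos)" for s x
    using T_Upos_Uneg[OF root_basis] that unfolding g set_mult_def by blast
  have sep': "s = \<one>" if s: "s \<in> T" "s \<in> gen U pos" for s
  proof -
    have "s \<otimes> \<one> \<in> (T <#> gen U (uminus ` pos)) \<inter> gen U (uminus ` uminus ` pos)"
      using s generate.one[of G] T_mem_carrier unfolding set_mult_def by (force simp: image_image)
    then show ?thesis
      using O.T_Upos_Uneg[OF root_basis_uminus(1)] s T_mem_carrier unfolding g root_basis_uminus by auto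
  qed
  have "t \<otimes> u = \<one>" using sep[OF t u] v e by simp
  then have "t = inv u" using c by (simp add: inv_equality)
  then have "t \<in> gen U pos"
    using generate_m_inv_closed[OF U_union_carrier[OF pos_subset] u] by simp
  then show "t = \<one>" using sep'[OF t] by simp
  then show "u = \<one>" "v = \<one>" using \<open>t \<otimes> u = \<one>\<close> c e by auto
qed

lemma U_in_gen: "u \<in> U \<alpha> \<Longrightarrow> \<alpha> \<in> A \<Longrightarrow> u \<in> gen U A"
  by (rule generate.incl) blast

lemma U_inter_uminus: "\<alpha> \<in> \<Phi> \<Longrightarrow> u \<in> U \<alpha> \<Longrightarrow> u \<in> U (- \<alpha>) \<Longrightarrow> u = \<one>"
proof -
  have *: "u = \<one>" if "\<alpha> \<in> pos" "u \<in> U \<alpha>" "u \<in> U (- \<alpha>)" for \<alpha> u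
    using that U_mem_carrier[OF that(2) pos_root]
    by (intro T_eq_Upos_Uneg(2)[OF subgroup.one_closed[OF T_subgroup], of u u] U_in_gen[of u \<alpha>] U_in_gen[of u "- \<alpha>"]) auto
  assume "\<alpha> \<in> \<Phi>" "u \<in> U \<alpha>" "u \<in> U (- \<alpha>)"
  then show "u = \<one>" using *[of \<alpha> u] *[of "- \<alpha>" u] pos_or_neg by auto
qed

lemma M_carrier: "\<alpha> \<in> \<Phi> \<Longrightarrow> M \<alpha> \<subseteq> carrier G"
  using M_rcoset subgroup.rcosets_carrier[OF T_subgroup is_group] by blast

lemma M_mem_carrier: "m \<in> M \<alpha> \<Longrightarrow> \<alpha> \<in> \<Phi> \<Longrightarrow> m \<in> carrier G"
  using M_carrier by blast

lemma M_eq_coset: "\<alpha> \<in> \<Phi> \<Longrightarrow> m \<in> M \<alpha> \<Longrightarrow> M \<alpha> = T #> m"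
  using M_rcoset T_subgroup repr_independence unfolding RCOSETS_def by fastforce

lemma T_mult_M: "\<alpha> \<in> \<Phi> \<Longrightarrow> m \<in> M \<alpha> \<Longrightarrow> t \<in> T \<Longrightarrow> t \<otimes> m \<in> M \<alpha>"
  using M_eq_coset[of \<alpha> m] unfolding r_coset_def by blast

lemma M_obtain_T: "\<alpha> \<in> \<Phi> \<Longrightarrow> m \<in> M \<alpha> \<Longrightarrow> m' \<in> M \<alpha> \<Longrightarrow> \<exists>t\<in>T. m' = t \<otimes> m"
  using M_eq_coset[of \<alpha> m] unfolding r_coset_def by blast

lemma M_mult_inv_M: "\<alpha> \<in> \<Phi> \<Longrightarrow> m \<in> M \<alpha> \<Longrightarrow> m' \<in> M \<alpha> \<Longrightarrow> m' \<otimes> inv m \<in> T"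
  using M_obtain_T[of \<alpha> m m'] M_mem_carrier T_mem_carrier by (auto simp: group_word)

lemma U_decomp:
  assumes "\<alpha> \<in> \<Phi>" "u \<in> U (- \<alpha>)" "u \<noteq> \<one>"
  obtains v m v' where "v \<in> U \<alpha>" "m \<in> M \<alpha>" "v' \<in> U \<alpha>" "u = v \<otimes> m \<otimes> v'"
  using U_decomp_set[OF assms(1)] assms(2,3) unfolding set_mult_def by blast

lemma M_nonempty: "\<alpha> \<in> \<Phi> \<Longrightarrow> \<exists>m. m \<in> M \<alpha>"
  using U_nontrivial[of "- \<alpha>"] uminus_root[of \<alpha>] U_decomp by metis

text \<open>Both m and t m lie in \<open>M \<beta>\<close>, so by (RGD5) both carry
  \<open>U (- \<beta>)\<close> onto \<open>U \<beta>\<close>; comparing the two shows that t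
  preserves \<open>U \<beta>\<close>.\<close>

lemma T_cj_U: "t \<in> T \<Longrightarrow> \<beta> \<in> \<Phi> \<Longrightarrow> cj t ` U \<beta> = U \<beta>"
proof -
  assume t: "t \<in> T" and b: "\<beta> \<in> \<Phi>"
  obtain m where m: "m \<in> M \<beta>" using M_nonempty b by blast
  have e: "cj m ` U (- \<beta>) = U \<beta>"
    using M_cj_U[OF b uminus_root[OF b] m] by (simp add: refl_uminus refl_self b)
  have "cj (t \<otimes> m) ` U (- \<beta>) = U \<beta>"
    using M_cj_U[OF b uminus_root[OF b] T_mult_M[OF b m t]] by (simp add: refl_uminus refl_self b)
  then show ?thesis
    using e cj_image_mult[OF T_mem_carrier[OF t] M_mem_carrier[OF m b] U_carrier[OF uminus_root[OF b]]] by simp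
qed

lemma U_cj_U: "u \<in> U \<alpha> \<Longrightarrow> \<alpha> \<in> \<Phi> \<Longrightarrow> v \<in> U \<alpha> \<Longrightarrow> cj u v \<in> U \<alpha>"
  by (intro cj_in_subgroup U_subgroup)

subsection \<open>Rank one\<close>

text \<open>If v is not 1, write v = y1 m y2 with y1, y2 in \<open>U (- \<alpha>)\<close>. Then m
  would normalise \<open>U (- \<alpha>)\<close> as well, although it carries that group onto
  \<open>U \<alpha>\<close>, and the two meet trivially.\<close>

lemma normalizing_eq_one:
  assumes a: "\<alpha> \<in> \<Phi>" and v: "v \<in> U \<alpha>" and n: "\<And>x. x \<in> U (- \<alpha>) \<Longrightarrow> cj v x \<in> U (- \<alpha>)"
  shows "v = \<one>"
proof (rule ccontr)
  assume "v \<noteq> \<one>"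
  note na = uminus_root[OF a]
  obtain y1 m y2 where d: "y1 \<in> U (- \<alpha>)" "m \<in> M (- \<alpha>)" "y2 \<in> U (- \<alpha>)" "v = y1 \<otimes> m \<otimes> y2"
    using U_decomp[OF na, of v] v \<open>v \<noteq> \<one>\<close> by auto
  obtain u where u: "u \<in> U \<alpha>" "u \<noteq> \<one>" using U_nontrivial[OF a] by blast
  have "cj m ` U (- \<alpha>) = U \<alpha>" using M_cj_U[OF na na d(2)] by (simp add: refl_self[OF na])
  then obtain x where x: "x \<in> U (- \<alpha>)" "u = cj m x" using u(1) by blast
  note c = U_mem_carrier[OF x(1) na] U_mem_carrier[OF d(1) na] U_mem_carrier[OF d(3) na] M_mem_carrier[OF d(2) na]
  have x': "cj (inv y2) x \<in> U (- \<alpha>)"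
    using U_cj_U[OF _ na] x d subgroup.m_inv_closed[OF U_subgroup[OF na]] by blast
  have "cj v (cj (inv y2) x) = cj y1 u"
    using c by (simp add: d(4) x(2) cj_mult)
  then have "cj y1 u \<in> U (- \<alpha>)" using n[OF x'] by simp
  then have "cj (inv y1) (cj y1 u) \<in> U (- \<alpha>)"
    using U_cj_U[OF _ na] d subgroup.m_inv_closed[OF U_subgroup[OF na]] by blast
  then have "u \<in> U (- \<alpha>)" using c x by simp
  then show False using U_inter_uminus[OF a u(1)] u(2) by simp
qed

text \<open>The property of elements of \<open>M \<alpha>\<close> on which the uniqueness of middle
  factors rests. Unlike membership in \<open>M \<alpha>\<close> it can be checked directly after a
  conjugation or when \<alpha> is compared with its double; \<open>swaps_in_M\<close> then recovers
  membership.\<close>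

definition swaps :: "'v dual \<Rightarrow> 'g \<Rightarrow> bool" where
  "swaps \<alpha> g \<longleftrightarrow> g \<in> carrier G \<and> cj g ` U \<alpha> = U (- \<alpha>) \<and> cj g ` U (- \<alpha>) = U \<alpha>"

lemma swaps_uminus: "swaps (- \<alpha>) g \<longleftrightarrow> swaps \<alpha> g"
  by (auto simp: swaps_def)

lemma swaps_M: "\<alpha> \<in> \<Phi> \<Longrightarrow> m \<in> M \<alpha> \<Longrightarrow> swaps \<alpha> m"
  using M_cj_U[of \<alpha> \<alpha> m] M_cj_U[of \<alpha> "- \<alpha>" m] uminus_root[of \<alpha>] M_mem_carrier[of m \<alpha>]
  by (simp add: swaps_def refl_uminus refl_self)

lemma swaps_inv: "\<alpha> \<in> \<Phi> \<Longrightarrow> swaps \<alpha> m \<Longrightarrow> swaps \<alpha> (inv m)"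
  using cj_image_inv[of m "U \<alpha>" "U (- \<alpha>)"] cj_image_inv[of m "U (- \<alpha>)" "U \<alpha>"]
    U_carrier uminus_root by (simp add: swaps_def)

text \<open>Collecting factors gives m1 = v m2 v'. Then v m2 = m1 v'^-1 shows that v normalises
  \<open>U (- \<alpha>)\<close>, so v = 1. The inverse equation treats v' in the same way.\<close>

lemma swaps_unique:
  assumes a: "\<alpha> \<in> \<Phi>" and m: "swaps \<alpha> m1" "swaps \<alpha> m2"
    and v: "v1 \<in> U \<alpha>" "v1' \<in> U \<alpha>" "v2 \<in> U \<alpha>" "v2' \<in> U \<alpha>"
    and e: "v1 \<otimes> m1 \<otimes> v1' = v2 \<otimes> m2 \<otimes> v2'"
  shows "m1 = m2"
proof -
  have key: "v = \<one>" if h: "swaps \<alpha> m1" "swaps \<alpha> m2" "v \<in> U \<alpha>" "v' \<in> U \<alpha>" "m1 = v \<otimes> m2 \<otimes> v'" for v v' m1 m2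
  proof (rule normalizing_eq_one[OF a \<open>v \<in> U \<alpha>\<close>])
    fix x assume "x \<in> U (- \<alpha>)"
    then obtain y where y: "y \<in> U \<alpha>" "x = cj m2 y" using h(2) unfolding swaps_def by blast
    have y': "cj (inv v') y \<in> U \<alpha>"
      using U_cj_U[OF _ a] y h(4) subgroup.m_inv_closed[OF U_subgroup[OF a]] by blast
    have "cj v x = cj m1 (cj (inv v') y)"
      using h(2) y U_mem_carrier[OF _ a] h(3,4) unfolding h(5) swaps_def by (simp add: cj_mult)
    then show "cj v x \<in> U (- \<alpha>)" using y' h(1) unfolding swaps_def by blast
  qed
  note c = v[THEN U_mem_carrier[OF _ a]]
  have mc: "m1 \<in> carrier G" "m2 \<in> carrier G" using m by (auto simp: swaps_def)
  define v v' where "v = inv v1 \<otimes> v2" and "v' = v2' \<otimes> inv v1'"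
  have vU: "v \<in> U \<alpha>" "v' \<in> U \<alpha>"
    unfolding v_def v'_def using v U_subgroup[OF a] subgroup.m_closed subgroup.m_inv_closed by metis+
  have vc: "v \<in> carrier G" "v' \<in> carrier G" using vU U_mem_carrier[OF _ a] by auto
  have e1: "m1 = v \<otimes> m2 \<otimes> v'"
  proof -
    have "m1 = inv v1 \<otimes> (v1 \<otimes> m1 \<otimes> v1') \<otimes> inv v1'" using c mc by (simp add: group_word)
    then show ?thesis unfolding e v_def v'_def using c mc by (simp add: group_word)
  qed
  have "v = \<one>" by (rule key[OF m vU e1])
  moreover have "inv v' = \<one>"
  proof (rule key[OF swaps_inv[OF a m(1)] swaps_inv[OF a m(2)]])
    show "inv m1 = inv v' \<otimes> inv m2 \<otimes> inv v" unfolding e1 using vc mc by (simp add: group_word)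
  qed (use vU subgroup.m_inv_closed[OF U_subgroup[OF a]] in auto)
  ultimately show ?thesis using e1 vc mc by (metis inv_inv inv_one l_one r_one)
qed

lemma swaps_in_M:
  assumes a: "\<alpha> \<in> \<Phi>" and m: "swaps \<alpha> m" and v: "v \<in> U \<alpha>" "v' \<in> U \<alpha>"
    and u: "v \<otimes> m \<otimes> v' \<in> U (- \<alpha>)" "v \<otimes> m \<otimes> v' \<noteq> \<one>"
  shows "m \<in> M \<alpha>"
proof -
  obtain v1 m1 v1' where d: "v1 \<in> U \<alpha>" "m1 \<in> M \<alpha>" "v1' \<in> U \<alpha>" "v \<otimes> m \<otimes> v' = v1 \<otimes> m1 \<otimes> v1'"
    using U_decomp[OF a u] by blast
  have "m = m1" using swaps_unique[OF a m swaps_M[OF a d(2)] v d(1,3,4)] .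
  then show ?thesis using d(2) by simp
qed

lemma cj_swaps:
  assumes n: "n \<in> carrier G" and a: "\<alpha> \<in> \<Phi>" "\<gamma> \<in> \<Phi>" "cj n ` U \<alpha> = U \<gamma>" "cj n ` U (- \<alpha>) = U (- \<gamma>)"
    and m: "swaps \<alpha> m"
  shows "swaps \<gamma> (cj n m)"
proof -
  have c: "m \<in> carrier G" using m by (simp add: swaps_def)
  note U\<alpha> = U_carrier[OF a(1)] U_carrier[OF uminus_root[OF a(1)]]
  note U\<gamma> = U_carrier[OF a(2)] U_carrier[OF uminus_root[OF a(2)]]
  have i: "cj (inv n) ` U \<gamma> = U \<alpha>" "cj (inv n) ` U (- \<gamma>) = U (- \<alpha>)"
    using cj_image_inv[OF n] U\<alpha> a by auto
  have "cj (cj n m) ` B = cj n ` cj m ` cj (inv n) ` B" if "B \<subseteq> carrier G" for B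
    unfolding image_image using that n c by (intro image_cong) (auto simp: cj_def[of n m] cj_mult)
  then have "cj (cj n m) ` U \<gamma> = cj n ` cj m ` U \<alpha>" "cj (cj n m) ` U (- \<gamma>) = cj n ` cj m ` U (- \<alpha>)"
    using U\<gamma> i by metis+
  then show ?thesis using m a(3,4) n c unfolding swaps_def by simp
qed

text \<open>Conjugating the (RGD4) decomposition of an element of \<open>U (- \<alpha>)\<close> by n
  gives such a decomposition in \<open>U (- \<gamma>)\<close>, whose middle factor is in
  \<open>M \<gamma>\<close> by uniqueness. A single m suffices at this stage: only once T is known
  to be normalised does the claim spread over the whole coset, in \<open>cj_M\<close>.\<close>

lemma cj_M_aux:
  assumes n: "n \<in> carrier G" and a: "\<alpha> \<in> \<Phi>" "\<gamma> \<in> \<Phi>" "cj n ` U \<alpha> = U \<gamma>" "cj n ` U (- \<alpha>) = U (- \<gamma>)"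
  shows "\<exists>m\<in>M \<alpha>. cj n m \<in> M \<gamma>"
proof -
  obtain u where u: "u \<in> U (- \<alpha>)" "u \<noteq> \<one>" using U_nontrivial[OF uminus_root[OF a(1)]] by blast
  obtain v m v' where d: "v \<in> U \<alpha>" "m \<in> M \<alpha>" "v' \<in> U \<alpha>" "u = v \<otimes> m \<otimes> v'"
    using U_decomp[OF a(1) u] by blast
  note c = U_mem_carrier[OF d(1) a(1)] U_mem_carrier[OF d(3) a(1)] M_mem_carrier[OF d(2) a(1)]
  have e: "cj n u = cj n v \<otimes> cj n m \<otimes> cj n v'"
    unfolding d(4) using n c by (simp add: cj_prod)
  have "cj n m \<in> M \<gamma>"
  proof (rule swaps_in_M[OF a(2) cj_swaps[OF n a swaps_M[OF a(1) d(2)]]])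
    show "cj n v \<in> U \<gamma>" "cj n v' \<in> U \<gamma>" using d a(3) by auto
    show "cj n v \<otimes> cj n m \<otimes> cj n v' \<in> U (- \<gamma>)" using u(1) a(4) unfolding e[symmetric] by blast
    show "cj n v \<otimes> cj n m \<otimes> cj n v' \<noteq> \<one>"
      unfolding e[symmetric] using u n c by (simp add: cj_eq_one d(4))
  qed
  then show ?thesis using d(2) by blast
qed

text \<open>Conjugation by t^-1 keeps some m1 inside its coset \<open>M \<alpha>\<close>, so t^-1 m1
  t m1^-1 lies in T, and multiplying by t from the left gives m1 t m1^-1 in T. Any other m is an
  element of T times m1.\<close>

lemma T_cj_M_mult: "\<alpha> \<in> \<Phi> \<Longrightarrow> m \<in> M \<alpha> \<Longrightarrow> t \<in> T \<Longrightarrow> cj m t \<in> T"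
proof -
  assume a: "\<alpha> \<in> \<Phi>" and m: "m \<in> M \<alpha>" and t: "t \<in> T"
  have it: "inv t \<in> T" using t subgroup.m_inv_closed[OF T_subgroup] by blast
  obtain m1 where m1: "m1 \<in> M \<alpha>" "cj (inv t) m1 \<in> M \<alpha>"
    using cj_M_aux[OF T_mem_carrier[OF it] a a] T_cj_U[OF it] a uminus_root by blast
  obtain s where s: "s \<in> T" "m = s \<otimes> m1" using M_obtain_T[OF a m1(1) m] by blast
  note c = T_mem_carrier[OF t] T_mem_carrier[OF s(1)] M_mem_carrier[OF m1(1) a]
  have "cj (inv t) m1 \<otimes> inv m1 \<in> T" using M_mult_inv_M[OF a m1] .
  then have "s \<otimes> (t \<otimes> (cj (inv t) m1 \<otimes> inv m1)) \<otimes> inv s \<in> T"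
    using s(1) t T_subgroup subgroup.m_closed subgroup.m_inv_closed by metis
  moreover have "s \<otimes> (t \<otimes> (cj (inv t) m1 \<otimes> inv m1)) \<otimes> inv s = cj m t"
    using c by (simp add: s(2) cj_def group_word)
  ultimately show "cj m t \<in> T" by simp
qed

text \<open>With v = 1, the element u = m v' would conjugate \<open>U \<alpha>\<close> into
  \<open>U (- \<alpha>)\<close>, a group that u itself normalises; then \<open>U \<alpha>\<close>
  would lie in \<open>U (- \<alpha>)\<close>.\<close>

lemma M_decomp_left_not_one:
  assumes a: "\<alpha> \<in> \<Phi>" and u: "u \<in> U (- \<alpha>)" and d: "v \<in> U \<alpha>" "m \<in> M \<alpha>" "v' \<in> U \<alpha>" "u = v \<otimes> m \<otimes> v'"
  shows "v \<noteq> \<one>"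
proof -
  note na = uminus_root[OF a]
  note c = U_mem_carrier[OF u na] U_mem_carrier[OF d(1) a] U_mem_carrier[OF d(3) a] M_mem_carrier[OF d(2) a]
  have sw: "cj m ` U \<alpha> = U (- \<alpha>)" "cj m ` U (- \<alpha>) = U \<alpha>"
    using swaps_M[OF a d(2)] by (auto simp: swaps_def)
  obtain x where x: "x \<in> U \<alpha>" "x \<noteq> \<one>" using U_nontrivial[OF a] by blast
  note xc = U_mem_carrier[OF x(1) a]
  show "v \<noteq> \<one>"
  proof
    assume "v = \<one>"
    then have m: "m = u \<otimes> inv v'" using c by (simp add: d(4) group_word)
    have "cj v' x \<in> U \<alpha>" using U_cj_U[OF d(3) a x(1)] .
    then have "cj m (cj v' x) \<in> U (- \<alpha>)" using sw by blast
    moreover have "cj m (cj v' x) = cj u x" unfolding m using c xc by (simp add: cj_mult)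
    ultimately have "cj (inv u) (cj u x) \<in> U (- \<alpha>)"
      using U_cj_U[OF _ na] u subgroup.m_inv_closed[OF U_subgroup[OF na]] by simp
    then show False using U_inter_uminus[OF a x(1)] x(2) c xc by simp
  qed
qed

text \<open>Solving u = v m1 v' for v gives v = u m1^-1 (m1 v'^-1 m1^-1), a decomposition of the
  non-trivial element v of \<open>U \<alpha>\<close> with respect to the opposite root. Its middle
  factor m1^-1 therefore lies in \<open>M (- \<alpha>)\<close>.\<close>

lemma inv_M_uminus: "\<alpha> \<in> \<Phi> \<Longrightarrow> m \<in> M \<alpha> \<Longrightarrow> inv m \<in> M (- \<alpha>)"
proof -
  assume a: "\<alpha> \<in> \<Phi>" and m: "m \<in> M \<alpha>"
  note na = uminus_root[OF a]
  obtain u where u: "u \<in> U (- \<alpha>)" "u \<noteq> \<one>" using U_nontrivial[OF na] by blast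
  obtain v m1 v' where d: "v \<in> U \<alpha>" "m1 \<in> M \<alpha>" "v' \<in> U \<alpha>" "u = v \<otimes> m1 \<otimes> v'"
    using U_decomp[OF a u] by blast
  note c = U_mem_carrier[OF u(1) na] U_mem_carrier[OF d(1) a] U_mem_carrier[OF d(3) a] M_mem_carrier[OF d(2) a]
  have sw: "swaps \<alpha> m1" using swaps_M[OF a d(2)] .
  have e: "v = u \<otimes> inv m1 \<otimes> cj m1 (inv v')"
    using c by (simp add: d(4) cj_def group_word)
  have iv: "inv v' \<in> U \<alpha>" using d(3) subgroup.m_inv_closed[OF U_subgroup[OF a]] by blast
  have i1: "inv m1 \<in> M (- \<alpha>)"
  proof (rule swaps_in_M[OF na])
    show "swaps (- \<alpha>) (inv m1)" using swaps_inv[OF a sw] swaps_uminus by simp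
    show "u \<in> U (- \<alpha>)" by (rule u)
    show "cj m1 (inv v') \<in> U (- \<alpha>)" using sw iv unfolding swaps_def by blast
    show "u \<otimes> inv m1 \<otimes> cj m1 (inv v') \<in> U (- (- \<alpha>))" using d(1) e by simp
    show "u \<otimes> inv m1 \<otimes> cj m1 (inv v') \<noteq> \<one>" using M_decomp_left_not_one[OF a u(1) d] e by simp
  qed
  obtain t where t: "t \<in> T" "m = t \<otimes> m1" using M_obtain_T[OF a d(2) m] by blast
  have "inv t \<in> T" using t subgroup.m_inv_closed[OF T_subgroup] by blast
  then have "cj (inv m1) (inv t) \<in> T" using T_cj_M_mult[OF na i1] by blast
  then have "cj (inv m1) (inv t) \<otimes> inv m1 \<in> M (- \<alpha>)" using T_mult_M[OF na i1] by blast
  moreover have "cj (inv m1) (inv t) \<otimes> inv m1 = inv m"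
    using c T_mem_carrier[OF t(1)] by (simp add: t(2) cj_def group_word)
  ultimately show "inv m \<in> M (- \<alpha>)" by simp
qed

lemma M_eqI: "\<alpha> \<in> \<Phi> \<Longrightarrow> \<beta> \<in> \<Phi> \<Longrightarrow> m \<in> M \<alpha> \<Longrightarrow> m \<in> M \<beta> \<Longrightarrow> M \<alpha> = M \<beta>"
  by (rule trans[OF M_eq_coset M_eq_coset[symmetric]])

text \<open>Conjugation by some m0 in \<open>M \<alpha>\<close> takes a suitable m = t m0 of
  \<open>M \<alpha>\<close> into \<open>M (- \<alpha>)\<close>, but the result (m0 t m0^-1) m0 is
  again in \<open>M \<alpha>\<close>. Cosets with a common element coincide.\<close>

lemma M_uminus: "\<alpha> \<in> \<Phi> \<Longrightarrow> M (- \<alpha>) = M \<alpha>"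
proof -
  assume a: "\<alpha> \<in> \<Phi>"
  note na = uminus_root[OF a]
  obtain m0 where m0: "m0 \<in> M \<alpha>" using M_nonempty a by blast
  note c = M_mem_carrier[OF m0 a]
  have "cj m0 ` U \<alpha> = U (- \<alpha>)" "cj m0 ` U (- \<alpha>) = U (- (- \<alpha>))"
    using swaps_M[OF a m0] by (auto simp: swaps_def)
  then obtain m where m: "m \<in> M \<alpha>" "cj m0 m \<in> M (- \<alpha>)"
    using cj_M_aux[OF c a na] by blast
  obtain t where t: "t \<in> T" "m = t \<otimes> m0" using M_obtain_T[OF a m0 m(1)] by blast
  have "cj m0 t \<otimes> m0 \<in> M \<alpha>" using T_cj_M_mult[OF a m0 t(1)] T_mult_M[OF a m0] by blast
  moreover have "cj m0 t \<otimes> m0 = cj m0 m"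
    using c T_mem_carrier[OF t(1)] by (simp add: t(2) cj_def group_word)
  ultimately show ?thesis using M_eqI[OF na a m(2)] by simp
qed

lemma inv_M: "\<alpha> \<in> \<Phi> \<Longrightarrow> m \<in> M \<alpha> \<Longrightarrow> inv m \<in> M \<alpha>"
  using inv_M_uminus M_uminus by blast

lemma M_mult_M: "\<alpha> \<in> \<Phi> \<Longrightarrow> m \<in> M \<alpha> \<Longrightarrow> m' \<in> M \<alpha> \<Longrightarrow> m \<otimes> m' \<in> T"
  using M_mult_inv_M[of \<alpha> "inv m'" m] inv_M M_mem_carrier by fastforce

lemma T_cj_M: "\<alpha> \<in> \<Phi> \<Longrightarrow> m \<in> M \<alpha> \<Longrightarrow> cj m ` T = T"
proof -
  assume a: "\<alpha> \<in> \<Phi>" and m: "m \<in> M \<alpha>"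
  note c = M_mem_carrier[OF m a]
  have "t \<in> cj m ` T" if "t \<in> T" for t
    using T_cj_M_mult[OF a inv_M[OF a m] that] cj_cj_inv[OF c T_mem_carrier[OF that]] by (metis imageI)
  then show ?thesis using T_cj_M_mult[OF a m] by blast
qed

lemma U_decomp_uminus:
  assumes "\<alpha> \<in> \<Phi>" "u \<in> U \<alpha>" "u \<noteq> \<one>"
  obtains v m v' where "v \<in> U (- \<alpha>)" "m \<in> M \<alpha>" "v' \<in> U (- \<alpha>)" "u = v \<otimes> m \<otimes> v'"
  using U_decomp[OF uminus_root[OF assms(1)], of u] assms M_uminus by auto

lemma cj_M:
  assumes n: "n \<in> carrier G" "cj n ` T \<subseteq> T"
    and a: "\<alpha> \<in> \<Phi>" "\<gamma> \<in> \<Phi>" "cj n ` U \<alpha> = U \<gamma>" "cj n ` U (- \<alpha>) = U (- \<gamma>)"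
    and m: "m \<in> M \<alpha>"
  shows "cj n m \<in> M \<gamma>"
proof -
  obtain m1 where m1: "m1 \<in> M \<alpha>" "cj n m1 \<in> M \<gamma>" using cj_M_aux[OF n(1) a] by blast
  obtain t where t: "t \<in> T" "m = t \<otimes> m1" using M_obtain_T[OF a(1) m1(1) m] by blast
  have "cj n t \<otimes> cj n m1 \<in> M \<gamma>" using T_mult_M[OF a(2) m1(2)] t(1) n(2) by blast
  then show ?thesis using t n(1) T_mem_carrier M_mem_carrier[OF m1(1) a(1)] by (simp add: cj_prod)
qed

text \<open>The reflection in the double of \<alpha> maps \<alpha> to its negative, so the middle
  factor of an element of \<open>U (- (2 *\<^sub>R \<alpha>))\<close> also swaps
  \<open>U \<alpha>\<close> and \<open>U (- \<alpha>)\<close>. By uniqueness it is in both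
  cosets.\<close>

lemma M_double: "\<alpha> \<in> \<Phi> \<Longrightarrow> 2 *\<^sub>R \<alpha> \<in> \<Phi> \<Longrightarrow> M (2 *\<^sub>R \<alpha>) = M \<alpha>"
proof -
  assume a: "\<alpha> \<in> \<Phi>" and b: "2 *\<^sub>R \<alpha> \<in> \<Phi>"
  have sub: "U (2 *\<^sub>R \<alpha>) \<subseteq> U \<alpha>" "U (- (2 *\<^sub>R \<alpha>)) \<subseteq> U (- \<alpha>)"
    using U_double[OF a b] U_double[OF uminus_root[OF a]] uminus_root[OF b] by auto
  obtain u where u: "u \<in> U (- (2 *\<^sub>R \<alpha>))" "u \<noteq> \<one>" using U_nontrivial[OF uminus_root[OF b]] by blast
  obtain v m v' where d: "v \<in> U (2 *\<^sub>R \<alpha>)" "m \<in> M (2 *\<^sub>R \<alpha>)" "v' \<in> U (2 *\<^sub>R \<alpha>)" "u = v \<otimes> m \<otimes> v'"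
    using U_decomp[OF b u] by blast
  have "2 *\<^sub>R refl (2 *\<^sub>R \<alpha>) \<alpha> = - (2 *\<^sub>R \<alpha>)"
    using linear_scale[OF linear_reflection, of cor "2 *\<^sub>R \<alpha>" 2 \<alpha>] refl_self[OF b] by simp
  then have r: "refl (2 *\<^sub>R \<alpha>) \<alpha> = - \<alpha>" by (metis scaleR_cancel_left scaleR_minus_right zero_neq_numeral)
  have "swaps \<alpha> m"
    using M_cj_U[OF b a d(2)] M_cj_U[OF b uminus_root[OF a] d(2)] M_mem_carrier[OF d(2) b]
    by (simp add: swaps_def refl_uminus r)
  then have "m \<in> M \<alpha>"
    using swaps_in_M[OF a _ _ _, of m v v'] d sub u by auto
  then show ?thesis using M_eqI[OF a b, of m] d by simp
qed

lemma rgd_m_eq: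
  assumes a: "\<alpha> \<in> \<Phi>" and d: "v \<in> U (- \<alpha>)" "m \<in> M \<alpha>" "v' \<in> U (- \<alpha>)" "u = v \<otimes> m \<otimes> v'"
  shows "rgd_m G U M \<alpha> u = m"
proof -
  note na = uminus_root[OF a]
  note c = U_mem_carrier[OF d(1) na] U_mem_carrier[OF d(3) na] M_mem_carrier[OF d(2) a]
  have iv: "inv v \<in> U (- \<alpha>)" "inv v' \<in> U (- \<alpha>)"
    using d subgroup.m_inv_closed[OF U_subgroup[OF na]] by auto
  have "m = inv v \<otimes> u \<otimes> inv v'" using c by (simp add: d(4) group_word)
  then have 1: "m \<in> M \<alpha> \<inter> (U (- \<alpha>) <#> {u} <#> U (- \<alpha>))"
    using iv d(2) unfolding set_mult_def by blast
  show ?thesis unfolding rgd_m_def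
  proof (rule the_equality)
    show "m \<in> M \<alpha> \<inter> (U (- \<alpha>) <#> {u} <#> U (- \<alpha>))" by (rule 1)
    fix m' assume "m' \<in> M \<alpha> \<inter> (U (- \<alpha>) <#> {u} <#> U (- \<alpha>))"
    then obtain y y' where y: "m' \<in> M \<alpha>" "y \<in> U (- \<alpha>)" "y' \<in> U (- \<alpha>)" "m' = y \<otimes> u \<otimes> y'"
      unfolding set_mult_def by blast
    note yc = U_mem_carrier[OF y(2) na] U_mem_carrier[OF y(3) na]
    have "\<one> \<otimes> m' \<otimes> \<one> = (y \<otimes> v) \<otimes> m \<otimes> (v' \<otimes> y')"
      using c yc by (simp add: y(4) d(4) group_word)
    moreover have "swaps (- \<alpha>) m'" "swaps (- \<alpha>) m" using swaps_M[OF a] y(1) d(2) swaps_uminus by auto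
    moreover have "y \<otimes> v \<in> U (- \<alpha>)" "v' \<otimes> y' \<in> U (- \<alpha>)" "\<one> \<in> U (- \<alpha>)"
      using y d U_subgroup[OF na] subgroup.m_closed subgroup.one_closed by metis+
    ultimately show "m' = m" using swaps_unique[OF na] by blast
  qed
qed

end

subsection \<open>Families of subgroups satisfying the commutator relations\<close>

context rgd
begin

text \<open>Abstracts what the full root groups and the subgroups
  \<open>U_root \<Phi> U \<phi> \<alpha> \<Omega>\<close> have in common, so that splitting off a
  simple root is proved once for both.\<close>

definition commutator_family :: "('v dual \<Rightarrow> 'g set) \<Rightarrow> bool" where
  "commutator_family X \<longleftrightarrow>
     (\<forall>\<alpha>\<in>\<Phi>. subgroup (X \<alpha>) G) \<and> (\<forall>\<alpha>\<in>\<Phi>. 2 *\<^sub>R \<alpha> \<in> \<Phi> \<longrightarrow> X (2 *\<^sub>R \<alpha>) \<subseteq> X \<alpha>) \<and>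
     (\<forall>\<alpha>\<in>\<Phi>. \<forall>\<beta>\<in>\<Phi>. \<not> (\<exists>c<0. \<beta> = c *\<^sub>R \<alpha>) \<longrightarrow>
        (\<forall>u\<in>X \<alpha>. \<forall>v\<in>X \<beta>. u \<otimes> v \<otimes> inv u \<otimes> inv v \<in> gen X (root_interval \<Phi> \<alpha> \<beta>)))"

lemma commutator_family_U: "commutator_family U"
proof -
  have "u \<otimes> v \<otimes> inv u \<otimes> inv v \<in> gen U (root_interval \<Phi> \<alpha> \<beta>)"
    if h: "\<alpha> \<in> \<Phi>" "\<beta> \<in> \<Phi>" "\<not> (\<exists>c<0. \<beta> = c *\<^sub>R \<alpha>)" "u \<in> U \<alpha>" "v \<in> U \<beta>" for \<alpha> \<beta> u v
  proof -
    have "u \<otimes> v \<otimes> inv u \<otimes> inv v \<in> commutator_subgroup G (U \<alpha>) (U \<beta>)"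
      unfolding commutator_subgroup_def using h(4,5) by (intro generate.incl) blast
    then show ?thesis using U_commutator[OF h(1-3)] by blast
  qed
  then show ?thesis
    unfolding commutator_family_def using U_subgroup U_double by blast
qed

lemma gen_mono: "A \<subseteq> B \<Longrightarrow> gen X A \<subseteq> gen X B"
  by (rule mono_generate) blast

context
  fixes X a
  assumes X: "commutator_family X" and a: "a \<in> \<Delta>"
begin

lemma family_subgroup: "\<alpha> \<in> \<Phi> \<Longrightarrow> subgroup (X \<alpha>) G"
  using X by (auto simp: commutator_family_def)

lemma family_union_carrier: "A \<subseteq> \<Phi> \<Longrightarrow> (\<Union>\<alpha>\<in>A. X \<alpha>) \<subseteq> carrier G"
  using family_subgroup subgroup.subset by blast

lemma gen_subgroup: "A \<subseteq> \<Phi> \<Longrightarrow> subgroup (gen X A) G"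
  by (rule generate_is_subgroup[OF family_union_carrier])

lemma radical_subset: "pos - {a, 2 *\<^sub>R a} \<subseteq> \<Phi>"
  using pos_subset by auto

text \<open>For a positive \<gamma> that is not a multiple of a, every root in the interval from a
  or from -a to \<gamma> still involves another basis root, hence is positive and no multiple of a.
  So both rank one root groups normalise the unipotent radical; the case of -a is what the
  decomposition theorems live on.\<close>

lemma family_normalizes_radical:
  assumes b: "b = a \<or> b = - a" and g: "g \<in> X b" and k: "k \<in> gen X (pos - {a, 2 *\<^sub>R a})"
  shows "cj g k \<in> gen X (pos - {a, 2 *\<^sub>R a})"
proof (rule generate_cj[OF _ _ _ _ k])
  have bR: "b \<in> \<Phi>" using b basis_root[OF a] uminus_root by auto
  show gc: "g \<in> carrier G" using g subgroup.mem_carrier[OF family_subgroup[OF bR]] by blast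
  show "(\<Union>\<alpha>\<in>pos - {a, 2 *\<^sub>R a}. X \<alpha>) \<subseteq> carrier G" by (rule family_union_carrier[OF radical_subset])
  then show "(\<Union>\<alpha>\<in>pos - {a, 2 *\<^sub>R a}. X \<alpha>) \<subseteq> carrier G" .
  fix s assume "s \<in> (\<Union>\<alpha>\<in>pos - {a, 2 *\<^sub>R a}. X \<alpha>)"
  then obtain \<gamma> where c: "\<gamma> \<in> pos - {a, 2 *\<^sub>R a}" "s \<in> X \<gamma>" by blast
  have cR: "\<gamma> \<in> \<Phi>" using c(1) pos_root by blast
  have sc: "s \<in> carrier G" using c(2) subgroup.mem_carrier[OF family_subgroup[OF cR]] by blast
  obtain e :: real where e: "b = e *\<^sub>R a" using b by (metis scaleR_minus1_left scaleR_one)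
  have "\<not> (\<exists>c<0. \<gamma> = c *\<^sub>R b)"
  proof
    assume "\<exists>c<0. \<gamma> = c *\<^sub>R b"
    then obtain c' where "\<gamma> = (c' * e) *\<^sub>R a" unfolding e by auto
    then show False using multiple_of_basis_root[OF a, of "c' * e"] c(1) by auto
  qed
  then have "g \<otimes> s \<otimes> inv g \<otimes> inv s \<in> gen X (root_interval \<Phi> b \<gamma>)"
    using X bR cR g c(2) unfolding commutator_family_def by blast
  moreover have "root_interval \<Phi> b \<gamma> \<subseteq> pos - {a, 2 *\<^sub>R a}"
  proof
    fix \<delta> assume "\<delta> \<in> root_interval \<Phi> b \<gamma>"
    then obtain r s :: nat where "\<delta> \<in> \<Phi>" "0 < s" "\<delta> = (real r * e) *\<^sub>R a + real s *\<^sub>R \<gamma>"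
      unfolding root_interval_def e by auto
    then show "\<delta> \<in> pos - {a, 2 *\<^sub>R a}" using pos_add_multiple[OF a c(1)] by (metis of_nat_0_less_iff)
  qed
  ultimately have "g \<otimes> s \<otimes> inv g \<otimes> inv s \<in> gen X (pos - {a, 2 *\<^sub>R a})" using gen_mono by blast
  moreover have "s \<in> gen X (pos - {a, 2 *\<^sub>R a})" by (rule generate.incl) (use c in blast)
  ultimately have "(g \<otimes> s \<otimes> inv g \<otimes> inv s) \<otimes> s \<in> gen X (pos - {a, 2 *\<^sub>R a})" by (rule generate.eng)
  then show "cj g s \<in> gen X (pos - {a, 2 *\<^sub>R a})" using gc sc by (simp add: cj_def group_word)
qed

lemma family_split:
  assumes z: "z \<in> gen X pos"
  shows "\<exists>x\<in>X a. \<exists>k\<in>gen X (pos - {a, 2 *\<^sub>R a}). z = x \<otimes> k"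
proof (rule generate_product[OF family_subgroup[OF basis_root[OF a]] gen_subgroup[OF radical_subset]])
  show "cj h k \<in> gen X (pos - {a, 2 *\<^sub>R a})" if "h \<in> X a" "k \<in> gen X (pos - {a, 2 *\<^sub>R a})" for h k
    using family_normalizes_radical[of a h k] that by blast
  have "X (2 *\<^sub>R a) \<subseteq> X a" if "2 *\<^sub>R a \<in> pos"
    using X basis_root[OF a] pos_root[OF that] unfolding commutator_family_def by blast
  moreover have "X \<gamma> \<subseteq> gen X (pos - {a, 2 *\<^sub>R a})" if "\<gamma> \<in> pos - {a, 2 *\<^sub>R a}" for \<gamma>
    using that by (auto intro: generate.incl)
  ultimately have "(\<Union>\<alpha>\<in>pos. X \<alpha>) \<subseteq> X a \<union> gen X (pos - {a, 2 *\<^sub>R a})" by blast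
  then show "z \<in> generate G (X a \<union> gen X (pos - {a, 2 *\<^sub>R a}))"
    using z mono_generate by blast
qed

lemma family_split':
  assumes z: "z \<in> gen X pos"
  shows "\<exists>x\<in>X a. \<exists>k\<in>gen X (pos - {a, 2 *\<^sub>R a}). z = k \<otimes> x"
proof -
  obtain x k where d: "x \<in> X a" "k \<in> gen X (pos - {a, 2 *\<^sub>R a})" "z = x \<otimes> k"
    using family_split[OF z] by blast
  have "x \<in> carrier G" "k \<in> carrier G"
    using d subgroup.mem_carrier family_subgroup[OF basis_root[OF a]] gen_subgroup[OF radical_subset] by metis+
  then have "z = cj x k \<otimes> x" using d(3) by (simp add: cj_mult_comm)
  then show ?thesis using family_normalizes_radical[of a x k] d by blast
qed

end

lemma Upos_subgroup: "subgroup (gen U pos) G" and Uneg_subgroup: "subgroup (gen U (uminus ` pos)) G"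
  by (intro generate_is_subgroup U_union_carrier pos_subset neg_subset)+

lemma pos_neg_inter:
  assumes "\<beta> \<in> pos" "- \<gamma> \<in> pos" "u \<in> U \<beta>" "u \<in> U \<gamma>"
  shows "u = \<one>"
proof -
  have "\<gamma> \<in> uminus ` pos" using assms(2) by (intro image_eqI[of _ _ "- \<gamma>"]) auto
  then have "u \<in> gen U (uminus ` pos)" by (rule U_in_gen[OF assms(4)])
  moreover have "u \<in> gen U pos" by (rule U_in_gen[OF assms(3,1)])
  moreover have "u \<in> carrier G" using U_mem_carrier[OF assms(3)] pos_root[OF assms(1)] by blast
  ultimately show ?thesis using T_eq_Upos_Uneg(2)[OF subgroup.one_closed[OF T_subgroup]] by (metis l_one)
qed

text \<open>Needed for the action of N on root groups to define an action on roots. For \<beta> = a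
  or 2a, the reflection in a makes \<beta> negative but keeps every positive root outside {a, 2a}
  positive, and U+ meets U- trivially; a and 2a are told apart by the strict inclusion in (RGD3).
  Simple reflections carry this to all positive roots, and the reflection in \<beta> itself to the
  negative ones.\<close>

lemma U_inj: "\<beta> \<in> \<Phi> \<Longrightarrow> \<gamma> \<in> \<Phi> \<Longrightarrow> U \<beta> = U \<gamma> \<Longrightarrow> \<beta> = \<gamma>"
proof -
  have cjr: "U (refl \<alpha> \<beta>) = U (refl \<alpha> \<gamma>)" if "\<alpha> \<in> \<Phi>" "\<beta> \<in> \<Phi>" "\<gamma> \<in> \<Phi>" "U \<beta> = U \<gamma>" for \<alpha> \<beta> \<gamma>
    using M_nonempty[OF that(1)] M_cj_U[OF that(1,2)] M_cj_U[OF that(1,3)] that(4) by auto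
  have opp: "U \<beta> \<noteq> U \<gamma>" if "\<beta> \<in> pos" "- \<gamma> \<in> pos" for \<beta> \<gamma>
    using pos_neg_inter[OF that] U_nontrivial[OF pos_root[OF that(1)]] by blast
  have other: "\<gamma> \<in> {a, 2 *\<^sub>R a}"
    if h: "a \<in> \<Delta>" "\<beta> \<in> {a, 2 *\<^sub>R a}" "\<beta> \<in> \<Phi>" "\<gamma> \<in> \<Phi>" "U \<beta> = U \<gamma>" for a \<beta> \<gamma>
  proof (rule ccontr)
    assume n: "\<gamma> \<notin> {a, 2 *\<^sub>R a}"
    have bp: "\<beta> \<in> pos" using h(1-3) basis_in_pos[OF h(1)] height_pos[of a]
      by (auto simp: pos_iff_height linear_scale[OF linear_height])
    then have "\<gamma> \<in> pos" using opp[OF bp] h(4,5) pos_or_neg by blast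
    then have "refl a \<gamma> \<in> pos" using refl_basis_pos[OF h(1)] n by blast
    moreover have "refl a \<beta> = - \<beta>"
      using h(2) refl_self[OF basis_root[OF h(1)]] refl_basis_multiple[OF h(1)] by auto
    then have "U (refl a \<gamma>) = U (- \<beta>)" using cjr[OF basis_root[OF h(1)] h(3-5)] by simp
    ultimately show False using opp[of "refl a \<gamma>" "- \<beta>"] bp by simp
  qed
  have posc: "\<forall>\<gamma>\<in>\<Phi>. U \<beta> = U \<gamma> \<longrightarrow> \<beta> = \<gamma>" if "\<beta> \<in> pos" for \<beta>
    using that
  proof (induction \<beta> rule: pos_induct)
    case (basis a)
    then show ?case using other[OF basis, of a] U_double[OF basis_root[OF basis]] basis_root[OF basis] by auto
  next
    case (double a)
    then show ?case
      using other[OF double(1), of "2 *\<^sub>R a"] U_double[OF basis_root[OF double(1)]] by auto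
  next
    case (refl a \<beta>)
    show ?case
    proof (intro ballI impI)
      fix \<gamma> assume g: "\<gamma> \<in> \<Phi>" "U (refl a \<beta>) = U \<gamma>"
      note aR = basis_root[OF refl(1)]
      have "U \<beta> = U (refl a \<gamma>)"
        using cjr[OF aR refl_root[OF aR pos_root[OF refl(2)]] g] aR by (simp add: refl_refl)
      then have "\<beta> = refl a \<gamma>" using refl(3) refl_root[OF aR g(1)] by blast
      then show "refl a \<beta> = \<gamma>" using aR by (simp add: refl_refl)
    qed
  qed
  assume bc: "\<beta> \<in> \<Phi>" "\<gamma> \<in> \<Phi>" "U \<beta> = U \<gamma>"
  show "\<beta> = \<gamma>"
  proof (cases "\<beta> \<in> pos")
    case False
    then have "- \<beta> \<in> pos" using bc pos_or_neg by blast
    moreover have "U (- \<beta>) = U (refl \<beta> \<gamma>)" using cjr[OF bc(1) bc] bc(1) by (simp add: refl_self)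
    ultimately have "- \<beta> = refl \<beta> \<gamma>" using posc refl_root[OF bc(1,2)] by blast
    then have "refl \<beta> (- \<beta>) = \<gamma>" using bc(1) by (simp add: refl_refl)
    then show ?thesis using bc(1) by (simp add: refl_uminus refl_self)
  qed (use posc bc in blast)
qed

subsection \<open>The group \<open>N\<close> and the Weyl group\<close>

abbreviation "W \<equiv> carrier (weyl_group \<Phi> cor)"
abbreviation "N \<equiv> rgd_N G \<Phi> M"

lemma BijGroup_UNIV:
  shows BijGroup_UNIV_carrier: "carrier (BijGroup UNIV) = {f. bij f}"
    and BijGroup_UNIV_mult: "f \<in> carrier (BijGroup UNIV) \<Longrightarrow> g \<in> carrier (BijGroup UNIV) \<Longrightarrow>
      f \<otimes>\<^bsub>BijGroup UNIV\<^esub> g = f \<circ> g"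
    and BijGroup_UNIV_one: "\<one>\<^bsub>BijGroup UNIV\<^esub> = id"
  by (auto simp: BijGroup_def Bij_def extensional_def compose_def fun_eq_iff)

lemma weyl_carrier_induct [consumes 1, case_names id refl comp]:
  assumes "w \<in> W" and "P id" and "\<And>\<alpha>. \<alpha> \<in> \<Phi> \<Longrightarrow> P (refl \<alpha>)"
    and "\<And>w w'. w \<in> W \<Longrightarrow> w' \<in> W \<Longrightarrow> P w \<Longrightarrow> P w' \<Longrightarrow> P (w \<circ> w')"
  shows "P w"
proof -
  define S where "S = carrier (BijGroup UNIV) \<inter> refl ` \<Phi>"
  interpret B: group "BijGroup (UNIV :: 'v dual set)" by (rule group_BijGroup)
  have Wg: "W = generate (BijGroup UNIV) S"
    by (simp add: weyl_group_def subgroup_generated_def S_def)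
  have Sc: "S \<subseteq> carrier (BijGroup UNIV)" by (auto simp: S_def)
  show "P w"
    using assms(1) unfolding Wg
  proof (induction w rule: generate.induct)
    case one
    show ?case unfolding BijGroup_UNIV_one by (rule assms(2))
  next
    case (incl h) then show ?case using assms(3) by (auto simp: S_def)
  next
    case (inv h)
    then obtain \<alpha> where al: "\<alpha> \<in> \<Phi>" "h = refl \<alpha>" by (auto simp: S_def)
    have "h \<circ> h = id" using al by (auto simp: refl_refl)
    then have "h \<otimes>\<^bsub>BijGroup UNIV\<^esub> h = \<one>\<^bsub>BijGroup UNIV\<^esub>"
      using inv Sc BijGroup_UNIV_mult[of h h] BijGroup_UNIV_one by (metis subsetD)
    then have "inv\<^bsub>BijGroup UNIV\<^esub> h = h" using inv Sc B.inv_equality by blast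
    then show ?case using assms(3) al by simp
  next
    case (eng h1 h2)
    have "h1 \<in> carrier (BijGroup UNIV)" "h2 \<in> carrier (BijGroup UNIV)"
      using eng B.generate_in_carrier[OF Sc] by auto
    then have "h1 \<otimes>\<^bsub>BijGroup UNIV\<^esub> h2 = h1 \<circ> h2" by (rule BijGroup_UNIV_mult)
    then show ?case using eng assms(4)[of h1 h2] unfolding Wg by metis
  qed
qed

lemma weyl_id: "id \<in> W" and weyl_refl: "\<alpha> \<in> \<Phi> \<Longrightarrow> refl \<alpha> \<in> W"
  and weyl_comp: "w \<in> W \<Longrightarrow> w' \<in> W \<Longrightarrow> w \<circ> w' \<in> W"
  and weyl_mult: "w \<in> W \<Longrightarrow> w' \<in> W \<Longrightarrow> w \<otimes>\<^bsub>weyl_group \<Phi> cor\<^esub> w' = w \<circ> w'"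
  and weyl_one: "\<one>\<^bsub>weyl_group \<Phi> cor\<^esub> = id"
proof -
  define S where "S = carrier (BijGroup UNIV) \<inter> refl ` \<Phi>"
  interpret B: group "BijGroup (UNIV :: 'v dual set)" by (rule group_BijGroup)
  have Wg: "W = generate (BijGroup UNIV) S"
    by (simp add: weyl_group_def subgroup_generated_def S_def)
  have Sc: "S \<subseteq> carrier (BijGroup UNIV)" by (auto simp: S_def)
  show "id \<in> W" unfolding Wg using generate.one[of "BijGroup UNIV" S] BijGroup_UNIV_one by metis
  show "refl \<alpha> \<in> W" if "\<alpha> \<in> \<Phi>"
    unfolding Wg using bij_refl that by (intro generate.incl) (auto simp: S_def BijGroup_UNIV_carrier)
  show *: "w \<otimes>\<^bsub>weyl_group \<Phi> cor\<^esub> w' = w \<circ> w'" if "w \<in> W" "w' \<in> W"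
    using BijGroup_UNIV_mult[of w w'] B.generate_in_carrier[OF Sc] that unfolding Wg
    by (simp add: weyl_group_def subgroup_generated_def)
  show "w \<circ> w' \<in> W" if "w \<in> W" "w' \<in> W"
  proof -
    have "w \<otimes>\<^bsub>BijGroup UNIV\<^esub> w' \<in> W" using that unfolding Wg by (rule generate.eng)
    then show ?thesis using BijGroup_UNIV_mult[of w w'] B.generate_in_carrier[OF Sc] that Wg by simp
  qed
  show "\<one>\<^bsub>weyl_group \<Phi> cor\<^esub> = id" by (simp add: weyl_group_def subgroup_generated_def BijGroup_UNIV_one)
qed

lemma weyl_linear: "w \<in> W \<Longrightarrow> linear w"
proof (induction rule: weyl_carrier_induct)
  case id
  show ?case by (simp add: linear_iff)
next
  case (comp w w')
  then show ?case by (intro linear_compose)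
qed (rule linear_reflection)

lemma weyl_root: "w \<in> W \<Longrightarrow> \<beta> \<in> \<Phi> \<Longrightarrow> w \<beta> \<in> \<Phi>"
  by (induction arbitrary: \<beta> rule: weyl_carrier_induct) (auto simp: refl_root)

lemma weyl_bij: "w \<in> W \<Longrightarrow> bij w"
proof (induction rule: weyl_carrier_induct)
  case (comp w w')
  then show ?case by (intro bij_comp)
qed (simp_all only: bij_refl bij_id)

lemma weyl_image_roots: "w \<in> W \<Longrightarrow> w ` \<Phi> = \<Phi>"
proof (induction rule: weyl_carrier_induct)
  case (comp w w')
  then show ?case by (simp only: image_comp[symmetric])
qed (simp_all add: refl_image_roots id_def)

lemma N_carrier: "n \<in> N \<Longrightarrow> n \<in> carrier G"
  unfolding rgd_N_def using generate_in_carrier[of "\<Union>\<alpha>\<in>\<Phi>. M \<alpha>"] M_carrier by blast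

lemma N_subgroup: "subgroup N G"
  unfolding rgd_N_def using M_carrier by (intro generate_is_subgroup) blast

lemma M_in_N: "\<alpha> \<in> \<Phi> \<Longrightarrow> m \<in> M \<alpha> \<Longrightarrow> m \<in> N"
  unfolding rgd_N_def by (rule generate.incl) blast

text \<open>Each \<open>M \<alpha>\<close> is closed under inverses, so the elements of N are plain
  products of elements of the cosets and multiplication on the right suffices.\<close>

lemma N_induct [consumes 1, case_names one step]:
  assumes n: "n \<in> N" and P1: "P \<one>"
    and step: "\<And>n \<alpha> m. n \<in> N \<Longrightarrow> \<alpha> \<in> \<Phi> \<Longrightarrow> m \<in> M \<alpha> \<Longrightarrow> P n \<Longrightarrow> P (n \<otimes> m)"
  shows "P n"
proof -
  have "\<forall>k\<in>N. P k \<longrightarrow> P (k \<otimes> n)"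
    using n unfolding rgd_N_def
  proof (induction n rule: generate.induct)
    case one then show ?case using N_carrier by (simp add: rgd_N_def)
  next
    case (incl h) then show ?case using step by (auto simp: rgd_N_def)
  next
    case (inv h)
    then obtain \<alpha> where "\<alpha> \<in> \<Phi>" "h \<in> M \<alpha>" by blast
    then show ?case using step inv_M by (auto simp: rgd_N_def)
  next
    case (eng h1 h2)
    show ?case
    proof (intro ballI impI)
      fix k assume k: "k \<in> generate G (\<Union>\<alpha>\<in>\<Phi>. M \<alpha>)" "P k"
      have kh: "k \<otimes> h1 \<in> generate G (\<Union>\<alpha>\<in>\<Phi>. M \<alpha>)" by (rule generate.eng[OF k(1) eng(1)])
      have "P (k \<otimes> h1)" using eng(3) k by blast
      then have "P (k \<otimes> h1 \<otimes> h2)" using eng(4) kh by blast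
      moreover have "k \<in> carrier G" "h1 \<in> carrier G" "h2 \<in> carrier G"
        using k(1) eng(1,2) N_carrier unfolding rgd_N_def by blast+
      ultimately show "P (k \<otimes> (h1 \<otimes> h2))" by (simp add: m_assoc)
    qed
  qed
  then show ?thesis using P1 n N_carrier subgroup.one_closed[OF N_subgroup] by force
qed

lemma N_cj_T: "n \<in> N \<Longrightarrow> cj n ` T = T"
proof (induction n rule: N_induct)
  case one
  have "cj \<one> ` T = (\<lambda>x. x) ` T" using T_mem_carrier by (intro image_cong) auto
  then show ?case by simp
next
  case (step n \<alpha> m)
  then show ?case
    using cj_image_mult[of n m T] N_carrier M_mem_carrier T_cj_M T_subgroup subgroup.subset by metis
qed

lemma N_cj_T_mem: "n \<in> N \<Longrightarrow> t \<in> T \<Longrightarrow> cj n t \<in> T"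
  using N_cj_T by blast

text \<open>A concrete model of the epimorphism onto the Weyl group: the permutation of the root
  groups under conjugation, made linear. It is well defined because root groups determine their
  roots and the roots span.\<close>

definition wN :: "'g \<Rightarrow> 'v dual \<Rightarrow> 'v dual" where
  "wN n = (THE w. w \<in> W \<and> (\<forall>\<beta>\<in>\<Phi>. cj n ` U \<beta> = U (w \<beta>)))"

lemma wN_eqI:
  assumes w: "w \<in> W" "\<And>\<beta>. \<beta> \<in> \<Phi> \<Longrightarrow> cj n ` U \<beta> = U (w \<beta>)"
  shows "wN n = w"
  unfolding wN_def
proof (rule the_equality)
  fix w' assume w': "w' \<in> W \<and> (\<forall>\<beta>\<in>\<Phi>. cj n ` U \<beta> = U (w' \<beta>))"
  show "w' = w"
  proof (rule linear_eq_on_roots)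
    show "w' \<beta> = w \<beta>" if "\<beta> \<in> \<Phi>" for \<beta>
      using U_inj[of "w' \<beta>" "w \<beta>"] w w' that weyl_root by simp
  qed (use w w' weyl_linear in auto)
qed (use w in blast)

lemma wN_aux: "n \<in> N \<Longrightarrow> \<exists>w\<in>W. \<forall>\<beta>\<in>\<Phi>. cj n ` U \<beta> = U (w \<beta>)"
proof (induction n rule: N_induct)
  case one
  have "cj \<one> ` U \<beta> = (\<lambda>x. x) ` U \<beta>" if "\<beta> \<in> \<Phi>" for \<beta>
    using U_mem_carrier[OF _ that] by (intro image_cong) auto
  then show ?case using weyl_id by (intro bexI[of _ id]) auto
next
  case (step n \<alpha> m)
  then obtain w where w: "w \<in> W" "\<And>\<beta>. \<beta> \<in> \<Phi> \<Longrightarrow> cj n ` U \<beta> = U (w \<beta>)" by blast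
  have "cj (n \<otimes> m) ` U \<beta> = U ((w \<circ> refl \<alpha>) \<beta>)" if "\<beta> \<in> \<Phi>" for \<beta>
    using cj_image_mult[OF N_carrier[OF step(1)] M_mem_carrier[OF step(3,2)] U_carrier[OF that]]
      M_cj_U[OF step(2) that step(3)] w(2)[OF refl_root[OF step(2) that]] by simp
  then show ?case using weyl_comp[OF w(1) weyl_refl[OF step(2)]] by blast
qed

lemma wN: assumes "n \<in> N" shows wN_weyl: "wN n \<in> W" and wN_cj_U: "\<beta> \<in> \<Phi> \<Longrightarrow> cj n ` U \<beta> = U (wN n \<beta>)"
proof -
  obtain w where w: "w \<in> W" "\<And>\<beta>. \<beta> \<in> \<Phi> \<Longrightarrow> cj n ` U \<beta> = U (w \<beta>)" using wN_aux[OF assms] by blast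
  have e: "wN n = w" by (rule wN_eqI[OF w])
  show "wN n \<in> W" unfolding e by (rule w)
  show "cj n ` U \<beta> = U (wN n \<beta>)" if "\<beta> \<in> \<Phi>" using w(2)[OF that] unfolding e .
qed

lemma wN_root: "n \<in> N \<Longrightarrow> \<beta> \<in> \<Phi> \<Longrightarrow> wN n \<beta> \<in> \<Phi>"
  using weyl_root wN_weyl by blast

lemma wN_linear: "n \<in> N \<Longrightarrow> linear (wN n)"
  using weyl_linear wN_weyl by blast

lemma wN_uminus: "n \<in> N \<Longrightarrow> wN n (- \<beta>) = - wN n \<beta>"
  by (rule linear_neg[OF wN_linear])

lemma wN_mult: assumes "n \<in> N" "n' \<in> N" shows "wN (n \<otimes> n') = wN n \<circ> wN n'"
proof (rule wN_eqI)
  show "cj (n \<otimes> n') ` U \<beta> = U ((wN n \<circ> wN n') \<beta>)" if "\<beta> \<in> \<Phi>" for \<beta>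
    using cj_image_mult[OF assms[THEN N_carrier] U_carrier[OF that]] wN_cj_U assms that wN_root by simp
qed (use assms wN_weyl weyl_comp in auto)

lemma wN_M: "\<alpha> \<in> \<Phi> \<Longrightarrow> m \<in> M \<alpha> \<Longrightarrow> wN m = refl \<alpha>"
  by (rule wN_eqI) (auto simp: weyl_refl M_cj_U)

lemma wN_T: "t \<in> T \<Longrightarrow> wN t = id"
  by (rule wN_eqI) (auto simp: weyl_id T_cj_U)

lemma wN_one: "wN \<one> = id"
  by (rule wN_T) (rule subgroup.one_closed[OF T_subgroup])

lemma wN_inv:
  assumes "n \<in> N" shows "wN n (wN (inv n) \<beta>) = \<beta>" "wN (inv n) (wN n \<beta>) = \<beta>"
proof -
  have "inv n \<in> N" using subgroup.m_inv_closed[OF N_subgroup assms] .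
  then have "wN n \<circ> wN (inv n) = id" "wN (inv n) \<circ> wN n = id"
    using wN_mult[of n "inv n"] wN_mult[of "inv n" n] assms N_carrier wN_one by auto
  then show "wN n (wN (inv n) \<beta>) = \<beta>" "wN (inv n) (wN n \<beta>) = \<beta>" by (auto simp: fun_eq_iff)
qed

lemma N_cj_M:
  assumes n: "n \<in> N" and a: "\<alpha> \<in> \<Phi>" "m \<in> M \<alpha>"
  shows "cj n m \<in> M (wN n \<alpha>)"
  using cj_M[OF N_carrier[OF n] _ a(1) wN_root[OF n a(1)] wN_cj_U[OF n a(1)] _ a(2)]
    wN_cj_U[OF n uminus_root[OF a(1)]] N_cj_T[OF n] wN_uminus[OF n] by simp

text \<open>A euclidean space has a non-zero dual, which the empty set cannot span.\<close>

lemma roots_nonempty: "\<Phi> \<noteq> {}"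
proof
  assume "\<Phi> = {}"
  then have "blinfun_inner_left b = (0 :: 'v dual)" for b
    using span_roots by (metis UNIV_I singletonD span_empty)
  then have "b \<bullet> b = 0" for b :: 'v
    using blinfun_inner_left.rep_eq[of b] zero_blinfun.rep_eq by (metis inner_commute)
  then show False using nonempty_Basis inner_eq_zero_iff nonzero_Basis by (metis ex_in_conv)
qed

lemma T_subset_N: "T \<subseteq> N"
proof
  fix t assume t: "t \<in> T"
  obtain \<alpha> m where m: "\<alpha> \<in> \<Phi>" "m \<in> M \<alpha>" using roots_nonempty M_nonempty by blast
  then have "t \<otimes> m \<in> N" "m \<in> N" using T_mult_M t M_in_N by auto
  then have "t \<otimes> m \<otimes> inv m \<in> N" using N_subgroup subgroup.m_closed subgroup.m_inv_closed by metis
  then show "t \<in> N" using T_mem_carrier[OF t] M_mem_carrier[OF m(2,1)] by (simp add: group_word)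
qed

subsection \<open>Words in the simple reflections\<close>

text \<open>The union of the products T M_a1 ... M_ak over all sequences of k basis roots. Nothing
  is reduced here; the least k serves as the length.\<close>

primrec words :: "nat \<Rightarrow> 'g set" where
  "words 0 = T"
| "words (Suc k) = {n \<otimes> m | n m a. n \<in> words k \<and> a \<in> \<Delta> \<and> m \<in> M a}"

lemma words_N: "words k \<subseteq> N"
proof (induction k)
  case (Suc k)
  show ?case
  proof
    fix z assume "z \<in> words (Suc k)"
    then obtain n m a where "z = n \<otimes> m" "n \<in> words k" "a \<in> \<Delta>" "m \<in> M a" by auto
    then show "z \<in> N" using M_in_N[OF basis_root] subgroup.m_closed[OF N_subgroup] Suc by blast
  qed
qed (simp add: T_subset_N)

lemma words_mult_T: "n \<in> words k \<Longrightarrow> t \<in> T \<Longrightarrow> n \<otimes> t \<in> words k"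
proof (induction k arbitrary: n t)
  case 0 then show ?case using subgroup.m_closed[OF T_subgroup] by simp
next
  case (Suc k)
  then obtain n1 m a where d: "n = n1 \<otimes> m" "n1 \<in> words k" "a \<in> \<Delta>" "m \<in> M a" by auto
  note aR = basis_root[OF d(3)]
  have "n1 \<otimes> cj m t \<in> words k" using Suc d(2) T_cj_M_mult[OF aR d(4)] by blast
  moreover have "n \<otimes> t = n1 \<otimes> cj m t \<otimes> m"
    using d(2) words_N N_carrier M_mem_carrier[OF d(4) aR] T_mem_carrier[OF Suc(3)]
    by (simp add: d(1) cj_def group_word subset_iff)
  ultimately show ?case using d(3,4) by auto
qed

lemma T_mult_words: "n \<in> words k \<Longrightarrow> t \<in> T \<Longrightarrow> t \<otimes> n \<in> words k"
proof (induction k arbitrary: n t)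
  case 0 then show ?case using subgroup.m_closed[OF T_subgroup] by simp
next
  case (Suc k)
  then obtain n1 m a where d: "n = n1 \<otimes> m" "n1 \<in> words k" "a \<in> \<Delta>" "m \<in> M a" by auto
  have "t \<otimes> n = (t \<otimes> n1) \<otimes> m"
    using d(2) words_N N_carrier M_mem_carrier[OF d(4) basis_root[OF d(3)]] T_mem_carrier[OF Suc(3)]
    by (simp add: d(1) m_assoc subset_iff)
  then show ?case using Suc d by auto
qed

text \<open>The simple cosets generate N over T: the coset of a reflected root is
  \<open>M \<alpha>\<close> conjugated by an element of \<open>M a\<close>, so going up by one
  reflection adds a letter on either side.\<close>

lemma pos_mult_M_words: "\<alpha> \<in> pos \<Longrightarrow> \<forall>k. \<forall>n\<in>words k. \<forall>m\<in>M \<alpha>. \<exists>j. n \<otimes> m \<in> words j"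
proof (induction \<alpha> rule: pos_induct)
  case (basis a)
  then have "n \<otimes> m \<in> words (Suc k)" if "n \<in> words k" "m \<in> M a" for n m k using that by auto
  then show ?case by blast
next
  case (double a)
  then have "n \<otimes> m \<in> words (Suc k)" if "n \<in> words k" "m \<in> M (2 *\<^sub>R a)" for n m k
    using that M_double[OF basis_root] by auto
  then show ?case by blast
next
  case (refl a \<alpha>)
  note aR = basis_root[OF refl(1)]
  obtain m1 where m1: "m1 \<in> M a" using M_nonempty[OF aR] by blast
  note m1' = inv_M[OF aR m1]
  have "\<exists>j. n \<otimes> m \<in> words j" if h: "n \<in> words k" "m \<in> M (refl a \<alpha>)" for n m k
  proof -
    have r: "refl a \<alpha> \<in> \<Phi>" using refl_root[OF aR pos_root[OF refl(2)]] .
    have "cj (inv m1) m \<in> M \<alpha>"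
      using N_cj_M[OF M_in_N[OF aR m1'] r h(2)] wN_M[OF aR m1'] refl_refl[OF aR] by simp
    moreover have "n \<otimes> m1 \<in> words (Suc k)" using h(1) m1 refl(1) by auto
    ultimately obtain j where j: "n \<otimes> m1 \<otimes> cj (inv m1) m \<in> words j" using refl(3) by blast
    then have "n \<otimes> m1 \<otimes> cj (inv m1) m \<otimes> inv m1 \<in> words (Suc j)" using m1' refl(1) by auto
    moreover have "n \<otimes> m1 \<otimes> cj (inv m1) m \<otimes> inv m1 = n \<otimes> m"
      using h words_N N_carrier M_mem_carrier[OF m1 aR] M_mem_carrier[OF h(2) r]
      by (simp add: cj_def group_word subset_iff)
    ultimately show ?thesis by metis
  qed
  then show ?case by blast
qed

lemma N_words: "n \<in> N \<Longrightarrow> \<exists>k. n \<in> words k"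
proof (induction n rule: N_induct)
  case one
  show ?case using subgroup.one_closed[OF T_subgroup] by (intro exI[of _ 0]) simp
next
  case (step n \<alpha> m)
  have "\<exists>\<beta>\<in>pos. m \<in> M \<beta>" using pos_or_neg[OF step(2)] M_uminus[OF step(2)] step(3) by auto
  then show ?case using step(4) pos_mult_M_words by blast
qed

text \<open>The strong exchange property. Either the last letter already makes \<beta> negative, so
  \<beta> is a or 2a and m cancels that letter modulo T, or m is conjugated across the last letter
  and the deleted letter lies further left.\<close>

lemma exchange:
  "n \<in> words k \<Longrightarrow> \<beta> \<in> pos \<Longrightarrow> wN n \<beta> \<notin> pos \<Longrightarrow> m \<in> M \<beta> \<Longrightarrow> \<exists>j. k = Suc j \<and> n \<otimes> m \<in> words j"
proof (induction k arbitrary: n \<beta> m)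
  case 0
  then show ?case using wN_T by simp
next
  case (Suc k)
  then obtain n1 m1 a where d: "n = n1 \<otimes> m1" "n1 \<in> words k" "a \<in> \<Delta>" "m1 \<in> M a" by auto
  note aR = basis_root[OF d(3)]
  have nN: "n1 \<in> N" using d(2) words_N by blast
  note c = N_carrier[OF nN] M_mem_carrier[OF d(4) aR] M_mem_carrier[OF Suc(5) pos_root[OF Suc(3)]]
  have w: "wN n \<beta> = wN n1 (refl a \<beta>)"
    using wN_mult[OF nN M_in_N[OF aR d(4)]] wN_M[OF aR d(4)] d(1) by simp
  show ?case
  proof (cases "refl a \<beta> \<in> pos")
    case False
    then have "\<beta> \<in> {a, 2 *\<^sub>R a}" using refl_basis_pos[OF d(3), of \<beta>] Suc(3) by blast
    then have "M \<beta> = M a" using M_double[OF aR] pos_root[OF Suc(3)] by auto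
    then have "m1 \<otimes> m \<in> T" using M_mult_M[OF aR d(4)] Suc(5) by simp
    then have "n1 \<otimes> (m1 \<otimes> m) \<in> words k" by (rule words_mult_T[OF d(2)])
    then show ?thesis using c by (simp add: d(1) m_assoc)
  next
    case True
    have "cj m1 m \<in> M (refl a \<beta>)"
      using N_cj_M[OF M_in_N[OF aR d(4)] pos_root[OF Suc(3)] Suc(5)] wN_M[OF aR d(4)] by simp
    then obtain j where j: "k = Suc j" "n1 \<otimes> cj m1 m \<in> words j"
      using Suc.IH[OF d(2) True] Suc(4) w by auto
    then have "n1 \<otimes> cj m1 m \<otimes> m1 \<in> words (Suc j)" using d(3,4) by auto
    then show ?thesis using c j(1) by (simp add: d(1) cj_def group_word)
  qed
qed

text \<open>If n1 m1 keeps a positive, then n1 makes a negative, and the exchange applied to the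
  prefix n1 with the letter m1 writes n itself with two letters less.\<close>

lemma pos_preserving_in_T_words: "n \<in> words k \<Longrightarrow> (\<And>\<beta>. \<beta> \<in> pos \<Longrightarrow> wN n \<beta> \<in> pos) \<Longrightarrow> n \<in> T"
proof (induction k arbitrary: n rule: less_induct)
  case (less k)
  show ?case
  proof (cases k)
    case 0
    then show ?thesis using less by simp
  next
    case (Suc k')
    then obtain n1 m1 a where d: "n = n1 \<otimes> m1" "n1 \<in> words k'" "a \<in> \<Delta>" "m1 \<in> M a" using less by auto
    note aR = basis_root[OF d(3)]
    have nN: "n1 \<in> N" using d(2) words_N by blast
    have "wN n a = - wN n1 a"
      using wN_mult[OF nN M_in_N[OF aR d(4)]] wN_M[OF aR d(4)] d(1) refl_self[OF aR] wN_uminus[OF nN] by simp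
    then have "wN n1 a \<notin> pos" using less(3)[OF basis_in_pos[OF d(3)]] uminus_notin_pos by fastforce
    then obtain j where "k' = Suc j" "n \<in> words j"
      using exchange[OF d(2) basis_in_pos[OF d(3)] _ d(4)] d(1) by blast
    then show ?thesis using less.IH[of j n] less.prems Suc by simp
  qed
qed

lemma pos_preserving_in_T: "n \<in> N \<Longrightarrow> (\<And>\<beta>. \<beta> \<in> pos \<Longrightarrow> wN n \<beta> \<in> pos) \<Longrightarrow> n \<in> T"
  using N_words pos_preserving_in_T_words by blast

lemma wN_eq_id_iff: "n \<in> N \<Longrightarrow> wN n = id \<longleftrightarrow> n \<in> T"
  using pos_preserving_in_T[of n] wN_T by auto

text \<open>Identifies the definite description with \<open>wN\<close>, which turns (CA1) into a
  statement about the permutation of root groups. Two homomorphisms with the prescribed values on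
  the cosets \<open>M \<alpha>\<close> agree by induction over N.\<close>

lemma weyl_epi_eq: 
  assumes "n \<in> N"
  shows "weyl_epi G \<Phi> cor T M n = wN n"
proof -
  let ?P = "\<lambda>f. f \<in> epi (rgd_N_group G \<Phi> M) (weyl_group \<Phi> cor) \<and> f \<in> extensional N \<and>
        kernel (rgd_N_group G \<Phi> M) (weyl_group \<Phi> cor) f = T \<and> (\<forall>\<alpha>\<in>\<Phi>. f ` M \<alpha> = {refl \<alpha>})"
  let ?f = "restrict wN N"
  have NG: "carrier (rgd_N_group G \<Phi> M) = N" "mult (rgd_N_group G \<Phi> M) = mult G"
    by (auto simp: rgd_N_group_def)
  have Nm: "n \<otimes> n' \<in> N" if "n \<in> N" "n' \<in> N" for n n'
    using that subgroup.m_closed[OF N_subgroup] by blast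
  have "?P ?f"
  proof (intro conjI ballI)
    have "\<exists>n\<in>N. wN n = w" if "w \<in> W" for w
      using that
    proof (induction w rule: weyl_carrier_induct)
      case id
      show ?case using wN_one subgroup.one_closed[OF N_subgroup] by blast
    next
      case (refl \<alpha>)
      then show ?case using M_nonempty[of \<alpha>] wN_M M_in_N by metis
    next
      case (comp w w')
      then obtain n n' where "n \<in> N" "n' \<in> N" "wN n = w" "wN n' = w'" by blast
      then show ?case using wN_mult[of n n'] Nm by blast
    qed
    then show "?f \<in> epi (rgd_N_group G \<Phi> M) (weyl_group \<Phi> cor)"
      unfolding epi_def hom_def NG
      using wN_weyl by (auto simp: Nm wN_mult weyl_mult image_iff NG)
    show "?f \<in> extensional N" by simp
    show "kernel (rgd_N_group G \<Phi> M) (weyl_group \<Phi> cor) ?f = T"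
      unfolding kernel_def NG weyl_one using T_subset_N wN_eq_id_iff by auto
    show "?f ` M \<alpha> = {refl \<alpha>}" if "\<alpha> \<in> \<Phi>" for \<alpha>
      using M_nonempty[OF that] M_in_N[OF that] wN_M[OF that] by (auto simp: image_iff)
  qed
  moreover have "f = ?f" if f: "?P f" for f
  proof (rule extensionalityI)
    show "f \<in> extensional N" "?f \<in> extensional N" using f by auto
    have hom: "f (n \<otimes> n') = f n \<circ> f n'" if "n \<in> N" "n' \<in> N" for n n'
      using f that unfolding epi_def hom_def NG by (auto simp: weyl_mult Pi_iff NG)
    show "f n = ?f n" if "n \<in> N" for n
      using that
    proof (induction n rule: N_induct)
      case one
      have o: "\<one> \<in> N" using subgroup.one_closed[OF N_subgroup] .
      have "\<one> \<in> T" using subgroup.one_closed[OF T_subgroup] .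
      then have "f \<one> = id" using f unfolding kernel_def weyl_one by blast
      then show ?case using o wN_one by simp
    next
      case (step n \<alpha> m)
      have mN: "m \<in> N" using M_in_N[OF step(2,3)] .
      have "f m = refl \<alpha>" using f step(2,3) by blast
      then show ?case using hom[OF step(1) mN] step mN Nm[OF step(1) mN]
        by (simp add: wN_mult wN_M)
    qed
  qed
  ultimately have "(THE f. ?P f) = ?f" by (rule the_equality)
  then show ?thesis unfolding weyl_epi_def using assms by simp
qed

subsection \<open>Bruhat decomposition\<close>

definition "Bo = generate G (T \<union> gen U pos)"

lemma T_Upos_carrier: "T \<union> gen U pos \<subseteq> carrier G"
  using T_mem_carrier subgroup.subset[OF Upos_subgroup] by blast

lemma Bo_subgroup: "subgroup Bo G"
  unfolding Bo_def by (rule generate_is_subgroup[OF T_Upos_carrier])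

lemma T_cj_gen: "t \<in> T \<Longrightarrow> A \<subseteq> \<Phi> \<Longrightarrow> u \<in> gen U A \<Longrightarrow> cj t u \<in> gen U A"
proof (rule generate_cj[OF _ U_union_carrier _ U_union_carrier])
  fix s assume "t \<in> T" "A \<subseteq> \<Phi>" "s \<in> \<Union> (U ` A)"
  then show "cj t s \<in> gen U A" using T_cj_U U_in_gen by blast
qed (auto simp: T_mem_carrier)

lemma Bo_split: "b \<in> Bo \<Longrightarrow> \<exists>t\<in>T. \<exists>u\<in>gen U pos. b = t \<otimes> u"
  unfolding Bo_def using T_cj_gen[OF _ pos_subset] by (rule generate_product[OF T_subgroup Upos_subgroup])

lemma T_Bo: "T \<subseteq> Bo" and Upos_Bo: "gen U pos \<subseteq> Bo"
  unfolding Bo_def by (auto intro: generate.incl)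

text \<open>If n made a positive \<beta> negative, then n U_\<beta> n^-1 would be a non-trivial
  subgroup of U- inside T U+, against (RGD6).\<close>

lemma N_inter_Bo:
  assumes n: "n \<in> N" "n \<in> Bo"
  shows "n \<in> T"
proof (rule pos_preserving_in_T[OF n(1)])
  fix \<beta> assume b: "\<beta> \<in> pos"
  note bR = pos_root[OF b]
  show "wN n \<beta> \<in> pos"
  proof (rule ccontr)
    assume "wN n \<beta> \<notin> pos"
    then have "wN n \<beta> \<in> uminus ` pos"
      using pos_or_neg[OF wN_root[OF n(1) bR]] by (intro image_eqI[of _ _ "- wN n \<beta>"]) auto
    moreover obtain u where u: "u \<in> U \<beta>" "u \<noteq> \<one>" using U_nontrivial[OF bR] by blast
    have "cj n u \<in> U (wN n \<beta>)" using wN_cj_U[OF n(1) bR] u(1) by blast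
    ultimately have v: "cj n u \<in> gen U (uminus ` pos)" using U_in_gen by blast
    have "u \<in> Bo" using U_in_gen[OF u(1) b] Upos_Bo by blast
    then have "cj n u \<in> Bo" using cj_in_subgroup[OF Bo_subgroup n(2)] by blast
    then obtain t x where "t \<in> T" "x \<in> gen U pos" "cj n u = t \<otimes> x" using Bo_split by blast
    then have "cj n u = \<one>" using T_eq_Upos_Uneg(3)[of t x] v by metis
    then show False using u cj_eq_one[OF N_carrier[OF n(1)] U_mem_carrier[OF u(1) bR]] by blast
  qed
qed

definition same_cell :: "'g \<Rightarrow> 'g \<Rightarrow> bool" where
  "same_cell n n' \<longleftrightarrow> (\<exists>b\<in>Bo. \<exists>b'\<in>Bo. n' = b \<otimes> n \<otimes> b')"

lemma same_cellI:
  assumes "n \<in> carrier G" "n' \<in> carrier G" "b \<in> Bo" "b' \<in> Bo" "b \<otimes> n = n' \<otimes> b'"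
  shows "same_cell n n'"
proof -
  note c = assms(3,4)[THEN subgroup.mem_carrier[OF Bo_subgroup]]
  have "n' = (n' \<otimes> b') \<otimes> inv b'" using assms c by (simp add: group_word)
  then have "n' = b \<otimes> n \<otimes> inv b'" using assms(5) by simp
  then show ?thesis unfolding same_cell_def using assms subgroup.m_inv_closed[OF Bo_subgroup] by blast
qed

lemma M_cj_radical:
  assumes a: "a \<in> \<Delta>" "m \<in> M a" and k: "k \<in> gen U (pos - {a, 2 *\<^sub>R a})"
  shows "cj m k \<in> gen U (pos - {a, 2 *\<^sub>R a})"
proof (rule generate_cj[OF _ _ _ _ k])
  show "\<Union> (U ` (pos - {a, 2 *\<^sub>R a})) \<subseteq> carrier G" using pos_subset by (intro U_union_carrier) auto
  then show "\<Union> (U ` (pos - {a, 2 *\<^sub>R a})) \<subseteq> carrier G" .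
  fix s assume "s \<in> \<Union> (U ` (pos - {a, 2 *\<^sub>R a}))"
  then obtain \<gamma> where g: "\<gamma> \<in> pos - {a, 2 *\<^sub>R a}" "s \<in> U \<gamma>" by blast
  then have "cj m s \<in> U (refl a \<gamma>)" using M_cj_U[OF basis_root[OF a(1)] _ a(2)] pos_root by blast
  then show "cj m s \<in> gen U (pos - {a, 2 *\<^sub>R a})" using refl_basis_pos[OF a(1) g(1)] by (rule U_in_gen)
qed (use a M_mem_carrier basis_root in blast)

text \<open>The multiplication rule for Bruhat cells. Up to factors in B, the hypothesis becomes n =
  n' x m^-1 with x in \<open>U a\<close>. If n' keeps a positive, x moves to the left into B.
  Otherwise a non-trivial x is y m' y' with y, y' in \<open>U (- a)\<close>; now y moves to the left
  across n', y' moves to the right across m^-1, and m' m^-1 is in T.\<close>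

lemma same_cell_step:
  assumes n: "n \<in> N" "n' \<in> N" and a: "a \<in> \<Delta>" "m \<in> M a" and s: "same_cell (n \<otimes> m) n'"
  shows "same_cell n n' \<or> same_cell n (n' \<otimes> inv m)"
proof -
  note aR = basis_root[OF a(1)]
  obtain b b' where b: "b \<in> Bo" "b' \<in> Bo" "n' = b \<otimes> (n \<otimes> m) \<otimes> b'" using s unfolding same_cell_def by blast
  obtain t0 u where tu: "t0 \<in> T" "u \<in> gen U pos" "b' = t0 \<otimes> u" using Bo_split[OF b(2)] by blast
  have "inv u \<in> gen U pos" using subgroup.m_inv_closed[OF Upos_subgroup tu(2)] .
  then obtain x k where xk: "x \<in> U a" "k \<in> gen U (pos - {a, 2 *\<^sub>R a})" "inv u = x \<otimes> k"
    using family_split[OF commutator_family_U a(1)] by blast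
  have rad: "gen U (pos - {a, 2 *\<^sub>R a}) \<subseteq> gen U pos" by (rule gen_mono) blast
  define t where "t = cj m t0"
  define k' where "k' = cj m k"
  have tT: "t \<in> T" unfolding t_def by (rule T_cj_M_mult[OF aR a(2) tu(1)])
  have kB: "k' \<in> Bo" unfolding k'_def using M_cj_radical[OF a xk(2)] rad Upos_Bo by blast
  note c = N_carrier[OF n(1)] N_carrier[OF n(2)] M_mem_carrier[OF a(2) aR] U_mem_carrier[OF xk(1) aR]
    subgroup.mem_carrier[OF Bo_subgroup b(1)] T_mem_carrier[OF tu(1)] subgroup.mem_carrier[OF Upos_subgroup tu(2)]
  have kc: "k \<in> carrier G" using xk(2) rad subgroup.mem_carrier[OF Upos_subgroup] by blast
  have nt: "cj n t \<in> Bo" using N_cj_T_mem[OF n(1) tT] T_Bo by blast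
  have u: "u = inv k \<otimes> inv x" using xk(3) c kc by (metis inv_inv inv_mult_group)
  \<comment> \<open>Everything except \<open>x\<close> can be moved across \<open>m\<close>.\<close>
  have key: "b \<otimes> cj n t \<otimes> n = n' \<otimes> x \<otimes> inv m \<otimes> k'"
    unfolding b(3) tu(3) u t_def k'_def using c kc by (simp add: cj_def group_word)
  have bn: "b \<otimes> cj n t \<in> Bo" using subgroup.m_closed[OF Bo_subgroup b(1) nt] .
  have k'c: "k' \<in> carrier G" using kB subgroup.mem_carrier[OF Bo_subgroup] by blast
  have bc: "b \<otimes> cj n t \<in> carrier G" using bn subgroup.mem_carrier[OF Bo_subgroup] by blast
  have nmc: "n' \<otimes> inv m \<in> carrier G" using c by simp
  show ?thesis
  proof (cases "wN n' a \<in> pos")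
    case True
    have "cj n' x \<in> U (wN n' a)" using wN_cj_U[OF n(2) aR] xk(1) by blast
    then have y: "cj n' x \<in> Bo" using U_in_gen[OF _ True] Upos_Bo by blast
    have "inv (cj n' x) \<otimes> (b \<otimes> cj n t) \<otimes> n = inv (cj n' x) \<otimes> (b \<otimes> cj n t \<otimes> n)"
      using bc c by (simp add: m_assoc)
    also have "\<dots> = (n' \<otimes> inv m) \<otimes> k'"
      unfolding key using c k'c by (simp add: cj_def group_word)
    finally have "same_cell n (n' \<otimes> inv m)"
      using subgroup.m_closed[OF Bo_subgroup subgroup.m_inv_closed[OF Bo_subgroup y] bn]
      by (intro same_cellI[OF c(1) nmc _ kB])
    then show ?thesis by blast
  next
    case False
    show ?thesis
    proof (cases "x = \<one>")
      case True
      then have "b \<otimes> cj n t \<otimes> n = (n' \<otimes> inv m) \<otimes> k'" using key c by simp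
      then have "same_cell n (n' \<otimes> inv m)" by (rule same_cellI[OF c(1) nmc bn kB])
      then show ?thesis by blast
    next
      case x1: False
      obtain y m' y' where d: "y \<in> U (- a)" "m' \<in> M a" "y' \<in> U (- a)" "x = y \<otimes> m' \<otimes> y'"
        using U_decomp_uminus[OF aR xk(1) x1] by blast
      note dc = U_mem_carrier[OF d(1) uminus_root[OF aR]] U_mem_carrier[OF d(3) uminus_root[OF aR]] M_mem_carrier[OF d(2) aR]
      have "cj n' y \<in> U (- wN n' a)" using wN_cj_U[OF n(2) uminus_root[OF aR]] d(1) wN_uminus[OF n(2)] by auto
      moreover have "- wN n' a \<in> pos" using False pos_or_neg[OF wN_root[OF n(2) aR]] by blast
      ultimately have y: "cj n' y \<in> Bo" using U_in_gen Upos_Bo by blast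
      have "m' \<otimes> inv m \<in> T" using M_mult_inv_M[OF aR a(2) d(2)] .
      then have sB: "m' \<otimes> inv m \<in> Bo" using T_Bo by blast
      have "cj m y' \<in> U a" using M_cj_U[OF aR uminus_root[OF aR] a(2)] d(3) by (auto simp: refl_uminus refl_self aR)
      then have y'B: "cj m y' \<in> Bo" using U_in_gen[OF _ basis_in_pos[OF a(1)]] Upos_Bo by blast
      have "inv (cj n' y) \<otimes> (b \<otimes> cj n t) \<otimes> n = inv (cj n' y) \<otimes> (b \<otimes> cj n t \<otimes> n)"
        using bc c dc by (simp add: m_assoc)
      also have "\<dots> = n' \<otimes> ((m' \<otimes> inv m) \<otimes> cj m y' \<otimes> k')"
        unfolding key d(4) using c k'c dc by (simp add: cj_def group_word)
      finally have "same_cell n n'"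
        using subgroup.m_closed[OF Bo_subgroup subgroup.m_inv_closed[OF Bo_subgroup y] bn]
          subgroup.m_closed[OF Bo_subgroup subgroup.m_closed[OF Bo_subgroup sB y'B] kB]
        by (intro same_cellI[OF c(1,2)])
      then show ?thesis by blast
    qed
  qed
qed

text \<open>Induction on the word of n, under the condition that n' has no shorter word. In the
  first alternative of \<open>same_cell_step\<close>, n' would be a T-multiple of the prefix n1 and
  hence too short; in the second, n' m^-1 loses at most one letter and the induction
  applies.\<close>

lemma same_cell_words:
  "n \<in> words k \<Longrightarrow> n' \<in> N \<Longrightarrow> (\<And>j. j < k \<Longrightarrow> n' \<notin> words j) \<Longrightarrow> same_cell n n' \<Longrightarrow> \<exists>t\<in>T. n' = t \<otimes> n"
proof (induction k arbitrary: n n')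
  case 0
  then have "n \<in> T" by simp
  then have "n' \<in> Bo"
    using 0(4) T_Bo subgroup.m_closed[OF Bo_subgroup] unfolding same_cell_def by blast
  then have t: "n' \<in> T" using N_inter_Bo 0 by blast
  then have "n' \<otimes> inv n \<in> T" using \<open>n \<in> T\<close> T_subgroup subgroup.m_closed subgroup.m_inv_closed by metis
  moreover have "n' = n' \<otimes> inv n \<otimes> n" using t \<open>n \<in> T\<close> T_mem_carrier by (simp add: group_word)
  ultimately show ?case by blast
next
  case (Suc k)
  then obtain n1 m a where d: "n = n1 \<otimes> m" "n1 \<in> words k" "a \<in> \<Delta>" "m \<in> M a" by auto
  note aR = basis_root[OF d(3)]
  have nN: "n1 \<in> N" using d(2) words_N by blast
  note c = N_carrier[OF nN] N_carrier[OF Suc(3)] M_mem_carrier[OF d(4) aR]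
  have "same_cell n1 n' \<or> same_cell n1 (n' \<otimes> inv m)"
    using same_cell_step[OF nN Suc(3) d(3,4)] Suc(5) d(1) by simp
  then show ?case
  proof
    assume "same_cell n1 n'"
    then obtain t where "t \<in> T" "n' = t \<otimes> n1" using Suc.IH[OF d(2) Suc(3)] Suc(4) by auto
    then have "n' \<in> words k" using T_mult_words[OF d(2)] by blast
    then show ?thesis using Suc(4)[of k] by blast
  next
    assume s: "same_cell n1 (n' \<otimes> inv m)"
    have nm: "n' \<otimes> inv m \<in> N"
      using Suc(3) M_in_N[OF aR d(4)] N_subgroup subgroup.m_closed subgroup.m_inv_closed by metis
    have "n' \<otimes> inv m \<notin> words j" if "j < k" for j
    proof
      assume "n' \<otimes> inv m \<in> words j"
      then have "n' \<otimes> inv m \<otimes> m \<in> words (Suc j)" using d(3,4) by auto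
      then show False using Suc(4)[of "Suc j"] that c by (simp add: m_assoc)
    qed
    then obtain t where t: "t \<in> T" "n' \<otimes> inv m = t \<otimes> n1" using Suc.IH[OF d(2) nm] s by blast
    have "n' = n' \<otimes> inv m \<otimes> m" using c by (simp add: group_word)
    then have "n' = t \<otimes> n" using t T_mem_carrier c by (simp add: d(1) m_assoc)
    then show ?thesis using t(1) by blast
  qed
qed

text \<open>Cells are compared starting from the shorter of the two elements, which is possible
  because lying in the same cell is symmetric.\<close>

lemma Bruhat_disjoint:
  assumes n: "n \<in> N" "n' \<in> N" and s: "same_cell n n'"
  shows "wN n = wN n'"
proof -
  have eq: "wN n = wN n'" if "n \<in> N" "t \<in> T" "n' = t \<otimes> n" for n n' t
    using wN_mult[of t n] that T_subset_N wN_T[OF that(2)] by auto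
  define l where "l n = (LEAST k. n \<in> words k)" for n
  have l: "n \<in> words (l n)" "\<And>j. j < l n \<Longrightarrow> n \<notin> words j" if "n \<in> N" for n
    using N_words[OF that] not_less_Least unfolding l_def by (auto intro: LeastI_ex)
  show ?thesis
  proof (cases "l n \<le> l n'")
    case True
    then show ?thesis using same_cell_words[OF l(1)[OF n(1)] n(2) _ s] l(2)[OF n(2)] eq[OF n(1)] by force
  next
    case False
    obtain b b' where b: "b \<in> Bo" "b' \<in> Bo" "n' = b \<otimes> n \<otimes> b'" using s unfolding same_cell_def by blast
    note bc = b(1,2)[THEN subgroup.mem_carrier[OF Bo_subgroup]]
    have "same_cell n' n"
      unfolding same_cell_def using b subgroup.m_inv_closed[OF Bo_subgroup] bc N_carrier[OF n(1)]
      by (intro bexI[of _ "inv b"] bexI[of _ "inv b'"]) (auto simp: group_word)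
    then show ?thesis using same_cell_words[OF l(1)[OF n(2)] n(1)] l(2)[OF n(1)] eq[OF n(2)] False by force
  qed
qed

text \<open>Take n with the most inversions, an inversion being a positive root made non-positive.
  If n left a simple root a positive, the inversions of n m with m in \<open>M a\<close> would
  contain a and the reflected inversions of n, one more in all. So n makes all simple roots
  negative, and by linearity of the height all positive ones.\<close>

lemma longest_element: "\<exists>n\<in>N. \<forall>\<beta>\<in>pos. wN n \<beta> \<notin> pos"
proof -
  define I where "I n = {\<beta> \<in> pos. wN n \<beta> \<notin> pos}" for n
  have fin: "finite pos" using finite_subset[OF pos_subset finite_roots] .
  have "card (I n) \<le> card pos" for n unfolding I_def by (rule card_mono[OF fin]) blast
  then have bd: "\<forall>n. n \<in> N \<longrightarrow> card (I n) < Suc (card pos)" by (simp add: le_imp_less_Suc)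
  obtain n where n: "n \<in> N" "\<And>n'. n' \<in> N \<Longrightarrow> card (I n') \<le> card (I n)"
    using ex_has_greatest_nat[of "\<lambda>n. n \<in> N" \<one> "\<lambda>n. card (I n)", OF subgroup.one_closed[OF N_subgroup] bd] by blast
  have simple: "wN n a \<notin> pos" if a: "a \<in> \<Delta>" for a
  proof
    assume wa: "wN n a \<in> pos"
    note aR = basis_root[OF a]
    obtain m where m: "m \<in> M a" using M_nonempty[OF aR] by blast
    have w: "wN (n \<otimes> m) \<beta> = wN n (refl a \<beta>)" for \<beta>
      using wN_mult[OF n(1) M_in_N[OF aR m]] wN_M[OF aR m] by simp
    have w2: "wN n (2 *\<^sub>R a) \<in> pos" if "2 *\<^sub>R a \<in> pos"
      using height_pos[OF wa] wN_root[OF n(1) pos_root[OF that]]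
      by (simp add: pos_iff_height linear_scale[OF wN_linear[OF n(1)]] linear_scale[OF linear_height])
    have I1: "refl a \<beta> \<in> pos - {a, 2 *\<^sub>R a}" if "\<beta> \<in> I n" for \<beta>
      using refl_basis_pos[OF a, of \<beta>] that wa w2 by (auto simp: I_def)
    have "insert a (refl a ` I n) \<subseteq> I (n \<otimes> m)"
    proof
      fix \<gamma> assume "\<gamma> \<in> insert a (refl a ` I n)"
      then consider "\<gamma> = a" | \<beta> where "\<beta> \<in> I n" "\<gamma> = refl a \<beta>" by blast
      then show "\<gamma> \<in> I (n \<otimes> m)"
      proof cases
        case 1
        then show ?thesis using basis_in_pos[OF a] wa uminus_notin_pos
          by (simp add: I_def w refl_self[OF aR] wN_uminus[OF n(1)])
      next
        case 2
        then show ?thesis using I1[OF 2(1)] by (auto simp: I_def w refl_refl[OF aR])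
      qed
    qed
    moreover have finI: "finite (I n')" for n' unfolding I_def using fin by simp
    ultimately have "card (insert a (refl a ` I n)) \<le> card (I (n \<otimes> m))" by (intro card_mono)
    moreover have "a \<notin> refl a ` I n"
    proof
      assume "a \<in> refl a ` I n"
      then obtain \<beta> where "\<beta> \<in> I n" "a = refl a \<beta>" by (rule imageE)
      then show False using I1[of \<beta>] by simp
    qed
    moreover have "card (refl a ` I n) = card (I n)"
      using bij_refl[OF aR] by (intro card_image inj_on_subset[OF bij_is_inj]) auto
    ultimately have "Suc (card (I n)) \<le> card (I (n \<otimes> m))"
      using finI[of n] by simp
    then show False using n(2)[of "n \<otimes> m"] subgroup.m_closed[OF N_subgroup n(1) M_in_N[OF aR m]] by simp
  qed
  have "wN n \<beta> \<notin> pos" if b: "\<beta> \<in> pos" for \<beta>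
  proof -
    have "height \<Delta> (wN n \<beta>) = (\<Sum>\<delta>\<in>\<Delta>. blinfun_apply \<beta> (coweight \<Delta> \<delta>) * height \<Delta> (wN n \<delta>))"
      by (subst (1) coweight_expand[of \<beta>, symmetric])
         (simp add: linear_sum[OF wN_linear[OF n(1)]] linear_scale[OF wN_linear[OF n(1)]]
           linear_sum[OF linear_height] linear_scale[OF linear_height])
    also have "\<dots> \<le> 0"
    proof (rule sum_nonpos)
      fix \<delta> assume d: "\<delta> \<in> \<Delta>"
      have "height \<Delta> (wN n \<delta>) \<le> 0"
        using simple[OF d] pos_iff_height[OF wN_root[OF n(1) basis_root[OF d]]] by simp
      then show "blinfun_apply \<beta> (coweight \<Delta> \<delta>) * height \<Delta> (wN n \<delta>) \<le> 0"
        using coweight_pos_ge[OF b d] by (simp add: mult_nonneg_nonpos)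
    qed
    finally show ?thesis using height_pos[of "wN n \<beta>"] by auto
  qed
  then show ?thesis using n(1) by blast
qed

text \<open>With n0 a longest element, n n0 = u n0 (n0^-1 v n0), and n0^-1 v n0 is in U+. So n n0
  and n0 share a Bruhat cell, n acts trivially on the roots and lies in T, and (RGD6)
  finishes.\<close>

lemma N_inter_Upos_Uneg:
  assumes n: "n \<in> N" and u: "u \<in> gen U pos" and v: "v \<in> gen U (uminus ` pos)" and e: "n = u \<otimes> v"
  shows "n = \<one>"
proof -
  obtain n0 where n0: "n0 \<in> N" "\<And>\<beta>. \<beta> \<in> pos \<Longrightarrow> wN n0 \<beta> \<notin> pos" using longest_element by blast
  have i0: "inv n0 \<in> N" using subgroup.m_inv_closed[OF N_subgroup n0(1)] .
  have neg: "wN (inv n0) \<beta> \<in> pos" if "\<beta> \<in> uminus ` pos" for \<beta>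
  proof (rule ccontr)
    have bR: "\<beta> \<in> \<Phi>" using that neg_subset by blast
    assume "wN (inv n0) \<beta> \<notin> pos"
    then have "- wN (inv n0) \<beta> \<in> pos" using pos_or_neg[OF wN_root[OF i0 bR]] by blast
    then have "wN n0 (- wN (inv n0) \<beta>) \<notin> pos" by (rule n0(2))
    then have "- \<beta> \<notin> pos" using wN_uminus[OF n0(1)] wN_inv(1)[OF n0(1)] by simp
    then show False using that by auto
  qed
  have "cj (inv n0) v \<in> gen U pos"
  proof (rule generate_cj[OF N_carrier[OF i0] U_union_carrier[OF neg_subset] _ U_union_carrier[OF pos_subset] v])
    fix s assume "s \<in> \<Union> (U ` uminus ` pos)"
    then obtain \<beta> where b: "\<beta> \<in> uminus ` pos" "s \<in> U \<beta>" by blast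
    then have "cj (inv n0) s \<in> U (wN (inv n0) \<beta>)" using wN_cj_U[OF i0] neg_subset by blast
    then show "cj (inv n0) s \<in> gen U pos" using neg[OF b(1)] by (rule U_in_gen)
  qed
  then have B: "cj (inv n0) v \<in> Bo" "u \<in> Bo" using u Upos_Bo by auto
  note c = N_carrier[OF n0(1)] N_carrier[OF n] subgroup.mem_carrier[OF Upos_subgroup u] subgroup.mem_carrier[OF Uneg_subgroup v]
  have "n \<otimes> n0 = u \<otimes> n0 \<otimes> cj (inv n0) v" using c by (simp add: e cj_def group_word)
  then have "same_cell n0 (n \<otimes> n0)" unfolding same_cell_def using B by blast
  then have "wN n0 = wN n \<circ> wN n0"
    using Bruhat_disjoint[OF n0(1) subgroup.m_closed[OF N_subgroup n n0(1)]] wN_mult[OF n n0(1)] by simp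
  then have "wN n = id" using wN_inv(1)[OF n0(1)] by (metis comp_apply eq_id_iff)
  then have nT: "n \<in> T" using wN_eq_id_iff[OF n] by simp
  have iT: "inv n \<in> T" using subgroup.m_inv_closed[OF T_subgroup nT] .
  have "inv n \<otimes> u = inv v" using c by (simp add: e group_word)
  then have "inv n = \<one>"
    using T_eq_Upos_Uneg(1)[OF iT u _] subgroup.m_inv_closed[OF Uneg_subgroup v] by blast
  then show ?thesis using c by (metis inv_inv inv_one)
qed

end

section \<open>The apartment\<close>

subsection \<open>Additive groups and integer multiples\<close>

lemma comm_group_additive_group:
  assumes "0 \<in> S" "\<And>x y. x \<in> S \<Longrightarrow> y \<in> S \<Longrightarrow> x + y \<in> S" "\<And>x. x \<in> S \<Longrightarrow> - x \<in> S"
  shows "comm_group (additive_group S)"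
proof (rule comm_groupI)
  fix x assume "x \<in> carrier (additive_group S)"
  then show "\<exists>y\<in>carrier (additive_group S). y \<otimes>\<^bsub>additive_group S\<^esub> x = \<one>\<^bsub>additive_group S\<^esub>"
    using assms by (intro bexI[of _ "- x"]) (auto simp: additive_group_def)
qed (use assms in \<open>auto simp: additive_group_def algebra_simps\<close>)

interpretation additive: comm_group "additive_group (UNIV :: 'r::ab_group_add set)"
  by (rule comm_group_additive_group) auto

lemma additive_group_simps [simp]:
  "carrier (additive_group S) = S" "x \<otimes>\<^bsub>additive_group S\<^esub> y = x + y" "\<one>\<^bsub>additive_group S\<^esub> = 0"
  by (simp_all add: additive_group_def)

lemma int_mult_0 [simp]: "int_mult 0 r = 0"
  and int_mult_0_right [simp]: "int_mult n 0 = 0"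
  and int_mult_1 [simp]: "int_mult 1 r = r"
  and int_mult_add_left: "int_mult (m + n) r = int_mult m r + int_mult n r"
  and int_mult_add_right: "int_mult n (r + s) = int_mult n r + int_mult n s"
  and int_mult_mult: "int_mult (m * n) r = int_mult m (int_mult n r)"
  using additive.int_pow_one[of n] additive.int_pow_pow[of r n m]
  unfolding int_mult_def
  by (simp_all add: additive.int_pow_mult[simplified] additive.int_pow_distrib[simplified] mult.commute)

lemma int_mult_minus_left: "int_mult (- n) r = - int_mult n r"
  using int_mult_add_left[of "- n" n r] by (simp add: eq_neg_iff_add_eq_0)

lemma int_mult_minus_right: "int_mult n (- r) = - int_mult n r"
  using int_mult_add_right[of n "- r" r] by (simp add: eq_neg_iff_add_eq_0)

lemma int_mult_sum_left: "int_mult (\<Sum>i\<in>S. k i) r = (\<Sum>i\<in>S. int_mult (k i) r)"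
  by (induction S rule: infinite_finite_induct) (auto simp: int_mult_add_left)

lemma int_mult_mono_right:
  fixes r s :: "'r::linordered_ab_group_add"
  assumes "0 \<le> n" "r \<le> s"
  shows "int_mult n r \<le> int_mult n s"
proof -
  obtain k where k: "n = int k" using assms(1) nonneg_int_cases by blast
  have "int_mult (int k) r \<le> int_mult (int k) s"
    using assms(2) by (induction k) (auto simp: int_mult_add_left add_mono)
  then show ?thesis using k by simp
qed

lemma int_mult_pos:
  fixes r :: "'r::linordered_ab_group_add"
  assumes "0 < n" "0 < r"
  shows "0 < int_mult n r"
proof -
  have "n = 1 + (n - 1)" by simp
  then have "int_mult n r = r + int_mult (n - 1) r" by (metis int_mult_1 int_mult_add_left)
  moreover have "int_mult (n - 1) 0 \<le> int_mult (n - 1) r" using assms by (intro int_mult_mono_right) auto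
  ultimately show ?thesis using assms by (simp add: add_pos_nonneg)
qed

text \<open>A totally ordered group has no torsion. This recovers integer coefficients of roots from
  their values on a point of the apartment.\<close>

lemma int_mult_left_inj:
  fixes r :: "'r::linordered_ab_group_add"
  assumes "0 < r" "int_mult m r = int_mult n r"
  shows "m = n"
proof (rule ccontr)
  assume "m \<noteq> n"
  have e: "int_mult (k - l) r = 0" if "int_mult k r = int_mult l r" for k l
    using int_mult_add_left[of "k - l" l r] that by simp
  show False
    using int_mult_pos[of "m - n" r] int_mult_pos[of "n - m" r] e[of m n] e[of n m] assms \<open>m \<noteq> n\<close>
    by (cases "m < n") auto
qed

subsection \<open>Tensor products\<close>

lemma comm_group_tensor_group:
  assumes "group A" "group B"
  shows "comm_group (tensor_group A B)"
proof -
  define F where "F = free_Abelian_group (carrier A \<times> carrier B)"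
  interpret F: comm_group F unfolding F_def by (rule abelian_free_Abelian_group)
  have n: "tensor_kernel A B \<lhd> F" unfolding F_def by (rule tensor_kernel_normal[OF assms])
  interpret Q: group "F Mod tensor_kernel A B" using n by (rule normal.factorgroup_is_group)
  show ?thesis
    unfolding tensor_group_def F_def[symmetric]
  proof (rule Q.group_comm_groupI)
    fix X Y assume "X \<in> carrier (F Mod tensor_kernel A B)" "Y \<in> carrier (F Mod tensor_kernel A B)"
    then obtain x y where "x \<in> carrier F" "y \<in> carrier F"
      "X = tensor_kernel A B #>\<^bsub>F\<^esub> x" "Y = tensor_kernel A B #>\<^bsub>F\<^esub> y"
      by (auto simp: carrier_FactGroup)
    then show "X \<otimes>\<^bsub>F Mod tensor_kernel A B\<^esub> Y = Y \<otimes>\<^bsub>F Mod tensor_kernel A B\<^esub> X"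
      using normal.rcos_sum[OF n] by (simp add: F.m_comm)
  qed
qed

lemma pure_tensor_closed:
  "a \<in> carrier A \<Longrightarrow> b \<in> carrier B \<Longrightarrow> pure_tensor A B a b \<in> carrier (tensor_group A B)"
  by (auto simp: tensor_group_def pure_tensor_def carrier_FactGroup)

lemma pure_tensor_add:
  assumes "group A" "group B"
  shows "a \<in> carrier A \<Longrightarrow> a' \<in> carrier A \<Longrightarrow> b \<in> carrier B \<Longrightarrow>
      pure_tensor A B (a \<otimes>\<^bsub>A\<^esub> a') b = pure_tensor A B a b \<otimes>\<^bsub>tensor_group A B\<^esub> pure_tensor A B a' b"
    and "a \<in> carrier A \<Longrightarrow> b \<in> carrier B \<Longrightarrow> b' \<in> carrier B \<Longrightarrow>
      pure_tensor A B a (b \<otimes>\<^bsub>B\<^esub> b') = pure_tensor A B a b \<otimes>\<^bsub>tensor_group A B\<^esub> pure_tensor A B a b'"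
proof -
  define F where "F = free_Abelian_group (carrier A \<times> carrier B)"
  define K where "K = tensor_kernel A B"
  interpret A: group A by fact
  interpret B: group B by fact
  interpret F: comm_group F unfolding F_def by (rule abelian_free_Abelian_group)
  have n: "K \<lhd> F" unfolding F_def K_def by (rule tensor_kernel_normal[OF assms])
  have add: "K #>\<^bsub>F\<^esub> frag_of p = (K #>\<^bsub>F\<^esub> frag_of q) <#>\<^bsub>F\<^esub> (K #>\<^bsub>F\<^esub> frag_of r)"
    if h: "q \<in> carrier A \<times> carrier B" "r \<in> carrier A \<times> carrier B"
      "frag_of p - frag_of q - frag_of r \<in> tensor_relators A B" for p q r
  proof -
    have qr: "frag_of q \<in> carrier F" "frag_of r \<in> carrier F" using h by (auto simp: F_def)
    have k: "frag_of p - frag_of q - frag_of r \<in> K"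
      unfolding K_def tensor_kernel_def using h(3) by (rule generate.incl)
    have "frag_of p = (frag_of p - frag_of q - frag_of r) + (frag_of q + frag_of r)" by simp
    then have "frag_of p \<in> K #>\<^bsub>F\<^esub> (frag_of q \<otimes>\<^bsub>F\<^esub> frag_of r)"
      unfolding r_coset_def using k by (auto simp: F_def intro!: bexI[of _ "frag_of p - frag_of q - frag_of r"])
    then have "K #>\<^bsub>F\<^esub> (frag_of q \<otimes>\<^bsub>F\<^esub> frag_of r) = K #>\<^bsub>F\<^esub> frag_of p"
      using qr n by (intro F.repr_independence normal_imp_subgroup) auto
    then show ?thesis using normal.rcos_sum[OF n qr] by simp
  qed
  have pt: "pure_tensor A B a b = K #>\<^bsub>F\<^esub> frag_of (a, b)"
    "X \<otimes>\<^bsub>tensor_group A B\<^esub> Y = X <#>\<^bsub>F\<^esub> Y" for a b X Y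
    by (auto simp: pure_tensor_def tensor_group_def K_def F_def)
  show "pure_tensor A B (a \<otimes>\<^bsub>A\<^esub> a') b = pure_tensor A B a b \<otimes>\<^bsub>tensor_group A B\<^esub> pure_tensor A B a' b"
    if "a \<in> carrier A" "a' \<in> carrier A" "b \<in> carrier B"
    unfolding pt using that by (intro add) (auto simp: tensor_relators_def)
  show "pure_tensor A B a (b \<otimes>\<^bsub>B\<^esub> b') = pure_tensor A B a b \<otimes>\<^bsub>tensor_group A B\<^esub> pure_tensor A B a b'"
    if "a \<in> carrier A" "b \<in> carrier B" "b' \<in> carrier B"
    unfolding pt using that by (intro add) (auto simp: tensor_relators_def)
qed

text \<open>The uniqueness half of the universal property: restricted to the carrier, both
  homomorphisms are lifts of the same biadditive map.\<close>

lemma tensor_hom_eqI: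
  assumes "group A" "group B" "comm_group H"
    and h: "h \<in> hom (tensor_group A B) H" "h' \<in> hom (tensor_group A B) H"
    and eq: "\<And>a b. a \<in> carrier A \<Longrightarrow> b \<in> carrier B \<Longrightarrow> h (pure_tensor A B a b) = h' (pure_tensor A B a b)"
    and x: "x \<in> carrier (tensor_group A B)"
  shows "h x = h' x"
proof -
  interpret V: comm_group "tensor_group A B" by (rule comm_group_tensor_group) fact+
  let ?f = "\<lambda>a b. h (pure_tensor A B a b)"
  note pc = pure_tensor_closed[of _ A _ B]
  have hc: "g y \<in> carrier H" if "g \<in> hom (tensor_group A B) H" "y \<in> carrier (tensor_group A B)" for g y
    using that by (auto simp: hom_def)
  have "\<exists>!g. is_tensor_lift A B H ?f g"
    using h(1) pc
    by (intro tensor_lift_unique assms(1-3))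
       (auto simp: hc pure_tensor_add[OF assms(1,2)] hom_mult)
  moreover have "restrict g (carrier (tensor_group A B)) \<in> hom (tensor_group A B) H"
    if "g \<in> hom (tensor_group A B) H" for g
    using that by (auto simp: hom_def)
  ultimately have "restrict h (carrier (tensor_group A B)) = restrict h' (carrier (tensor_group A B))"
    using h pc eq by (auto simp: is_tensor_lift_def)
  then show ?thesis using x by (metis restrict_apply')
qed

lemma tensor_lift:
  assumes "group A" "group B" "comm_group H"
    and "\<And>a b. a \<in> carrier A \<Longrightarrow> b \<in> carrier B \<Longrightarrow> f a b \<in> carrier H"
    and "\<And>a a' b. a \<in> carrier A \<Longrightarrow> a' \<in> carrier A \<Longrightarrow> b \<in> carrier B \<Longrightarrow>
          f (a \<otimes>\<^bsub>A\<^esub> a') b = f a b \<otimes>\<^bsub>H\<^esub> f a' b"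
    and "\<And>a b b'. a \<in> carrier A \<Longrightarrow> b \<in> carrier B \<Longrightarrow> b' \<in> carrier B \<Longrightarrow>
          f a (b \<otimes>\<^bsub>B\<^esub> b') = f a b \<otimes>\<^bsub>H\<^esub> f a b'"
  shows "tensor_lift A B H f \<in> hom (tensor_group A B) H"
    and "a \<in> carrier A \<Longrightarrow> b \<in> carrier B \<Longrightarrow> tensor_lift A B H f (pure_tensor A B a b) = f a b"
proof -
  have "is_tensor_lift A B H f (tensor_lift A B H f)"
    unfolding tensor_lift_def using tensor_lift_unique[OF assms] by (rule theI')
  then show "tensor_lift A B H f \<in> hom (tensor_group A B) H"
    and "a \<in> carrier A \<Longrightarrow> b \<in> carrier B \<Longrightarrow> tensor_lift A B H f (pure_tensor A B a b) = f a b"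
    by (auto simp: is_tensor_lift_def)
qed

subsection \<open>Coordinates\<close>

context root_sys
begin

abbreviation lattice :: "'v set" where
  "lattice \<equiv> carrier (coweight_lattice \<Phi>)"

abbreviation tensor :: "'v \<Rightarrow> 'r::linordered_ab_group_add \<Rightarrow> ('v, 'r) point" (infixl \<open>\<otimes>\<^sub>p\<close> 70) where
  "v \<otimes>\<^sub>p r \<equiv> pure_tensor (coweight_lattice \<Phi>) (additive_group UNIV) v r"

lemma lattice_iff: "v \<in> lattice \<longleftrightarrow> (\<forall>\<alpha>\<in>\<Phi>. blinfun_apply \<alpha> v \<in> \<int>)"
  by (simp add: coweight_lattice_def)

lemma lattice_mult [simp]: "v \<otimes>\<^bsub>coweight_lattice \<Phi>\<^esub> v' = v + v'"
  by (simp add: coweight_lattice_def)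

sublocale L: comm_group "coweight_lattice \<Phi>"
  unfolding coweight_lattice_def
  by (rule comm_group_additive_group) (auto simp: blinfun.add_right blinfun.minus_right)

sublocale VR: comm_group "VR \<Phi> :: ('v, 'r::linordered_ab_group_add) point monoid"
  unfolding VR_def by (rule comm_group_tensor_group) (auto intro: L.is_group additive.is_group)

lemma tensor_closed [simp, intro]: "v \<in> lattice \<Longrightarrow> v \<otimes>\<^sub>p r \<in> apartment \<Phi>"
  unfolding VR_def by (rule pure_tensor_closed) auto

lemma tensor_add_left: "v \<in> lattice \<Longrightarrow> v' \<in> lattice \<Longrightarrow> (v + v') \<otimes>\<^sub>p r = (v \<otimes>\<^sub>p r) \<otimes>\<^bsub>VR \<Phi>\<^esub> (v' \<otimes>\<^sub>p r)"
  using pure_tensor_add(1)[OF L.is_group additive.is_group, of v v' r] by (simp add: VR_def)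

lemma tensor_add_right: "v \<in> lattice \<Longrightarrow> v \<otimes>\<^sub>p (r + s) = (v \<otimes>\<^sub>p r) \<otimes>\<^bsub>VR \<Phi>\<^esub> (v \<otimes>\<^sub>p s)"
  using pure_tensor_add(2)[OF L.is_group additive.is_group, of v r s] by (simp add: VR_def)

lemma VR_hom_eqI:
  assumes "comm_group H" "h \<in> hom (VR \<Phi>) H" "h' \<in> hom (VR \<Phi>) H"
    and "\<And>v r. v \<in> lattice \<Longrightarrow> h (v \<otimes>\<^sub>p r) = h' (v \<otimes>\<^sub>p r)" and "x \<in> apartment \<Phi>"
  shows "h x = h' x"
  using assms unfolding VR_def
  by (intro tensor_hom_eqI[OF L.is_group additive.is_group, of H h h' x]) auto

text \<open>On the coweight lattice the floor in \<open>root_value\<close> rounds nothing.\<close>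

lemma floor_root: "\<alpha> \<in> \<Phi> \<Longrightarrow> v \<in> lattice \<Longrightarrow> of_int \<lfloor>blinfun_apply \<alpha> v\<rfloor> = blinfun_apply \<alpha> v"
  by (simp add: lattice_iff)

lemma root_value:
  assumes "\<alpha> \<in> \<Phi>"
  shows root_value_hom: "root_value \<Phi> \<alpha> \<in> hom (VR \<Phi>) (additive_group (UNIV :: 'r::linordered_ab_group_add set))"
    and root_value_tensor: "v \<in> lattice \<Longrightarrow> root_value \<Phi> \<alpha> (v \<otimes>\<^sub>p (r::'r)) = int_mult \<lfloor>blinfun_apply \<alpha> v\<rfloor> r"
proof -
  have "\<lfloor>blinfun_apply \<alpha> (v + v')\<rfloor> = \<lfloor>blinfun_apply \<alpha> v\<rfloor> + \<lfloor>blinfun_apply \<alpha> v'\<rfloor>"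
    if "v \<in> lattice" for v v'
    using assms that by (simp add: blinfun.add_right lattice_iff floor_add_int[symmetric] add.commute)
  then show "root_value \<Phi> \<alpha> \<in> hom (VR \<Phi>) (additive_group (UNIV :: 'r set))"
    and "v \<in> lattice \<Longrightarrow> root_value \<Phi> \<alpha> (v \<otimes>\<^sub>p (r::'r)) = int_mult \<lfloor>blinfun_apply \<alpha> v\<rfloor> r"
    unfolding root_value_def VR_def
    by (intro tensor_lift L.is_group additive.is_group additive.comm_group_axioms;
        simp add: int_mult_add_left int_mult_add_right)+
qed

lemma root_value_mult: "\<alpha> \<in> \<Phi> \<Longrightarrow> x \<in> apartment \<Phi> \<Longrightarrow> y \<in> apartment \<Phi> \<Longrightarrow>
    root_value \<Phi> \<alpha> (x \<otimes>\<^bsub>VR \<Phi>\<^esub> y) = root_value \<Phi> \<alpha> x + root_value \<Phi> \<alpha> y"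
  using hom_mult[OF root_value_hom] by fastforce

lemma root_value_one: "\<alpha> \<in> \<Phi> \<Longrightarrow> root_value \<Phi> \<alpha> \<one>\<^bsub>VR \<Phi>\<^esub> = 0"
  using root_value_mult[of \<alpha> "\<one>\<^bsub>VR \<Phi>\<^esub>" "\<one>\<^bsub>VR \<Phi>\<^esub>"] by simp

text \<open>Integral relations between roots pass to their values. Both sides are homomorphisms, so
  pure tensors suffice, and there it is the same relation between integers.\<close>

lemma root_value_sum:
  fixes x :: "('v, 'r::linordered_ab_group_add) point"
  assumes \<alpha>: "\<alpha> \<in> \<Phi>" "\<alpha> = (\<Sum>i\<in>S. of_int (k i) *\<^sub>R \<beta> i)" and \<beta>: "\<And>i. i \<in> S \<Longrightarrow> \<beta> i \<in> \<Phi>"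
    and x: "x \<in> apartment \<Phi>"
  shows "root_value \<Phi> \<alpha> x = (\<Sum>i\<in>S. int_mult (k i) (root_value \<Phi> (\<beta> i) x))"
proof (rule VR_hom_eqI[OF additive.comm_group_axioms root_value_hom[OF \<alpha>(1)] _ _ x])
  show "(\<lambda>x. \<Sum>i\<in>S. int_mult (k i) (root_value \<Phi> (\<beta> i) x)) \<in> hom (VR \<Phi>) (additive_group UNIV)"
    by (rule homI) (auto simp: root_value_mult \<beta> int_mult_add_right sum.distrib)
  fix v :: 'v and r :: 'r assume v: "v \<in> lattice"
  have "real_of_int \<lfloor>blinfun_apply \<alpha> v\<rfloor> = (\<Sum>i\<in>S. of_int (k i) * blinfun_apply (\<beta> i) v)"
    using floor_root[OF \<alpha>(1) v] by (simp add: \<alpha>(2) blinfun.sum_left blinfun.scaleR_left)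
  also have "\<dots> = real_of_int (\<Sum>i\<in>S. k i * \<lfloor>blinfun_apply (\<beta> i) v\<rfloor>)"
    unfolding of_int_sum of_int_mult by (rule sum.cong) (simp_all only: floor_root[OF \<beta> v])
  finally have "\<lfloor>blinfun_apply \<alpha> v\<rfloor> = (\<Sum>i\<in>S. k i * \<lfloor>blinfun_apply (\<beta> i) v\<rfloor>)" by linarith
  then show "root_value \<Phi> \<alpha> (v \<otimes>\<^sub>p r) = (\<Sum>i\<in>S. int_mult (k i) (root_value \<Phi> (\<beta> i) (v \<otimes>\<^sub>p r)))"
    using v \<alpha>(1) \<beta> by (simp add: root_value_tensor int_mult_sum_left int_mult_mult)
qed

text \<open>The summation runs over truth values rather than over the set {\<beta>, \<gamma>}, so
  that \<beta> = \<gamma> is allowed.\<close>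

lemma root_value_comb:
  assumes "\<alpha> \<in> \<Phi>" "\<beta> \<in> \<Phi>" "\<gamma> \<in> \<Phi>" "\<alpha> = of_int k *\<^sub>R \<beta> + of_int l *\<^sub>R \<gamma>" "x \<in> apartment \<Phi>"
  shows "root_value \<Phi> \<alpha> x = int_mult k (root_value \<Phi> \<beta> x) + int_mult l (root_value \<Phi> \<gamma> x)"
  using root_value_sum[of \<alpha> "\<lambda>b. if b then k else l" "\<lambda>b. if b then \<beta> else \<gamma>" UNIV x] assms
  by (simp add: UNIV_bool)

lemma root_value_uminus:
  "\<alpha> \<in> \<Phi> \<Longrightarrow> x \<in> apartment \<Phi> \<Longrightarrow> root_value \<Phi> (- \<alpha>) x = - root_value \<Phi> \<alpha> x"
  by (subst root_value_comb[of "- \<alpha>" \<alpha> \<alpha> "-1" 0 x]) (simp_all only: uminus_root, simp_all add: int_mult_minus_left)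

end

section \<open>Coordinates of the apartment with respect to the fundamental coweights\<close>

context based_root_sys
begin

lemma coweight_lattice_coweight: "\<delta> \<in> \<Delta> \<Longrightarrow> coweight \<Delta> \<delta> \<in> lattice"
  by (simp add: lattice_iff coweight_int)

lemma dual_expand: "(\<Sum>\<delta>\<in>\<Delta>. blinfun_apply \<delta> v *\<^sub>R coweight \<Delta> \<delta>) = v"
proof -
  have "blinfun_apply \<beta> (\<Sum>\<delta>\<in>\<Delta>. blinfun_apply \<delta> v *\<^sub>R coweight \<Delta> \<delta>) = blinfun_apply \<beta> v" for \<beta> :: "'v dual"
  proof -
    have "blinfun_apply \<beta> v = blinfun_apply (\<Sum>\<delta>\<in>\<Delta>. blinfun_apply \<beta> (coweight \<Delta> \<delta>) *\<^sub>R \<delta>) v"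
      by (simp add: coweight_expand)
    then show ?thesis
      by (simp add: blinfun.sum_left blinfun.scaleR_left blinfun.sum_right blinfun.scaleR_right mult.commute)
  qed
  then have "blinfun_apply (blinfun_inner_left b) (\<Sum>\<delta>\<in>\<Delta>. blinfun_apply \<delta> v *\<^sub>R coweight \<Delta> \<delta>)
      = blinfun_apply (blinfun_inner_left b) v" for b by blast
  then have "b \<bullet> (\<Sum>\<delta>\<in>\<Delta>. blinfun_apply \<delta> v *\<^sub>R coweight \<Delta> \<delta>) = b \<bullet> v" for b
    by (simp add: inner_commute)
  then show ?thesis by (metis euclidean_eqI inner_commute)
qed

text \<open>The point with prescribed coordinates: the coweights form a basis of the lattice, and
  the values of the basis roots are the coordinates.\<close>

definition point_of :: "('v dual \<Rightarrow> 'r) \<Rightarrow> ('v, 'r::linordered_ab_group_add) point" where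
  "point_of c = finprod (VR \<Phi>) (\<lambda>\<delta>. coweight \<Delta> \<delta> \<otimes>\<^sub>p c \<delta>) \<Delta>"

lemma point_of_closed [simp, intro]: "point_of c \<in> apartment \<Phi>"
  unfolding point_of_def by (rule VR.finprod_closed) (auto intro: coweight_lattice_coweight)

lemma tensor_zero:
  fixes r :: "'r::linordered_ab_group_add"
  shows "0 \<otimes>\<^sub>p r = \<one>\<^bsub>VR \<Phi>\<^esub>" and "v \<in> lattice \<Longrightarrow> v \<otimes>\<^sub>p (0::'r) = \<one>\<^bsub>VR \<Phi>\<^esub>"
proof -
  have *: "X = \<one>\<^bsub>VR \<Phi>\<^esub>" if "X \<in> apartment \<Phi>" "X = X \<otimes>\<^bsub>VR \<Phi>\<^esub> X" for X :: "('v, 'r) point"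
    using that VR.l_cancel_one' by blast
  have z: "(0::'v) \<in> lattice" by (simp add: lattice_iff)
  show "0 \<otimes>\<^sub>p r = \<one>\<^bsub>VR \<Phi>\<^esub>" using *[OF tensor_closed[OF z]] tensor_add_left[OF z z, of r] unfolding add_0 .
  show "v \<otimes>\<^sub>p (0::'r) = \<one>\<^bsub>VR \<Phi>\<^esub>" if "v \<in> lattice"
    using *[OF tensor_closed[OF that]] tensor_add_right[OF that, of 0 0] unfolding add_0 .
qed

lemma tensor_int_mult:
  fixes r :: "'r::linordered_ab_group_add"
  assumes v: "v \<in> lattice"
  shows "v \<otimes>\<^sub>p int_mult k r = (of_int k *\<^sub>R v) \<otimes>\<^sub>p r"
proof -
  have kl: "of_int k *\<^sub>R v \<in> lattice" for k using v by (simp add: lattice_iff blinfun.scaleR_right)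
  have nat: "v \<otimes>\<^sub>p int_mult (int n) r = (of_int (int n) *\<^sub>R v) \<otimes>\<^sub>p r" for n
  proof (induction n)
    case 0
    show ?case using v by (simp add: tensor_zero)
  next
    case (Suc n)
    have "int_mult (int (Suc n)) r = int_mult (int n) r + r" by (simp add: int_mult_add_left add.commute)
    moreover have "of_int (int (Suc n)) *\<^sub>R v = of_int (int n) *\<^sub>R v + v" by (simp add: scaleR_left_distrib add.commute)
    ultimately show ?case using Suc tensor_add_right[OF v] tensor_add_left[OF kl[of "int n"] v] by metis
  qed
  show ?thesis
  proof (cases "0 \<le> k")
    case True then show ?thesis using nat[of "nat k"] by simp
  next
    case False
    define n where "n = nat (- k)"
    have k: "k = - int n" using False by (simp add: n_def)
    have "(v \<otimes>\<^sub>p int_mult (int n) r) \<otimes>\<^bsub>VR \<Phi>\<^esub> (v \<otimes>\<^sub>p int_mult k r) = v \<otimes>\<^sub>p int_mult (int n + k) r"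
      by (simp add: tensor_add_right[OF v] int_mult_add_left)
    also have "\<dots> = (of_int (int n + k) *\<^sub>R v) \<otimes>\<^sub>p r"
      using nat[of 0] by (simp add: k)
    also have "\<dots> = ((of_int (int n) *\<^sub>R v) \<otimes>\<^sub>p r) \<otimes>\<^bsub>VR \<Phi>\<^esub> ((of_int k *\<^sub>R v) \<otimes>\<^sub>p r)"
      unfolding of_int_add scaleR_left_distrib by (rule tensor_add_left[OF kl kl])
    finally show ?thesis
      unfolding nat[of n] using VR.Units_l_cancel tensor_closed[OF kl] tensor_closed[OF v] VR.Units_eq by metis
  qed
qed

lemma tensor_sum_left:
  fixes r :: "'r::linordered_ab_group_add"
  assumes "finite S" "\<And>i. i \<in> S \<Longrightarrow> f i \<in> lattice"
  shows "(\<Sum>i\<in>S. f i) \<otimes>\<^sub>p r = finprod (VR \<Phi>) (\<lambda>i. f i \<otimes>\<^sub>p r) S \<and> (\<Sum>i\<in>S. f i) \<in> lattice"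
  using assms
proof (induction S rule: finite_induct)
  case empty
  have "(0::'v) \<in> lattice" by (simp add: lattice_iff)
  then show ?case by (simp add: tensor_zero)
next
  case (insert i S)
  have "f i + (\<Sum>i\<in>S. f i) \<in> lattice" using insert L.m_closed[of "f i" "\<Sum>i\<in>S. f i"] by simp
  then show ?case using insert by (simp add: tensor_add_left VR.finprod_insert Pi_iff)
qed

text \<open>Both sides are homomorphisms in x. On a pure tensor of v and r the claim is the
  expansion of v in the coweights, whose coefficients are integers and can be moved across the
  tensor sign.\<close>

lemma point_of_root_values:
  fixes x :: "('v, 'r::linordered_ab_group_add) point"
  assumes x: "x \<in> apartment \<Phi>"
  shows "point_of (\<lambda>\<delta>. root_value \<Phi> \<delta> x) = x"
proof (rule VR_hom_eqI[OF VR.comm_group_axioms _ _ _ x, of "\<lambda>x. point_of (\<lambda>\<delta>. root_value \<Phi> \<delta> x)" "\<lambda>x. x"])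
  have cw: "\<delta> \<in> \<Delta> \<Longrightarrow> coweight \<Delta> \<delta> \<otimes>\<^sub>p r \<in> apartment \<Phi>" for \<delta> and r :: 'r
    by (rule tensor_closed[OF coweight_lattice_coweight])
  show "(\<lambda>x :: ('v, 'r) point. point_of (\<lambda>\<delta>. root_value \<Phi> \<delta> x)) \<in> hom (VR \<Phi>) (VR \<Phi>)"
  proof (rule homI)
    fix x y :: "('v, 'r) point" assume "x \<in> apartment \<Phi>" "y \<in> apartment \<Phi>"
    then have "point_of (\<lambda>\<delta>. root_value \<Phi> \<delta> (x \<otimes>\<^bsub>VR \<Phi>\<^esub> y)) = finprod (VR \<Phi>) (\<lambda>\<delta>.
        (coweight \<Delta> \<delta> \<otimes>\<^sub>p root_value \<Phi> \<delta> x) \<otimes>\<^bsub>VR \<Phi>\<^esub> (coweight \<Delta> \<delta> \<otimes>\<^sub>p root_value \<Phi> \<delta> y)) \<Delta>"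
      unfolding point_of_def
      by (intro VR.finprod_cong') (auto simp: cw root_value_mult basis_root tensor_add_right coweight_lattice_coweight)
    also have "\<dots> = point_of (\<lambda>\<delta>. root_value \<Phi> \<delta> x) \<otimes>\<^bsub>VR \<Phi>\<^esub> point_of (\<lambda>\<delta>. root_value \<Phi> \<delta> y)"
      unfolding point_of_def by (rule VR.finprod_multf) (auto simp: cw)
    finally show "point_of (\<lambda>\<delta>. root_value \<Phi> \<delta> (x \<otimes>\<^bsub>VR \<Phi>\<^esub> y)) =
        point_of (\<lambda>\<delta>. root_value \<Phi> \<delta> x) \<otimes>\<^bsub>VR \<Phi>\<^esub> point_of (\<lambda>\<delta>. root_value \<Phi> \<delta> y)" .
  qed auto
  show "(\<lambda>x :: ('v, 'r) point. x) \<in> hom (VR \<Phi>) (VR \<Phi>)" by (auto simp: hom_def)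
  fix v :: 'v and r :: 'r assume v: "v \<in> lattice"
  have kl: "of_int k *\<^sub>R coweight \<Delta> \<delta> \<in> lattice" if "\<delta> \<in> \<Delta>" for k \<delta>
    using coweight_lattice_coweight[OF that] by (simp add: lattice_iff blinfun.scaleR_right)
  have "point_of (\<lambda>\<delta>. root_value \<Phi> \<delta> (v \<otimes>\<^sub>p r)) =
      finprod (VR \<Phi>) (\<lambda>\<delta>. (of_int \<lfloor>blinfun_apply \<delta> v\<rfloor> *\<^sub>R coweight \<Delta> \<delta>) \<otimes>\<^sub>p r) \<Delta>"
    unfolding point_of_def
    by (rule VR.finprod_cong')
       (auto simp: root_value_tensor basis_root v tensor_int_mult coweight_lattice_coweight intro!: tensor_closed kl)
  also have "\<dots> = (\<Sum>\<delta>\<in>\<Delta>. of_int \<lfloor>blinfun_apply \<delta> v\<rfloor> *\<^sub>R coweight \<Delta> \<delta>) \<otimes>\<^sub>p r"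
    using tensor_sum_left[OF finite_basis, of "\<lambda>\<delta>. of_int \<lfloor>blinfun_apply \<delta> v\<rfloor> *\<^sub>R coweight \<Delta> \<delta>" r] kl by auto
  also have "(\<Sum>\<delta>\<in>\<Delta>. of_int \<lfloor>blinfun_apply \<delta> v\<rfloor> *\<^sub>R coweight \<Delta> \<delta>) = (\<Sum>\<delta>\<in>\<Delta>. blinfun_apply \<delta> v *\<^sub>R coweight \<Delta> \<delta>)"
    by (rule sum.cong) (simp_all add: floor_root basis_root v)
  finally show "point_of (\<lambda>\<delta>. root_value \<Phi> \<delta> (v \<otimes>\<^sub>p r)) = v \<otimes>\<^sub>p r" by (simp add: dual_expand)
qed

lemma apartment_eqI:
  assumes "x \<in> apartment \<Phi>" "y \<in> apartment \<Phi>" "\<And>\<delta>. \<delta> \<in> \<Delta> \<Longrightarrow> root_value \<Phi> \<delta> x = root_value \<Phi> \<delta> y"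
  shows "x = y"
proof -
  have "point_of (\<lambda>\<delta>. root_value \<Phi> \<delta> x) = point_of (\<lambda>\<delta>. root_value \<Phi> \<delta> y)"
    unfolding point_of_def
    by (rule VR.finprod_cong') (auto simp: assms(3) intro: coweight_lattice_coweight)
  then show ?thesis using point_of_root_values assms by metis
qed

lemma root_value_basis_sum:
  assumes "\<beta> \<in> \<Phi>" "x \<in> apartment \<Phi>"
  shows "root_value \<Phi> \<beta> x = (\<Sum>\<delta>\<in>\<Delta>. int_mult \<lfloor>blinfun_apply \<beta> (coweight \<Delta> \<delta>)\<rfloor> (root_value \<Phi> \<delta> x))"
proof (rule root_value_sum[OF assms(1) _ _ assms(2)])
  have "\<beta> = (\<Sum>\<delta>\<in>\<Delta>. blinfun_apply \<beta> (coweight \<Delta> \<delta>) *\<^sub>R \<delta>)" by (simp add: coweight_expand)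
  also have "\<dots> = (\<Sum>\<delta>\<in>\<Delta>. real_of_int \<lfloor>blinfun_apply \<beta> (coweight \<Delta> \<delta>)\<rfloor> *\<^sub>R \<delta>)"
    using coweight_int[OF assms(1)] by (intro sum.cong) auto
  finally show "\<beta> = (\<Sum>\<delta>\<in>\<Delta>. real_of_int \<lfloor>blinfun_apply \<beta> (coweight \<Delta> \<delta>)\<rfloor> *\<^sub>R \<delta>)" .
qed (rule basis_root)

lemma root_value_point_of:
  fixes c :: "'v dual \<Rightarrow> 'r::linordered_ab_group_add"
  assumes d: "\<delta> \<in> \<Delta>"
  shows "root_value \<Phi> \<delta> (point_of c) = c \<delta>"
proof -
  have "root_value \<Phi> \<delta> (finprod (VR \<Phi>) (\<lambda>\<delta>. coweight \<Delta> \<delta> \<otimes>\<^sub>p c \<delta>) S) = (if \<delta> \<in> S then c \<delta> else 0)"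
    if "finite S" "S \<subseteq> \<Delta>" for S
    using that
  proof (induction S rule: finite_induct)
    case empty
    then show ?case by (simp add: root_value_one basis_root[OF d])
  next
    case (insert a S)
    have a: "a \<in> \<Delta>" using insert by blast
    have "\<lfloor>blinfun_apply \<delta> (coweight \<Delta> a)\<rfloor> = (if \<delta> = a then 1 else 0)" using coweight_basis[OF d, of a] by auto
    moreover have "finprod (VR \<Phi>) (\<lambda>\<delta>. coweight \<Delta> \<delta> \<otimes>\<^sub>p c \<delta>) S \<in> apartment \<Phi>"
      using insert by (intro VR.finprod_closed) (auto intro: coweight_lattice_coweight)
    moreover have "finprod (VR \<Phi>) (\<lambda>\<delta>. coweight \<Delta> \<delta> \<otimes>\<^sub>p c \<delta>) (insert a S) =
      (coweight \<Delta> a \<otimes>\<^sub>p c a) \<otimes>\<^bsub>VR \<Phi>\<^esub> finprod (VR \<Phi>) (\<lambda>\<delta>. coweight \<Delta> \<delta> \<otimes>\<^sub>p c \<delta>) S"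
      using insert by (intro VR.finprod_insert) (auto intro: coweight_lattice_coweight)
    ultimately show ?case
      using insert a by (simp add: root_value_mult basis_root[OF d] root_value_tensor coweight_lattice_coweight)
  qed
  then show ?thesis unfolding point_of_def using finite_basis d by simp
qed

end

subsection \<open>Affine transformations\<close>

context root_sys
begin

abbreviation "GLat \<equiv> AutoGroup (coweight_lattice \<Phi>)"

sublocale GL: group "AutoGroup (coweight_lattice \<Phi>)"
  by (rule L.AutoGroup)

lemma GL_carrier: "g \<in> carrier GLat \<longleftrightarrow>
    g \<in> extensional lattice \<and> bij_betw g lattice lattice \<and> (\<forall>v\<in>lattice. \<forall>v'\<in>lattice. g (v + v') = g v + g v')"
proof -
  have "carrier GLat = {g. g \<in> hom (coweight_lattice \<Phi>) (coweight_lattice \<Phi>) \<and> g \<in> Bij lattice}"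
    by (auto simp: AutoGroup_def auto_def)
  then show ?thesis
    by (auto simp: hom_def Bij_def bij_betw_def)
qed

lemma GL_closed: "g \<in> carrier GLat \<Longrightarrow> v \<in> lattice \<Longrightarrow> g v \<in> lattice"
  unfolding GL_carrier by (auto simp: bij_betw_def)

lemma GL_mult: "g \<in> carrier GLat \<Longrightarrow> g' \<in> carrier GLat \<Longrightarrow> v \<in> lattice \<Longrightarrow> (g \<otimes>\<^bsub>GLat\<^esub> g') v = g (g' v)"
  unfolding AutoGroup_def BijGroup_def auto_def by (simp add: compose_def)

lemma GL_one: "v \<in> lattice \<Longrightarrow> \<one>\<^bsub>GLat\<^esub> v = v"
  by (simp add: AutoGroup_def BijGroup_def)

lemma GL_one_closed: "\<one>\<^bsub>GLat\<^esub> \<in> carrier GLat"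
  by (rule GL.one_closed)

lemma GL_eqI:
  assumes "g \<in> carrier GLat" "g' \<in> carrier GLat" "\<And>v. v \<in> lattice \<Longrightarrow> g v = g' v"
  shows "g = g'"
  using assms unfolding GL_carrier by (blast intro: extensionalityI)

lemma VR_map:
  assumes "g \<in> carrier GLat"
  shows VR_map_hom: "VR_map \<Phi> g \<in> hom (VR \<Phi>) (VR \<Phi> :: ('v, 'r::linordered_ab_group_add) point monoid)"
    and VR_map_tensor: "v \<in> lattice \<Longrightarrow> VR_map \<Phi> g (v \<otimes>\<^sub>p (r::'r)) = g v \<otimes>\<^sub>p r"
proof -
  have add: "g (v + v') = g v + g v'" if "v \<in> lattice" "v' \<in> lattice" for v v'
    using assms that unfolding GL_carrier by blast
  have H: "comm_group (tensor_group (coweight_lattice \<Phi>) (additive_group (UNIV :: 'r set)))"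
    using VR.comm_group_axioms unfolding VR_def .
  note t = pure_tensor_add[OF L.is_group additive.is_group] pure_tensor_closed
  show "VR_map \<Phi> g \<in> hom (VR \<Phi>) (VR \<Phi> :: ('v, 'r) point monoid)"
    unfolding VR_map_def VR_def
    by (rule tensor_lift(1)[OF L.is_group additive.is_group H])
       (use GL_closed[OF assms] t in \<open>simp_all add: add del: additive_group_simps(2) add: t[simplified]\<close>)
  show "v \<in> lattice \<Longrightarrow> VR_map \<Phi> g (v \<otimes>\<^sub>p (r::'r)) = g v \<otimes>\<^sub>p r"
    unfolding VR_map_def VR_def
    by (rule tensor_lift(2)[OF L.is_group additive.is_group H])
       (use GL_closed[OF assms] t in \<open>simp_all add: add del: additive_group_simps(2) add: t[simplified]\<close>)
qed

lemma VR_map_closed [simp, intro]: "g \<in> carrier GLat \<Longrightarrow> x \<in> apartment \<Phi> \<Longrightarrow> VR_map \<Phi> g x \<in> apartment \<Phi>"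
  using hom_in_carrier[OF VR_map_hom] by blast

lemma VR_map_mult: "g \<in> carrier GLat \<Longrightarrow> x \<in> apartment \<Phi> \<Longrightarrow> y \<in> apartment \<Phi> \<Longrightarrow>
    VR_map \<Phi> g (x \<otimes>\<^bsub>VR \<Phi>\<^esub> y) = VR_map \<Phi> g x \<otimes>\<^bsub>VR \<Phi>\<^esub> VR_map \<Phi> g y"
  using hom_mult[OF VR_map_hom] by blast

lemma VR_map_one_point: "g \<in> carrier GLat \<Longrightarrow> VR_map \<Phi> g \<one>\<^bsub>VR \<Phi>\<^esub> = \<one>\<^bsub>VR \<Phi>\<^esub>"
  using hom_one[OF VR_map_hom VR.is_group VR.is_group] by blast

lemma VR_map_comp:
  fixes x :: "('v, 'r::linordered_ab_group_add) point"
  assumes "g \<in> carrier GLat" "g' \<in> carrier GLat" "x \<in> apartment \<Phi>"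
  shows "VR_map \<Phi> (g \<otimes>\<^bsub>GLat\<^esub> g') x = VR_map \<Phi> g (VR_map \<Phi> g' x)"
proof (rule VR_hom_eqI[OF VR.comm_group_axioms VR_map_hom _ _ assms(3)])
  show "(\<lambda>x :: ('v, 'r) point. VR_map \<Phi> g (VR_map \<Phi> g' x)) \<in> hom (VR \<Phi>) (VR \<Phi>)"
    by (rule homI) (auto simp: assms VR_map_mult)
qed (use assms in \<open>auto simp: VR_map_tensor GL_mult GL_closed\<close>)

lemma VR_map_id:
  fixes x :: "('v, 'r::linordered_ab_group_add) point"
  assumes "x \<in> apartment \<Phi>"
  shows "VR_map \<Phi> \<one>\<^bsub>GLat\<^esub> x = x"
proof (rule VR_hom_eqI[OF VR.comm_group_axioms VR_map_hom[OF GL_one_closed] _ _ assms])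
  show "(\<lambda>x :: ('v, 'r) point. x) \<in> hom (VR \<Phi>) (VR \<Phi>)" by (auto simp: hom_def)
qed (auto simp: VR_map_tensor GL_one)

lemma aff_simps:
  "carrier (aff_group \<Phi>) = apartment \<Phi> \<times> carrier GLat"
  "(t, g) \<otimes>\<^bsub>aff_group \<Phi>\<^esub> (t', g') = (t \<otimes>\<^bsub>VR \<Phi>\<^esub> VR_map \<Phi> g t', g \<otimes>\<^bsub>GLat\<^esub> g')"
  "\<one>\<^bsub>aff_group \<Phi>\<^esub> = (\<one>\<^bsub>VR \<Phi>\<^esub>, \<one>\<^bsub>GLat\<^esub>)"
  by (simp_all add: aff_group_def)

sublocale aff: group "aff_group \<Phi> :: ('v, 'r::linordered_ab_group_add) aff monoid"
proof (rule groupI)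
  fix a :: "('v, 'r) aff" assume a: "a \<in> carrier (aff_group \<Phi>)"
  obtain t g where e: "a = (t, g)" by (cases a)
  have tg: "t \<in> apartment \<Phi>" "g \<in> carrier GLat" "inv\<^bsub>GLat\<^esub> g \<in> carrier GLat"
    using a e by (auto simp: aff_simps)
  show "\<one>\<^bsub>aff_group \<Phi>\<^esub> \<otimes>\<^bsub>aff_group \<Phi>\<^esub> a = a"
    using tg by (simp add: aff_simps e VR_map_id)
  have "(inv\<^bsub>VR \<Phi>\<^esub> (VR_map \<Phi> (inv\<^bsub>GLat\<^esub> g) t), inv\<^bsub>GLat\<^esub> g) \<otimes>\<^bsub>aff_group \<Phi>\<^esub> a = \<one>\<^bsub>aff_group \<Phi>\<^esub>"
    using tg by (simp add: aff_simps e)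
  moreover have "(inv\<^bsub>VR \<Phi>\<^esub> (VR_map \<Phi> (inv\<^bsub>GLat\<^esub> g) t), inv\<^bsub>GLat\<^esub> g) \<in> carrier (aff_group \<Phi>)"
    using tg by (simp add: aff_simps)
  ultimately show "\<exists>b\<in>carrier (aff_group \<Phi>). b \<otimes>\<^bsub>aff_group \<Phi>\<^esub> a = \<one>\<^bsub>aff_group \<Phi>\<^esub>" by blast
qed (auto simp: aff_simps VR_map_comp VR_map_mult VR.m_assoc GL.m_assoc)

lemma aff_apply_one: "x \<in> apartment \<Phi> \<Longrightarrow> aff_apply \<Phi> \<one>\<^bsub>aff_group \<Phi>\<^esub> x = x"
  by (simp add: aff_apply_def aff_simps VR_map_id)

lemma aff_apply_origin: "a \<in> carrier (aff_group \<Phi>) \<Longrightarrow> aff_apply \<Phi> a \<one>\<^bsub>VR \<Phi>\<^esub> = fst a"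
  by (cases a) (simp add: aff_apply_def aff_simps VR_map_one_point)

lemma root_value_VR_map:
  fixes x :: "('v, 'r::linordered_ab_group_add) point"
  assumes g: "g \<in> carrier GLat" and "\<beta> \<in> \<Phi>" "\<gamma> \<in> \<Phi>"
    and eq: "\<And>v. v \<in> lattice \<Longrightarrow> blinfun_apply \<gamma> (g v) = blinfun_apply \<beta> v" and x: "x \<in> apartment \<Phi>"
  shows "root_value \<Phi> \<gamma> (VR_map \<Phi> g x) = root_value \<Phi> \<beta> x"
proof (rule VR_hom_eqI[OF additive.comm_group_axioms _ root_value_hom[OF assms(2)] _ x])
  show "(\<lambda>x :: ('v, 'r) point. root_value \<Phi> \<gamma> (VR_map \<Phi> g x)) \<in> hom (VR \<Phi>) (additive_group UNIV)"
    by (rule homI) (auto simp: assms VR_map_mult root_value_mult)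
qed (use assms in \<open>auto simp: VR_map_tensor root_value_tensor GL_closed\<close>)

end

section \<open>Valued root group data\<close>

text \<open>The Q-module structure on R is recorded as divisibility by positive integers.\<close>

locale valued_rgd = rgd \<Phi> cor \<Delta> G T U M
  for \<Phi> :: "'v::euclidean_space dual set" and cor \<Delta> and G :: "('g, 'b) monoid_scheme" (structure) and T U M +
  fixes \<phi> :: "'v dual \<Rightarrow> 'g \<Rightarrow> 'r::linordered_ab_group_add extended" and \<nu> :: "'g \<Rightarrow> ('v, 'r) aff"
  assumes valuation: "rgd_valuation G \<Phi> U M \<phi>"
    and compatible: "compatible_action G \<Phi> cor T U M \<phi> \<nu>"
    and R_nontrivial: "\<exists>r::'r. r \<noteq> 0"
    and R_divisible: "0 < n \<Longrightarrow> \<exists>s::'r. int_mult (int n) s = r"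
begin

lemmas val = valuation[unfolded rgd_valuation_def]

lemma val_not_Minf: "\<alpha> \<in> \<Phi> \<Longrightarrow> u \<in> U \<alpha> \<Longrightarrow> \<phi> \<alpha> u \<noteq> Minf"
  using val[THEN conjunct1] by blast

lemma val_subgroup: "\<alpha> \<in> \<Phi> \<Longrightarrow> l \<noteq> Minf \<Longrightarrow> subgroup (val_subgroup U \<phi> \<alpha> l) G"
  and val_subgroup_Pinf: "\<alpha> \<in> \<Phi> \<Longrightarrow> val_subgroup U \<phi> \<alpha> Pinf = {\<one>}"
  using val[THEN conjunct2, THEN conjunct2, THEN conjunct1] by blast+

lemmas val_commutator = val[THEN conjunct2, THEN conjunct2, THEN conjunct2, THEN conjunct2, THEN conjunct1, rule_format]

lemma val_double: "\<alpha> \<in> \<Phi> \<Longrightarrow> 2 *\<^sub>R \<alpha> \<in> \<Phi> \<Longrightarrow> u \<in> U (2 *\<^sub>R \<alpha>) \<Longrightarrow> \<phi> (2 *\<^sub>R \<alpha>) u = \<phi> \<alpha> u + \<phi> \<alpha> u"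
  using val[THEN conjunct2, THEN conjunct2, THEN conjunct2, THEN conjunct2, THEN conjunct2, THEN conjunct1]
  unfolding multipliable_def by blast

lemmas val_V5 = val[THEN conjunct2, THEN conjunct2, THEN conjunct2, THEN conjunct2, THEN conjunct2, THEN conjunct2, rule_format]

lemma val_one: "\<alpha> \<in> \<Phi> \<Longrightarrow> \<phi> \<alpha> \<one> = Pinf"
  using val_subgroup_Pinf[of \<alpha>] unfolding val_subgroup_def by auto

lemma val_eq_Pinf: "\<alpha> \<in> \<Phi> \<Longrightarrow> u \<in> U \<alpha> \<Longrightarrow> \<phi> \<alpha> u = Pinf \<Longrightarrow> u = \<one>"
  using val_subgroup_Pinf[of \<alpha>] unfolding val_subgroup_def by auto

lemma val_finite:
  assumes "\<alpha> \<in> \<Phi>" "u \<in> U \<alpha>" "u \<noteq> \<one>"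
  obtains r where "\<phi> \<alpha> u = Fin r"
  using assms val_not_Minf val_eq_Pinf by (cases "\<phi> \<alpha> u") blast+

lemma val_inv_le: "\<alpha> \<in> \<Phi> \<Longrightarrow> u \<in> U \<alpha> \<Longrightarrow> \<phi> \<alpha> u \<le> \<phi> \<alpha> (inv u)"
  using subgroup.m_inv_closed[OF val_subgroup[OF _ val_not_Minf, of \<alpha> \<alpha> u], of u]
  by (simp add: val_subgroup_def)

lemma val_inv: "\<alpha> \<in> \<Phi> \<Longrightarrow> u \<in> U \<alpha> \<Longrightarrow> \<phi> \<alpha> (inv u) = \<phi> \<alpha> u"
  using val_inv_le[of \<alpha> u] val_inv_le[of \<alpha> "inv u"] subgroup.m_inv_closed[OF U_subgroup[of \<alpha>], of u]
    U_mem_carrier[of u \<alpha>] by simp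

lemma val_mult_ge: "\<alpha> \<in> \<Phi> \<Longrightarrow> u \<in> U \<alpha> \<Longrightarrow> v \<in> U \<alpha> \<Longrightarrow> min (\<phi> \<alpha> u) (\<phi> \<alpha> v) \<le> \<phi> \<alpha> (u \<otimes> v)"
proof -
  assume h: "\<alpha> \<in> \<Phi>" "u \<in> U \<alpha>" "v \<in> U \<alpha>"
  have "min (\<phi> \<alpha> u) (\<phi> \<alpha> v) \<noteq> Minf" using val_not_Minf h by (simp add: min_def)
  from subgroup.m_closed[OF val_subgroup[OF h(1) this], of u v] show ?thesis
    using h by (simp add: val_subgroup_def)
qed

text \<open>The ultrametric principle: v = u^-1 (u v), so a larger value of u v would force a larger
  value of v.\<close>

lemma val_mult_eq:
  assumes h: "\<alpha> \<in> \<Phi>" "u \<in> U \<alpha>" "v \<in> U \<alpha>" and l: "\<phi> \<alpha> v < \<phi> \<alpha> u"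
  shows "\<phi> \<alpha> (u \<otimes> v) = \<phi> \<alpha> v"
proof (rule antisym)
  have uv: "u \<otimes> v \<in> U \<alpha>" "inv u \<in> U \<alpha>"
    using h U_subgroup[OF h(1)] subgroup.m_closed subgroup.m_inv_closed by metis+
  have "min (\<phi> \<alpha> (inv u)) (\<phi> \<alpha> (u \<otimes> v)) \<le> \<phi> \<alpha> (inv u \<otimes> (u \<otimes> v))"
    by (rule val_mult_ge[OF h(1) uv(2,1)])
  also have "inv u \<otimes> (u \<otimes> v) = v" using h U_mem_carrier by (simp add: cancel_inv_left)
  finally show "\<phi> \<alpha> (u \<otimes> v) \<le> \<phi> \<alpha> v" using l by (auto simp: val_inv h min_def split: if_splits)
  show "\<phi> \<alpha> v \<le> \<phi> \<alpha> (u \<otimes> v)" using val_mult_ge[OF h] l by simp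
qed

text \<open>(V5) speaks of the left factor only. The right one is reached by inverting: y' u^-1 y =
  m^-1 is again in \<open>M \<alpha>\<close>.\<close>

lemma val_decomp:
  assumes a: "\<alpha> \<in> \<Phi>" and d: "y \<in> U (- \<alpha>)" "m \<in> M \<alpha>" "y' \<in> U (- \<alpha>)" "u \<in> U \<alpha>" "u = y \<otimes> m \<otimes> y'"
  shows "\<phi> (- \<alpha>) y = - \<phi> \<alpha> u" "\<phi> (- \<alpha>) y' = - \<phi> \<alpha> u"
proof -
  note na = uminus_root[OF a]
  note c = U_mem_carrier[OF d(1) na] U_mem_carrier[OF d(3) na] M_mem_carrier[OF d(2) a] U_mem_carrier[OF d(4) a]
  have i: "inv y \<in> U (- \<alpha>)" "inv y' \<in> U (- \<alpha>)" "inv u \<in> U \<alpha>"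
    using d subgroup.m_inv_closed U_subgroup[OF na] U_subgroup[OF a] by metis+
  have "inv y \<otimes> u \<otimes> inv y' = m" using c by (simp add: d(5) group_word)
  then have "inv y \<otimes> u \<otimes> inv y' \<in> M \<alpha>" using d(2) by simp
  from val_V5[OF a d(4) i(1,2) this] show "\<phi> (- \<alpha>) y = - \<phi> \<alpha> u" using val_inv[OF na d(1)] by simp
  have "y' \<otimes> inv u \<otimes> y = inv m" unfolding d(5) using c by (simp add: group_word)
  then have "y' \<otimes> inv u \<otimes> y \<in> M \<alpha>" using inv_M[OF a d(2)] by simp
  from val_V5[OF a i(3) d(3,1) this] show "\<phi> (- \<alpha>) y' = - \<phi> \<alpha> u" using val_inv[OF a d(4)] by simp
qed

subsection \<open>The action on the apartment\<close>

lemmas compat = compatible[unfolded compatible_action_def]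

lemma NG_simps: "carrier (rgd_N_group G \<Phi> M) = N" "x \<otimes>\<^bsub>rgd_N_group G \<Phi> M\<^esub> y = x \<otimes> y"
  "\<one>\<^bsub>rgd_N_group G \<Phi> M\<^esub> = \<one>"
  by (simp_all add: rgd_N_group_def)

lemma \<nu>_closed: "n \<in> N \<Longrightarrow> \<nu> n \<in> carrier (aff_group \<Phi>)"
  using hom_in_carrier[OF compat[THEN conjunct1]] by (simp add: NG_simps)

lemma \<nu>_mult: "n \<in> N \<Longrightarrow> n' \<in> N \<Longrightarrow> \<nu> (n \<otimes> n') = \<nu> n \<otimes>\<^bsub>aff_group \<Phi>\<^esub> \<nu> n'"
  using hom_mult[OF compat[THEN conjunct1]] by (simp add: NG_simps)

lemma \<nu>_fst: "n \<in> N \<Longrightarrow> fst (\<nu> n) \<in> apartment \<Phi>" and \<nu>_snd: "n \<in> N \<Longrightarrow> snd (\<nu> n) \<in> carrier GLat"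
  using \<nu>_closed by (auto simp: aff_simps mem_Times_iff)

lemma \<nu>_one: "\<nu> \<one> = \<one>\<^bsub>aff_group \<Phi>\<^esub>"
  using \<nu>_mult[of \<one> \<one>] \<nu>_closed[of \<one>] subgroup.one_closed[OF N_subgroup] by simp

lemma \<nu>_linear:
  assumes "n \<in> N" "v \<in> lattice"
  shows "blinfun_apply (wN n \<beta>) (snd (\<nu> n) v) = blinfun_apply \<beta> v"
  using compat[THEN conjunct2, THEN conjunct1] assms weyl_epi_eq by simp

lemma root_value_\<nu>:
  assumes "n \<in> N" "\<beta> \<in> \<Phi>" "x \<in> apartment \<Phi>"
  shows "root_value \<Phi> (wN n \<beta>) (VR_map \<Phi> (snd (\<nu> n)) x) = root_value \<Phi> \<beta> x"
  by (rule root_value_VR_map[OF \<nu>_snd[OF assms(1)] assms(2) wN_root[OF assms(1,2)] \<nu>_linear[OF assms(1)] assms(3)])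

lemma \<nu>_M_square: "\<alpha> \<in> \<Phi> \<Longrightarrow> m \<in> M \<alpha> \<Longrightarrow> \<nu> m \<otimes>\<^bsub>aff_group \<Phi>\<^esub> \<nu> m = \<one>\<^bsub>aff_group \<Phi>\<^esub>"
proof -
  assume h: "\<alpha> \<in> \<Phi>" "m \<in> M \<alpha>"
  have c: "\<nu> m \<in> carrier (aff_group \<Phi>)" using \<nu>_closed M_in_N h by blast
  have "aff.ord (\<nu> m) = 2"
    using compat[THEN conjunct2, THEN conjunct2, THEN conjunct2] h by blast
  then have "\<nu> m [^]\<^bsub>aff_group \<Phi>\<^esub> (2::nat) = \<one>\<^bsub>aff_group \<Phi>\<^esub>" using aff.pow_ord_eq_1[OF c] by simp
  then show ?thesis using c by (simp add: numeral_2_eq_2)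
qed

lemma \<nu>_M_translation:
  assumes a: "\<alpha> \<in> \<Phi>" and d: "y \<in> U (- \<alpha>)" "m \<in> M \<alpha>" "y' \<in> U (- \<alpha>)" "u \<in> U \<alpha>" "u = y \<otimes> m \<otimes> y'" "u \<noteq> \<one>"
    and l: "\<phi> \<alpha> u = Fin l"
  shows "root_value \<Phi> \<alpha> (fst (\<nu> m)) = - (l + l)"
proof -
  have "\<phi> \<alpha> u + \<phi> \<alpha> u + Fin (root_value \<Phi> \<alpha> (aff_apply \<Phi> (\<nu> (rgd_m G U M \<alpha> u)) \<one>\<^bsub>VR \<Phi>\<^esub>)) = 0"
    using compat[THEN conjunct2, THEN conjunct2, THEN conjunct1] a d(4,6) by blast
  then have "l + l + root_value \<Phi> \<alpha> (fst (\<nu> m)) = 0"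
    using rgd_m_eq[OF a d(1-3,5)] aff_apply_origin[OF \<nu>_closed[OF M_in_N[OF a d(2)]]] l
    by (simp add: zero_extended_def)
  then show ?thesis by (rule minus_unique[symmetric])
qed

lemma double_cancel: "(a::'r) + a = b + b \<Longrightarrow> a = b"
  by (metis add_less_le_mono less_le_not_le linorder_less_linear)

lemma roots_separate: "(\<And>\<beta>. \<beta> \<in> \<Phi> \<Longrightarrow> blinfun_apply \<beta> v = blinfun_apply \<beta> v') \<Longrightarrow> v = v'"
  by (subst dual_expand[of v, symmetric], subst dual_expand[of v', symmetric]) (simp add: basis_root)

text \<open>The linear part of \<nu>(m) is the reflection in \<alpha>. By (CA3) its translation part
  t satisfies t + r_\<alpha>(t) = 0, that is 2 \<beta>(t) = \<beta>(\<alpha>^vee) \<alpha>(t) for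
  every root \<beta>. As R has no 2-torsion, \<alpha>(t) determines t.\<close>

lemma \<nu>_M_eqI:
  assumes a: "\<alpha> \<in> \<Phi>" and m: "m \<in> M \<alpha>" "m' \<in> M \<alpha>"
    and t: "root_value \<Phi> \<alpha> (fst (\<nu> m)) = root_value \<Phi> \<alpha> (fst (\<nu> m'))"
  shows "\<nu> m = \<nu> m'"
proof (rule prod_eqI)
  note n = m[THEN M_in_N[OF a]]
  have main: "root_value \<Phi> \<beta> (fst (\<nu> m)) + root_value \<Phi> \<beta> (fst (\<nu> m)) =
      int_mult \<lfloor>blinfun_apply \<beta> (cor \<alpha>)\<rfloor> (root_value \<Phi> \<alpha> (fst (\<nu> m)))"
    if b: "\<beta> \<in> \<Phi>" and m: "m \<in> M \<alpha>" for m \<beta>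
  proof -
    have nm: "m \<in> N" by (rule M_in_N[OF a m])
    note f = \<nu>_fst[OF nm] note s = \<nu>_snd[OF nm]
    have sq: "fst (\<nu> m) \<otimes>\<^bsub>VR \<Phi>\<^esub> VR_map \<Phi> (snd (\<nu> m)) (fst (\<nu> m)) = \<one>\<^bsub>VR \<Phi>\<^esub>"
      using \<nu>_M_square[OF a m] by (cases "\<nu> m") (simp add: aff_simps)
    have "root_value \<Phi> \<beta> (fst (\<nu> m)) + root_value \<Phi> \<beta> (VR_map \<Phi> (snd (\<nu> m)) (fst (\<nu> m))) = 0"
      using root_value_mult[OF b f VR_map_closed[OF s f]] unfolding sq root_value_one[OF b] by simp
    moreover have "root_value \<Phi> \<beta> (VR_map \<Phi> (snd (\<nu> m)) (fst (\<nu> m))) = root_value \<Phi> (refl \<alpha> \<beta>) (fst (\<nu> m))"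
      using root_value_\<nu>[OF nm refl_root[OF a b] f] wN_M[OF a m] by (simp add: refl_refl a)
    moreover have "root_value \<Phi> (refl \<alpha> \<beta>) (fst (\<nu> m)) = int_mult 1 (root_value \<Phi> \<beta> (fst (\<nu> m)))
        + int_mult (- \<lfloor>blinfun_apply \<beta> (cor \<alpha>)\<rfloor>) (root_value \<Phi> \<alpha> (fst (\<nu> m)))"
    proof (rule root_value_comb[OF refl_root[OF a b] b a _ f])
      have "of_int \<lfloor>blinfun_apply \<beta> (cor \<alpha>)\<rfloor> = blinfun_apply \<beta> (cor \<alpha>)" using coroot_int[OF a b] by simp
      then show "refl \<alpha> \<beta> = real_of_int 1 *\<^sub>R \<beta> + real_of_int (- \<lfloor>blinfun_apply \<beta> (cor \<alpha>)\<rfloor>) *\<^sub>R \<alpha>"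
        by (simp only: of_int_minus reflection_def) simp
    qed
    ultimately show ?thesis by (simp add: int_mult_minus_left algebra_simps)
  qed
  show "fst (\<nu> m) = fst (\<nu> m')"
    by (rule apartment_eqI[OF \<nu>_fst[OF n(1)] \<nu>_fst[OF n(2)]])
       (rule double_cancel, simp only: main[OF basis_root m(1)] main[OF basis_root m(2)] t)
  show "snd (\<nu> m) = snd (\<nu> m')"
  proof (rule GL_eqI[OF \<nu>_snd[OF n(1)] \<nu>_snd[OF n(2)]])
    fix v assume v: "v \<in> lattice"
    show "snd (\<nu> m) v = snd (\<nu> m') v"
    proof (rule roots_separate)
      fix \<beta> assume b: "\<beta> \<in> \<Phi>"
      show "blinfun_apply \<beta> (snd (\<nu> m) v) = blinfun_apply \<beta> (snd (\<nu> m') v)"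
        using \<nu>_linear[OF n(1) v, of "refl \<alpha> \<beta>"] \<nu>_linear[OF n(2) v, of "refl \<alpha> \<beta>"]
          wN_M[OF a m(1)] wN_M[OF a m(2)] by (simp add: refl_refl a)
    qed
  qed
qed

abbreviation "Tb \<equiv> rgd_Tb G \<Phi> M \<nu>"

lemma Tb_iff: "t \<in> Tb \<longleftrightarrow> t \<in> N \<and> \<nu> t = \<one>\<^bsub>aff_group \<Phi>\<^esub>"
  by (simp add: rgd_Tb_def kernel_def NG_simps)

lemma Tb_subset_T: "Tb \<subseteq> T"
proof
  fix t assume "t \<in> Tb"
  then have t: "t \<in> N" "\<nu> t = \<one>\<^bsub>aff_group \<Phi>\<^esub>" by (auto simp: Tb_iff)
  have "wN t \<beta> = \<beta>" for \<beta>
  proof (rule coweight_eqI)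
    fix \<delta> assume "\<delta> \<in> \<Delta>"
    then show "blinfun_apply (wN t \<beta>) (coweight \<Delta> \<delta>) = blinfun_apply \<beta> (coweight \<Delta> \<delta>)"
      using \<nu>_linear[OF t(1) coweight_lattice_coweight[of \<delta>], of \<beta>] t(2)
      by (simp add: aff_simps GL_one coweight_lattice_coweight)
  qed
  then show "t \<in> T" using wN_eq_id_iff[OF t(1)] by auto
qed

lemma Tb_subgroup: "subgroup Tb G"
proof (rule subgroupI)
  show "Tb \<subseteq> carrier G" using Tb_subset_T T_mem_carrier by blast
  have "\<one> \<in> Tb" using \<nu>_one subgroup.one_closed[OF N_subgroup] by (simp add: Tb_iff)
  then show "Tb \<noteq> {}" by blast
  fix s t assume st: "s \<in> Tb"
  have i: "inv s \<in> N" using st subgroup.m_inv_closed[OF N_subgroup] by (simp add: Tb_iff)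
  have sN: "s \<in> N" using st by (simp add: Tb_iff)
  have "\<nu> (inv s) \<otimes>\<^bsub>aff_group \<Phi>\<^esub> \<nu> s = \<one>\<^bsub>aff_group \<Phi>\<^esub>"
    using \<nu>_mult[OF i sN] unfolding l_inv[OF N_carrier[OF sN]] \<nu>_one by simp
  then show "inv s \<in> Tb" using st i \<nu>_closed[OF i] by (simp add: Tb_iff)
  assume "t \<in> Tb"
  then have tN: "t \<in> N" "\<nu> t = \<one>\<^bsub>aff_group \<Phi>\<^esub>" by (auto simp: Tb_iff)
  then show "s \<otimes> t \<in> Tb"
    using st subgroup.m_closed[OF N_subgroup sN tN(1)] \<nu>_mult[OF sN tN(1)] by (simp add: Tb_iff)
qed

lemma \<nu>_eq_iff: "n \<in> N \<Longrightarrow> n' \<in> N \<Longrightarrow> \<nu> n = \<nu> n' \<longleftrightarrow> inv n \<otimes> n' \<in> Tb"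
proof -
  assume n: "n \<in> N" "n' \<in> N"
  have i: "inv n \<in> N" using n subgroup.m_inv_closed[OF N_subgroup] by blast
  have "\<nu> (inv n) \<otimes>\<^bsub>aff_group \<Phi>\<^esub> \<nu> n = \<one>\<^bsub>aff_group \<Phi>\<^esub>"
    using \<nu>_mult[OF i n(1)] N_carrier[OF n(1)] \<nu>_one by simp
  then have inv: "\<nu> (inv n) = inv\<^bsub>aff_group \<Phi>\<^esub> \<nu> n"
    using \<nu>_closed i n by (metis aff.inv_equality)
  have "inv n \<otimes> n' \<in> Tb \<longleftrightarrow> inv\<^bsub>aff_group \<Phi>\<^esub> \<nu> n \<otimes>\<^bsub>aff_group \<Phi>\<^esub> \<nu> n' = \<one>\<^bsub>aff_group \<Phi>\<^esub>"
    using \<nu>_mult[OF i n(2)] subgroup.m_closed[OF N_subgroup i n(2)] by (simp add: Tb_iff inv)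
  also have "\<dots> \<longleftrightarrow> \<nu> n = \<nu> n'"
    using \<nu>_closed[OF n(1)] \<nu>_closed[OF n(2)]
    by (metis aff.inv_equality aff.inv_inv aff.l_inv aff.inv_closed)
  finally show ?thesis by simp
qed

text \<open>Conjugation by t turns m(u) into m(t u t^-1) and does not change its image under \<nu>,
  since \<nu>(t) = 1. By (CA2) this image determines the double of the value.\<close>

lemma Tb_val:
  assumes t: "t \<in> Tb" and a: "\<alpha> \<in> \<Phi>" and u: "u \<in> U \<alpha>"
  shows "\<phi> \<alpha> (cj t u) = \<phi> \<alpha> u"
proof (cases "u = \<one>")
  case True
  then show ?thesis using t Tb_subset_T T_mem_carrier by (auto simp: subset_iff)
next
  case False
  have tT: "t \<in> T" using t Tb_subset_T by blast
  note tc = T_mem_carrier[OF tT]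
  note na = uminus_root[OF a]
  obtain y m y' where d: "y \<in> U (- \<alpha>)" "m \<in> M \<alpha>" "y' \<in> U (- \<alpha>)" "u = y \<otimes> m \<otimes> y'"
    using U_decomp_uminus[OF a u False] by blast
  note c = U_mem_carrier[OF d(1) na] U_mem_carrier[OF d(3) na] M_mem_carrier[OF d(2) a] U_mem_carrier[OF u a]
  have tN: "t \<in> N" "\<nu> t = \<one>\<^bsub>aff_group \<Phi>\<^esub>" "inv t \<in> Tb"
    using t subgroup.m_inv_closed[OF Tb_subgroup t] by (auto simp: Tb_iff)
  have d': "cj t y \<in> U (- \<alpha>)" "cj t y' \<in> U (- \<alpha>)" "cj t u \<in> U \<alpha>" "cj t m \<in> M \<alpha>"
    using T_cj_U[OF tT na] T_cj_U[OF tT a] d u N_cj_M[OF tN(1) a d(2)] wN_T[OF tT] by auto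
  have e: "cj t u = cj t y \<otimes> cj t m \<otimes> cj t y'" unfolding d(4) using c tc by (simp add: cj_prod)
  have mN: "m \<in> N" by (rule M_in_N[OF a d(2)])
  have "\<nu> (cj t m) = \<nu> m"
    unfolding cj_def
    using tN mN \<nu>_mult[OF tN(1) mN] \<nu>_mult[of "t \<otimes> m" "inv t"] \<nu>_closed[OF mN] subgroup.m_closed[OF N_subgroup tN(1) mN]
    by (simp add: Tb_iff)
  moreover have n1: "cj t u \<noteq> \<one>" using cj_eq_one[OF tc c(4)] False by simp
  moreover obtain l where l: "\<phi> \<alpha> u = Fin l" using val_finite[OF a u False] .
  moreover obtain l' where l': "\<phi> \<alpha> (cj t u) = Fin l'" using val_finite[OF a d'(3) n1] .
  ultimately have "- (l' + l') = - (l + l)"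
    using \<nu>_M_translation[OF a d(1-3) u d(4) False l] \<nu>_M_translation[OF a d'(1,4,2,3) e n1 l'] by metis
  then have "l' = l" using double_cancel neg_equal_iff_equal by blast
  then show ?thesis using l l' by simp
qed

subsection \<open>Rank one\<close>

text \<open>Collecting factors leaves t u = v with t in T, u in \<open>U \<alpha>\<close> and v in
  \<open>U (- \<alpha>)\<close>, which (RGD6) makes trivial. For negative \<alpha> the factor t is
  first moved to the other side, since then v is in U+ and u in U-.\<close>

lemma opposite_unique:
  assumes a: "\<alpha> \<in> \<Phi>" and h: "y \<in> U (- \<alpha>)" "t \<in> T" "z \<in> U \<alpha>" "y' \<in> U (- \<alpha>)" "t' \<in> T" "z' \<in> U \<alpha>"
    and e: "y \<otimes> t \<otimes> z = y' \<otimes> t' \<otimes> z'"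
  shows "y = y'" "z = z'"
proof -
  note na = uminus_root[OF a]
  have key: "u = \<one> \<and> v = \<one>" if h: "t \<in> T" "u \<in> U \<alpha>" "v \<in> U (- \<alpha>)" "t \<otimes> u = v" for t u v
  proof (cases "\<alpha> \<in> pos")
    case True
    have "- \<alpha> \<in> uminus ` pos" using True by (rule imageI)
    then have "v \<in> gen U (uminus ` pos)" "u \<in> gen U pos" using U_in_gen[OF h(3)] U_in_gen[OF h(2) True] by blast+
    then show ?thesis using T_eq_Upos_Uneg[OF h(1)] h(4) by blast
  next
    case False
    then have p: "- \<alpha> \<in> pos" using a pos_or_neg by blast
    then have "\<alpha> \<in> uminus ` pos" by (intro image_eqI[of _ _ "- \<alpha>"]) auto
    then have "u \<in> gen U (uminus ` pos)" "v \<in> gen U pos" using U_in_gen[OF h(2)] U_in_gen[OF h(3) p] by blast+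
    moreover have "inv t \<otimes> v = u" using h(4) T_mem_carrier[OF h(1)] U_mem_carrier[OF h(2) a] by (auto simp: cancel_inv_left)
    ultimately show ?thesis using T_eq_Upos_Uneg[OF subgroup.m_inv_closed[OF T_subgroup h(1)]] by blast
  qed
  note c = h(1)[THEN U_mem_carrier[OF _ na]] h(4)[THEN U_mem_carrier[OF _ na]] T_mem_carrier[OF h(2)] T_mem_carrier[OF h(5)]
    U_mem_carrier[OF h(3) a] U_mem_carrier[OF h(6) a]
  define u where "u = cj t (z' \<otimes> inv z)"
  have zz: "z' \<otimes> inv z \<in> U \<alpha>" using h U_subgroup[OF a] subgroup.m_closed subgroup.m_inv_closed by metis
  have uU: "u \<in> U \<alpha>" unfolding u_def using T_cj_U[OF h(2) a] zz by blast
  have "inv y' \<otimes> y = inv y' \<otimes> (y \<otimes> t \<otimes> z) \<otimes> inv z \<otimes> inv t" using c by (simp add: group_word)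
  also have "\<dots> = (t' \<otimes> inv t) \<otimes> u" unfolding e u_def using c by (simp add: group_word cj_def)
  finally have e1: "(t' \<otimes> inv t) \<otimes> u = inv y' \<otimes> y" by simp
  have "u = \<one> \<and> inv y' \<otimes> y = \<one>"
  proof (rule key[OF _ uU _ e1])
    show "t' \<otimes> inv t \<in> T" using h T_subgroup subgroup.m_closed subgroup.m_inv_closed by metis
    show "inv y' \<otimes> y \<in> U (- \<alpha>)" using h U_subgroup[OF na] subgroup.m_closed subgroup.m_inv_closed by metis
  qed
  then have u1: "u = \<one>" and y1: "inv y' \<otimes> y = \<one>" by auto
  have "y' \<otimes> (inv y' \<otimes> y) = y' \<otimes> \<one>" using y1 by simp
  then show "y = y'" using c by (simp add: cancel_left_inv)
  have "z' \<otimes> inv z = \<one>" using u1 cj_eq_one[of t "z' \<otimes> inv z"] c unfolding u_def by simp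
  then have "z' \<otimes> inv z \<otimes> z = \<one> \<otimes> z" by simp
  then show "z = z'" using c by (simp add: m_assoc)
qed

text \<open>The hypothesis says that the values of u and u' have a positive sum. Write u' = v m v';
  then u has a larger value than v, so u v has the value of v. Decomposing u v = y m1 y' gives u u'
  = y (m1 m) ((m^-1 y' m) v'), and the point is that m1 m lies in T_b.\<close>

lemma rank_one_half:
  assumes a: "\<alpha> \<in> \<Phi>" and u: "u \<in> U \<alpha>" and u': "u' \<in> U (- \<alpha>)" and l: "- \<phi> (- \<alpha>) u' < \<phi> \<alpha> u"
  shows "\<exists>y\<in>U (- \<alpha>). \<exists>t\<in>Tb. \<exists>z\<in>U \<alpha>. u \<otimes> u' = y \<otimes> t \<otimes> z \<and> \<phi> (- \<alpha>) y = \<phi> (- \<alpha>) u'"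
proof (cases "u' = \<one>")
  case True
  then have "u \<otimes> u' = u' \<otimes> \<one> \<otimes> u" using U_mem_carrier[OF u a] by simp
  then show ?thesis using u u' subgroup.one_closed[OF Tb_subgroup] by blast
next
  case False
  note na = uminus_root[OF a]
  obtain v m v' where d: "v \<in> U \<alpha>" "m \<in> M \<alpha>" "v' \<in> U \<alpha>" "u' = v \<otimes> m \<otimes> v'"
    using U_decomp[OF a u' False] by blast
  have dn: "v \<in> U (- (- \<alpha>))" "m \<in> M (- \<alpha>)" "v' \<in> U (- (- \<alpha>))" using d M_uminus[OF a] by auto
  obtain l' where l': "\<phi> (- \<alpha>) u' = Fin l'" using val_finite[OF na u' False] .
  have v: "\<phi> \<alpha> v = Fin (- l')" using val_decomp(1)[OF na dn u' d(4)] l' by simp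
  have uv: "u \<otimes> v \<in> U \<alpha>" using u d(1) U_subgroup[OF a] subgroup.m_closed by metis
  have vuv: "\<phi> \<alpha> (u \<otimes> v) = Fin (- l')" using val_mult_eq[OF a u d(1)] l v l' by simp
  then have uv1: "u \<otimes> v \<noteq> \<one>" using val_one[OF a] by auto
  obtain y m1 y' where e: "y \<in> U (- \<alpha>)" "m1 \<in> M \<alpha>" "y' \<in> U (- \<alpha>)" "u \<otimes> v = y \<otimes> m1 \<otimes> y'"
    using U_decomp_uminus[OF a uv uv1] by blast
  have vy: "\<phi> (- \<alpha>) y = Fin l'" using val_decomp(1)[OF a e(1-3) uv e(4)] vuv by simp
  note c = U_mem_carrier[OF u a] U_mem_carrier[OF d(1) a] U_mem_carrier[OF d(3) a] M_mem_carrier[OF d(2) a]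
    U_mem_carrier[OF e(1) na] U_mem_carrier[OF e(3) na] M_mem_carrier[OF e(2) a]
  have im: "inv m \<in> M \<alpha>" by (rule inv_M[OF a d(2)])
  have "cj (inv m) y' \<in> U \<alpha>" using M_cj_U[OF a na im] e(3) by (auto simp: refl_uminus refl_self a)
  then have z: "cj (inv m) y' \<otimes> v' \<in> U \<alpha>" using d(3) U_subgroup[OF a] subgroup.m_closed by metis
  \<comment> \<open>Here m1 comes from an element of \<open>U \<alpha>\<close> of value -l', and m
    from one of \<open>U (- \<alpha>)\<close> of value l'. By (CA2) both move the origin to a point
    where \<alpha> is 2 l', so they act equally on the apartment.\<close>
  have "root_value \<Phi> \<alpha> (fst (\<nu> m1)) = l' + l'"
    using \<nu>_M_translation[OF a e(1-3) uv e(4) uv1 vuv] by simp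
  moreover have "root_value \<Phi> (- \<alpha>) (fst (\<nu> m)) = - (l' + l')"
    using \<nu>_M_translation[OF na dn u' d(4) False l'] .
  then have "root_value \<Phi> \<alpha> (fst (\<nu> m)) = l' + l'"
    unfolding root_value_uminus[OF a \<nu>_fst[OF M_in_N[OF a d(2)]]] neg_equal_iff_equal .
  ultimately have "\<nu> m1 = \<nu> m" using \<nu>_M_eqI[OF a e(2) d(2)] by simp
  then have t: "m1 \<otimes> m \<in> Tb"
    using \<nu>_mult[OF M_in_N[OF a e(2)] M_in_N[OF a d(2)]] \<nu>_M_square[OF a d(2)]
      subgroup.m_closed[OF N_subgroup M_in_N[OF a e(2)] M_in_N[OF a d(2)]] by (simp add: Tb_iff)
  have "u \<otimes> u' = (u \<otimes> v) \<otimes> (m \<otimes> v')" using c by (simp add: d(4) m_assoc)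
  also have "\<dots> = y \<otimes> (m1 \<otimes> m) \<otimes> (cj (inv m) y' \<otimes> v')" unfolding e(4) using c by (simp add: cj_def group_word)
  finally show ?thesis using e(1) t z vy l' by auto
qed

text \<open>The value of z is not visible in the construction of \<open>rank_one_half\<close>. Apply
  that lemma to the inverse product u'^-1 u^-1 with the opposite root, which controls the factor in
  \<open>U \<alpha>\<close>, and identify the two factorisations by uniqueness.\<close>

lemma rank_one:
  assumes a: "\<alpha> \<in> \<Phi>" and u: "u \<in> U \<alpha>" and u': "u' \<in> U (- \<alpha>)" and l: "- \<phi> (- \<alpha>) u' < \<phi> \<alpha> u"
  shows "\<exists>y\<in>U (- \<alpha>). \<exists>t\<in>Tb. \<exists>z\<in>U \<alpha>. u \<otimes> u' = y \<otimes> t \<otimes> z \<and> \<phi> (- \<alpha>) y = \<phi> (- \<alpha>) u' \<and> \<phi> \<alpha> z = \<phi> \<alpha> u"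
proof -
  note na = uminus_root[OF a]
  obtain y t z where d: "y \<in> U (- \<alpha>)" "t \<in> Tb" "z \<in> U \<alpha>" "u \<otimes> u' = y \<otimes> t \<otimes> z" "\<phi> (- \<alpha>) y = \<phi> (- \<alpha>) u'"
    using rank_one_half[OF a u u' l] by blast
  have i: "inv u' \<in> U (- \<alpha>)" "inv u \<in> U (- (- \<alpha>))"
    using u u' subgroup.m_inv_closed[OF U_subgroup[OF a]] subgroup.m_inv_closed[OF U_subgroup[OF na]] by auto
  have "- \<phi> (- (- \<alpha>)) (inv u) < \<phi> (- \<alpha>) (inv u')"
    using l val_inv[OF a u] val_inv[OF na u'] val_not_Minf[OF a u] val_not_Minf[OF na u']
    by (cases "\<phi> \<alpha> u"; cases "\<phi> (- \<alpha>) u'") (auto simp: minus_less_iff)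
  from rank_one_half[OF na i this] obtain y1 t1 z1
    where e: "y1 \<in> U \<alpha>" "t1 \<in> Tb" "z1 \<in> U (- \<alpha>)" "inv u' \<otimes> inv u = y1 \<otimes> t1 \<otimes> z1" "\<phi> \<alpha> y1 = \<phi> \<alpha> (inv u)"
    by auto
  have tT: "t \<in> T" "inv t1 \<in> T" using d(2) e(2) Tb_subset_T subgroup.m_inv_closed[OF T_subgroup] by auto
  note c = U_mem_carrier[OF u a] U_mem_carrier[OF u' na] U_mem_carrier[OF e(1) a] U_mem_carrier[OF e(3) na]
    T_mem_carrier[OF subsetD[OF Tb_subset_T e(2)]]
  have i1: "inv z1 \<in> U (- \<alpha>)" "inv y1 \<in> U \<alpha>"
    using e subgroup.m_inv_closed[OF U_subgroup[OF a]] subgroup.m_inv_closed[OF U_subgroup[OF na]] by auto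
  have "u \<otimes> u' = inv (inv u' \<otimes> inv u)" using c by (simp add: group_word)
  also have "\<dots> = inv z1 \<otimes> inv t1 \<otimes> inv y1" unfolding e(4) using c by (simp add: group_word)
  finally have "y \<otimes> t \<otimes> z = inv z1 \<otimes> inv t1 \<otimes> inv y1" using d(4) by simp
  then have "z = inv y1" by (rule opposite_unique(2)[OF a d(1) tT(1) d(3) i1(1) tT(2) i1(2)])
  then have "\<phi> \<alpha> z = \<phi> \<alpha> u" using val_inv[OF a e(1)] e(5) val_inv[OF a u] by simp
  then show ?thesis using d by blast
qed

end

section \<open>Iwahori decomposition\<close>

context valued_rgd
begin

lemma U_root_iff: "\<Omega> \<noteq> {} \<Longrightarrow> u \<in> U_root \<Phi> U \<phi> \<alpha> \<Omega> \<longleftrightarrow>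
    u \<in> U \<alpha> \<and> (\<forall>x\<in>\<Omega>. Fin (- root_value \<Phi> \<alpha> x) \<le> \<phi> \<alpha> u)"
  by (auto simp: U_root_def val_subgroup_def)

lemma U_root_subset: "\<Omega> \<noteq> {} \<Longrightarrow> U_root \<Phi> U \<phi> \<alpha> \<Omega> \<subseteq> U \<alpha>"
  using U_root_iff by blast

lemma U_root_subgroup: "\<Omega> \<noteq> {} \<Longrightarrow> \<alpha> \<in> \<Phi> \<Longrightarrow> subgroup (U_root \<Phi> U \<phi> \<alpha> \<Omega>) G"
  unfolding U_root_def by (rule subgroups_Inter) (auto intro: val_subgroup)

text \<open>The condition at a point x bounds the value of u in \<open>U \<alpha>\<close> below by
  -\<alpha>(x). These bounds are additive along positive integral combinations of roots, just as the
  levels in (V3).\<close>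

lemma commutator_family_U_root:
  assumes \<Omega>: "\<Omega> \<noteq> {}" "\<Omega> \<subseteq> apartment \<Phi>"
  shows "commutator_family (\<lambda>\<alpha>. U_root \<Phi> U \<phi> \<alpha> \<Omega>)"
proof -
  let ?X = "\<lambda>\<alpha>. U_root \<Phi> U \<phi> \<alpha> \<Omega>"
  have double: "?X (2 *\<^sub>R \<alpha>) \<subseteq> ?X \<alpha>" if a: "\<alpha> \<in> \<Phi>" "2 *\<^sub>R \<alpha> \<in> \<Phi>" for \<alpha>
  proof
    fix u assume "u \<in> ?X (2 *\<^sub>R \<alpha>)"
    then have u: "u \<in> U (2 *\<^sub>R \<alpha>)" "\<And>x. x \<in> \<Omega> \<Longrightarrow> Fin (- root_value \<Phi> (2 *\<^sub>R \<alpha>) x) \<le> \<phi> (2 *\<^sub>R \<alpha>) u"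
      by (auto simp: U_root_iff \<Omega>)
    have uU: "u \<in> U \<alpha>" using u(1) U_double[OF a] by blast
    have "Fin (- root_value \<Phi> \<alpha> x) \<le> \<phi> \<alpha> u" if x: "x \<in> \<Omega>" for x
    proof (cases "u = \<one>")
      case True
      then show ?thesis using val_one a by simp
    next
      case False
      obtain l where l: "\<phi> \<alpha> u = Fin l" using val_finite[OF a(1) uU False] .
      have "root_value \<Phi> (2 *\<^sub>R \<alpha>) x = int_mult 1 (root_value \<Phi> \<alpha> x) + int_mult 1 (root_value \<Phi> \<alpha> x)"
        by (rule root_value_comb[OF a(2) a(1) a(1)]) (use x \<Omega> in \<open>auto simp: scaleR_2\<close>)
      then have "- (root_value \<Phi> \<alpha> x + root_value \<Phi> \<alpha> x) \<le> l + l"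
        using u(2)[OF x] val_double[OF a u(1)] l by simp
      then have le: "(- root_value \<Phi> \<alpha> x) + (- root_value \<Phi> \<alpha> x) \<le> l + l" by simp
      have "- root_value \<Phi> \<alpha> x \<le> l"
      proof (rule ccontr)
        assume "\<not> - root_value \<Phi> \<alpha> x \<le> l"
        then have "l < - root_value \<Phi> \<alpha> x" by simp
        then have "l + l < (- root_value \<Phi> \<alpha> x) + (- root_value \<Phi> \<alpha> x)" by (intro add_strict_mono)
        then show False using le by simp
      qed
      then show ?thesis using l by simp
    qed
    then show "u \<in> ?X \<alpha>" using uU by (simp add: U_root_iff \<Omega>)
  qed
  have comm: "u \<otimes> v \<otimes> inv u \<otimes> inv v \<in> gen ?X (root_interval \<Phi> \<alpha> \<beta>)"
    if h: "\<alpha> \<in> \<Phi>" "\<beta> \<in> \<Phi>" "\<not> (\<exists>c<0. \<beta> = c *\<^sub>R \<alpha>)" "u \<in> ?X \<alpha>" "v \<in> ?X \<beta>" for \<alpha> \<beta> u v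
  proof -
    have u: "u \<in> U \<alpha>" "\<And>x. x \<in> \<Omega> \<Longrightarrow> Fin (- root_value \<Phi> \<alpha> x) \<le> \<phi> \<alpha> u"
      and v: "v \<in> U \<beta>" "\<And>x. x \<in> \<Omega> \<Longrightarrow> Fin (- root_value \<Phi> \<beta> x) \<le> \<phi> \<beta> v"
      using h(4,5) by (auto simp: U_root_iff \<Omega>)
    note c = U_mem_carrier[OF u(1) h(1)] U_mem_carrier[OF v(1) h(2)]
    show ?thesis
    \<comment> \<open>(V3) speaks of finite levels, so elements of value \<open>Pinf\<close> are set
      apart.\<close>
    proof (cases "u = \<one> \<or> v = \<one>")
      case True
      then have "u \<otimes> v \<otimes> inv u \<otimes> inv v = \<one>" using c by auto
      then show ?thesis using generate.one by metis
    next
      case False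
      \<comment> \<open>The levels are the exact values of u and v and not bounds coming from a
        point, so that one use of (V3) serves all points of \<Omega> at once.\<close>
      obtain l k where l: "\<phi> \<alpha> u = Fin l" and k: "\<phi> \<beta> v = Fin k"
        using val_finite[OF h(1) u(1)] val_finite[OF h(2) v(1)] False by metis
      have "\<not> (\<exists>c\<le>0. \<beta> = c *\<^sub>R \<alpha>)"
        using h(2,3) zero_notin_roots by (metis le_less scaleR_zero_left)
      from val_commutator[OF h(1,2) this, of l k]
      have sub: "commutator_subgroup G (val_subgroup U \<phi> \<alpha> (Fin l)) (val_subgroup U \<phi> \<beta> (Fin k))
        \<subseteq> generate G (\<Union>{val_subgroup U \<phi> (real r *\<^sub>R \<alpha> + real s *\<^sub>R \<beta>)
          (Fin (int_mult (int r) l + int_mult (int s) k)) | r s. 0 < r \<and> 0 < s \<and> real r *\<^sub>R \<alpha> + real s *\<^sub>R \<beta> \<in> \<Phi>})" .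
      have "u \<otimes> v \<otimes> inv u \<otimes> inv v \<in> commutator_subgroup G (val_subgroup U \<phi> \<alpha> (Fin l)) (val_subgroup U \<phi> \<beta> (Fin k))"
      proof -
        have "u \<in> val_subgroup U \<phi> \<alpha> (Fin l)" "v \<in> val_subgroup U \<phi> \<beta> (Fin k)"
          using u(1) v(1) l k by (auto simp: val_subgroup_def)
        then show ?thesis unfolding commutator_subgroup_def by (intro generate.incl) blast
      qed
      moreover have "val_subgroup U \<phi> (real r *\<^sub>R \<alpha> + real s *\<^sub>R \<beta>) (Fin (int_mult (int r) l + int_mult (int s) k))
          \<subseteq> \<Union> (?X ` root_interval \<Phi> \<alpha> \<beta>)"
        if rs: "0 < r" "0 < s" "real r *\<^sub>R \<alpha> + real s *\<^sub>R \<beta> \<in> \<Phi>" for r s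
      proof
        let ?\<gamma> = "real r *\<^sub>R \<alpha> + real s *\<^sub>R \<beta>"
        fix w assume w: "w \<in> val_subgroup U \<phi> ?\<gamma> (Fin (int_mult (int r) l + int_mult (int s) k))"
        have "Fin (- root_value \<Phi> ?\<gamma> x) \<le> \<phi> ?\<gamma> w" if x: "x \<in> \<Omega>" for x
        proof -
          have "root_value \<Phi> ?\<gamma> x = int_mult (int r) (root_value \<Phi> \<alpha> x) + int_mult (int s) (root_value \<Phi> \<beta> x)"
            by (rule root_value_comb[OF rs(3) h(1,2)]) (use x \<Omega> in auto)
          then have "- root_value \<Phi> ?\<gamma> x = int_mult (int r) (- root_value \<Phi> \<alpha> x) + int_mult (int s) (- root_value \<Phi> \<beta> x)"
            by (simp add: int_mult_minus_right)
          also have "\<dots> \<le> int_mult (int r) l + int_mult (int s) k"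
            using u(2)[OF x] v(2)[OF x] l k by (intro add_mono int_mult_mono_right) auto
          finally have "Fin (- root_value \<Phi> ?\<gamma> x) \<le> Fin (int_mult (int r) l + int_mult (int s) k)" by simp
          also have "\<dots> \<le> \<phi> ?\<gamma> w" using w by (simp add: val_subgroup_def)
          finally show ?thesis .
        qed
        then have "w \<in> ?X ?\<gamma>" using w by (simp add: U_root_iff \<Omega> val_subgroup_def)
        moreover have "?\<gamma> \<in> root_interval \<Phi> \<alpha> \<beta>" using rs unfolding root_interval_def by blast
        ultimately show "w \<in> \<Union> (?X ` root_interval \<Phi> \<alpha> \<beta>)" by blast
      qed
      then have "generate G (\<Union>{val_subgroup U \<phi> (real r *\<^sub>R \<alpha> + real s *\<^sub>R \<beta>)
          (Fin (int_mult (int r) l + int_mult (int s) k)) | r s. 0 < r \<and> 0 < s \<and> real r *\<^sub>R \<alpha> + real s *\<^sub>R \<beta> \<in> \<Phi>})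
          \<subseteq> gen ?X (root_interval \<Phi> \<alpha> \<beta>)"
        by (intro mono_generate) blast
      ultimately show ?thesis using sub by blast
    qed
  qed
  show ?thesis
    unfolding commutator_family_def using U_root_subgroup[OF \<Omega>(1)] double comm by blast
qed

text \<open>Two points at which a root differs make the sum of the values of
  \<open>u \<in> U_root \<Phi> U \<phi> \<alpha> \<Omega>\<close> and of its counterpart for
  -\<alpha> strictly positive. For a single point the sum could be zero, and the rank one
  factorisation would fail to start.\<close>

definition wide :: "('v, 'r) point set \<Rightarrow> bool" where
  "wide \<Omega> \<longleftrightarrow> \<Omega> \<noteq> {} \<and> \<Omega> \<subseteq> apartment \<Phi> \<and>
     (\<forall>\<alpha>\<in>\<Phi>. \<exists>x\<in>\<Omega>. \<exists>y\<in>\<Omega>. root_value \<Phi> \<alpha> x < root_value \<Phi> \<alpha> y)"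

text \<open>Only a set of products at first. It contains \<open>P_hat\<close> once it is known to be
  independent of A and stable under left multiplication by generators.\<close>

definition iwahori :: "('v, 'r) point set \<Rightarrow> 'v dual set \<Rightarrow> 'g set" where
  "iwahori \<Omega> A = {p \<otimes> n \<otimes> t | p n t.
     p \<in> gen (\<lambda>\<alpha>. U_root \<Phi> U \<phi> \<alpha> \<Omega>) A \<and> n \<in> gen (\<lambda>\<alpha>. U_root \<Phi> U \<phi> \<alpha> \<Omega>) (uminus ` A) \<and> t \<in> Tb}"

lemma Tb_mem_carrier: "t \<in> Tb \<Longrightarrow> t \<in> carrier G"
  using Tb_subset_T T_mem_carrier by blast

lemma Tb_cj_U_root:
  assumes "\<Omega> \<noteq> {}" "t \<in> Tb" "\<alpha> \<in> \<Phi>" "u \<in> U_root \<Phi> U \<phi> \<alpha> \<Omega>"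
  shows "cj t u \<in> U_root \<Phi> U \<phi> \<alpha> \<Omega>"
proof -
  have "cj t u \<in> U \<alpha>" using T_cj_U[of t \<alpha>] Tb_subset_T assms U_root_subset by blast
  then show ?thesis using assms Tb_val by (auto simp: U_root_iff)
qed

lemma U_root_union_carrier: "\<Omega> \<noteq> {} \<Longrightarrow> A \<subseteq> \<Phi> \<Longrightarrow> (\<Union>\<alpha>\<in>A. U_root \<Phi> U \<phi> \<alpha> \<Omega>) \<subseteq> carrier G"
  using U_root_subset U_carrier by blast

lemma Tb_cj_gen:
  assumes "\<Omega> \<noteq> {}" "A \<subseteq> \<Phi>" "t \<in> Tb" "u \<in> gen (\<lambda>\<alpha>. U_root \<Phi> U \<phi> \<alpha> \<Omega>) A"
  shows "cj t u \<in> gen (\<lambda>\<alpha>. U_root \<Phi> U \<phi> \<alpha> \<Omega>) A"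
proof (rule generate_cj[OF Tb_mem_carrier[OF assms(3)] U_root_union_carrier[OF assms(1,2)] _ U_root_union_carrier[OF assms(1,2)] assms(4)])
  fix s assume "s \<in> (\<Union>\<alpha>\<in>A. U_root \<Phi> U \<phi> \<alpha> \<Omega>)"
  then obtain \<alpha> where a: "\<alpha> \<in> A" "s \<in> U_root \<Phi> U \<phi> \<alpha> \<Omega>" by blast
  have "\<alpha> \<in> \<Phi>" using a(1) assms(2) by blast
  then have "cj t s \<in> U_root \<Phi> U \<phi> \<alpha> \<Omega>" using Tb_cj_U_root[OF assms(1,3) _ a(2)] by blast
  then show "cj t s \<in> gen (\<lambda>\<alpha>. U_root \<Phi> U \<phi> \<alpha> \<Omega>) A" using a(1) by (intro generate.incl) blast
qed

text \<open>With \<alpha>(x1) < \<alpha>(x2), u has value at least -\<alpha>(x1) and u' at least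
  \<alpha>(x2). As \<open>rank_one\<close> preserves both values, the new factors satisfy the
  conditions at all points of \<Omega>.\<close>

lemma U_root_rank_one:
  assumes w: "wide \<Omega>" and a: "\<alpha> \<in> \<Phi>" and u: "u \<in> U_root \<Phi> U \<phi> \<alpha> \<Omega>" "u' \<in> U_root \<Phi> U \<phi> (- \<alpha>) \<Omega>"
  shows "\<exists>y\<in>U_root \<Phi> U \<phi> (- \<alpha>) \<Omega>. \<exists>t\<in>Tb. \<exists>z\<in>U_root \<Phi> U \<phi> \<alpha> \<Omega>. u \<otimes> u' = y \<otimes> t \<otimes> z"
proof -
  have \<Omega>: "\<Omega> \<noteq> {}" "\<Omega> \<subseteq> apartment \<Phi>" using w by (auto simp: wide_def)
  obtain x1 x2 where x: "x1 \<in> \<Omega>" "x2 \<in> \<Omega>" "root_value \<Phi> \<alpha> x1 < root_value \<Phi> \<alpha> x2"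
    using w a unfolding wide_def by blast
  have uU: "u \<in> U \<alpha>" "u' \<in> U (- \<alpha>)" using u U_root_subset[OF \<Omega>(1)] by auto
  have 1: "Fin (- root_value \<Phi> \<alpha> x1) \<le> \<phi> \<alpha> u" using u(1) x(1) by (simp add: U_root_iff \<Omega>)
  have "Fin (- root_value \<Phi> (- \<alpha>) x2) \<le> \<phi> (- \<alpha>) u'" using u(2) x(2) by (simp add: U_root_iff \<Omega>)
  then have "Fin (root_value \<Phi> \<alpha> x2) \<le> \<phi> (- \<alpha>) u'"
    using root_value_uminus[OF a subsetD[OF \<Omega>(2) x(2)]] by simp
  then have "- \<phi> (- \<alpha>) u' \<le> Fin (- root_value \<Phi> \<alpha> x2)"
    by (cases "\<phi> (- \<alpha>) u'") auto
  also have "\<dots> < Fin (- root_value \<Phi> \<alpha> x1)" using x(3) by simp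
  finally have "- \<phi> (- \<alpha>) u' < \<phi> \<alpha> u" using 1 by simp
  from rank_one[OF a uU this] obtain y t z where d: "y \<in> U (- \<alpha>)" "t \<in> Tb" "z \<in> U \<alpha>"
    "u \<otimes> u' = y \<otimes> t \<otimes> z" "\<phi> (- \<alpha>) y = \<phi> (- \<alpha>) u'" "\<phi> \<alpha> z = \<phi> \<alpha> u" by blast
  have "y \<in> U_root \<Phi> U \<phi> (- \<alpha>) \<Omega>" "z \<in> U_root \<Phi> U \<phi> \<alpha> \<Omega>"
    using u d by (auto simp: U_root_iff \<Omega>)
  then show ?thesis using d by blast
qed

lemma valued_rgd_basis: "root_basis \<Phi> \<Delta>' \<Longrightarrow> valued_rgd \<Phi> cor \<Delta>' G T U M \<phi> \<nu>"
  using valuation compatible R_nontrivial R_divisible root_group_datum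
  by unfold_locales auto

text \<open>Exchanging the factors of rank one inside the product replaces a system of positive roots by
  an adjacent one.\<close>

lemma iwahori_refl:
  assumes w: "wide \<Omega>" and a: "a \<in> \<Delta>"
  shows "iwahori \<Omega> pos \<subseteq> iwahori \<Omega> (refl a ` pos)"
proof
  let ?X = "\<lambda>\<alpha>. U_root \<Phi> U \<phi> \<alpha> \<Omega>"
  let ?P = "refl a ` pos"
  have \<Omega>: "\<Omega> \<noteq> {}" "\<Omega> \<subseteq> apartment \<Phi>" using w by (auto simp: wide_def)
  note X = commutator_family_U_root[OF \<Omega>]
  interpret O: valued_rgd \<Phi> cor "uminus ` \<Delta>" G T U M \<phi> \<nu>
    by (rule valued_rgd_basis[OF root_basis_uminus(1)])
  note aR = basis_root[OF a]
  have na: "- a \<in> uminus ` \<Delta>" using a by blast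
  have Psub: "?P \<subseteq> \<Phi>" using refl_root[OF aR pos_root] by blast
  have nPsub: "uminus ` ?P \<subseteq> \<Phi>" using Psub uminus_root by blast
  have sub: "pos - {a, 2 *\<^sub>R a} \<subseteq> ?P" using refl_basis_pos_image[OF a] by blast
  have nsub: "uminus ` pos - {- a, 2 *\<^sub>R (- a)} \<subseteq> uminus ` ?P"
  proof
    fix \<gamma> assume "\<gamma> \<in> uminus ` pos - {- a, 2 *\<^sub>R (- a)}"
    then have "- \<gamma> \<in> pos - {a, 2 *\<^sub>R a}" by auto
    then have "- \<gamma> \<in> ?P" using sub by blast
    then show "\<gamma> \<in> uminus ` ?P" by (rule image_eqI[rotated]) simp
  qed
  have naP: "- a \<in> ?P" using refl_self[OF aR] basis_in_pos[OF a] by (metis imageI)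
  then have aP: "a \<in> uminus ` ?P" by (rule image_eqI[rotated]) simp
  fix g assume "g \<in> iwahori \<Omega> pos"
  then obtain p n t where g: "g = p \<otimes> n \<otimes> t" "p \<in> gen ?X pos" "n \<in> gen ?X (uminus ` pos)" "t \<in> Tb"
    unfolding iwahori_def by blast
  obtain x k where p: "x \<in> ?X a" "k \<in> gen ?X (pos - {a, 2 *\<^sub>R a})" "p = k \<otimes> x"
    using family_split'[OF X a g(2)] by blast
  have "n \<in> gen ?X (pos_roots \<Phi> (uminus ` \<Delta>))" using g(3) root_basis_uminus(2) by simp
  then obtain x' k' where n: "x' \<in> ?X (- a)" "k' \<in> gen ?X (uminus ` pos - {- a, 2 *\<^sub>R (- a)})" "n = x' \<otimes> k'"
    using O.family_split[OF X na] unfolding root_basis_uminus(2) by blast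
  obtain y t0 z where yz: "y \<in> ?X (- a)" "t0 \<in> Tb" "z \<in> ?X a" "x \<otimes> x' = y \<otimes> t0 \<otimes> z"
    using U_root_rank_one[OF w aR p(1) n(1)] by blast
  have k: "k \<in> gen ?X ?P" using p(2) gen_mono[OF sub] by blast
  have k': "k' \<in> gen ?X (uminus ` ?P)" using n(2) gen_mono[OF nsub] by blast
  have y: "y \<in> gen ?X ?P" using yz(1) naP by (intro generate.incl) blast
  have z: "z \<in> gen ?X (uminus ` ?P)" using yz(3) aP by (intro generate.incl) blast
  have zk: "z \<otimes> k' \<in> gen ?X (uminus ` ?P)" using z k' by (rule generate.eng)
  note c = generate_in_carrier[OF U_root_union_carrier[OF \<Omega>(1) Psub] k]
    generate_in_carrier[OF U_root_union_carrier[OF \<Omega>(1) Psub] y]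
    generate_in_carrier[OF U_root_union_carrier[OF \<Omega>(1) nPsub] k']
    generate_in_carrier[OF U_root_union_carrier[OF \<Omega>(1) nPsub] z]
    Tb_mem_carrier[OF g(4)] Tb_mem_carrier[OF yz(2)]
  have xc: "x \<in> carrier G" "x' \<in> carrier G"
    using p(1) n(1) U_root_subset[OF \<Omega>(1)] U_mem_carrier aR uminus_root by blast+
  have "g = k \<otimes> (x \<otimes> x') \<otimes> k' \<otimes> t" unfolding g(1) p(3) n(3) using c xc by (simp add: m_assoc)
  also have "\<dots> = (k \<otimes> y) \<otimes> cj t0 (z \<otimes> k') \<otimes> (t0 \<otimes> t)"
    unfolding yz(4) using c by (simp add: cj_def group_word)
  finally show "g \<in> iwahori \<Omega> ?P"
    unfolding iwahori_def
    using generate.eng[OF k y] Tb_cj_gen[OF \<Omega>(1) nPsub yz(2) zk] subgroup.m_closed[OF Tb_subgroup yz(2) g(4)] by blast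
qed

text \<open>Reading one more letter m in \<open>M a\<close> reflects the system
  n1(\<open>pos\<close>) in the root n1(a), which is simple for the basis n1(\<Delta>).
  Instantiating the locale at that basis makes each letter a passage to an adjacent system.\<close>

lemma iwahori_words: "wide \<Omega> \<Longrightarrow> n \<in> words k \<Longrightarrow> iwahori \<Omega> pos \<subseteq> iwahori \<Omega> (wN n ` pos)"
proof (induction k arbitrary: n)
  case 0
  then show ?case using wN_T by simp
next
  case (Suc k)
  then obtain n1 m a where d: "n = n1 \<otimes> m" "n1 \<in> words k" "a \<in> \<Delta>" "m \<in> M a" by auto
  note aR = basis_root[OF d(3)]
  have n1: "n1 \<in> N" using d(2) words_N by blast
  have mN: "m \<in> N" using M_in_N[OF aR d(4)] .
  note w1 = weyl_linear[OF wN_weyl[OF n1]] weyl_bij[OF wN_weyl[OF n1]] weyl_image_roots[OF wN_weyl[OF n1]]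
  interpret D: valued_rgd \<Phi> cor "wN n1 ` \<Delta>" G T U M \<phi> \<nu>
    by (rule valued_rgd_basis[OF root_basis_image(1)[OF w1]])
  have "refl (wN n1 a) = wN (cj n1 m)"
    using wN_M[OF wN_root[OF n1 aR] N_cj_M[OF n1 aR d(4)]] by simp
  also have "cj n1 m = n1 \<otimes> m \<otimes> inv n1" by (simp add: cj_def)
  also have "wN \<dots> = wN n1 \<circ> wN m \<circ> wN (inv n1)"
    using wN_mult[OF subgroup.m_closed[OF N_subgroup n1 mN] subgroup.m_inv_closed[OF N_subgroup n1]]
      wN_mult[OF n1 mN] by simp
  finally have "refl (wN n1 a) ` wN n1 ` pos = wN n ` pos"
    using wN_mult[OF n1 mN] by (simp add: image_image wN_inv[OF n1] d(1))
  moreover have "iwahori \<Omega> (wN n1 ` pos) \<subseteq> iwahori \<Omega> (refl (wN n1 a) ` wN n1 ` pos)"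
    using D.iwahori_refl[OF Suc.prems(1), of "wN n1 a"] d(3) unfolding root_basis_image(2)[OF w1] by blast
  ultimately show ?case using Suc.IH[OF Suc.prems(1) d(2)] by simp
qed

text \<open>The reverse inclusion is the same statement for n^-1, read over the basis
  n(\<Delta>).\<close>

lemma iwahori_N:
  assumes w: "wide \<Omega>" and n: "n \<in> N"
  shows "iwahori \<Omega> (wN n ` pos) = iwahori \<Omega> pos"
proof
  note w1 = weyl_linear[OF wN_weyl[OF n]] weyl_bij[OF wN_weyl[OF n]] weyl_image_roots[OF wN_weyl[OF n]]
  interpret D: valued_rgd \<Phi> cor "wN n ` \<Delta>" G T U M \<phi> \<nu>
    by (rule valued_rgd_basis[OF root_basis_image(1)[OF w1]])
  have i: "inv n \<in> N" using subgroup.m_inv_closed[OF N_subgroup n] .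
  obtain k where "inv n \<in> D.words k" using D.N_words[OF i] by blast
  then have "iwahori \<Omega> (wN n ` pos) \<subseteq> iwahori \<Omega> (wN (inv n) ` wN n ` pos)"
    using D.iwahori_words[OF w] unfolding root_basis_image(2)[OF w1] by blast
  then show "iwahori \<Omega> (wN n ` pos) \<subseteq> iwahori \<Omega> pos" by (simp add: image_image wN_inv[OF n])
  show "iwahori \<Omega> pos \<subseteq> iwahori \<Omega> (wN n ` pos)" using N_words[OF n] iwahori_words[OF w] by blast
qed

text \<open>A factor for a root in the chosen system is absorbed on the left. For a negative root,
  use the system reflected in that root: it contains the root, and the set of products is the
  same.\<close>

lemma U_root_mult_iwahori:
  assumes w: "wide \<Omega>" and a: "\<alpha> \<in> \<Phi>" and g: "g \<in> U_root \<Phi> U \<phi> \<alpha> \<Omega>" and y: "y \<in> iwahori \<Omega> pos"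
  shows "g \<otimes> y \<in> iwahori \<Omega> pos"
proof -
  let ?X = "\<lambda>\<alpha>. U_root \<Phi> U \<phi> \<alpha> \<Omega>"
  have \<Omega>: "\<Omega> \<noteq> {}" using w by (auto simp: wide_def)
  have key: "g \<otimes> y \<in> iwahori \<Omega> A" if h: "A \<subseteq> \<Phi>" "\<alpha> \<in> A" "y \<in> iwahori \<Omega> A" for A
  proof -
    obtain p n t where d: "y = p \<otimes> n \<otimes> t" "p \<in> gen ?X A" "n \<in> gen ?X (uminus ` A)" "t \<in> Tb"
      using h(3) unfolding iwahori_def by blast
    have nA: "uminus ` A \<subseteq> \<Phi>" using h(1) uminus_root by blast
    note c = generate_in_carrier[OF U_root_union_carrier[OF \<Omega> h(1)] d(2)]
      generate_in_carrier[OF U_root_union_carrier[OF \<Omega> nA] d(3)] Tb_mem_carrier[OF d(4)]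
      subgroup.mem_carrier[OF U_root_subgroup[OF \<Omega> a] g]
    have gA: "g \<in> gen ?X A" using g h(2) by (intro generate.incl) blast
    have "g \<otimes> y = (g \<otimes> p) \<otimes> n \<otimes> t" unfolding d(1) using c by (simp add: m_assoc)
    then show ?thesis unfolding iwahori_def using generate.eng[OF gA d(2)] d by blast
  qed
  show ?thesis
  proof (cases "\<alpha> \<in> pos")
    case True
    then show ?thesis using key[OF pos_subset _ y] by blast
  next
    case False
    then have "- \<alpha> \<in> pos" using pos_or_neg[OF a] by blast
    then have al: "\<alpha> \<in> refl \<alpha> ` pos"
      by (intro image_eqI[of _ _ "- \<alpha>"]) (simp add: refl_uminus refl_self[OF a])
    obtain m where m: "m \<in> M \<alpha>" using M_nonempty[OF a] by blast
    have e: "iwahori \<Omega> (refl \<alpha> ` pos) = iwahori \<Omega> pos"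
      using iwahori_N[OF w M_in_N[OF a m]] wN_M[OF a m] by simp
    have "refl \<alpha> ` pos \<subseteq> \<Phi>" using refl_root[OF a pos_root] by blast
    then have "g \<otimes> y \<in> iwahori \<Omega> (refl \<alpha> ` pos)" using key al y e by blast
    then show ?thesis using e by simp
  qed
qed

lemma Tb_mult_iwahori:
  assumes w: "wide \<Omega>" and t: "t \<in> Tb" and y: "y \<in> iwahori \<Omega> pos"
  shows "t \<otimes> y \<in> iwahori \<Omega> pos"
proof -
  let ?X = "\<lambda>\<alpha>. U_root \<Phi> U \<phi> \<alpha> \<Omega>"
  have \<Omega>: "\<Omega> \<noteq> {}" using w by (auto simp: wide_def)
  obtain p n s where d: "y = p \<otimes> n \<otimes> s" "p \<in> gen ?X pos" "n \<in> gen ?X (uminus ` pos)" "s \<in> Tb"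
    using y unfolding iwahori_def by blast
  note c = generate_in_carrier[OF U_root_union_carrier[OF \<Omega> pos_subset] d(2)]
    generate_in_carrier[OF U_root_union_carrier[OF \<Omega> neg_subset] d(3)] Tb_mem_carrier[OF d(4)] Tb_mem_carrier[OF t]
  have "t \<otimes> y = cj t p \<otimes> cj t n \<otimes> (t \<otimes> s)" unfolding d(1) using c by (simp add: cj_def group_word)
  then show ?thesis
    unfolding iwahori_def
    using Tb_cj_gen[OF \<Omega> pos_subset t d(2)] Tb_cj_gen[OF \<Omega> neg_subset t d(3)] subgroup.m_closed[OF Tb_subgroup t d(4)]
    by blast
qed

lemma generate_mult_stable:
  assumes S: "S \<subseteq> carrier G" "\<And>s. s \<in> S \<Longrightarrow> inv s \<in> S"
    and Y: "Y \<subseteq> carrier G" and st: "\<And>s y. s \<in> S \<Longrightarrow> y \<in> Y \<Longrightarrow> s \<otimes> y \<in> Y"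
    and g: "g \<in> generate G S" and y: "y \<in> Y"
  shows "g \<otimes> y \<in> Y"
  using g y
proof (induction g arbitrary: y rule: generate.induct)
  case one then show ?case using Y by auto
next
  case (incl h) then show ?case using st by blast
next
  case (inv h) then show ?case using st S(2) by blast
next
  case (eng h1 h2)
  then have "h1 \<otimes> (h2 \<otimes> y) \<in> Y" by blast
  moreover have "h1 \<in> carrier G" "h2 \<in> carrier G" "y \<in> carrier G"
    using eng generate_in_carrier[OF S(1)] Y by auto
  ultimately show ?case by (simp add: m_assoc)
qed

text \<open>By the assumption on the stabiliser, \<open>P_hat\<close> is inside the group generated
  by T_b and the subgroups \<open>U_root\<close>; the set of products contains 1 and is stable under
  these generators.\<close>

lemma P_hat_subset_iwahori:
  assumes w: "wide \<Omega>" and n: "N_hat G \<Phi> M \<nu> \<Omega> \<subseteq> Tb"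
  shows "P_hat G \<Phi> U M \<phi> \<nu> \<Omega> \<subseteq> iwahori \<Omega> pos"
proof
  let ?X = "\<lambda>\<alpha>. U_root \<Phi> U \<phi> \<alpha> \<Omega>"
  have \<Omega>: "\<Omega> \<noteq> {}" using w by (auto simp: wide_def)
  let ?S = "(\<Union>\<alpha>\<in>\<Phi>. ?X \<alpha>) \<union> Tb"
  have Sc: "?S \<subseteq> carrier G" using U_root_union_carrier[OF \<Omega>, of \<Phi>] Tb_mem_carrier by blast
  have "U_set G \<Phi> U \<phi> \<Omega> \<subseteq> generate G ?S" unfolding U_set_def by (rule mono_generate) blast
  moreover have "N_hat G \<Phi> M \<nu> \<Omega> \<subseteq> generate G ?S" using n by (auto intro: generate.incl)
  ultimately have sub: "P_hat G \<Phi> U M \<phi> \<nu> \<Omega> \<subseteq> generate G ?S"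
    unfolding P_hat_def by (intro generate_subgroup_incl generate_is_subgroup[OF Sc]) blast
  have Yc: "iwahori \<Omega> pos \<subseteq> carrier G"
    using generate_in_carrier[OF U_root_union_carrier[OF \<Omega> pos_subset]]
      generate_in_carrier[OF U_root_union_carrier[OF \<Omega> neg_subset]] Tb_mem_carrier
    unfolding iwahori_def by blast
  have one: "\<one> \<in> iwahori \<Omega> pos"
  proof -
    have "\<one> = \<one> \<otimes> \<one> \<otimes> \<one>" by simp
    then show ?thesis
      unfolding iwahori_def using generate.one[of G] subgroup.one_closed[OF Tb_subgroup] by blast
  qed
  fix g assume "g \<in> P_hat G \<Phi> U M \<phi> \<nu> \<Omega>"
  then have g: "g \<in> generate G ?S" using sub by blast
  have "g \<otimes> \<one> \<in> iwahori \<Omega> pos"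
  proof (rule generate_mult_stable[OF Sc _ Yc _ g one])
    show "inv s \<in> ?S" if "s \<in> ?S" for s
      using that subgroup.m_inv_closed[OF U_root_subgroup[OF \<Omega>]] subgroup.m_inv_closed[OF Tb_subgroup] by blast
    show "s \<otimes> y \<in> iwahori \<Omega> pos" if "s \<in> ?S" "y \<in> iwahori \<Omega> pos" for s y
      using that U_root_mult_iwahori[OF w] Tb_mult_iwahori[OF w] by blast
  qed
  then show "g \<in> iwahori \<Omega> pos" using generate_in_carrier[OF Sc g] by simp
qed

section \<open>Iwasawa decomposition\<close>

text \<open>Write p = q r t with respect to the system n^-1(\<open>pos\<close>), in which n^-1 u n
  is positive. Then n^-1 n' t^-1 = ((n^-1 u n) q) r is an element of N in a product U+ U-, hence 1,
  and n^-1 n' = t is in T_b.\<close>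

lemma Iwasawa_unique:
  assumes w: "wide \<Omega>" and Nh: "N_hat G \<Phi> M \<nu> \<Omega> \<subseteq> Tb"
    and n: "n \<in> N" "n' \<in> N" and u: "u \<in> gen U pos" and p: "p \<in> P_hat G \<Phi> U M \<phi> \<nu> \<Omega>"
    and e: "n' = u \<otimes> n \<otimes> p"
  shows "\<nu> n = \<nu> n'"
proof -
  let ?X = "\<lambda>\<alpha>. U_root \<Phi> U \<phi> \<alpha> \<Omega>"
  have \<Omega>: "\<Omega> \<noteq> {}" using w by (auto simp: wide_def)
  have i: "inv n \<in> N" using subgroup.m_inv_closed[OF N_subgroup n(1)] .
  note w1 = weyl_linear[OF wN_weyl[OF i]] weyl_bij[OF wN_weyl[OF i]] weyl_image_roots[OF wN_weyl[OF i]]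
  interpret D: valued_rgd \<Phi> cor "wN (inv n) ` \<Delta>" G T U M \<phi> \<nu>
    by (rule valued_rgd_basis[OF root_basis_image(1)[OF w1]])
  let ?P = "wN (inv n) ` pos"
  have pr: "pos_roots \<Phi> (wN (inv n) ` \<Delta>) = ?P" by (rule root_basis_image(2)[OF w1])
  have "p \<in> iwahori \<Omega> ?P" using D.P_hat_subset_iwahori[OF w Nh] p unfolding pr by blast
  then obtain q r t where d: "p = q \<otimes> r \<otimes> t" "q \<in> gen ?X ?P" "r \<in> gen ?X (uminus ` ?P)" "t \<in> Tb"
    unfolding iwahori_def by blast
  have XU: "gen ?X A \<subseteq> gen U A" for A
    by (rule mono_generate) (use U_root_subset[OF \<Omega>] in blast)
  have q: "q \<in> gen U ?P" and r: "r \<in> gen U (uminus ` ?P)" using d XU by blast+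
  have u1: "cj (inv n) u \<in> gen U ?P"
  proof (rule generate_cj[OF N_carrier[OF i] U_union_carrier[OF pos_subset] _ _ u])
    show "\<Union> (U ` ?P) \<subseteq> carrier G" using D.U_union_carrier[OF D.pos_subset] unfolding pr .
    fix s assume "s \<in> \<Union> (U ` pos)"
    then obtain \<beta> where b: "\<beta> \<in> pos" "s \<in> U \<beta>" by blast
    then have "cj (inv n) s \<in> U (wN (inv n) \<beta>)" using wN_cj_U[OF i pos_root[OF b(1)]] by blast
    then show "cj (inv n) s \<in> gen U ?P" using b(1) by (intro U_in_gen) auto
  qed
  have tN: "t \<in> N" using d(4) by (simp add: Tb_iff)
  note c = N_carrier[OF n(1)] N_carrier[OF tN] subgroup.mem_carrier[OF Upos_subgroup u]
    subgroup.mem_carrier[OF D.Upos_subgroup[unfolded pr] q] subgroup.mem_carrier[OF D.Uneg_subgroup[unfolded pr] r]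
  have "inv n \<otimes> n' \<otimes> inv t = (cj (inv n) u \<otimes> q) \<otimes> r"
    unfolding e d(1) using c by (simp add: cj_def group_word)
  moreover have "inv n \<otimes> n' \<otimes> inv t \<in> N"
    using i n(2) tN N_subgroup subgroup.m_closed subgroup.m_inv_closed by metis
  moreover have "cj (inv n) u \<otimes> q \<in> gen U ?P" using u1 q by (rule generate.eng)
  ultimately have "inv n \<otimes> n' \<otimes> inv t = \<one>"
    using D.N_inter_Upos_Uneg[unfolded pr] r by blast
  then have "inv n \<otimes> n' \<otimes> inv t \<otimes> t = \<one> \<otimes> t" by simp
  then have "inv n \<otimes> n' = t" using c N_carrier[OF n(2)] by (simp add: m_assoc)
  then show ?thesis using \<nu>_eq_iff[OF n] d(4) by simp
qed

end

section \<open>Existence of the Iwasawa decomposition\<close>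

context rgd
begin

text \<open>P is an arbitrary subgroup with the alternative \<open>dich\<close>. Nothing ties it to
  the basis at hand, so it may come from the face of a different chamber.\<close>

lemma Iwasawa_exists:
  assumes gen: "generating_rgd G \<Phi> T U" and P: "subgroup P G"
    and dich: "\<And>b u. b \<in> \<Phi> \<Longrightarrow> u \<in> U b \<Longrightarrow> u \<noteq> \<one> \<Longrightarrow>
      u \<in> P \<or> (\<exists>y\<in>U (- b). \<exists>m\<in>M b. \<exists>y'\<in>P. u = y \<otimes> m \<otimes> y')"
    and g: "g \<in> carrier G"
  shows "\<exists>u\<in>gen U pos. \<exists>n\<in>N. \<exists>p\<in>P. g = u \<otimes> n \<otimes> p"
proof -
  define Z where "Z = {u \<otimes> n \<otimes> p | u n p. u \<in> gen U pos \<and> n \<in> N \<and> p \<in> P}"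
  note Uc = subgroup.mem_carrier[OF Upos_subgroup] and Pc = subgroup.mem_carrier[OF P]
  have Zc: "Z \<subseteq> carrier G" using Uc Pc N_carrier unfolding Z_def by blast
  have ZI: "u \<otimes> n \<otimes> p \<in> Z" if "u \<in> gen U pos" "n \<in> N" "p \<in> P" for u n p
    using that unfolding Z_def by blast
  have NPZ: "n \<otimes> p \<in> Z" if "n \<in> N" "p \<in> P" for n p
    using ZI[OF generate.one that] N_carrier[OF that(1)] by simp
  have Z1: "x \<otimes> z \<in> Z" if x: "x \<in> gen U pos" and z: "z \<in> Z" for x z
  proof -
    obtain u n p where d: "z = u \<otimes> n \<otimes> p" "u \<in> gen U pos" "n \<in> N" "p \<in> P" using z unfolding Z_def by blast
    have "x \<otimes> z = (x \<otimes> u) \<otimes> n \<otimes> p" using d x Uc N_carrier Pc by (simp add: m_assoc)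
    then show ?thesis using ZI[OF generate.eng[OF x d(2)] d(3,4)] by simp
  qed
  have ZT: "t \<otimes> z \<in> Z" if t: "t \<in> T" and z: "z \<in> Z" for t z
  proof -
    obtain u n p where d: "z = u \<otimes> n \<otimes> p" "u \<in> gen U pos" "n \<in> N" "p \<in> P" using z unfolding Z_def by blast
    have "t \<otimes> z = cj t u \<otimes> (t \<otimes> n) \<otimes> p"
      using T_mem_carrier[OF t] Uc[OF d(2)] N_carrier[OF d(3)] Pc[OF d(4)] by (simp add: d(1) cj_def group_word)
    then show ?thesis
      using ZI[OF T_cj_gen[OF t pos_subset d(2)] subgroup.m_closed[OF N_subgroup subsetD[OF T_subset_N t] d(3)] d(4)] by simp
  qed
  have Z2: "g \<otimes> z \<in> Z" if a: "a \<in> \<Delta>" and g: "g \<in> U (- a)" and z: "z \<in> Z" for a g z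
  proof (cases "g = \<one>")
    case True
    then show ?thesis using z Zc by auto
  next
    case False
    note aR = basis_root[OF a]
    have rad: "gen U (pos - {a, 2 *\<^sub>R a}) \<subseteq> gen U pos" by (rule gen_mono) blast
    obtain u n p where d: "z = u \<otimes> n \<otimes> p" "u \<in> gen U pos" "n \<in> N" "p \<in> P" using z unfolding Z_def by blast
    obtain x k where xk: "x \<in> U a" "k \<in> gen U (pos - {a, 2 *\<^sub>R a})" "u = x \<otimes> k"
      using family_split[OF commutator_family_U a d(2)] by blast
    \<comment> \<open>The factor k of u = x k is in the unipotent radical, which x and the negative
      element g both normalise, so it can be moved out to the left.\<close>
    have k1: "cj g (cj x k) \<in> gen U pos"
      using family_normalizes_radical[OF commutator_family_U a _ g] family_normalizes_radical[OF commutator_family_U a _ xk(1,2)] rad by blast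
    obtain v m v' where e: "v \<in> U a" "m \<in> M a" "v' \<in> U a" "g = v \<otimes> m \<otimes> v'"
      using U_decomp[OF aR g False] by blast
    have y: "v' \<otimes> x \<in> U a" using e(3) xk(1) U_subgroup[OF aR] subgroup.m_closed by metis
    have i: "inv n \<in> N" using subgroup.m_inv_closed[OF N_subgroup d(3)] .
    \<comment> \<open>The remaining factor of \<open>U a\<close> is carried across n towards P,
      where it becomes an element of the root group of b = n^-1(a), to which the alternative
      applies.\<close>
    define b where "b = wN (inv n) a"
    have bR: "b \<in> \<Phi>" unfolding b_def by (rule wN_root[OF i aR])
    have mN: "m \<in> N" by (rule M_in_N[OF aR e(2)])
    have mnN: "m \<otimes> n \<in> N" using mN d(3) subgroup.m_closed[OF N_subgroup] by blast
    define y' where "y' = cj (inv n) (v' \<otimes> x)"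
    have y'U: "y' \<in> U b" unfolding y'_def b_def using wN_cj_U[OF i aR] y by blast
    have kc: "k \<in> carrier G" using xk(2) rad Uc by blast
    note c = U_mem_carrier[OF xk(1) aR] kc U_mem_carrier[OF e(1) aR] U_mem_carrier[OF e(3) aR] M_mem_carrier[OF e(2) aR]
      N_carrier[OF d(3)] Pc[OF d(4)] U_mem_carrier[OF y'U bR] U_mem_carrier[OF g uminus_root[OF aR]]
    have "g \<otimes> z = cj g (cj x k) \<otimes> (g \<otimes> (x \<otimes> n \<otimes> p))"
      unfolding d(1) xk(3) using c by (simp add: cj_def group_word)
    also have "g \<otimes> (x \<otimes> n \<otimes> p) = v \<otimes> (m \<otimes> n \<otimes> (y' \<otimes> p))"
      unfolding e(4) y'_def using c by (simp add: cj_def group_word)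
    finally have gz: "g \<otimes> z = cj g (cj x k) \<otimes> (v \<otimes> (m \<otimes> n \<otimes> (y' \<otimes> p)))" .
    have "m \<otimes> n \<otimes> (y' \<otimes> p) \<in> Z"
    proof (cases "y' \<in> P")
      case True
      then show ?thesis using NPZ[OF mnN] subgroup.m_closed[OF P _ d(4)] by blast
    next
      case False
      then have "y' \<noteq> \<one>" using subgroup.one_closed[OF P] by blast
      \<comment> \<open>The factor r is in \<open>U (- b)\<close>, and m n maps -b to a. So r goes
        back to the left as an element of \<open>U a\<close>, m' joins N and r' joins P.\<close>
      then obtain r m' r' where f: "r \<in> U (- b)" "m' \<in> M b" "r' \<in> P" "y' = r \<otimes> m' \<otimes> r'"
        using dich[OF bR y'U] False by blast
      note fc = U_mem_carrier[OF f(1) uminus_root[OF bR]] M_mem_carrier[OF f(2) bR] Pc[OF f(3)]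
      have "wN (m \<otimes> n) (- b) = a"
        using wN_mult[OF mN d(3)] wN_inv(1)[OF d(3)] wN_M[OF aR e(2)] wN_uminus[OF d(3)]
        by (simp add: b_def refl_uminus refl_self aR)
      then have "cj (m \<otimes> n) r \<in> U a" using wN_cj_U[OF mnN uminus_root[OF bR]] f(1) by auto
      then have 1: "cj (m \<otimes> n) r \<in> gen U pos" using U_in_gen basis_in_pos[OF a] by blast
      have 2: "m \<otimes> n \<otimes> m' \<in> N" using subgroup.m_closed[OF N_subgroup mnN M_in_N[OF bR f(2)]] .
      have 3: "r' \<otimes> p \<in> P" using subgroup.m_closed[OF P f(3) d(4)] .
      have "m \<otimes> n \<otimes> (y' \<otimes> p) = cj (m \<otimes> n) r \<otimes> (m \<otimes> n \<otimes> m') \<otimes> (r' \<otimes> p)"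
        unfolding f(4) using c fc by (simp add: cj_def group_word)
      then show ?thesis using ZI[OF 1 2 3] by simp
    qed
    then have "v \<otimes> (m \<otimes> n \<otimes> (y' \<otimes> p)) \<in> Z"
      using Z1 U_in_gen[OF e(1) basis_in_pos[OF a]] by blast
    then show ?thesis unfolding gz by (rule Z1[OF k1])
  qed
  \<comment> \<open>An element of \<open>M a\<close> is a product of elements of T,
    \<open>U a\<close> and \<open>U (- a)\<close>, for all of which stability is known.\<close>
  have Z3: "m \<otimes> z \<in> Z" if a: "a \<in> \<Delta>" and m: "m \<in> M a" and z: "z \<in> Z" for a m z
  proof -
    note aR = basis_root[OF a]
    obtain u where u: "u \<in> U a" "u \<noteq> \<one>" using U_nontrivial[OF aR] by blast
    obtain y m0 y' where d: "y \<in> U (- a)" "m0 \<in> M a" "y' \<in> U (- a)" "u = y \<otimes> m0 \<otimes> y'"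
      using U_decomp_uminus[OF aR u] by blast
    obtain t where t: "t \<in> T" "m = t \<otimes> m0" using M_obtain_T[OF aR d(2) m] by blast
    note c = U_mem_carrier[OF d(1) uminus_root[OF aR]] U_mem_carrier[OF d(3) uminus_root[OF aR]] M_mem_carrier[OF d(2) aR]
      T_mem_carrier[OF t(1)] subsetD[OF Zc z]
    have i: "inv y \<in> U (- a)" "inv y' \<in> U (- a)"
      using d subgroup.m_inv_closed[OF U_subgroup[OF uminus_root[OF aR]]] by auto
    have "t \<otimes> (inv y \<otimes> (u \<otimes> (inv y' \<otimes> z))) \<in> Z"
      using ZT[OF t(1)] Z2[OF a i(1)] Z1[OF U_in_gen[OF u(1) basis_in_pos[OF a]]] Z2[OF a i(2) z] by blast
    moreover have "t \<otimes> (inv y \<otimes> (u \<otimes> (inv y' \<otimes> z))) = m \<otimes> z"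
      unfolding d(4) t(2) using c by (simp add: group_word)
    ultimately show ?thesis by simp
  qed
  have Z4: "n \<in> words k \<Longrightarrow> z \<in> Z \<Longrightarrow> n \<otimes> z \<in> Z" for n k z
  proof (induction k arbitrary: n z)
    case 0
    then show ?case using ZT by simp
  next
    case (Suc k)
    then obtain n1 m a where d: "n = n1 \<otimes> m" "n1 \<in> words k" "a \<in> \<Delta>" "m \<in> M a" by auto
    have "n1 \<in> carrier G" using d(2) words_N N_carrier by blast
    then have "n \<otimes> z = n1 \<otimes> (m \<otimes> z)"
      using d M_mem_carrier[OF d(4) basis_root[OF d(3)]] subsetD[OF Zc Suc.prems(2)] by (simp add: m_assoc)
    then show ?case using Suc.IH[OF d(2) Z3[OF d(3,4) Suc.prems(2)]] by simp
  qed
  \<comment> \<open>Negative roots other than -a are reached by conjugation: stability under all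
    words in the simple cosets covers the elements of \<open>M \<alpha>\<close>.\<close>
  have ZU: "g \<otimes> z \<in> Z" if al: "\<alpha> \<in> \<Phi>" and g: "g \<in> U \<alpha>" and z: "z \<in> Z" for \<alpha> g z
  proof (cases "\<alpha> \<in> pos")
    case True
    then show ?thesis using Z1[OF U_in_gen[OF g True] z] by simp
  next
    case False
    then have n: "- \<alpha> \<in> pos" using pos_or_neg[OF al] by blast
    obtain m where m: "m \<in> M \<alpha>" using M_nonempty[OF al] by blast
    note im = inv_M[OF al m]
    obtain k j where w: "m \<in> words k" "inv m \<in> words j" using N_words M_in_N[OF al m] M_in_N[OF al im] by blast
    have "cj (inv m) g \<in> U (- \<alpha>)" using M_cj_U[OF al al im] g refl_self[OF al] by auto
    then have "m \<otimes> (cj (inv m) g \<otimes> (inv m \<otimes> z)) \<in> Z"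
      using Z4[OF w(1)] Z1[OF U_in_gen[OF _ n]] Z4[OF w(2) z] by blast
    moreover have "m \<otimes> (cj (inv m) g \<otimes> (inv m \<otimes> z)) = g \<otimes> z"
      using M_mem_carrier[OF m al] U_mem_carrier[OF g al] subsetD[OF Zc z] by (simp add: cj_def group_word)
    ultimately show ?thesis by simp
  qed
  have one: "\<one> \<in> Z" using NPZ[OF subgroup.one_closed[OF N_subgroup] subgroup.one_closed[OF P]] by simp
  have "h \<otimes> z \<in> Z" if "h \<in> generate G (T \<union> (\<Union>\<alpha>\<in>\<Phi>. U \<alpha>))" "z \<in> Z" for h z
    using that
  proof (induction h arbitrary: z rule: generate.induct)
    case one then show ?case using Zc by auto
  next
    case (incl h) then show ?case using ZT ZU by blast
  next
    case (inv h)
    then have "inv h \<in> T \<union> (\<Union>\<alpha>\<in>\<Phi>. U \<alpha>)"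
      using subgroup.m_inv_closed[OF T_subgroup] subgroup.m_inv_closed[OF U_subgroup] by blast
    then show ?case using ZT ZU inv(2) by blast
  next
    case (eng h1 h2)
    have "h1 \<in> carrier G" "h2 \<in> carrier G"
      using eng(1,2) gen unfolding generating_rgd_def by auto
    then show ?case using eng(3)[OF eng(4)[OF eng(5)]] subsetD[OF Zc eng(5)] by (simp add: m_assoc)
  qed
  then have "g \<otimes> \<one> \<in> Z" using g gen one unfolding generating_rgd_def by blast
  then show ?thesis using g unfolding Z_def by auto
qed

end

subsection \<open>Neighbourhoods\<close>

context root_sys
begin

lemma open_half_space_Fin:
  "y \<in> open_half_space \<Phi> \<alpha> (Fin l) \<longleftrightarrow> y \<in> apartment \<Phi> \<and> - l < root_value \<Phi> \<alpha> y"
  by (simp add: open_half_space_def)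

lemma half_space_Fin:
  "y \<in> half_space \<Phi> \<alpha> (Fin l) \<longleftrightarrow> y \<in> apartment \<Phi> \<and> - l \<le> root_value \<Phi> \<alpha> y"
  by (simp add: half_space_def)

lemma half_space_Pinf: "half_space \<Phi> \<alpha> Pinf = apartment \<Phi>"
  by (simp add: half_space_def)

lemma neighbourhood_open_half_space:
  assumes "\<alpha> \<in> \<Phi>" "x \<in> open_half_space \<Phi> \<alpha> (Fin l)"
  shows "neighbourhood \<Phi> x (open_half_space \<Phi> \<alpha> (Fin l))"
proof -
  have "openin (apartment_topology \<Phi>) (open_half_space \<Phi> \<alpha> (Fin l))"
    unfolding apartment_topology_def by (rule topology_generated_by_Basis) (use assms in blast)
  then show ?thesis using assms(2) unfolding neighbourhood_def by (auto simp: open_half_space_def)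
qed

text \<open>Lower bounds on all roots are two-sided bounds because the roots are closed under
  negation. The proof follows the generation of the topology and takes the smaller radius at
  intersections.\<close>

lemma neighbourhood_contains_box:
  fixes x :: "('v, 'r::linordered_ab_group_add) point"
  assumes R: "\<exists>e::'r. 0 < e" and n: "neighbourhood \<Phi> x \<Omega>"
  shows "\<exists>e>0. \<forall>y\<in>apartment \<Phi>. (\<forall>\<beta>\<in>\<Phi>. root_value \<Phi> \<beta> x - e < root_value \<Phi> \<beta> y) \<longrightarrow> y \<in> \<Omega>"
proof -
  obtain S where S: "openin (apartment_topology \<Phi>) S" "x \<in> S" "S \<subseteq> \<Omega>"
    using n unfolding neighbourhood_def by blast
  have "generate_topology_on {open_half_space \<Phi> \<alpha> (Fin l) | \<alpha> l. \<alpha> \<in> \<Phi>} S"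
    using S(1) unfolding apartment_topology_def openin_topology_generated_by_iff .
  then have "x \<in> S \<Longrightarrow> \<exists>e>0. \<forall>y\<in>apartment \<Phi>. (\<forall>\<beta>\<in>\<Phi>. root_value \<Phi> \<beta> x - e < root_value \<Phi> \<beta> y) \<longrightarrow> y \<in> S"
  proof (induction S rule: generate_topology_on.induct)
    case Empty
    then show ?case by simp
  next
    case (Int A B)
    then obtain e e' where e: "e > 0" "\<forall>y\<in>apartment \<Phi>. (\<forall>\<beta>\<in>\<Phi>. root_value \<Phi> \<beta> x - e < root_value \<Phi> \<beta> y) \<longrightarrow> y \<in> A"
      "e' > 0" "\<forall>y\<in>apartment \<Phi>. (\<forall>\<beta>\<in>\<Phi>. root_value \<Phi> \<beta> x - e' < root_value \<Phi> \<beta> y) \<longrightarrow> y \<in> B"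
      by auto
    have le: "r - e \<le> r - min e e'" "r - e' \<le> r - min e e'" for r :: 'r by (auto simp: min_def)
    have "y \<in> A \<inter> B" if "y \<in> apartment \<Phi>" "\<forall>\<beta>\<in>\<Phi>. root_value \<Phi> \<beta> x - min e e' < root_value \<Phi> \<beta> y" for y
      using e(2,4) that le by (meson IntI order.strict_trans1)
    then show ?case using e(1,3) by (intro exI[of _ "min e e'"]) auto
  next
    case (UN K)
    then obtain A where A: "A \<in> K" "x \<in> A" by blast
    then obtain e where "e > 0" "\<forall>y\<in>apartment \<Phi>. (\<forall>\<beta>\<in>\<Phi>. root_value \<Phi> \<beta> x - e < root_value \<Phi> \<beta> y) \<longrightarrow> y \<in> A"
      using UN.IH by blast
    then show ?case using A(1) by blast
  next
    case (Basis s)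
    then obtain \<alpha> l where s: "\<alpha> \<in> \<Phi>" "s = open_half_space \<Phi> \<alpha> (Fin l)" by blast
    \<comment> \<open>The radius for a single half-space is the distance of x from its wall,
      measured by \<alpha>.\<close>
    have "0 < root_value \<Phi> \<alpha> x + l" using Basis(2) unfolding s(2) open_half_space_Fin
      by (metis add.commute neg_less_iff_less add.inverse_inverse less_add_same_cancel1 add_uminus_conv_diff diff_gt_0_iff_gt)
    moreover have "y \<in> s" if "y \<in> apartment \<Phi>" "\<forall>\<beta>\<in>\<Phi>. root_value \<Phi> \<beta> x - (root_value \<Phi> \<alpha> x + l) < root_value \<Phi> \<beta> y" for y
      using that s(1) unfolding s(2) open_half_space_Fin by (auto dest: bspec[of _ _ \<alpha>])
    ultimately show ?case by blast
  qed
  then show ?thesis using S(2,3) by blast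
qed

end

subsection \<open>The face of a chamber\<close>

context valued_rgd
begin

lemma R_pos: "\<exists>e::'r. 0 < e"
  using R_nontrivial by (metis linorder_neqE neg_0_less_iff_less)

lemma root_value_point_of_const:
  assumes "\<beta> \<in> \<Phi>"
  shows "root_value \<Phi> \<beta> (point_of (\<lambda>\<delta>. r :: 'r)) = int_mult (\<Sum>\<delta>\<in>\<Delta>. \<lfloor>blinfun_apply \<beta> (coweight \<Delta> \<delta>)\<rfloor>) r"
  using root_value_basis_sum[OF assms point_of_closed, of "\<lambda>\<delta>. r"]
  by (simp add: root_value_point_of int_mult_sum_left)

text \<open>Bounds all roots at once on a box of coordinates. The box reaches up to s + s so that it
  has room for points with coordinates s and with coordinates s + s.\<close>

lemma small_points:
  assumes e: "0 < (e::'r)"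
  shows "\<exists>s>0. \<forall>c. (\<forall>\<delta>\<in>\<Delta>. 0 \<le> c \<delta> \<and> c \<delta> \<le> s + s) \<longrightarrow> (\<forall>\<beta>\<in>\<Phi>. root_value \<Phi> \<beta> (point_of c) < e)"
proof -
  \<comment> \<open>K exceeds, for each root, twice the sum of the absolute values of its
    coefficients. With s = e / K, coordinates of at most 2 s keep every root below K s = e; the
    summand 1 makes this strict.\<close>
  define K where "K = 1 + (\<Sum>\<beta>\<in>\<Phi>. \<Sum>\<delta>\<in>\<Delta>. 2 * \<bar>\<lfloor>blinfun_apply \<beta> (coweight \<Delta> \<delta>)\<rfloor>\<bar>)"
  have K0: "0 < K" unfolding K_def by (intro add_pos_nonneg sum_nonneg) auto
  then have "0 < nat K" by simp
  then obtain s where s: "int_mult K s = e" using R_divisible[of "nat K" e] K0 by auto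
  have s0: "0 < s"
  proof (rule ccontr)
    assume "\<not> 0 < s"
    then have "int_mult K s \<le> int_mult K 0" using K0 by (intro int_mult_mono_right) auto
    then show False using s e by simp
  qed
  have "root_value \<Phi> \<beta> (point_of c) < e" if c: "\<And>\<delta>. \<delta> \<in> \<Delta> \<Longrightarrow> 0 \<le> c \<delta> \<and> c \<delta> \<le> s + s" and b: "\<beta> \<in> \<Phi>" for c \<beta>
  proof -
    let ?k = "\<lambda>\<delta>. \<lfloor>blinfun_apply \<beta> (coweight \<Delta> \<delta>)\<rfloor>"
    have "root_value \<Phi> \<beta> (point_of c) = (\<Sum>\<delta>\<in>\<Delta>. int_mult (?k \<delta>) (c \<delta>))"
      unfolding root_value_basis_sum[OF b point_of_closed] by (rule sum.cong) (simp_all add: root_value_point_of)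
    also have "\<dots> \<le> (\<Sum>\<delta>\<in>\<Delta>. int_mult (2 * \<bar>?k \<delta>\<bar>) s)"
    proof (rule sum_mono)
      fix \<delta> assume d: "\<delta> \<in> \<Delta>"
      have two: "int_mult (2 * \<bar>?k \<delta>\<bar>) s = int_mult \<bar>?k \<delta>\<bar> (s + s)"
        using int_mult_add_left[of "\<bar>?k \<delta>\<bar>" "\<bar>?k \<delta>\<bar>" s] by (simp add: int_mult_add_right)
      show "int_mult (?k \<delta>) (c \<delta>) \<le> int_mult (2 * \<bar>?k \<delta>\<bar>) s"
      proof (cases "0 \<le> ?k \<delta>")
        case True
        then show ?thesis unfolding two using c[OF d] by (simp add: int_mult_mono_right)
      next
        case False
        have "int_mult (- ?k \<delta>) 0 \<le> int_mult (- ?k \<delta>) (c \<delta>)" using False c[OF d] by (intro int_mult_mono_right) auto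
        then have "int_mult (?k \<delta>) (c \<delta>) \<le> 0" by (simp add: int_mult_minus_left)
        also have "0 \<le> int_mult \<bar>?k \<delta>\<bar> (s + s)"
          using int_mult_mono_right[of "\<bar>?k \<delta>\<bar>" 0 "s + s"] s0 by (simp add: add_nonneg_nonneg less_imp_le)
        finally show ?thesis unfolding two .
      qed
    qed
    also have "\<dots> = int_mult (\<Sum>\<delta>\<in>\<Delta>. 2 * \<bar>?k \<delta>\<bar>) s" by (simp only: int_mult_sum_left)
    also have "\<dots> < int_mult K s"
    proof -
      have "(\<Sum>\<delta>\<in>\<Delta>. 2 * \<bar>?k \<delta>\<bar>) < K"
        using member_le_sum[OF b, of "\<lambda>\<beta>. \<Sum>\<delta>\<in>\<Delta>. 2 * \<bar>\<lfloor>blinfun_apply \<beta> (coweight \<Delta> \<delta>)\<rfloor>\<bar>"] finite_roots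
        unfolding K_def by (simp add: sum_nonneg)
      then have "0 < int_mult (K - (\<Sum>\<delta>\<in>\<Delta>. 2 * \<bar>?k \<delta>\<bar>)) s" using s0 by (intro int_mult_pos) auto
      moreover have "int_mult K s = int_mult (K - (\<Sum>\<delta>\<in>\<Delta>. 2 * \<bar>?k \<delta>\<bar>)) s + int_mult (\<Sum>\<delta>\<in>\<Delta>. 2 * \<bar>?k \<delta>\<bar>) s"
        by (simp only: int_mult_add_left[symmetric]) simp
      ultimately show ?thesis by simp
    qed
    finally show ?thesis using s by simp
  qed
  then show ?thesis using s0 by blast
qed

text \<open>A box at the tip of x + C, open at its lower faces. This is the one thing that is
  extracted from a member of the face for the uniqueness part.\<close>

definition thick :: "('v, 'r) point \<Rightarrow> ('v, 'r) point set \<Rightarrow> bool" where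
  "thick x \<Omega> \<longleftrightarrow> (\<exists>s>0. \<forall>c. (\<forall>\<delta>\<in>\<Delta>. 0 < c \<delta> \<and> c \<delta> \<le> s + s) \<longrightarrow> x \<otimes>\<^bsub>VR \<Phi>\<^esub> point_of c \<in> \<Omega>)"

lemma point_of_in_chamber: "(\<And>\<delta>. \<delta> \<in> \<Delta> \<Longrightarrow> 0 < c \<delta>) \<Longrightarrow> point_of c \<in> vector_chamber \<Phi> \<Delta>"
  by (simp add: vector_chamber_def root_value_point_of)

lemma root_value_chamber_pos:
  assumes v: "v \<in> vector_chamber \<Phi> \<Delta>" and b: "\<beta> \<in> pos"
  shows "0 < root_value \<Phi> \<beta> v"
proof -
  have vA: "v \<in> apartment \<Phi>" and vp: "\<And>\<delta>. \<delta> \<in> \<Delta> \<Longrightarrow> 0 < root_value \<Phi> \<delta> v"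
    using v by (auto simp: vector_chamber_def)
  obtain \<delta> where d: "\<delta> \<in> \<Delta>" "0 < blinfun_apply \<beta> (coweight \<Delta> \<delta>)" using coweight_pos_pos[OF b] .
  have "1 \<le> \<lfloor>blinfun_apply \<beta> (coweight \<Delta> \<delta>)\<rfloor>"
    using d(2) coweight_int[OF pos_root[OF b] d(1)] by (auto elim!: Ints_cases)
  then have "0 < int_mult \<lfloor>blinfun_apply \<beta> (coweight \<Delta> \<delta>)\<rfloor> (root_value \<Phi> \<delta> v)"
    using vp[OF d(1)] by (intro int_mult_pos) auto
  moreover have "0 \<le> int_mult \<lfloor>blinfun_apply \<beta> (coweight \<Delta> \<delta>)\<rfloor> (root_value \<Phi> \<delta> v)" if "\<delta> \<in> \<Delta>" for \<delta>
    using int_mult_mono_right[of "\<lfloor>blinfun_apply \<beta> (coweight \<Delta> \<delta>)\<rfloor>" 0 "root_value \<Phi> \<delta> v"]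
      coweight_pos_ge[OF b that] vp[OF that] by simp
  ultimately show ?thesis
    unfolding root_value_basis_sum[OF pos_root[OF b] vA] by (intro sum_pos2[OF finite_basis d(1)])
qed

lemma chamber_subset: "vector_chamber \<Phi> \<Delta> \<subseteq> apartment \<Phi>"
  by (auto simp: vector_chamber_def)

lemma chamber_nonempty: "\<exists>v :: ('v, 'r) point. v \<in> vector_chamber \<Phi> \<Delta>"
proof -
  obtain e :: 'r where "0 < e" using R_pos by blast
  then have "point_of (\<lambda>\<delta>. e) \<in> vector_chamber \<Phi> \<Delta>" by (intro point_of_in_chamber)
  then show ?thesis ..
qed

lemma pos_iff_chamber:
  "\<beta> \<in> pos \<longleftrightarrow> \<beta> \<in> \<Phi> \<and> (\<forall>v \<in> (vector_chamber \<Phi> \<Delta> :: ('v, 'r) point set). 0 < root_value \<Phi> \<beta> v)"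
proof
  assume "\<beta> \<in> \<Phi> \<and> (\<forall>v \<in> (vector_chamber \<Phi> \<Delta> :: ('v, 'r) point set). 0 < root_value \<Phi> \<beta> v)"
  then have b: "\<beta> \<in> \<Phi>" "\<And>v. v \<in> (vector_chamber \<Phi> \<Delta> :: ('v, 'r) point set) \<Longrightarrow> 0 < root_value \<Phi> \<beta> v" by auto
  obtain v :: "('v, 'r) point" where v: "v \<in> vector_chamber \<Phi> \<Delta>" using chamber_nonempty by blast
  then have vA: "v \<in> apartment \<Phi>" using chamber_subset by blast
  have "\<not> 0 < root_value \<Phi> (- \<beta>) v" using b(2)[OF v] root_value_uminus[OF b(1) vA] by simp
  then have "- \<beta> \<notin> pos" using root_value_chamber_pos[OF v] by blast
  then show "\<beta> \<in> pos" using pos_or_neg[OF b(1)] by blast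
qed (use root_value_chamber_pos pos_root in blast)

text \<open>\<open>U_chamber\<close> sees the chamber only as a set and joins the root groups of all
  bases with that chamber. The positive roots are those positive on the chamber, so all these bases
  give the same ones.\<close>

lemma U_chamber_eq: "U_chamber G \<Phi> U (vector_chamber \<Phi> \<Delta> :: ('v, 'r) point set) = gen U pos"
proof -
  have "pos_roots \<Phi> \<Delta>' = pos"
    if "root_basis \<Phi> \<Delta>'" "(vector_chamber \<Phi> \<Delta> :: ('v, 'r) point set) = vector_chamber \<Phi> \<Delta>'" for \<Delta>'
  proof -
    interpret D: valued_rgd \<Phi> cor \<Delta>' G T U M \<phi> \<nu> by (rule valued_rgd_basis[OF that(1)])
    show ?thesis using pos_iff_chamber D.pos_iff_chamber that(2) by auto
  qed
  note pe = this
  have "{U \<alpha> | \<alpha> \<Delta>'. root_basis \<Phi> \<Delta>' \<and> (vector_chamber \<Phi> \<Delta> :: ('v, 'r) point set) = vector_chamber \<Phi> \<Delta>' \<and> \<alpha> \<in> pos_roots \<Phi> \<Delta>'}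
      = U ` pos" (is "?L = _")
  proof
    show "?L \<subseteq> U ` pos"
    proof
      fix S assume "S \<in> ?L"
      then obtain \<alpha> \<Delta>' where "S = U \<alpha>" "root_basis \<Phi> \<Delta>'"
        "(vector_chamber \<Phi> \<Delta> :: ('v, 'r) point set) = vector_chamber \<Phi> \<Delta>'" "\<alpha> \<in> pos_roots \<Phi> \<Delta>'" by blast
      then show "S \<in> U ` pos" using pe[of \<Delta>'] by blast
    qed
    show "U ` pos \<subseteq> ?L" using root_basis by blast
  qed
  then show ?thesis unfolding U_chamber_def by simp
qed

context
  fixes x :: "('v, 'r) point"
  assumes x: "x \<in> apartment \<Phi>"
begin

text \<open>The points of the box with all coordinates s and with all coordinates s + s are told
  apart by every root.\<close>

lemma thick_wide:
  assumes t: "thick x \<Omega>" and \<Omega>: "\<Omega> \<subseteq> apartment \<Phi>"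
  shows "wide \<Omega>"
proof -
  obtain s where s: "s > 0" "\<And>c. (\<forall>\<delta>\<in>\<Delta>. 0 < c \<delta> \<and> c \<delta> \<le> s + s) \<Longrightarrow> x \<otimes>\<^bsub>VR \<Phi>\<^esub> point_of c \<in> \<Omega>"
    using t unfolding thick_def by blast
  have ss: "s < s + s" using s(1) by simp
  have p1: "x \<otimes>\<^bsub>VR \<Phi>\<^esub> point_of (\<lambda>\<delta>. s) \<in> \<Omega>" by (rule s(2)) (use s(1) ss in auto)
  have p2: "x \<otimes>\<^bsub>VR \<Phi>\<^esub> point_of (\<lambda>\<delta>. s + s) \<in> \<Omega>" by (rule s(2)) (use s(1) ss in \<open>auto simp: add_pos_pos\<close>)
  have lt: "root_value \<Phi> \<alpha> (x \<otimes>\<^bsub>VR \<Phi>\<^esub> point_of (\<lambda>\<delta>. s)) < root_value \<Phi> \<alpha> (x \<otimes>\<^bsub>VR \<Phi>\<^esub> point_of (\<lambda>\<delta>. s + s))"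
    if "\<alpha> \<in> pos" for \<alpha>
    using root_value_chamber_pos[OF point_of_in_chamber that, of "\<lambda>\<delta>. s"] s(1)
    by (simp add: root_value_mult pos_root[OF that] x root_value_point_of_const int_mult_add_right)
  have "\<exists>y\<in>\<Omega>. \<exists>z\<in>\<Omega>. root_value \<Phi> \<alpha> y < root_value \<Phi> \<alpha> z" if a: "\<alpha> \<in> \<Phi>" for \<alpha>
  proof (cases "\<alpha> \<in> pos")
    case True
    then show ?thesis using lt p1 p2 by blast
  next
    case False
    then have "- \<alpha> \<in> pos" using pos_or_neg[OF a] by blast
    from lt[OF this] show ?thesis
      using root_value_uminus[OF a subsetD[OF \<Omega> p1]] root_value_uminus[OF a subsetD[OF \<Omega> p2]] p1 p2 by force
  qed
  then show ?thesis using p1 \<Omega> unfolding wide_def by blast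
qed

text \<open>An element fixing two points fixes their difference under its linear part. Differences
  of points in the box give s times each coweight, so all coefficients of roots are preserved, the
  linear part is trivial, and then so is the translation.\<close>

lemma thick_N_hat:
  assumes t: "thick x \<Omega>"
  shows "N_hat G \<Phi> M \<nu> \<Omega> \<subseteq> Tb"
proof
  fix n assume "n \<in> N_hat G \<Phi> M \<nu> \<Omega>"
  then have n: "n \<in> N" and fix': "\<And>y. y \<in> \<Omega> \<Longrightarrow> aff_apply \<Phi> (\<nu> n) y = y" by (auto simp: N_hat_def)
  obtain s where s: "s > 0" "\<And>c. (\<forall>\<delta>\<in>\<Delta>. 0 < c \<delta> \<and> c \<delta> \<le> s + s) \<Longrightarrow> x \<otimes>\<^bsub>VR \<Phi>\<^esub> point_of c \<in> \<Omega>"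
    using t unfolding thick_def by blast
  have ss: "s < s + s" using s(1) by simp
  define y where "y = x \<otimes>\<^bsub>VR \<Phi>\<^esub> point_of (\<lambda>\<delta>. s)"
  have yO: "y \<in> \<Omega>" unfolding y_def by (rule s(2)) (use s(1) ss in auto)
  have yA: "y \<in> apartment \<Phi>" unfolding y_def using x by simp
  note f = \<nu>_fst[OF n] note g = \<nu>_snd[OF n]
  have fy: "VR_map \<Phi> (snd (\<nu> n)) y \<otimes>\<^bsub>VR \<Phi>\<^esub> fst (\<nu> n) = y"
    using fix'[OF yO] by (simp add: aff_apply_def)
  have w: "wN n \<beta> = \<beta>" if b: "\<beta> \<in> \<Phi>" for \<beta>
  proof (rule coweight_eqI)
    fix \<delta> assume d: "\<delta> \<in> \<Delta>"
    \<comment> \<open>The displacement from y when the single coordinate at \<delta> is raised from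
      s to s + s, which stays inside the box.\<close>
    define e where "e = point_of (\<lambda>\<delta>'. if \<delta>' = \<delta> then s else 0)"
    have eA: "e \<in> apartment \<Phi>" unfolding e_def by simp
    have "point_of (\<lambda>\<delta>'. if \<delta>' = \<delta> then s + s else s) = point_of (\<lambda>\<delta>. s) \<otimes>\<^bsub>VR \<Phi>\<^esub> e"
      by (rule apartment_eqI) (auto simp: e_def root_value_mult basis_root root_value_point_of)
    moreover have "x \<otimes>\<^bsub>VR \<Phi>\<^esub> point_of (\<lambda>\<delta>'. if \<delta>' = \<delta> then s + s else s) \<in> \<Omega>"
      by (rule s(2)) (use s(1) ss in \<open>auto simp: add_pos_pos\<close>)
    ultimately have "y \<otimes>\<^bsub>VR \<Phi>\<^esub> e \<in> \<Omega>" unfolding y_def using x eA by (simp add: VR.m_assoc)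
    from fix'[OF this] have "VR_map \<Phi> (snd (\<nu> n)) (y \<otimes>\<^bsub>VR \<Phi>\<^esub> e) \<otimes>\<^bsub>VR \<Phi>\<^esub> fst (\<nu> n) = y \<otimes>\<^bsub>VR \<Phi>\<^esub> e"
      by (simp add: aff_apply_def)
    moreover have "VR_map \<Phi> (snd (\<nu> n)) (y \<otimes>\<^bsub>VR \<Phi>\<^esub> e) \<otimes>\<^bsub>VR \<Phi>\<^esub> fst (\<nu> n) =
        (VR_map \<Phi> (snd (\<nu> n)) y \<otimes>\<^bsub>VR \<Phi>\<^esub> fst (\<nu> n)) \<otimes>\<^bsub>VR \<Phi>\<^esub> VR_map \<Phi> (snd (\<nu> n)) e"
      using f VR_map_closed[OF g yA] VR_map_closed[OF g eA]
      by (simp add: VR_map_mult[OF g yA eA] VR.m_ac)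
    ultimately have "y \<otimes>\<^bsub>VR \<Phi>\<^esub> VR_map \<Phi> (snd (\<nu> n)) e = y \<otimes>\<^bsub>VR \<Phi>\<^esub> e" unfolding fy by simp
    then have ge: "VR_map \<Phi> (snd (\<nu> n)) e = e"
      using VR.Units_l_cancel[of y] yA eA VR_map_closed[OF g eA] VR.Units_eq by blast
    have ev: "root_value \<Phi> \<gamma> e = int_mult \<lfloor>blinfun_apply \<gamma> (coweight \<Delta> \<delta>)\<rfloor> s" if "\<gamma> \<in> \<Phi>" for \<gamma>
    proof -
      have "root_value \<Phi> \<gamma> e = (\<Sum>\<delta>'\<in>\<Delta>. if \<delta>' = \<delta> then int_mult \<lfloor>blinfun_apply \<gamma> (coweight \<Delta> \<delta>)\<rfloor> s else 0)"
        unfolding root_value_basis_sum[OF that eA] unfolding e_def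
        by (rule sum.cong) (auto simp: root_value_point_of)
      then show ?thesis using d finite_basis by simp
    qed
    have "root_value \<Phi> (wN n \<beta>) e = root_value \<Phi> \<beta> e" using root_value_\<nu>[OF n b eA] ge by simp
    then have "\<lfloor>blinfun_apply (wN n \<beta>) (coweight \<Delta> \<delta>)\<rfloor> = \<lfloor>blinfun_apply \<beta> (coweight \<Delta> \<delta>)\<rfloor>"
      using int_mult_left_inj[OF s(1)] ev[OF b] ev[OF wN_root[OF n b]] by simp
    then show "blinfun_apply (wN n \<beta>) (coweight \<Delta> \<delta>) = blinfun_apply \<beta> (coweight \<Delta> \<delta>)"
      using floor_root[OF b coweight_lattice_coweight[OF d]] floor_root[OF wN_root[OF n b] coweight_lattice_coweight[OF d]] by metis
  qed
  have g1: "snd (\<nu> n) = \<one>\<^bsub>GLat\<^esub>"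
  proof (rule GL_eqI[OF g GL_one_closed])
    fix v assume v: "v \<in> lattice"
    have "snd (\<nu> n) v = v" by (rule roots_separate) (use \<nu>_linear[OF n v] w in metis)
    then show "snd (\<nu> n) v = \<one>\<^bsub>GLat\<^esub> v" by (simp add: GL_one v)
  qed
  have "y \<otimes>\<^bsub>VR \<Phi>\<^esub> fst (\<nu> n) = y" using fy unfolding g1 by (simp add: VR_map_id yA)
  then have "fst (\<nu> n) = \<one>\<^bsub>VR \<Phi>\<^esub>" using VR.l_cancel_one[OF yA f] by simp
  then have "\<nu> n = \<one>\<^bsub>aff_group \<Phi>\<^esub>" using g1 by (simp add: aff_simps prod_eq_iff)
  then show "n \<in> Tb" using n by (simp add: Tb_iff)
qed

abbreviation F :: "('v, 'r) point filter" where
  "F \<equiv> face G \<Phi> U \<phi> x (vector_chamber \<Phi> \<Delta>)"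

text \<open>A property holds eventually for the face if it holds on a finite intersection of
  generating sets. Each of these contains the points of x + C near x, and the smallest of finitely
  many radii works for all.\<close>

lemma eventually_face_germ:
  assumes "eventually P F"
  shows "\<exists>e>0. \<forall>v\<in>vector_chamber \<Phi> \<Delta>. (\<forall>\<beta>\<in>\<Phi>. - e < root_value \<Phi> \<beta> v) \<longrightarrow> P (x \<otimes>\<^bsub>VR \<Phi>\<^esub> v)"
proof -
  obtain X where X: "X \<subseteq> face_generators G \<Phi> U \<phi> x (vector_chamber \<Phi> \<Delta>)" "finite X" "eventually P (INF S\<in>X. principal S)"
    using assms[unfolded face_def, THEN eventually_INF[THEN iffD1]] by blast
  have "\<exists>e>0. \<forall>v\<in>vector_chamber \<Phi> \<Delta>. (\<forall>\<beta>\<in>\<Phi>. - e < root_value \<Phi> \<beta> v) \<longrightarrow> x \<otimes>\<^bsub>VR \<Phi>\<^esub> v \<in> \<Inter>X"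
    using X(2,1)
  proof (induction X rule: finite_induct)
    case empty
    then show ?case using R_pos by auto
  next
    case (insert S X)
    obtain e where e: "e > 0" "\<And>v. v \<in> vector_chamber \<Phi> \<Delta> \<Longrightarrow> (\<forall>\<beta>\<in>\<Phi>. - e < root_value \<Phi> \<beta> v) \<Longrightarrow> x \<otimes>\<^bsub>VR \<Phi>\<^esub> v \<in> \<Inter>X"
      using insert by blast
    obtain \<Omega> where \<Omega>: "neighbourhood \<Phi> x \<Omega>" "(\<lambda>v. x \<otimes>\<^bsub>VR \<Phi>\<^esub> v) ` vector_chamber \<Phi> \<Delta> \<inter> \<Omega> \<subseteq> S"
      using insert.prems unfolding face_generators_def by auto
    obtain e' where e': "e' > 0" "\<And>y. y \<in> apartment \<Phi> \<Longrightarrow> (\<forall>\<beta>\<in>\<Phi>. root_value \<Phi> \<beta> x - e' < root_value \<Phi> \<beta> y) \<Longrightarrow> y \<in> \<Omega>"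
      using neighbourhood_contains_box[OF R_pos \<Omega>(1)] by blast
    have "x \<otimes>\<^bsub>VR \<Phi>\<^esub> v \<in> \<Inter>(insert S X)"
      if v: "v \<in> vector_chamber \<Phi> \<Delta>" "\<forall>\<beta>\<in>\<Phi>. - min e e' < root_value \<Phi> \<beta> v" for v
    proof -
      have vA: "v \<in> apartment \<Phi>" using v(1) chamber_subset by blast
      have le: "- e \<le> - min e e'" "- e' \<le> - min e e'" by auto
      have "x \<otimes>\<^bsub>VR \<Phi>\<^esub> v \<in> \<Inter>X" using e(2)[OF v(1)] v(2) le(1) by (meson order.strict_trans1)
      moreover have "- e' < root_value \<Phi> \<beta> v" if "\<beta> \<in> \<Phi>" for \<beta> using v(2) le(2) that by (meson order.strict_trans1)
      then have "x \<otimes>\<^bsub>VR \<Phi>\<^esub> v \<in> \<Omega>"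
        using x vA by (intro e'(2)) (auto simp: root_value_mult diff_conv_add_uminus simp del: add_uminus_conv_diff)
      then have "x \<otimes>\<^bsub>VR \<Phi>\<^esub> v \<in> S" using \<Omega>(2) v(1) by blast
      ultimately show ?thesis by blast
    qed
    then show ?case using e(1) e'(1) by (intro exI[of _ "min e e'"]) auto
  qed
  moreover have "P y" if "y \<in> \<Inter>X" for y
    using X(3) that unfolding INF_principal_finite[OF X(2), of "\<lambda>S. S"] eventually_principal by auto
  ultimately show ?thesis by blast
qed

lemma eventually_face_thick:
  assumes "eventually (\<lambda>y. y \<in> \<Omega>) F"
  shows "thick x \<Omega>"
proof -
  obtain e where e: "e > 0" "\<And>v. v \<in> vector_chamber \<Phi> \<Delta> \<Longrightarrow> (\<forall>\<beta>\<in>\<Phi>. - e < root_value \<Phi> \<beta> v) \<Longrightarrow> x \<otimes>\<^bsub>VR \<Phi>\<^esub> v \<in> \<Omega>"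
    using eventually_face_germ[OF assms] by blast
  obtain s where s: "s > 0" "\<forall>c. (\<forall>\<delta>\<in>\<Delta>. 0 \<le> c \<delta> \<and> c \<delta> \<le> s + s) \<longrightarrow> (\<forall>\<beta>\<in>\<Phi>. root_value \<Phi> \<beta> (point_of c) < e)"
    using small_points[OF e(1)] by (elim exE conjE) (rule that)
  have "x \<otimes>\<^bsub>VR \<Phi>\<^esub> point_of c \<in> \<Omega>" if c: "\<forall>\<delta>\<in>\<Delta>. 0 < c \<delta> \<and> c \<delta> \<le> s + s" for c
  proof (rule e(2)[OF point_of_in_chamber])
    show "0 < c \<delta>" if "\<delta> \<in> \<Delta>" for \<delta> using c that by blast
    show "\<forall>\<beta>\<in>\<Phi>. - e < root_value \<Phi> \<beta> (point_of c)"
    proof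
      fix \<beta> assume b: "\<beta> \<in> \<Phi>"
      have "root_value \<Phi> (- \<beta>) (point_of c) < e" by (rule s(2)[rule_format]) (use c b uminus_root in \<open>auto simp: less_imp_le\<close>)
      then show "- e < root_value \<Phi> \<beta> (point_of c)"
        unfolding root_value_uminus[OF b point_of_closed] by (simp add: minus_less_iff)
    qed
  qed
  then show ?thesis unfolding thick_def using s(1) by blast
qed

lemma eventually_face_nonempty: "eventually (\<lambda>y. y \<in> \<Omega>) F \<Longrightarrow> \<Omega> \<noteq> {}"
proof -
  assume "eventually (\<lambda>y. y \<in> \<Omega>) F"
  then obtain s where "s > 0" "\<And>c. (\<forall>\<delta>\<in>\<Delta>. 0 < c \<delta> \<and> c \<delta> \<le> s + s) \<Longrightarrow> x \<otimes>\<^bsub>VR \<Phi>\<^esub> point_of c \<in> \<Omega>"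
    using eventually_face_thick unfolding thick_def by blast
  from this(2)[of "\<lambda>\<delta>. s"] \<open>s > 0\<close> show ?thesis by (auto simp: less_imp_le)
qed

text \<open>If x is inside the half-space, some neighbourhood of x is. If x is on its wall, all of x
  + C is on the right side precisely because b is positive on C; this is where the direction of the
  face counts.\<close>

lemma eventually_half_space:
  assumes b: "b \<in> \<Phi>" and l: "Fin l \<in> val_Gamma G U \<phi> b"
    and c: "- l < root_value \<Phi> b x \<or> - l = root_value \<Phi> b x \<and> b \<in> pos"
  shows "eventually (\<lambda>y. y \<in> half_space \<Phi> b (Fin l)) F"
proof -
  have "\<exists>\<Omega>. neighbourhood \<Phi> x \<Omega> \<and> (\<lambda>v. x \<otimes>\<^bsub>VR \<Phi>\<^esub> v) ` vector_chamber \<Phi> \<Delta> \<inter> \<Omega> \<subseteq> half_space \<Phi> b (Fin l)"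
    using c
  proof
    assume "- l < root_value \<Phi> b x"
    then have "neighbourhood \<Phi> x (open_half_space \<Phi> b (Fin l))"
      using x b by (intro neighbourhood_open_half_space) (auto simp: open_half_space_Fin)
    moreover have "open_half_space \<Phi> b (Fin l) \<subseteq> half_space \<Phi> b (Fin l)"
      by (auto simp: open_half_space_Fin half_space_Fin)
    ultimately show ?thesis by blast
  next
    assume c: "- l = root_value \<Phi> b x \<and> b \<in> pos"
    \<comment> \<open>The neighbourhood is immaterial in this case; enlarging the half-space by any
      positive e supplies one.\<close>
    obtain e :: 'r where e: "e > 0" using R_pos by blast
    have "- (l + e) < root_value \<Phi> b x" using c e by (metis add.commute add.right_neutral add_less_cancel_left neg_less_iff_less)
    then have "neighbourhood \<Phi> x (open_half_space \<Phi> b (Fin (l + e)))"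
      using x b by (intro neighbourhood_open_half_space) (auto simp: open_half_space_Fin)
    moreover have "x \<otimes>\<^bsub>VR \<Phi>\<^esub> v \<in> half_space \<Phi> b (Fin l)" if v: "v \<in> vector_chamber \<Phi> \<Delta>" for v
    proof -
      have vA: "v \<in> apartment \<Phi>" using v chamber_subset by blast
      have "0 < root_value \<Phi> b v" using root_value_chamber_pos[OF v] c by blast
      then have "root_value \<Phi> b x \<le> root_value \<Phi> b (x \<otimes>\<^bsub>VR \<Phi>\<^esub> v)"
        using root_value_mult[OF b x vA] by simp
      then show ?thesis using c x vA by (simp add: half_space_Fin)
    qed
    ultimately show ?thesis by blast
  qed
  \<comment> \<open>A generating set with no open half-space and with level \<open>Pinf\<close> at
    all roots but b, where the half-space is the whole apartment.\<close>
  moreover have "half_space \<Phi> b (Fin l) = apartment \<Phi> \<inter> (\<Inter>\<alpha>\<in>{}. open_half_space \<Phi> \<alpha> (if \<alpha> = b then Fin l else Pinf))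
      \<inter> (\<Inter>\<alpha>\<in>\<Phi> - {}. half_space \<Phi> \<alpha> (if \<alpha> = b then Fin l else Pinf))"
    using b by (auto simp: half_space_Pinf half_space_Fin split: if_splits)
  ultimately have "half_space \<Phi> b (Fin l) \<in> face_generators G \<Phi> U \<phi> x (vector_chamber \<Phi> \<Delta>)"
    unfolding face_generators_def using l by (auto intro!: exI[of _ "{}"] exI[of _ "\<lambda>\<alpha>. if \<alpha> = b then Fin l else Pinf"])
  then show ?thesis unfolding face_def by (rule eventually_INF1) (simp add: eventually_principal)
qed

section \<open>The group attached to the face\<close>

abbreviation PF :: "'g set" where
  "PF \<equiv> P_hat_filter G \<Phi> U M \<phi> \<nu> F"

lemma P_hat_carrier: "\<Omega> \<noteq> {} \<Longrightarrow> U_set G \<Phi> U \<phi> \<Omega> \<union> N_hat G \<Phi> M \<nu> \<Omega> \<subseteq> carrier G"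
  unfolding U_set_def using generate_in_carrier[OF U_root_union_carrier] N_carrier by (auto simp: N_hat_def)

lemma P_hat_subgroup: "\<Omega> \<noteq> {} \<Longrightarrow> subgroup (P_hat G \<Phi> U M \<phi> \<nu> \<Omega>) G"
  unfolding P_hat_def by (rule generate_is_subgroup[OF P_hat_carrier])

lemma P_hat_antimono: "\<Omega>' \<subseteq> \<Omega> \<Longrightarrow> P_hat G \<Phi> U M \<phi> \<nu> \<Omega> \<subseteq> P_hat G \<Phi> U M \<phi> \<nu> \<Omega>'"
proof -
  assume "\<Omega>' \<subseteq> \<Omega>"
  then have "U_set G \<Phi> U \<phi> \<Omega> \<subseteq> U_set G \<Phi> U \<phi> \<Omega>'"
    unfolding U_set_def U_root_def by (intro mono_generate) blast
  moreover have "N_hat G \<Phi> M \<nu> \<Omega> \<subseteq> N_hat G \<Phi> M \<nu> \<Omega>'"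
    using \<open>\<Omega>' \<subseteq> \<Omega>\<close> unfolding N_hat_def by blast
  ultimately show ?thesis unfolding P_hat_def by (intro mono_generate) blast
qed

lemma PF_iff: "g \<in> PF \<longleftrightarrow> (\<exists>\<Omega>. \<Omega> \<subseteq> apartment \<Phi> \<and> eventually (\<lambda>y. y \<in> \<Omega>) F \<and> g \<in> P_hat G \<Phi> U M \<phi> \<nu> \<Omega>)"
proof
  assume "g \<in> PF"
  then show "\<exists>\<Omega>. \<Omega> \<subseteq> apartment \<Phi> \<and> eventually (\<lambda>y. y \<in> \<Omega>) F \<and> g \<in> P_hat G \<Phi> U M \<phi> \<nu> \<Omega>"
    unfolding P_hat_filter_def by auto
next
  assume "\<exists>\<Omega>. \<Omega> \<subseteq> apartment \<Phi> \<and> eventually (\<lambda>y. y \<in> \<Omega>) F \<and> g \<in> P_hat G \<Phi> U M \<phi> \<nu> \<Omega>"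
  then obtain \<Omega> where "\<Omega> \<subseteq> apartment \<Phi>" "eventually (\<lambda>y. y \<in> \<Omega>) F" "g \<in> P_hat G \<Phi> U M \<phi> \<nu> \<Omega>" by (elim exE conjE)
  moreover from this(2) have "\<Omega> \<noteq> {}" by (rule eventually_face_nonempty)
  ultimately show "g \<in> PF" unfolding P_hat_filter_def by auto
qed

text \<open>An element of value l belongs to the group of the half-space of level l, and l is an
  admissible level exactly because it is the value of an element.\<close>

lemma U_mem_PF:
  assumes b: "b \<in> \<Phi>" and u: "u \<in> U b" "u \<noteq> \<one>" and l: "\<phi> b u = Fin l"
    and c: "- l < root_value \<Phi> b x \<or> - l = root_value \<Phi> b x \<and> b \<in> pos"
  shows "u \<in> PF"
proof -
  let ?\<Omega> = "half_space \<Phi> b (Fin l) :: ('v, 'r) point set"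
  have "Fin l \<in> val_Gamma G U \<phi> b" unfolding val_Gamma_def using u l by force
  then have ev: "eventually (\<lambda>y. y \<in> ?\<Omega>) F" using c by (rule eventually_half_space[OF b])
  have ne: "?\<Omega> \<noteq> {}" using eventually_face_nonempty[OF ev] .
  have "u \<in> U_root \<Phi> U \<phi> b ?\<Omega>"
    using u l by (auto simp: U_root_iff[OF ne] half_space_Fin minus_le_iff)
  then have "u \<in> U_set G \<Phi> U \<phi> ?\<Omega>" unfolding U_set_def using b by (intro generate.incl) blast
  then have "u \<in> P_hat G \<Phi> U M \<phi> \<nu> ?\<Omega>" unfolding P_hat_def by (intro generate.incl) blast
  moreover have "?\<Omega> \<subseteq> apartment \<Phi>" by (auto simp: half_space_Fin)
  ultimately show ?thesis using ev unfolding PF_iff by blast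
qed

text \<open>In u = y m y' the factor y' has value -l, so u and y' belong to the groups of the two
  opposite half-spaces with the same wall. The face lies in one of them: x decides if it is off the
  wall, and the sign of b on C if it is on the wall.\<close>

lemma PF_dichotomy:
  assumes b: "b \<in> \<Phi>" and u: "u \<in> U b" "u \<noteq> \<one>"
  shows "u \<in> PF \<or> (\<exists>y\<in>U (- b). \<exists>m\<in>M b. \<exists>y'\<in>PF. u = y \<otimes> m \<otimes> y')"
proof -
  note nb = uminus_root[OF b]
  obtain l where l: "\<phi> b u = Fin l" using val_finite[OF b u] .
  obtain y m y' where d: "y \<in> U (- b)" "m \<in> M b" "y' \<in> U (- b)" "u = y \<otimes> m \<otimes> y'"
    using U_decomp_uminus[OF b u] by blast
  have v: "\<phi> (- b) y' = Fin (- l)" using val_decomp(2)[OF b d(1-3) u(1) d(4)] l by simp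
  then have y1: "y' \<noteq> \<one>" using val_one[OF nb] by auto
  have rv: "root_value \<Phi> (- b) x = - root_value \<Phi> b x" by (rule root_value_uminus[OF b x])
  consider "- l < root_value \<Phi> b x" | "- l = root_value \<Phi> b x" "b \<in> pos" | "- l = root_value \<Phi> b x" "- b \<in> pos"
    | "root_value \<Phi> b x < - l"
    using pos_or_neg[OF b] by (meson linorder_less_linear)
  then show ?thesis
  proof cases
    case 3
    then have "y' \<in> PF" using rv by (intro U_mem_PF[OF nb d(3) y1 v]) auto
    then show ?thesis using d by blast
  next
    case 4
    then have "y' \<in> PF" using rv by (intro U_mem_PF[OF nb d(3) y1 v]) (auto simp: less_minus_iff)
    then show ?thesis using d by blast
  qed (use U_mem_PF[OF b u l] in blast)+
qed

text \<open>The filter lives on the ambient type. That the apartment is one of its members is read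
  off from any element of \<open>PF\<close>, which the dichotomy provides, since its witness is a
  subset of the apartment.\<close>

lemma eventually_apartment: "eventually (\<lambda>y. y \<in> apartment \<Phi>) F"
proof -
  obtain b where b: "b \<in> \<Phi>" using roots_nonempty by blast
  obtain u where u: "u \<in> U b" "u \<noteq> \<one>" using U_nontrivial[OF b] by blast
  obtain g where "g \<in> PF" using PF_dichotomy[OF b u] by blast
  then show ?thesis unfolding PF_iff by (auto elim: eventually_mono)
qed

text \<open>A directed union of subgroups: smaller sets have larger groups, and two members of the
  filter have a common refinement.\<close>

lemma PF_subgroup: "subgroup PF G"
proof (rule subgroupI)
  show "PF \<subseteq> carrier G"
  proof
    fix g assume "g \<in> PF"
    then obtain \<Omega> where "eventually (\<lambda>y. y \<in> \<Omega>) F" "g \<in> P_hat G \<Phi> U M \<phi> \<nu> \<Omega>" unfolding PF_iff by (elim exE conjE)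
    then show "g \<in> carrier G" using subgroup.mem_carrier[OF P_hat_subgroup[OF eventually_face_nonempty]] by blast
  qed
  have "\<one> \<in> P_hat G \<Phi> U M \<phi> \<nu> (apartment \<Phi>)" unfolding P_hat_def by (rule generate.one)
  then have "\<one> \<in> PF" unfolding PF_iff using eventually_apartment by blast
  then show "PF \<noteq> {}" by blast
  fix g h assume g: "g \<in> PF"
  then obtain \<Omega> where \<Omega>: "\<Omega> \<subseteq> apartment \<Phi>" "eventually (\<lambda>y. y \<in> \<Omega>) F" "g \<in> P_hat G \<Phi> U M \<phi> \<nu> \<Omega>"
    unfolding PF_iff by blast
  then show "inv g \<in> PF"
    unfolding PF_iff using subgroup.m_inv_closed[OF P_hat_subgroup[OF eventually_face_nonempty]] by blast
  assume "h \<in> PF"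
  then obtain \<Omega>' where \<Omega>': "\<Omega>' \<subseteq> apartment \<Phi>" "eventually (\<lambda>y. y \<in> \<Omega>') F" "h \<in> P_hat G \<Phi> U M \<phi> \<nu> \<Omega>'"
    unfolding PF_iff by blast
  have ev: "eventually (\<lambda>y. y \<in> \<Omega> \<inter> \<Omega>') F" using eventually_conj[OF \<Omega>(2) \<Omega>'(2)] by simp
  have "g \<in> P_hat G \<Phi> U M \<phi> \<nu> (\<Omega> \<inter> \<Omega>')" "h \<in> P_hat G \<Phi> U M \<phi> \<nu> (\<Omega> \<inter> \<Omega>')"
    using \<Omega>(3) \<Omega>'(3) P_hat_antimono[of "\<Omega> \<inter> \<Omega>'"] by blast+
  then have "g \<otimes> h \<in> P_hat G \<Phi> U M \<phi> \<nu> (\<Omega> \<inter> \<Omega>')"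
    by (rule subgroup.m_closed[OF P_hat_subgroup[OF eventually_face_nonempty[OF ev]]])
  then show "g \<otimes> h \<in> PF" unfolding PF_iff using ev \<Omega>(1) by blast
qed

lemma Tb_subset_PF: "Tb \<subseteq> PF"
proof
  fix t assume "t \<in> Tb"
  then have "t \<in> N_hat G \<Phi> M \<nu> (apartment \<Phi>)" by (auto simp: N_hat_def Tb_iff aff_apply_one)
  then have "t \<in> P_hat G \<Phi> U M \<phi> \<nu> (apartment \<Phi>)" unfolding P_hat_def by (intro generate.incl) blast
  then show "t \<in> PF" unfolding PF_iff using eventually_apartment by blast
qed

end

end

section \<open>Double cosets and the assembly of the theorem\<close>

text \<open>Two maps with the same fibres have images in natural bijection. Both bijections of the
  theorem arise in this way from maps on N.\<close>

lemma induced_bij: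
  assumes "\<And>a b. a \<in> A \<Longrightarrow> b \<in> A \<Longrightarrow> h a = h b \<longleftrightarrow> k a = k b"
  shows "\<exists>f. bij_betw f (h ` A) (k ` A) \<and> (\<forall>a\<in>A. f (h a) = k a)"
proof -
  define f where "f y = k (inv_into A h y)" for y
  have f: "f (h a) = k a" if "a \<in> A" for a
    using assms[of "inv_into A h (h a)" a] that by (simp add: f_def inv_into_into f_inv_into_f)
  then have "bij_betw f (h ` A) (k ` A)"
    using assms by (auto simp: bij_betw_def inj_on_def image_image)
  then show ?thesis using f by blast
qed

lemma int_mult_module:
  assumes "Modules.module q"
  shows "int_mult (int n) r = q (of_nat n) r"
proof -
  interpret q: Modules.module q by fact
  show ?thesis by (induction n) (auto simp: int_mult_add_left q.scale_left_distrib)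
qed

lemma (in group) double_coset_mem:
  "g' \<in> double_coset G H g K \<longleftrightarrow> (\<exists>h\<in>H. \<exists>k\<in>K. g' = h \<otimes> g \<otimes> k)"
  unfolding double_coset_def set_mult_def by blast

lemma (in group) double_coset_eq:
  assumes H: "subgroup H G" and K: "subgroup K G" and g: "g \<in> carrier G"
    and g': "g' \<in> double_coset G H g K"
  shows "double_coset G H g' K = double_coset G H g K"
proof -
  have sub: "double_coset G H g' K \<subseteq> double_coset G H g K"
    if g: "g \<in> carrier G" and g': "g' \<in> double_coset G H g K" for g g'
  proof
    fix z assume "z \<in> double_coset G H g' K"
    then obtain h k where z: "h \<in> H" "k \<in> K" "z = h \<otimes> g' \<otimes> k" unfolding double_coset_mem by blast
    obtain h1 k1 where d: "h1 \<in> H" "k1 \<in> K" "g' = h1 \<otimes> g \<otimes> k1" using g' unfolding double_coset_mem by blast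
    have "z = (h \<otimes> h1) \<otimes> g \<otimes> (k1 \<otimes> k)"
      unfolding z(3) d(3) using z d g subgroup.mem_carrier[OF H] subgroup.mem_carrier[OF K] by (simp add: m_assoc)
    then show "z \<in> double_coset G H g K"
      unfolding double_coset_mem using subgroup.m_closed[OF H z(1) d(1)] subgroup.m_closed[OF K d(2) z(2)] by blast
  qed
  obtain h k where d: "h \<in> H" "k \<in> K" "g' = h \<otimes> g \<otimes> k" using g' unfolding double_coset_mem by blast
  note c = subgroup.mem_carrier[OF H d(1)] subgroup.mem_carrier[OF K d(2)]
  have "g = inv h \<otimes> g' \<otimes> inv k" unfolding d(3) using c g by (simp add: group_word)
  then have "g \<in> double_coset G H g' K"
    unfolding double_coset_mem using subgroup.m_inv_closed[OF H d(1)] subgroup.m_inv_closed[OF K d(2)] by blast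
  moreover have "g' \<in> carrier G" using d(3) c g by simp
  ultimately show ?thesis using sub[OF g g'] sub by blast
qed

theorem theorem5p36:
  fixes G :: "('g, 'b) monoid_scheme"
    and \<Phi> :: "'v::euclidean_space dual set" and cor :: "'v dual \<Rightarrow> 'v"
    and T :: "'g set" and U M :: "'v dual \<Rightarrow> 'g set"
    and \<phi> :: "'v dual \<Rightarrow> 'g \<Rightarrow> 'r::linordered_ab_group_add extended"
    and \<nu> :: "'g \<Rightarrow> ('v, 'r) aff"
    and q :: "rat \<Rightarrow> 'r \<Rightarrow> 'r"
    and C C' :: "('v, 'r) point set" and x :: "('v, 'r) point"
  assumes "group G"
    and "root_system \<Phi> cor" and "\<Phi> \<noteq> {}"
    and "root_group_datum G \<Phi> cor T U M" and "generating_rgd G \<Phi> T U"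
    and "\<exists>r::'r. r \<noteq> 0"
    and "rgd_valuation G \<Phi> U M \<phi>"
    and "compatible_action G \<Phi> cor T U M \<phi> \<nu>"
    and "Modules.module q"
    and "C \<in> vector_chambers \<Phi>" and "C' \<in> vector_chambers \<Phi>"
    and "x \<in> apartment \<Phi>"
  shows "let N = rgd_N G \<Phi> M;
             NG = rgd_N_group G \<Phi> M;
             Tb = rgd_Tb G \<Phi> M \<nu>;
             UC' = U_chamber G \<Phi> U C';
             P = P_hat_filter G \<Phi> U M \<phi> \<nu> (face G \<Phi> U \<phi> x C)
         in carrier G = UC' <#>\<^bsub>G\<^esub> N <#>\<^bsub>G\<^esub> P \<and>
            (\<exists>f. bij_betw f (\<nu> ` N) (double_cosets G UC' P) \<and>
                 (\<forall>n\<in>N. f (\<nu> n) = double_coset G UC' n P)) \<and>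
            (\<exists>f. bij_betw f (carrier (NG Mod Tb)) (double_cosets G UC' P) \<and>
                 (\<forall>n\<in>N. f (Tb #>\<^bsub>NG\<^esub> n) = double_coset G UC' n P))"
proof -
  obtain \<Delta> where \<Delta>: "root_basis \<Phi> \<Delta>" "C = vector_chamber \<Phi> \<Delta>"
    using assms(10) unfolding vector_chambers_def by blast
  obtain \<Delta>' where \<Delta>': "root_basis \<Phi> \<Delta>'" "C' = vector_chamber \<Phi> \<Delta>'"
    using assms(11) unfolding vector_chambers_def by blast
  have div: "\<exists>s. int_mult (int n) s = r" if "0 < n" for n and r :: 'r
  proof -
    interpret q: Modules.module q by fact
    have "int_mult (int n) (q (1 / of_nat n) r) = r"
      unfolding int_mult_module[OF assms(9)] q.scale_scale using that by simp
    then show ?thesis by blast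
  qed
  interpret G: group G by fact
  \<comment> \<open>Two instances over the same data: \<open>D\<close> at the basis of C governs the
    face and P, and \<open>E\<close> at the basis of C' governs the unipotent factor.\<close>
  interpret D: valued_rgd \<Phi> cor \<Delta> G T U M \<phi> \<nu>
    using assms \<Delta>(1) div by unfold_locales auto
  interpret E: valued_rgd \<Phi> cor \<Delta>' G T U M \<phi> \<nu>
    by (rule D.valued_rgd_basis[OF \<Delta>'(1)])
  define P where "P = P_hat_filter G \<Phi> U M \<phi> \<nu> (face G \<Phi> U \<phi> x C)"
  define UC where "UC = U_chamber G \<Phi> U C'"
  define N where "N = rgd_N G \<Phi> M"
  define NG where "NG = rgd_N_group G \<Phi> M"
  define Tb where "Tb = rgd_Tb G \<Phi> M \<nu>"
  have P: "subgroup P G" unfolding P_def \<Delta>(2) by (rule D.PF_subgroup[OF assms(12)])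
  have UCe: "UC = E.gen U (pos_roots \<Phi> \<Delta>')" unfolding UC_def \<Delta>'(2) by (rule E.U_chamber_eq)
  have UCs: "subgroup UC G" unfolding UCe by (rule E.Upos_subgroup)
  have Nc: "N \<subseteq> carrier G" unfolding N_def using D.N_carrier by blast
  let ?dc = "\<lambda>n. double_coset G UC n P"
  have ex: "\<exists>u\<in>UC. \<exists>n\<in>N. \<exists>p\<in>P. g = u \<otimes>\<^bsub>G\<^esub> n \<otimes>\<^bsub>G\<^esub> p" if "g \<in> carrier G" for g
    unfolding UCe N_def
  proof (rule E.Iwasawa_exists[OF assms(5) P _ that])
    show "u \<in> P \<or> (\<exists>y\<in>U (- b). \<exists>m\<in>M b. \<exists>y'\<in>P. u = y \<otimes>\<^bsub>G\<^esub> m \<otimes>\<^bsub>G\<^esub> y')"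
      if "b \<in> \<Phi>" "u \<in> U b" "u \<noteq> \<one>\<^bsub>G\<^esub>" for b u
      using D.PF_dichotomy[OF assms(12) that] unfolding P_def \<Delta>(2) .
  qed
  have 1: "carrier G = UC <#>\<^bsub>G\<^esub> N <#>\<^bsub>G\<^esub> P"
  proof
    show "carrier G \<subseteq> UC <#>\<^bsub>G\<^esub> N <#>\<^bsub>G\<^esub> P"
    proof
      fix g assume "g \<in> carrier G"
      then obtain u n p where "u \<in> UC" "n \<in> N" "p \<in> P" "g = u \<otimes>\<^bsub>G\<^esub> n \<otimes>\<^bsub>G\<^esub> p" using ex[of g] by blast
      then show "g \<in> UC <#>\<^bsub>G\<^esub> N <#>\<^bsub>G\<^esub> P" unfolding set_mult_def by blast
    qed
    show "UC <#>\<^bsub>G\<^esub> N <#>\<^bsub>G\<^esub> P \<subseteq> carrier G"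
      using subgroup.subset[OF P] subgroup.subset[OF UCs] Nc by (intro G.set_mult_closed)
  qed
  have uniq: "\<nu> n = \<nu> n'" if n: "n \<in> N" "n' \<in> N" and e: "?dc n = ?dc n'" for n n'
  proof -
    have c: "n \<in> carrier G" "n' \<in> carrier G" using n Nc by auto
    have "n' = \<one>\<^bsub>G\<^esub> \<otimes>\<^bsub>G\<^esub> n' \<otimes>\<^bsub>G\<^esub> \<one>\<^bsub>G\<^esub>" using c by simp
    then have "n' \<in> ?dc n"
      unfolding e G.double_coset_mem using subgroup.one_closed[OF P] subgroup.one_closed[OF UCs] by blast
    then obtain u p where up: "u \<in> UC" "p \<in> P" "n' = u \<otimes>\<^bsub>G\<^esub> n \<otimes>\<^bsub>G\<^esub> p"
      unfolding G.double_coset_mem by blast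
    obtain \<Omega> where \<Omega>: "\<Omega> \<subseteq> apartment \<Phi>" "eventually (\<lambda>y. y \<in> \<Omega>) (face G \<Phi> U \<phi> x (vector_chamber \<Phi> \<Delta>))"
      "p \<in> P_hat G \<Phi> U M \<phi> \<nu> \<Omega>"
      using up(2) D.PF_iff[OF assms(12)] unfolding P_def \<Delta>(2) by blast
    have th: "D.thick x \<Omega>" using D.eventually_face_thick[OF assms(12) \<Omega>(2)] .
    show ?thesis
      using E.Iwasawa_unique[OF D.thick_wide[OF assms(12) th \<Omega>(1)] D.thick_N_hat[OF assms(12) th] _ _ _ \<Omega>(3) up(3)]
        n up(1) unfolding N_def UCe by blast
  qed
  have Tb_P: "Tb \<subseteq> P" unfolding Tb_def P_def \<Delta>(2) by (rule D.Tb_subset_PF[OF assms(12)])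
  have wd: "?dc n = ?dc n'" if n: "n \<in> N" "n' \<in> N" and e: "\<nu> n = \<nu> n'" for n n'
  proof -
    have c: "n \<in> carrier G" "n' \<in> carrier G" using n Nc by auto
    have "inv\<^bsub>G\<^esub> n \<otimes>\<^bsub>G\<^esub> n' \<in> P" using D.\<nu>_eq_iff n e Tb_P unfolding N_def Tb_def by blast
    moreover have "n' = \<one>\<^bsub>G\<^esub> \<otimes>\<^bsub>G\<^esub> n \<otimes>\<^bsub>G\<^esub> (inv\<^bsub>G\<^esub> n \<otimes>\<^bsub>G\<^esub> n')" using c by (simp add: G.group_word)
    ultimately have "n' \<in> ?dc n" unfolding G.double_coset_mem using subgroup.one_closed[OF UCs] by blast
    then show ?thesis using G.double_coset_eq[OF UCs P c(1)] by simp
  qed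
  have \<nu>_dc: "\<nu> n = \<nu> n' \<longleftrightarrow> ?dc n = ?dc n'" if "n \<in> N" "n' \<in> N" for n n'
    using uniq[OF that] wd[OF that] by blast
  have dcs: "double_cosets G UC P = ?dc ` N"
  proof
    show "double_cosets G UC P \<subseteq> ?dc ` N"
    proof
      fix X assume "X \<in> double_cosets G UC P"
      then obtain g where g: "g \<in> carrier G" "X = ?dc g" unfolding double_cosets_def by blast
      obtain u n p where d: "u \<in> UC" "n \<in> N" "p \<in> P" "g = u \<otimes>\<^bsub>G\<^esub> n \<otimes>\<^bsub>G\<^esub> p" using ex[OF g(1)] by blast
      then have "g \<in> ?dc n" unfolding G.double_coset_mem by blast
      then have "?dc g = ?dc n" using G.double_coset_eq[OF UCs P] d(2) Nc by blast
      then show "X \<in> ?dc ` N" using g(2) d(2) by blast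
    qed
    show "?dc ` N \<subseteq> double_cosets G UC P" unfolding double_cosets_def using Nc by blast
  qed
  have coset_iff: "Tb #>\<^bsub>NG\<^esub> n = Tb #>\<^bsub>NG\<^esub> n' \<longleftrightarrow> \<nu> n = \<nu> n'" if n: "n \<in> N" "n' \<in> N" for n n'
  proof -
    have r: "Tb #>\<^bsub>NG\<^esub> k = Tb #>\<^bsub>G\<^esub> k" for k unfolding NG_def r_coset_def D.NG_simps ..
    have c: "n \<in> carrier G" "n' \<in> carrier G" using n Nc by auto
    have nN: "n \<in> rgd_N G \<Phi> M" "n' \<in> rgd_N G \<Phi> M" using n by (auto simp: N_def)
    have Tbs: "subgroup Tb G" unfolding Tb_def by (rule D.Tb_subgroup)
    show ?thesis unfolding r
    proof
      assume "Tb #>\<^bsub>G\<^esub> n = Tb #>\<^bsub>G\<^esub> n'"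
      then have "n' \<in> Tb #>\<^bsub>G\<^esub> n" using G.rcos_self[OF c(2) Tbs] by simp
      then obtain t where t: "t \<in> Tb" "n' = t \<otimes>\<^bsub>G\<^esub> n" unfolding r_coset_def by blast
      then have tN: "t \<in> rgd_N G \<Phi> M" "\<nu> t = \<one>\<^bsub>aff_group \<Phi>\<^esub>" unfolding Tb_def D.Tb_iff by auto
      show "\<nu> n = \<nu> n'" using D.\<nu>_mult[OF tN(1) nN(1)] tN(2) D.\<nu>_closed[OF nN(1)] t(2) by simp
    next
      assume e: "\<nu> n = \<nu> n'"
      have i: "inv\<^bsub>G\<^esub> n \<in> rgd_N G \<Phi> M" using subgroup.m_inv_closed[OF D.N_subgroup nN(1)] .
      have "\<nu> (n' \<otimes>\<^bsub>G\<^esub> inv\<^bsub>G\<^esub> n) = \<nu> (n \<otimes>\<^bsub>G\<^esub> inv\<^bsub>G\<^esub> n)"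
        unfolding D.\<nu>_mult[OF nN(2) i] D.\<nu>_mult[OF nN(1) i] e ..
      then have "n' \<otimes>\<^bsub>G\<^esub> inv\<^bsub>G\<^esub> n \<in> Tb"
        unfolding Tb_def D.Tb_iff using subgroup.m_closed[OF D.N_subgroup nN(2) i] c D.\<nu>_one by simp
      moreover have "n' = n' \<otimes>\<^bsub>G\<^esub> inv\<^bsub>G\<^esub> n \<otimes>\<^bsub>G\<^esub> n" using c by (simp add: G.group_word)
      ultimately have "n' \<in> Tb #>\<^bsub>G\<^esub> n" unfolding r_coset_def by blast
      then show "Tb #>\<^bsub>G\<^esub> n = Tb #>\<^bsub>G\<^esub> n'" by (rule G.repr_independence[OF _ c(1) Tbs])
    qed
  qed
  have cQ: "carrier (NG Mod Tb) = (\<lambda>n. Tb #>\<^bsub>NG\<^esub> n) ` N"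
    unfolding carrier_FactGroup NG_def N_def D.NG_simps ..
  have 2: "\<exists>f. bij_betw f (\<nu> ` N) (double_cosets G UC P) \<and> (\<forall>n\<in>N. f (\<nu> n) = ?dc n)"
    unfolding dcs by (rule induced_bij) (rule \<nu>_dc)
  have 3: "\<exists>f. bij_betw f (carrier (NG Mod Tb)) (double_cosets G UC P) \<and> (\<forall>n\<in>N. f (Tb #>\<^bsub>NG\<^esub> n) = ?dc n)"
    unfolding dcs cQ by (rule induced_bij) (use coset_iff \<nu>_dc in blast)
  show ?thesis
    unfolding Let_def using 1 2 3 unfolding N_def NG_def Tb_def UC_def P_def by blast
qed

end
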